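(* Let $(W,\omega)$ be a symplectic manifold admitting an exhaustion of contact type. Then $\omega$ is homotopic through symplectic forms on $W$ to a strongly geometrically bounded symplectic form $\omega'$.
   Context: Exhaustion of contact type: a collection of compact sets $\mathcal{K}=\{K_n\}_{n\in\mathbb{N}}$ of $W$ such that (i) $K_0=\emptyset$, $W=\bigcup_{n\in\mathbb{N}}K_n$ and $K_n\subset \operatorname{int}K_{n+1}$ for all $n$; (ii) each $(K_n,\omega|_{K_n})$ is a symplectic domain with smooth boundary $\partial K_n$ which is a hypersurface of convex contact type. Geometrically bounded triple: a triple $(\omega,J,g)$ on $W$, where $\omega$ is a symplectic form, $J$ an almost complex structure and $g$ a complete Riemannian metric, such that: (GB1) there are constants $A,B>0$ with $\omega(u,Ju)\ge A\|u\|_g^2$ and $|\omega(u,v)|\le B\|u\|_g\|v\|_g$ for all tangent vectors $u,v$ at the same point of $W$; (GB2) the sectional curvature of $g$ is bounded from above and the injectivity radius of $(W,g)$ is bounded from below by a positive constant. Strongly geometrically bounded: a symplectic form $\omega$ on $W$ (or the symplectic manifold $(W,\omega)$) is strongly geometrically bounded if there is an almost complex structure $J$ compatible with $\omega$ such that, with $g_{\omega,J}=\omega(\cdot,J\cdot)$, the triple $(\omega,J,g_{\omega,J})$ is a geometrically bounded triple. *)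

theory Defs
  imports "HOL-Analysis.Analysis"
begin

section \<open>Smooth maps between Euclidean spaces\<close>

primrec Ck_on :: "nat \<Rightarrow> 'a::euclidean_space set \<Rightarrow> ('a \<Rightarrow> 'b::real_normed_vector) \<Rightarrow> bool" where
  "Ck_on 0 S f \<longleftrightarrow> continuous_on S f"
| "Ck_on (Suc k) S f \<longleftrightarrow>
     (\<forall>x\<in>S. f differentiable (at x)) \<and> (\<forall>v. Ck_on k S (\<lambda>x. frechet_derivative f (at x) v))"

text \<open>Openness of the domain is part of the definition. For a map defined on a subset by a
  preimage of a chart domain, this clause is what makes the map continuous.\<close>

definition smooth_on :: "'a::euclidean_space set \<Rightarrow> ('a \<Rightarrow> 'b::real_normed_vector) \<Rightarrow> bool" where
  "smooth_on S f \<longleftrightarrow> open S \<and> (\<forall>k. Ck_on k S f)"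

section \<open>Smooth manifolds\<close>

text \<open>A chart is a pair of its domain and the coordinate map; values of the coordinate map outside
  the domain are irrelevant.\<close>

type_synonym ('a, 'e) chart = "'a set \<times> ('a \<Rightarrow> 'e)"

record ('a, 'e) manifold =
  mtop :: "'a topology"
  atlas :: "('a, 'e) chart set"

definition is_chart :: "'a topology \<Rightarrow> ('a, 'e::euclidean_space) chart \<Rightarrow> bool" where
  "is_chart W = (\<lambda>(U, \<phi>). openin W U \<and> open (\<phi> ` U) \<and>
     homeomorphic_map (subtopology W U) (top_of_set (\<phi> ` U)) \<phi>)"

definition chart_inv :: "('a, 'e) chart \<Rightarrow> 'e \<Rightarrow> 'a" where
  "chart_inv c = inv_into (fst c) (snd c)"

definition chart_img :: "('a, 'e) chart \<Rightarrow> 'e set" where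
  "chart_img c = snd c ` fst c"

definition compatible_charts ::
    "('a, 'e::euclidean_space) chart \<Rightarrow> ('a, 'e) chart \<Rightarrow> bool" where
  "compatible_charts c d \<longleftrightarrow>
     smooth_on (snd c ` (fst c \<inter> fst d)) (snd d \<circ> chart_inv c) \<and>
     smooth_on (snd d ` (fst c \<inter> fst d)) (snd c \<circ> chart_inv d)"

definition smooth_manifold :: "('a, 'e::euclidean_space) manifold \<Rightarrow> bool" where
  "smooth_manifold M \<longleftrightarrow>
     Hausdorff_space (mtop M) \<and> second_countable (mtop M) \<and>
     (\<forall>c\<in>atlas M. is_chart (mtop M) c) \<and>
     (\<forall>c\<in>atlas M. \<forall>d\<in>atlas M. compatible_charts c d) \<and>
     (\<Union>c\<in>atlas M. fst c) = topspace (mtop M)"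

text \<open>The maximal atlas.\<close>

definition charts :: "('a, 'e::euclidean_space) manifold \<Rightarrow> ('a, 'e) chart set" where
  "charts M = {c. is_chart (mtop M) c \<and> (\<forall>d\<in>atlas M. compatible_charts c d)}"

section \<open>Tangent vectors, vector fields and tensor fields\<close>

definition smooth_near ::
    "('a, 'e::euclidean_space) manifold \<Rightarrow> 'a \<Rightarrow> ('a \<Rightarrow> real) \<Rightarrow> bool" where
  "smooth_near M p f \<longleftrightarrow> (\<exists>N. openin (mtop M) N \<and> p \<in> N \<and>
     (\<forall>c\<in>charts M. smooth_on (snd c ` (fst c \<inter> N)) (f \<circ> chart_inv c)))"

text \<open>Tangent vectors at \<open>p\<close> are the derivations at \<open>p\<close> of functions smooth near \<open>p\<close>. That a
  derivation depends only on the germ of its argument follows from the Leibniz rule, since functions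
  may be arbitrary away from \<open>p\<close>. The value \<open>0\<close> on other functions makes the representing function
  unique. Vector space operations on tangent vectors are the pointwise ones.\<close>

type_synonym 'a tvec = "('a \<Rightarrow> real) \<Rightarrow> real"

definition tangent_space :: "('a, 'e::euclidean_space) manifold \<Rightarrow> 'a \<Rightarrow> 'a tvec set" where
  "tangent_space M p = {D.
     (\<forall>f. \<not> smooth_near M p f \<longrightarrow> D f = 0) \<and>
     (\<forall>f h a b. smooth_near M p f \<and> smooth_near M p h \<longrightarrow>
        D (\<lambda>x. a * f x + b * h x) = a * D f + b * D h) \<and>
     (\<forall>f h. smooth_near M p f \<and> smooth_near M p h \<longrightarrow>
        D (\<lambda>x. f x * h x) = f p * D h + h p * D f)}"

definition coord_vec ::
    "('a, 'e::euclidean_space) manifold \<Rightarrow> ('a, 'e) chart \<Rightarrow> 'a \<Rightarrow> 'e \<Rightarrow> 'a tvec" where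
  "coord_vec M c p u = (\<lambda>f. if smooth_near M p f
     then frechet_derivative (f \<circ> chart_inv c) (at (snd c p)) u else 0)"

definition vec_coords :: "('a, 'e::euclidean_space) chart \<Rightarrow> 'a tvec \<Rightarrow> 'e" where
  "vec_coords c D = (\<Sum>b\<in>Basis. D (\<lambda>q. snd c q \<bullet> b) *\<^sub>R b)"

definition smooth_vector_field_on ::
    "('a, 'e::euclidean_space) manifold \<Rightarrow> 'a set \<Rightarrow> ('a \<Rightarrow> 'a tvec) \<Rightarrow> bool" where
  "smooth_vector_field_on M V X \<longleftrightarrow>
     openin (mtop M) V \<and> (\<forall>p\<in>V. X p \<in> tangent_space M p) \<and>
     (\<forall>c\<in>charts M. smooth_on (snd c ` (fst c \<inter> V)) (\<lambda>x. vec_coords c (X (chart_inv c x))))"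

text \<open>Values of tensor fields at points outside the manifold, or on arguments that are not tangent
  vectors, are irrelevant. The functions \<open>loc2\<close> and \<open>loc_endo\<close> are the local representatives of
  covariant 2-tensor fields and of endomorphism fields in a chart.\<close>

type_synonym 'a tensor2 = "'a \<Rightarrow> 'a tvec \<Rightarrow> 'a tvec \<Rightarrow> real"
type_synonym 'a endo = "'a \<Rightarrow> 'a tvec \<Rightarrow> 'a tvec"

definition loc2 :: "('a, 'e::euclidean_space) manifold \<Rightarrow> ('a, 'e) chart \<Rightarrow> 'a tensor2 \<Rightarrow>
    'e \<Rightarrow> 'e \<Rightarrow> 'e \<Rightarrow> real" where
  "loc2 M c T x u v = (let p = chart_inv c x in T p (coord_vec M c p u) (coord_vec M c p v))"

definition loc_endo :: "('a, 'e::euclidean_space) manifold \<Rightarrow> ('a, 'e) chart \<Rightarrow> 'a endo \<Rightarrow>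
    'e \<Rightarrow> 'e \<Rightarrow> 'e" where
  "loc_endo M c J x u = (let p = chart_inv c x in vec_coords c (J p (coord_vec M c p u)))"

definition smooth_tensor2 :: "('a, 'e::euclidean_space) manifold \<Rightarrow> 'a tensor2 \<Rightarrow> bool" where
  "smooth_tensor2 M T \<longleftrightarrow> (\<forall>c\<in>charts M.
     (\<forall>x\<in>chart_img c. bilinear (loc2 M c T x)) \<and>
     (\<forall>u v. smooth_on (chart_img c) (\<lambda>x. loc2 M c T x u v)))"

definition smooth_endo :: "('a, 'e::euclidean_space) manifold \<Rightarrow> 'a endo \<Rightarrow> bool" where
  "smooth_endo M J \<longleftrightarrow>
     (\<forall>p\<in>topspace (mtop M). J p ` tangent_space M p \<subseteq> tangent_space M p) \<and>
     (\<forall>c\<in>charts M.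
        (\<forall>x\<in>chart_img c. linear (loc_endo M c J x)) \<and>
        (\<forall>u. smooth_on (chart_img c) (\<lambda>x. loc_endo M c J x u)))"

section \<open>Symplectic forms\<close>

definition two_form :: "('a, 'e::euclidean_space) manifold \<Rightarrow> 'a tensor2 \<Rightarrow> bool" where
  "two_form M \<omega> \<longleftrightarrow> smooth_tensor2 M \<omega> \<and>
     (\<forall>p\<in>topspace (mtop M). \<forall>D\<in>tangent_space M p. \<omega> p D D = 0)"

text \<open>Exterior derivatives of a 1-form and of a 2-form in coordinates, evaluated on constant
  vectors.\<close>

definition ext_deriv1 :: "('e::euclidean_space \<Rightarrow> 'e \<Rightarrow> real) \<Rightarrow> 'e \<Rightarrow> 'e \<Rightarrow> 'e \<Rightarrow> real" where
  "ext_deriv1 \<alpha> x u v =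
     frechet_derivative (\<lambda>y. \<alpha> y v) (at x) u - frechet_derivative (\<lambda>y. \<alpha> y u) (at x) v"

definition ext_deriv2 ::
    "('e::euclidean_space \<Rightarrow> 'e \<Rightarrow> 'e \<Rightarrow> real) \<Rightarrow> 'e \<Rightarrow> 'e \<Rightarrow> 'e \<Rightarrow> 'e \<Rightarrow> real" where
  "ext_deriv2 \<beta> x u v w =
     frechet_derivative (\<lambda>y. \<beta> y v w) (at x) u - frechet_derivative (\<lambda>y. \<beta> y u w) (at x) v
     + frechet_derivative (\<lambda>y. \<beta> y u v) (at x) w"

definition symplectic_form :: "('a, 'e::euclidean_space) manifold \<Rightarrow> 'a tensor2 \<Rightarrow> bool" where
  "symplectic_form M \<omega> \<longleftrightarrow> two_form M \<omega> \<and>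
     (\<forall>c\<in>charts M. \<forall>x\<in>chart_img c. \<forall>u v w. ext_deriv2 (loc2 M c \<omega>) x u v w = 0) \<and>
     (\<forall>p\<in>topspace (mtop M). \<forall>D\<in>tangent_space M p.
        (\<forall>E\<in>tangent_space M p. \<omega> p D E = 0) \<longrightarrow> D = (\<lambda>_. 0))"

text \<open>Two symplectic forms are homotopic through symplectic forms if a family \<open>\<Omega> t\<close>,
  \<open>0 \<le> t \<le> 1\<close>, of symplectic forms, jointly smooth in \<open>t\<close> and the point, joins them. Smoothness on
  the closed time interval means existence of a smooth extension; the extending 2-forms with \<open>t\<close>
  outside of the interval need not be symplectic.\<close>

definition symplectic_homotopic ::
    "('a, 'e::euclidean_space) manifold \<Rightarrow> 'a tensor2 \<Rightarrow> 'a tensor2 \<Rightarrow> bool" where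
  "symplectic_homotopic M \<omega> \<omega>' \<longleftrightarrow> (\<exists>\<Omega> :: real \<Rightarrow> 'a tensor2.
     (\<forall>t. two_form M (\<Omega> t)) \<and>
     (\<forall>t\<in>{0..1}. symplectic_form M (\<Omega> t)) \<and>
     (\<forall>c\<in>charts M. \<forall>u v.
        smooth_on (UNIV \<times> chart_img c) (\<lambda>(t, x). loc2 M c (\<Omega> t) x u v)) \<and>
     (\<forall>p\<in>topspace (mtop M). \<forall>D\<in>tangent_space M p. \<forall>E\<in>tangent_space M p.
        \<Omega> 0 p D E = \<omega> p D E \<and> \<Omega> 1 p D E = \<omega>' p D E))"

section \<open>Exhaustions of contact type\<close>

text \<open>A chart at \<open>p\<close> in which \<open>K\<close> is the half-space given by nonpositivity of coordinate \<open>b\<close>.\<close>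

definition boundary_chart :: "('a, 'e::euclidean_space) manifold \<Rightarrow> 'a set \<Rightarrow> 'a \<Rightarrow>
    ('a, 'e) chart \<Rightarrow> 'e \<Rightarrow> bool" where
  "boundary_chart M K p c b \<longleftrightarrow> c \<in> charts M \<and> b \<in> Basis \<and> p \<in> fst c \<and> snd c p \<bullet> b = 0 \<and>
     K \<inter> fst c = {q \<in> fst c. snd c q \<bullet> b \<le> 0}"

definition compact_smooth_domain :: "('a, 'e::euclidean_space) manifold \<Rightarrow> 'a set \<Rightarrow> bool" where
  "compact_smooth_domain M K \<longleftrightarrow> compactin (mtop M) K \<and>
     (\<forall>p \<in> mtop M frontier_of K. \<exists>c b. boundary_chart M K p c b)"

text \<open>Liouville vector fields: \<open>d(\<iota>\<^sub>X \<omega>) = \<omega>\<close>. For closed \<open>\<omega>\<close> the left-hand side is the Lie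
  derivative of \<open>\<omega>\<close> along \<open>X\<close>.\<close>

definition liouville_field_on :: "('a, 'e::euclidean_space) manifold \<Rightarrow> 'a tensor2 \<Rightarrow> 'a set \<Rightarrow>
    ('a \<Rightarrow> 'a tvec) \<Rightarrow> bool" where
  "liouville_field_on M \<omega> V X \<longleftrightarrow> smooth_vector_field_on M V X \<and>
     (\<forall>c\<in>charts M. \<forall>x \<in> snd c ` (fst c \<inter> V). \<forall>u v.
        ext_deriv1 (\<lambda>y w. let q = chart_inv c y in \<omega> q (X q) (coord_vec M c q w)) x u v
        = loc2 M c \<omega> x u v)"

definition points_outward :: "('a, 'e::euclidean_space) manifold \<Rightarrow> 'a set \<Rightarrow> 'a \<Rightarrow>
    'a tvec \<Rightarrow> bool" where
  "points_outward M K p D \<longleftrightarrow>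
     (\<exists>c b. boundary_chart M K p c b \<and> D (\<lambda>q. snd c q \<bullet> b) > 0)"

text \<open>The boundary is of convex contact type: a Liouville vector field defined near it is transverse
  to it and points out of the domain.\<close>

definition convex_contact_boundary ::
    "('a, 'e::euclidean_space) manifold \<Rightarrow> 'a tensor2 \<Rightarrow> 'a set \<Rightarrow> bool" where
  "convex_contact_boundary M \<omega> K \<longleftrightarrow>
     (\<exists>V X. mtop M frontier_of K \<subseteq> V \<and> liouville_field_on M \<omega> V X \<and>
        (\<forall>p \<in> mtop M frontier_of K. points_outward M K p (X p)))"

definition contact_exhaustion ::
    "('a, 'e::euclidean_space) manifold \<Rightarrow> 'a tensor2 \<Rightarrow> (nat \<Rightarrow> 'a set) \<Rightarrow> bool" where
  "contact_exhaustion M \<omega> K \<longleftrightarrow>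
     K 0 = {} \<and> topspace (mtop M) = (\<Union>n. K n) \<and>
     (\<forall>n. K n \<subseteq> mtop M interior_of K (Suc n)) \<and>
     (\<forall>n. compact_smooth_domain M (K n) \<and> convex_contact_boundary M \<omega> (K n))"

section \<open>Riemannian metrics\<close>

definition riemannian_metric :: "('a, 'e::euclidean_space) manifold \<Rightarrow> 'a tensor2 \<Rightarrow> bool" where
  "riemannian_metric M g \<longleftrightarrow> smooth_tensor2 M g \<and>
     (\<forall>p\<in>topspace (mtop M). \<forall>D\<in>tangent_space M p.
        (\<forall>E\<in>tangent_space M p. g p D E = g p E D) \<and> (D \<noteq> (\<lambda>_. 0) \<longrightarrow> g p D D > 0))"

definition gnorm :: "'a tensor2 \<Rightarrow> 'a \<Rightarrow> 'a tvec \<Rightarrow> real" where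
  "gnorm g p D = sqrt (g p D D)"

definition smooth_curve_on ::
    "('a, 'e::euclidean_space) manifold \<Rightarrow> real set \<Rightarrow> (real \<Rightarrow> 'a) \<Rightarrow> bool" where
  "smooth_curve_on M I \<gamma> \<longleftrightarrow> \<gamma> ` I \<subseteq> topspace (mtop M) \<and>
     (\<forall>c\<in>charts M. smooth_on {t\<in>I. \<gamma> t \<in> fst c} (snd c \<circ> \<gamma>))"

definition velocity ::
    "('a, 'e::euclidean_space) manifold \<Rightarrow> (real \<Rightarrow> 'a) \<Rightarrow> real \<Rightarrow> 'a tvec" where
  "velocity M \<gamma> t = (\<lambda>f. if smooth_near M (\<gamma> t) f then deriv (f \<circ> \<gamma>) t else 0)"

definition curve_length ::
    "('a, 'e::euclidean_space) manifold \<Rightarrow> 'a tensor2 \<Rightarrow> (real \<Rightarrow> 'a) \<Rightarrow> real" where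
  "curve_length M g \<gamma> = integral {0..1} (\<lambda>t. gnorm g (\<gamma> t) (velocity M \<gamma> t))"

text \<open>The distance is infinite between different components. A smooth curve on the closed unit
  interval is the restriction of a smooth curve on the real line.\<close>

definition riemannian_dist ::
    "('a, 'e::euclidean_space) manifold \<Rightarrow> 'a tensor2 \<Rightarrow> 'a \<Rightarrow> 'a \<Rightarrow> ereal" where
  "riemannian_dist M g p q =
     (INF \<gamma>\<in>{\<gamma>. smooth_curve_on M UNIV \<gamma> \<and> \<gamma> 0 = p \<and> \<gamma> 1 = q}. ereal (curve_length M g \<gamma>))"

definition complete_metric :: "('a, 'e::euclidean_space) manifold \<Rightarrow> 'a tensor2 \<Rightarrow> bool" where
  "complete_metric M g \<longleftrightarrow> (\<forall>s :: nat \<Rightarrow> 'a. range s \<subseteq> topspace (mtop M) \<and>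
     (\<forall>e>0. \<exists>N. \<forall>m\<ge>N. \<forall>n\<ge>N. riemannian_dist M g (s m) (s n) < ereal e) \<longrightarrow>
     (\<exists>p\<in>topspace (mtop M). (\<lambda>n. riemannian_dist M g (s n) p) \<longlonglongrightarrow> 0))"

subsection \<open>Sectional curvature\<close>

text \<open>Below, \<open>G\<close> is the local representative of a Riemannian metric. Then \<open>christoffel G x u v\<close> is
  the Levi-Civita derivative in direction \<open>u\<close> of the constant vector field \<open>v\<close>, and
  \<open>riemann_tensor G x u v w\<close> is \<open>R(u,v)w = \<nabla>\<^sub>u \<nabla>\<^sub>v w - \<nabla>\<^sub>v \<nabla>\<^sub>u w\<close> for constant fields.\<close>

definition christoffel ::
    "('e::euclidean_space \<Rightarrow> 'e \<Rightarrow> 'e \<Rightarrow> real) \<Rightarrow> 'e \<Rightarrow> 'e \<Rightarrow> 'e \<Rightarrow> 'e" where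
  "christoffel G x u v = (THE w. \<forall>z. G x w z =
     (frechet_derivative (\<lambda>y. G y v z) (at x) u + frechet_derivative (\<lambda>y. G y u z) (at x) v
      - frechet_derivative (\<lambda>y. G y u v) (at x) z) / 2)"

definition riemann_tensor ::
    "('e::euclidean_space \<Rightarrow> 'e \<Rightarrow> 'e \<Rightarrow> real) \<Rightarrow> 'e \<Rightarrow> 'e \<Rightarrow> 'e \<Rightarrow> 'e \<Rightarrow> 'e" where
  "riemann_tensor G x u v w =
     frechet_derivative (\<lambda>y. christoffel G y v w) (at x) u
     - frechet_derivative (\<lambda>y. christoffel G y u w) (at x) v
     + christoffel G x u (christoffel G x v w) - christoffel G x v (christoffel G x u w)"

definition sectional_curvature ::
    "('e::euclidean_space \<Rightarrow> 'e \<Rightarrow> 'e \<Rightarrow> real) \<Rightarrow> 'e \<Rightarrow> 'e \<Rightarrow> 'e \<Rightarrow> real" where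
  "sectional_curvature G x u v =
     G x (riemann_tensor G x u v v) u / (G x u u * G x v v - (G x u v)\<^sup>2)"

definition sectional_curvature_bounded_above ::
    "('a, 'e::euclidean_space) manifold \<Rightarrow> 'a tensor2 \<Rightarrow> bool" where
  "sectional_curvature_bounded_above M g \<longleftrightarrow> (\<exists>C. \<forall>c\<in>charts M. \<forall>x\<in>chart_img c. \<forall>u v.
     u \<noteq> v \<and> independent {u, v} \<longrightarrow> sectional_curvature (loc2 M c g) x u v \<le> C)"

subsection \<open>Injectivity radius\<close>

definition geodesic_on ::
    "('a, 'e::euclidean_space) manifold \<Rightarrow> 'a tensor2 \<Rightarrow> real set \<Rightarrow> (real \<Rightarrow> 'a) \<Rightarrow> bool" where
  "geodesic_on M g I \<gamma> \<longleftrightarrow> smooth_curve_on M I \<gamma> \<and>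
     (\<forall>c\<in>charts M. \<forall>t\<in>I. \<gamma> t \<in> fst c \<longrightarrow>
        (let y = snd c \<circ> \<gamma>; y' = (\<lambda>s. vector_derivative y (at s)) in
         vector_derivative y' (at t) + christoffel (loc2 M c g) (y t) (y' t) (y' t) = 0))"

definition exp_graph :: "('a, 'e::euclidean_space) manifold \<Rightarrow> 'a tensor2 \<Rightarrow> 'a \<Rightarrow> 'a tvec \<Rightarrow>
    'a \<Rightarrow> bool" where
  "exp_graph M g p D q \<longleftrightarrow> (\<exists>I \<gamma>. open I \<and> is_interval I \<and> {0..1} \<subseteq> I \<and> geodesic_on M g I \<gamma> \<and>
     \<gamma> 0 = p \<and> velocity M \<gamma> 0 = D \<and> \<gamma> 1 = q)"

definition exp_map ::
    "('a, 'e::euclidean_space) manifold \<Rightarrow> 'a tensor2 \<Rightarrow> 'a \<Rightarrow> 'a tvec \<Rightarrow> 'a" where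
  "exp_map M g p D = (THE q. exp_graph M g p D q)"

text \<open>The exponential map at \<open>p\<close> is defined on the open ball of radius \<open>r\<close> in the tangent space and
  is a diffeomorphism from it onto an open set; the tangent space is identified with the model
  space through a chart at \<open>p\<close>.\<close>

definition exp_diffeo_on_ball ::
    "('a, 'e::euclidean_space) manifold \<Rightarrow> 'a tensor2 \<Rightarrow> 'a \<Rightarrow> real \<Rightarrow> bool" where
  "exp_diffeo_on_ball M g p r \<longleftrightarrow> (\<forall>c\<in>charts M. p \<in> fst c \<longrightarrow>
     (let B = {u. gnorm g p (coord_vec M c p u) < r};
          E = (\<lambda>u. exp_map M g p (coord_vec M c p u)) in
      (\<forall>u\<in>B. \<exists>q. exp_graph M g p (coord_vec M c p u) q) \<and>
      inj_on E B \<and> openin (mtop M) (E ` B) \<and>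
      (\<forall>d\<in>charts M.
         smooth_on {u\<in>B. E u \<in> fst d} (snd d \<circ> E) \<and>
         smooth_on (snd d ` (fst d \<inter> E ` B)) (inv_into B E \<circ> chart_inv d))))"

definition inj_radius_at ::
    "('a, 'e::euclidean_space) manifold \<Rightarrow> 'a tensor2 \<Rightarrow> 'a \<Rightarrow> ereal" where
  "inj_radius_at M g p = (SUP r\<in>{r. 0 \<le> r \<and> exp_diffeo_on_ball M g p r}. ereal r)"

definition inj_radius :: "('a, 'e::euclidean_space) manifold \<Rightarrow> 'a tensor2 \<Rightarrow> ereal" where
  "inj_radius M g = (INF p\<in>topspace (mtop M). inj_radius_at M g p)"

section \<open>Geometrically bounded triples\<close>

definition almost_complex_structure ::
    "('a, 'e::euclidean_space) manifold \<Rightarrow> 'a endo \<Rightarrow> bool" where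
  "almost_complex_structure M J \<longleftrightarrow> smooth_endo M J \<and>
     (\<forall>p\<in>topspace (mtop M). \<forall>D\<in>tangent_space M p. J p (J p D) = (\<lambda>f. - D f))"

definition geometrically_bounded ::
    "('a, 'e::euclidean_space) manifold \<Rightarrow> 'a tensor2 \<Rightarrow> 'a endo \<Rightarrow> 'a tensor2 \<Rightarrow> bool" where
  "geometrically_bounded M \<omega> J g \<longleftrightarrow>
     symplectic_form M \<omega> \<and> almost_complex_structure M J \<and>
     riemannian_metric M g \<and> complete_metric M g \<and>
     (\<exists>A>0. \<exists>B>0. \<forall>p\<in>topspace (mtop M). \<forall>u\<in>tangent_space M p. \<forall>v\<in>tangent_space M p.
        \<omega> p u (J p u) \<ge> A * (gnorm g p u)\<^sup>2 \<and> \<bar>\<omega> p u v\<bar> \<le> B * gnorm g p u * gnorm g p v) \<and>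
     sectional_curvature_bounded_above M g \<and> (\<exists>\<epsilon>>0. ereal \<epsilon> \<le> inj_radius M g)"

definition compatible_acs ::
    "('a, 'e::euclidean_space) manifold \<Rightarrow> 'a tensor2 \<Rightarrow> 'a endo \<Rightarrow> bool" where
  "compatible_acs M \<omega> J \<longleftrightarrow> almost_complex_structure M J \<and>
     (\<forall>p\<in>topspace (mtop M). \<forall>u\<in>tangent_space M p.
        (\<forall>v\<in>tangent_space M p. \<omega> p (J p u) (J p v) = \<omega> p u v) \<and>
        (u \<noteq> (\<lambda>_. 0) \<longrightarrow> \<omega> p u (J p u) > 0))"

definition compatible_metric :: "'a tensor2 \<Rightarrow> 'a endo \<Rightarrow> 'a tensor2" where
  "compatible_metric \<omega> J p u v = \<omega> p u (J p v)"

definition strongly_geometrically_bounded ::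
    "('a, 'e::euclidean_space) manifold \<Rightarrow> 'a tensor2 \<Rightarrow> bool" where
  "strongly_geometrically_bounded M \<omega> \<longleftrightarrow> symplectic_form M \<omega> \<and>
     (\<exists>J. compatible_acs M \<omega> J \<and> geometrically_bounded M \<omega> J (compatible_metric \<omega> J))"

end

theory Submission
 imports Defs
begin

text \<open>Write the exhaustion as the sublevel sets of a function \<open>R\<close> that increases along Liouville fields
near the boundaries \<open>\<partial>K\<^sub>n\<close>. On these necks \<open>\<omega> = d\<lambda>\<close>, and \<open>\<omega>\<close> is deformed through symplectic forms to
\<open>exp(t(R)) (\<omega> + \<tau>(R) dR \<and> \<lambda>)\<close>, where \<open>t\<close> is constant off the necks and the necks are stretched, so that \<open>t\<close> grows at a
fixed speed along an arbitrarily long neck. An almost complex structure comes from the polar decomposition of the twisted form with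
respect to an auxiliary metric that is stretched as well. In stretched coordinates of a neck the forms and
metrics depend smoothly on a point of a compact set and on the inverse stretching factor, and extend nondegenerately
to the factor \<open>0\<close> of an infinitely long neck; compactness gives uniform bounds on the metric, its Christoffel
symbols and their derivatives, up to the conformal factor, which may be taken large by choosing \<open>t\<close> increasing enough. Coordinate
balls of a uniform \<open>g\<close>-size with such bounds give completeness, the curvature bound, and, through the
flow of the geodesic equation, a lower bound of the injectivity radius.\<close>

text \<open>With \<open>\<tau>\<close> the derivative of \<open>t\<close>, the deformed form is the
  differential of exp(t(R)) \<lambda> on a neck, hence closed; off the necks it is a locally
  constant multiple of \<omega>. It is nondegenerate because R increases along the Liouville field
  and \<tau> is nonnegative, and the affine path from \<omega> keeps both properties. A large
  conformal factor produces bounded geometry: it lowers the curvature and enlarges the injectivity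
  radius. The threshold that it has to exceed differs from shell to shell, but it can grow only on
  necks, where rapid growth would spoil the estimates. Stretching resolves the conflict: the growth
  per unit of stretched length stays bounded while the total gain is as large as desired. This would
  be circular if the thresholds depended on the stretching factors. The extension to factor 0 makes
  the estimates uniform over all inverse factors in [0,1], so the threshold of each shell is fixed
  first and the factors are chosen afterwards.\<close>

abbreviation FD :: "('a::real_normed_vector => 'b::real_normed_vector) => 'a => 'a => 'b" where
 "FD f x == frechet_derivative f (at x)"

abbreviation pts :: "('a, 'e::euclidean_space) manifold => 'a set" where "pts M == topspace (mtop M)"

abbreviation opn :: "('a, 'e::euclidean_space) manifold => 'a set => bool" where "opn M == openin (mtop M)"

notation scaleR (infixr "*R" 75)

section \<open>Calculus of smooth maps\<close>

lemma has_derivative_frechet: "(f has_derivative f') (at x) ==> FD f x = f'" by (rule frechet_derivative_at[symmetric])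

lemma Ck_on_cong:
 assumes "open S" "!!x. x : S ==> f x = g x" "Ck_on k S f"
 shows "Ck_on k S g"
 using assms(2,3)
proof (induction k arbitrary: f g)
 case 0
 thus ?case using continuous_on_cong by (metis Ck_on.simps(1))
next
 case (Suc k)
 have d: "f differentiable (at x)" if "x : S" for x using Suc.prems that by auto
 have d': "g differentiable (at x) & FD g x = FD f x"
  if "x : S" for x
 proof -
  have g: "(g has_derivative FD f x) (at x)" by (rule has_derivative_transform_within_open[OF _ assms(1) that Suc.prems(1)])
    (use d[OF that] frechet_derivative_works in auto)
  show ?thesis
   using has_derivative_frechet[OF g] differentiableI[OF g] by auto
 qed
 have "Ck_on k S (%x. FD g x v)" for v by (rule Suc.IH[of "%x. FD f x v"]) (use Suc.prems d' in auto)
 thus ?case using d' by auto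
qed

lemma Ck_on_subset: "Ck_on k S f ==> T <= S ==> Ck_on k T f" by (induction k arbitrary: f) (auto intro: continuous_on_subset)

lemma Ck_on_Suc_imp: "Ck_on (Suc k) S f ==> Ck_on k S f"
proof (induction k arbitrary: f)
 case 0
 thus ?case by (auto intro!: continuous_at_imp_continuous_on differentiable_imp_continuous_within)
next
 case (Suc k) thus ?case by simp
qed

lemma Ck_on_cont: "Ck_on k S f ==> continuous_on S f" by (induction k) (auto dest: Ck_on_Suc_imp simp del: Ck_on.simps(2))

lemma smooth_onD: "smooth_on S f ==> Ck_on k S f"
 and smooth_open: "smooth_on S f ==> open S" by (auto simp: smooth_on_def)

lemma smooth_cont: "smooth_on S f ==> continuous_on S f"
 using Ck_on_cont smooth_on_def by blast

lemma smooth_differentiable: "smooth_on S f ==> x : S ==> f differentiable (at x)"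
 using smooth_onD[of S f "Suc 0"] by simp

lemma smooth_has_derivative:
 "smooth_on S f ==> x : S ==> (f has_derivative FD f x) (at x)" by (simp add: smooth_differentiable frechet_derivative_works[symmetric])

lemmas smooth_FD_linear = has_derivative_linear[OF smooth_has_derivative]

lemma smooth_deriv: "smooth_on S f ==> smooth_on S (%x. FD f x v)"
 unfolding smooth_on_def by (metis Ck_on.simps(2))

lemma smooth_cong:
 "smooth_on S f ==> (!!x. x : S ==> f x = g x) ==> smooth_on S g"
 unfolding smooth_on_def using Ck_on_cong by blast

lemma smooth_subset: "smooth_on S f ==> open T ==> T <= S ==> smooth_on T f"
 unfolding smooth_on_def using Ck_on_subset by blast

lemma Ck_on_has_derivativeI:
 assumes "open S" "!!x. x : S ==> (f has_derivative f' x) (at x)"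
  and "!!v. Ck_on k S (%x. f' x v)"
 shows "Ck_on (Suc k) S f"
proof -
 have "FD f x = f' x" if "x : S" for x by (rule has_derivative_frechet[OF assms(2)[OF that]])
 hence "Ck_on k S (%x. FD f x v)" for v by (intro Ck_on_cong[OF assms(1) _ assms(3)[of v]]) auto
 moreover have "f differentiable (at x)" if "x : S" for x by (rule differentiableI[OF assms(2)[OF that]])
 ultimately show ?thesis by simp
qed

lemma smooth_has_derivativeI:
 assumes "open S" "!!x. x : S ==> (f has_derivative f' x) (at x)"
  and "!!v. smooth_on S (%x. f' x v)"
 shows "smooth_on S f"
proof -
 have "Ck_on (Suc k) S f" for k by (rule Ck_on_has_derivativeI[OF assms(1,2)]) (use assms(3) smooth_onD in auto)
 thus ?thesis using assms(1) Ck_on_Suc_imp unfolding smooth_on_def by blast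
qed

lemma Ck_on_const: "Ck_on k S (%x. c)" by (induction k arbitrary: c) auto

lemma smooth_const: "open S ==> smooth_on S (%x. c)" by (simp add: smooth_on_def Ck_on_const)

lemma Ck_on_bounded_linear:
 assumes "bounded_linear h" "open S" "Ck_on k S f"
 shows "Ck_on k S (%x. h (f x))"
 using assms(3)
proof (induction k arbitrary: f)
 case 0
 thus ?case using assms(1) by (simp add: bounded_linear.continuous_on)
next
 case (Suc k)
 have *: "(f has_derivative FD f x) (at x)" if "x : S" for x
  using Suc.prems that by (auto simp: frechet_derivative_works[symmetric])
 show ?case by (rule Ck_on_has_derivativeI[OF assms(2), of _ "%x v. h (FD f x v)"])
   (use Suc in "auto intro!: bounded_linear.has_derivative[OF assms(1)] simp: *")
qed

lemma Ck_on_add: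
 assumes "open S" "Ck_on k S f" "Ck_on k S g"
 shows "Ck_on k S (%x. f x + g x)"
 using assms(2,3)
proof (induction k arbitrary: f g)
 case 0 thus ?case by (simp add: continuous_on_add)
next
 case (Suc k)
 show ?case by (rule Ck_on_has_derivativeI[OF assms(1), of _
     "%x v. FD f x v + FD g x v"])
   (use Suc in "auto intro!: has_derivative_add simp: frechet_derivative_works")
qed

lemma Ck_on_sum:
 assumes "open S" "!!i. i : I ==> Ck_on k S (f i)"
 shows "Ck_on k S (%x. SUM i:I. f i x)"
 using assms(2) by (induction I rule: infinite_finite_induct) (auto simp: Ck_on_const intro: Ck_on_add[OF assms(1)])

lemma Ck_on_bilinear:
 assumes "bounded_bilinear h" "open S" "Ck_on k S f" "Ck_on k S g"
 shows "Ck_on k S (%x. h (f x) (g x))"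
 using assms(3,4)
proof (induction k arbitrary: f g)
 case 0
 thus ?case using assms(1) by (simp add: bounded_bilinear.continuous_on)
next
 case (Suc k)
 have *: "(f has_derivative FD f x) (at x)"
  "(g has_derivative FD g x) (at x)" if "x : S" for x
  using Suc.prems that by (auto simp: frechet_derivative_works[symmetric])
 have k: "Ck_on k S f" "Ck_on k S g" using Suc.prems Ck_on_Suc_imp by auto
 show ?case by (rule Ck_on_has_derivativeI[OF assms(2), of _
     "%x v. h (f x) (FD g x v) + h (FD f x v) (g x)"])
   (use Suc k in "auto intro!: Ck_on_add[OF assms(2)] bounded_bilinear.FDERIV[OF assms(1)] simp: *")
qed

text \<open>\<open>Ck_on\<close> controls derivatives in fixed directions only, while the chain rule
  evaluates \<open>FD g (f x)\<close> at the moving vector \<open>FD f x v\<close>. Expanding that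
  vector in the basis leaves products with fixed directions, to which the induction hypothesis
  applies.\<close>

lemma Ck_on_comp:
 fixes f :: "'a::euclidean_space => 'b::euclidean_space" and g :: "'b => 'c::real_normed_vector"
 assumes "open S" "open T" "Ck_on k S f" "Ck_on k T g" "f ` S <= T"
 shows "Ck_on k S (%x. g (f x))"
 using assms(3,4)
proof (induction k arbitrary: g)
 case 0
 thus ?case using assms(5) by (auto intro: continuous_on_compose2)
next
 case (Suc k)
 have f: "(f has_derivative FD f x) (at x)" if "x : S" for x
  using Suc.prems that by (auto simp: frechet_derivative_works[symmetric])
 have g: "(g has_derivative FD g (f x)) (at (f x))" if "x : S" for x
  using Suc.prems that assms(5) by (auto simp: frechet_derivative_works[symmetric])
 have k: "Ck_on k S f" using Suc.prems Ck_on_Suc_imp by auto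
 have eq: "FD g (f x) w = (SUM b:Basis. (w \<bullet> b) *R FD g (f x) b)"
  if "x : S" for x w
 proof -
  have "linear (FD g (f x))" by (rule has_derivative_linear[OF g[OF that]])
  hence "FD g (f x) (SUM b:Basis. (w \<bullet> b) *R b) = (SUM b:Basis. (w \<bullet> b) *R FD g (f x) b)" by (simp add: linear_sum linear_cmul)
  thus ?thesis by (simp add: euclidean_representation)
 qed
 show ?case
 proof (rule Ck_on_has_derivativeI[OF assms(1), of _
    "%x v. SUM b:Basis. (FD f x v \<bullet> b) *R FD g (f x) b"])
  fix x assume x: "x : S"
  show "((%x. g (f x)) has_derivative (%v. SUM b:Basis. (FD f x v \<bullet> b) *R
    FD g (f x) b)) (at x)"
   unfolding eq[OF x, symmetric] by (rule has_derivative_compose[OF f[OF x] g[OF x]])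
 next
  fix v
  have "Ck_on k S (%x. (FD f x v \<bullet> b) *R FD g (f x) b)" for b by (rule Ck_on_bilinear[OF bounded_bilinear_scaleR assms(1)
    Ck_on_bounded_linear[OF bounded_linear_inner_left assms(1)]])
    (use Suc.prems Suc.IH[OF k, of "%y. FD g y b"] in auto)
  thus "Ck_on k S (%x. SUM b:Basis. (FD f x v \<bullet> b) *R FD g (f x) b)" by (intro Ck_on_sum[OF assms(1)])
 qed
qed

lemma Ck_on_ident: "open S ==> Ck_on k S (%x. x)" by (cases k) (auto simp: Ck_on_const)

lemma smooth_ident: "open S ==> smooth_on S (%x. x)" by (simp add: smooth_on_def Ck_on_ident)

lemma smooth_bounded_linear:
 "bounded_linear h ==> smooth_on S f ==> smooth_on S (%x. h (f x))" by (simp add: smooth_on_def Ck_on_bounded_linear)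

lemma smooth_linear:
 fixes h :: "'a::euclidean_space => 'b::real_normed_vector"
 shows "linear h ==> open S ==> smooth_on S h"
 using smooth_bounded_linear[OF _ smooth_ident] linear_conv_bounded_linear by blast

lemma smooth_bilinear:
 "bounded_bilinear h ==> smooth_on S f ==> smooth_on S g ==> smooth_on S (%x. h (f x) (g x))" by (simp add: smooth_on_def Ck_on_bilinear)

lemmas smooth_mult = smooth_bilinear[OF bounded_bilinear_mult]
 and smooth_scaleR = smooth_bilinear[OF bounded_bilinear_scaleR]
 and smooth_inner = smooth_bilinear[OF bounded_bilinear_inner]
 and smooth_inner_const = smooth_bounded_linear[OF bounded_linear_inner_left]

lemma smooth_add: "smooth_on S f ==> smooth_on S g ==> smooth_on S (%x. f x + g x)" by (simp add: smooth_on_def Ck_on_add)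

lemma smooth_sum:
 "open S ==> (!!i. i : I ==> smooth_on S (f i)) ==> smooth_on S (%x. SUM i:I. f i x)" by (simp add: smooth_on_def Ck_on_sum)

lemma smooth_minus: "smooth_on S f ==> smooth_on S (%x. - f x)"
 using smooth_bounded_linear[OF bounded_linear_minus[OF bounded_linear_ident]] .

lemma smooth_diff: "smooth_on S f ==> smooth_on S g ==> smooth_on S (%x. f x - g x)"
 using smooth_add[OF _ smooth_minus, of S f g] by simp

lemma smooth_cmult: "smooth_on S f ==> smooth_on S (%x. c * f x :: real)"
 using smooth_mult smooth_const smooth_open by blast

lemma smooth_comp:
 fixes f :: "'a::euclidean_space => 'b::euclidean_space" and g :: "'b => 'c::real_normed_vector"
 shows "smooth_on T g ==> smooth_on S f ==> f ` S <= T ==> smooth_on S (%x. g (f x))"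
 unfolding smooth_on_def using Ck_on_comp[where f=f and g=g and S=S and T=T] by simp

lemma smooth_Pair:
 assumes "smooth_on S f" "smooth_on S g"
 shows "smooth_on S (%x. (f x, g x))"
proof -
 have 1: "bounded_linear (%x. (x, 0))" and 2: "bounded_linear (%x. (0, x))"
  by (auto intro: bounded_linear_Pair bounded_linear_ident bounded_linear_zero)
 show ?thesis
  using smooth_add[OF smooth_bounded_linear[OF 1 assms(1)] smooth_bounded_linear[OF 2 assms(2)]] by simp
qed

lemmas smooth_fst = smooth_bounded_linear[OF bounded_linear_fst]
 and smooth_snd = smooth_bounded_linear[OF bounded_linear_snd]

lemma smooth_local:
 assumes "!!x. x : S ==> EX T. x : T & smooth_on T f"
 shows "open S ==> smooth_on S f"
proof -
 assume S: "open S"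
 have "Ck_on k S f" if "!!x. x : S ==> EX T. x : T & open T & Ck_on k T f" for k
  using that
 proof (induction k arbitrary: f)
  case 0
  thus ?case by simp (metis continuous_on_eq_continuous_at continuous_at_imp_continuous_on)
 next
  case (Suc k)
  have "Ck_on k S (%x. FD f x v)" for v by (rule Suc.IH) (use Suc.prems in force)
  thus ?case using Suc.prems by force
 qed
 thus ?thesis using S assms unfolding smooth_on_def by meson
qed

section \<open>Elementary functions of one real variable\<close>

lemma smooth_realI:
 fixes f :: "real => 'b::real_normed_vector"
 assumes "open S" "!!x. x : S ==> (f has_vector_derivative f' x) (at x)" "smooth_on S f'"
 shows "smooth_on S f" by (rule smooth_has_derivativeI[OF assms(1), of _ "%x v. v *R f' x"])
  (use assms smooth_scaleR[OF smooth_const] in "auto simp: has_vector_derivative_def")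

lemma smooth_vector_derivative:
 assumes "smooth_on S f"
 shows "smooth_on S (%x::real. vector_derivative f (at x))"
proof (rule smooth_cong[OF smooth_deriv[OF assms, of 1]])
 fix x assume "x : S"
 thus "FD f x 1 = vector_derivative f (at x)"
  using frechet_derivative_eq_vector_derivative[OF smooth_differentiable[OF assms]] by simp
qed

text \<open>If every derivative of a member is a linear combination of members, continuity
  bootstraps to smoothness: the induction on \<open>k\<close> runs over all members at once. The
  exponential, sine and cosine, the powers of the inverse and the flat functions are treated in this
  way.\<close>

lemma Ck_on_selfderiv:
 fixes f :: "nat => real => real"
 assumes "open S" "!!n x. x : S ==> (f n has_real_derivative (SUM i:I n. c n i * f i x)) (at x)"
 shows "smooth_on S (f n)"
proof -
 have "Ck_on k S (f n)" for k
 proof (induction k arbitrary: n)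
  case 0
  thus ?case using assms(2) by (meson Ck_on.simps(1) DERIV_isCont continuous_at_imp_continuous_on)
 next
  case (Suc k)
  show ?case
  proof (rule Ck_on_has_derivativeI[OF assms(1), of _ "%x v. (SUM i:I n. c n i * f i x) * v"])
   fix x assume "x : S"
   thus "(f n has_derivative (*) (SUM i:I n. c n i * f i x)) (at x)"
    using assms(2) has_field_derivative_def by blast
  next
   fix v
   show "Ck_on k S (%x. (SUM i:I n. c n i * f i x) * v)" by (intro Ck_on_bilinear[OF bounded_bilinear_mult] Ck_on_sum Ck_on_const assms Suc)
  qed
 qed
 thus ?thesis using assms(1) smooth_on_def by blast
qed

lemma smooth_exp: "smooth_on UNIV (exp :: real => real)"
 using Ck_on_selfderiv[of UNIV "%_. exp" "%_ _. 1" "%n. {0}"] by (auto intro!: derivative_eq_intros)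

lemma smooth_inverse: "smooth_on (-{0}) (inverse :: real => real)"
proof -
 have d: "((%x. inverse (x^Suc n)) has_real_derivative - real (Suc n) * inverse (x^Suc (Suc n))) (at x)"
  if "x ~= 0" for n and x :: real
 proof -
  have "((%x. inverse (x^Suc n)) has_real_derivative
    - (inverse (x^Suc n) * (real (Suc n) * x^n) * inverse (x^Suc n))) (at x)"
   using DERIV_pow[of "Suc n" x] that by (intro DERIV_inverse' derivative_eq_intros) (auto simp del: power_Suc)
  moreover have "inverse (x^Suc n) * (real (Suc n) * x^n) * inverse (x^Suc n)
    = real (Suc n) * inverse (x^Suc (Suc n))"
   using that by (simp add: field_simps)
  ultimately show ?thesis by (metis mult_minus_left)
 qed
 have "smooth_on (-{0::real}) ((%n x. inverse (x^Suc n)) 0)"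
  by (rule Ck_on_selfderiv[where f = "%n x. inverse (x^Suc n)" and I = "%n. {Suc n}" and c = "%n i. - real (Suc n)"])
   (use d in "auto simp del: power_Suc of_nat_Suc")
 thus ?thesis by simp
qed

lemma smooth_sin_cos:
 shows smooth_on_sin: "smooth_on UNIV (sin :: real => real)"
  and smooth_cos: "smooth_on UNIV (cos :: real => real)"
proof -
 define f where "f n = (if n = 0 then sin else cos :: real => real)" for n :: nat
 have "smooth_on UNIV (f n)" for n by (rule Ck_on_selfderiv[where I = "%n. {if n = 0 then 1 else 0}"
    and c = "%n i. if n = 0 then 1 else -1"]) (auto simp: f_def intro!: derivative_eq_intros)
 from this[of 0] this[of 1] show "smooth_on UNIV (sin :: real => real)" "smooth_on UNIV (cos :: real => real)" by (auto simp: f_def)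
qed

lemma smooth_divide:
 fixes f g :: "'a::euclidean_space => real"
 assumes "smooth_on S f" "smooth_on S g" "!!x. x : S ==> g x ~= 0"
 shows "smooth_on S (%x. f x / g x)"
proof -
 have "smooth_on S (%x. inverse (g x))" by (rule smooth_comp[OF smooth_inverse assms(2)]) (use assms(3) in auto)
 from smooth_mult[OF assms(1) this] show ?thesis by (simp add: divide_inverse)
qed

section \<open>Smooth fields of linear and bilinear maps\<close>

lemma Ck_on_linear_apply:
 fixes L :: "'a::euclidean_space => 'b::euclidean_space => 'c::real_normed_vector"
 assumes "open S" "!!x. x : S ==> linear (L x)" "!!v. v : Basis ==> Ck_on k S (%x. L x v)" "Ck_on k S f"
 shows "Ck_on k S (%x. L x (f x))"
proof -
 have "Ck_on k S (%x. SUM b:Basis. (f x \<bullet> b) *R L x b)" by (intro Ck_on_sum Ck_on_bilinear[OF bounded_bilinear_scaleR]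
   Ck_on_bounded_linear[OF bounded_linear_inner_left] assms)
 moreover have "(SUM b:Basis. (f x \<bullet> b) *R L x b) = L x (f x)" if "x : S" for x
 proof -
  have "L x (SUM b:Basis. (f x \<bullet> b) *R b) = (SUM b:Basis. (f x \<bullet> b) *R L x b)"
   using assms(2)[OF that] by (simp add: linear_sum linear_cmul)
  thus ?thesis by (simp add: euclidean_representation)
 qed
 ultimately show ?thesis by (rule Ck_on_cong[OF assms(1), rotated])
qed

lemma smooth_linear_apply:
 fixes L :: "'a::euclidean_space => 'b::euclidean_space => 'c::real_normed_vector"
 assumes "!!x. x : S ==> linear (L x)" "!!v. v : Basis ==> smooth_on S (%x. L x v)" "smooth_on S f"
 shows "smooth_on S (%x. L x (f x))"
proof -
 have "Ck_on k S (%x. L x (f x))" for k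
  by (rule Ck_on_linear_apply[OF smooth_open[OF assms(3)] assms(1) smooth_onD[OF assms(2)] smooth_onD[OF assms(3)]])
 thus ?thesis using smooth_open[OF assms(3)] unfolding smooth_on_def by simp
qed

lemma smooth_bilinear_apply:
 fixes L :: "'a::euclidean_space => 'b::euclidean_space => 'd::euclidean_space => 'c::real_normed_vector"
 assumes "!!x. x : S ==> bilinear (L x)"
  "!!v w. v : Basis ==> w : Basis ==> smooth_on S (%x. L x v w)" "smooth_on S f" "smooth_on S g"
 shows "smooth_on S (%x. L x (f x) (g x))"
proof (rule smooth_linear_apply[where L = "%x. L x (f x)", OF _ _ assms(4)])
 show "!!x. x : S ==> linear (L x (f x))" using assms(1) by (simp add: bilinear_def)
 fix w :: 'd assume w: "w : Basis"
 show "smooth_on S (%x. L x (f x) w)" by (rule smooth_linear_apply[where L="%x u. L x u w", OF _ _ assms(3)])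
   (use assms(1,2) w in "auto simp: bilinear_def")
qed

lemma smooth_deriv_apply:
 fixes f :: "'a::euclidean_space => 'b::real_normed_vector"
 assumes "smooth_on S f" "smooth_on S v"
 shows "smooth_on S (%x. FD f x (v x))" by (rule smooth_linear_apply[OF _ smooth_deriv[OF assms(1)] assms(2)])
  (rule smooth_FD_linear[OF assms(1)])

section \<open>Symmetry of second derivatives\<close>

lemma smooth_compose_line:
 fixes f :: "'a::euclidean_space => 'b::real_normed_vector"
 assumes "smooth_on S f" "x + t *R u : S"
 shows "((%t. f (x + t *R u)) has_vector_derivative FD f (x + t *R u) u) (at t)"
proof -
 have f: "(f has_derivative FD f (x + t *R u)) (at (x + t *R u))" by (rule smooth_has_derivative[OF assms])
 have "((%t. x + t *R u) has_derivative (%s. s *R u)) (at t)" by (auto intro!: derivative_eq_intros)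
 from has_derivative_compose[OF this f]
 have "((%t. f (x + t *R u)) has_derivative (%s. FD f (x + t *R u) (s *R u))) (at t)" .
 thus ?thesis
  unfolding has_vector_derivative_def linear_cmul[OF has_derivative_linear[OF f]] .
qed

text \<open>The mean value theorem is applied twice: to the difference in direction \<open>v\<close>
  as a function of the step along \<open>u\<close>, then to the derivative along \<open>u\<close> as
  a function of the step along \<open>v\<close>.\<close>

lemma second_difference_mvt:
 fixes f :: "'a::euclidean_space => real"
 assumes f: "smooth_on S f" and r: "ball x r <= S" and h: "0 < h" "h * (norm u + norm v) < r"
 shows "EX xx. norm (xx - x) <= h * (norm u + norm v) &
  f (x + h *R u + h *R v) - f (x + h *R u) - f (x + h *R v) + f x
   = h * h * FD (%z. FD f z u) xx v"
proof -
 have bnd: "norm (s *R u + t *R v) <= h * (norm u + norm v)" if "0 <= s" "s <= h" "0 <= t" "t <= h" for s t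
 proof -
  have "norm (s *R u + t *R v) <= s * norm u + t * norm v"
   using norm_triangle_ineq[of "s *R u" "t *R v"] that by simp
  also have "... <= h * norm u + h * norm v"
   using that by (intro add_mono mult_right_mono) auto
  finally show ?thesis by (simp add: algebra_simps)
 qed
 have inS: "x + s *R u + t *R v : S" if "0 <= s" "s <= h" "0 <= t" "t <= h" for s t
 proof -
  have "norm (s *R u + t *R v) < r" using bnd[OF that] h by linarith
  thus ?thesis by (intro subsetD[OF r]) (simp add: dist_norm norm_minus_commute add.commute)
 qed
 define g where "g s = f (x + s *R u + h *R v) - f (x + s *R u)" for s
 have der: "(g has_real_derivative FD f (x + s *R u + h *R v) u
   - FD f (x + s *R u) u) (at s)" if "0 <= s" "s <= h" for s
 proof -
  have "((%s. f ((x + h *R v) + s *R u)) has_vector_derivative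
    FD f ((x + h *R v) + s *R u) u) (at s)" by (rule smooth_compose_line[OF f]) (use inS[OF that, of h] h in "simp add: algebra_simps")
  moreover have "((%s. f (x + s *R u)) has_vector_derivative
    FD f (x + s *R u) u) (at s)" by (rule smooth_compose_line[OF f]) (use inS[OF that, of 0] h in "simp add: algebra_simps")
  ultimately have "(g has_vector_derivative (FD f ((x + h *R v) + s *R u) u
    - FD f (x + s *R u) u)) (at s)"
   unfolding g_def by (auto intro!: has_vector_derivative_diff simp: algebra_simps)
  thus ?thesis by (simp add: has_real_derivative_iff_has_vector_derivative algebra_simps)
 qed
 obtain s where s: "0 < s" "s < h" and gs: "g h - g 0 = (h - 0) * (FD f (x + s *R u + h *R v) u
   - FD f (x + s *R u) u)"
  using MVT2[OF h(1) der] by blast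
 define k where "k t = FD f (x + s *R u + t *R v) u" for t
 have der2: "(k has_real_derivative
  FD (%z. FD f z u) (x + s *R u + t *R v) v) (at t)" if "0 <= t" "t <= h" for t
  using smooth_compose_line[OF smooth_deriv[OF f, of u], of "x + s *R u" t v] inS[of s t] that s
  by (simp add: k_def[abs_def] has_real_derivative_iff_has_vector_derivative)
 obtain t where t: "0 < t" "t < h" and kt: "k h - k 0 = (h - 0) *
  FD (%z. FD f z u) (x + s *R u + t *R v) v"
  using MVT2[OF h(1) der2] by blast
 have "g h - g 0 = h * (k h - k 0)" using gs by (simp add: k_def)
 hence "g h - g 0 = h * h * FD (%z. FD f z u) (x + s *R u + t *R v) v"
  using kt by simp
 moreover have "norm (x + s *R u + t *R v - x) <= h * (norm u + norm v)"
  using bnd[of s t] s t by (simp add: add.assoc)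
 ultimately show ?thesis by (intro exI[of _ "x + s *R u + t *R v"]) (simp add: g_def)
qed

text \<open>The second difference is symmetric in \<open>u\<close> and \<open>v\<close>, so the two
  mixed derivatives take a common value at two points arbitrarily close to \<open>x\<close>; their
  continuity does the rest.\<close>

lemma second_derivative_symmetric_real:
 fixes f :: "'a::euclidean_space => real"
 assumes f: "smooth_on S f" and x: "x : S"
 shows "FD (%z. FD f z u) x v
   = FD (%z. FD f z v) x u"
proof (rule ccontr)
 define P where "P y = FD (%z. FD f z u) y v" for y
 define Q where "Q y = FD (%z. FD f z v) y u" for y
 assume "~ ?thesis"
 hence e: "0 < \<bar>P x - Q x\<bar> / 2" by (simp add: P_def Q_def)
 have op: "open S" by (rule smooth_open[OF f])
 have cont: "continuous_on S P" "continuous_on S Q"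
  unfolding P_def Q_def by (intro smooth_cont smooth_deriv f)+
 obtain r where r: "0 < r" "ball x r <= S" using op x open_contains_ball by blast
 have "isCont P x" "isCont Q x" using cont op x by (auto simp: continuous_on_eq_continuous_at)
 then obtain d1 d2 where d1: "0 < d1" "!!y. dist y x < d1 ==> dist (P y) (P x) < \<bar>P x - Q x\<bar> / 2"
  and d2: "0 < d2" "!!y. dist y x < d2 ==> dist (Q y) (Q x) < \<bar>P x - Q x\<bar> / 2"
  using e unfolding continuous_at_eps_delta dist_norm by (metis norm_minus_commute)
 define m where "m = min r (min d1 d2)"
 have m: "0 < m" "m <= r" "m <= d1" "m <= d2" using r d1 d2 by (auto simp: m_def)
 define h where "h = m / (2 * (norm u + norm v + 1))"
 have den: "0 < norm u + norm v + 1" by (smt (verit) norm_ge_zero)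
 have h: "0 < h" using m den by (simp add: h_def)
 have "h * (norm u + norm v) <= h * (norm u + norm v + 1)" using h by simp
 also have "... = m / 2" using den unfolding h_def by (simp only: times_divide_eq_left times_divide_eq_right) (simp add: field_simps)
 finally have hm: "h * (norm u + norm v) < m" using m by linarith
 obtain xx where xx: "norm (xx - x) <= h * (norm u + norm v)"
  "f (x + h *R u + h *R v) - f (x + h *R u) - f (x + h *R v) + f x = h * h * P xx"
  using second_difference_mvt[OF f r(2) h, of u v] hm m by (auto simp: P_def)
 obtain et where et: "norm (et - x) <= h * (norm v + norm u)"
  "f (x + h *R v + h *R u) - f (x + h *R v) - f (x + h *R u) + f x = h * h * Q et"
  using second_difference_mvt[OF f r(2) h, of v u] hm m by (auto simp: Q_def add.commute)
 have "h * h * P xx = h * h * Q et" using xx(2) et(2) by (simp add: algebra_simps)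
 hence "P xx = Q et" using h by simp
 moreover have "dist (P xx) (P x) < \<bar>P x - Q x\<bar> / 2" "dist (Q et) (Q x) < \<bar>P x - Q x\<bar> / 2"
  using d1(2)[of xx] d2(2)[of et] xx(1) et(1) hm m by (auto simp: dist_norm add.commute)
 ultimately show False by (simp add: dist_real_def abs_if split: if_splits)
qed

lemma frechet_derivative_inner:
 assumes "f differentiable (at x)"
 shows "FD (%z. f z \<bullet> b) x v = FD f x v \<bullet> b"
proof -
 have "((%z. f z \<bullet> b) has_derivative (%v. FD f x v \<bullet> b)) (at x)"
  using assms unfolding frechet_derivative_works by (rule bounded_linear.has_derivative[OF bounded_linear_inner_left])
 thus ?thesis by (simp add: has_derivative_frechet)
qed

lemma frechet_derivative_cong_open:
 assumes "open S" "x : S" "!!y. y : S ==> f y = g y"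
 shows "FD f x = FD g x"
proof -
 have "(f has_derivative D) (at x) \<longleftrightarrow> (g has_derivative D) (at x)" for D
  using has_derivative_transform_within_open[OF _ assms(1,2), where f = f and g = g and f' = D]
   has_derivative_transform_within_open[OF _ assms(1,2), where f = g and g = f and f' = D] assms(3) by auto
 thus ?thesis by (simp add: frechet_derivative_def)
qed

lemma second_derivative_symmetric:
 fixes f :: "'a::euclidean_space => 'b::euclidean_space"
 assumes f: "smooth_on S f" and x: "x : S"
 shows "FD (%z. FD f z u) x v
   = FD (%z. FD f z v) x u"
proof (rule euclidean_eqI)
 fix b :: 'b assume "b : Basis"
 have *: "FD (%z. FD f z u) x v \<bullet> b
   = FD (%z. FD (%z. f z \<bullet> b) z u) x v" for u v
 proof -
  have "FD (%z. FD f z u) x v \<bullet> b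
   = FD (%z. FD f z u \<bullet> b) x v" by (rule frechet_derivative_inner[symmetric])
    (rule smooth_differentiable[OF smooth_deriv[OF f] x])
  also have "FD (%z. FD f z u \<bullet> b) x
   = FD (%z. FD (%z. f z \<bullet> b) z u) x" by (rule frechet_derivative_cong_open[OF smooth_open[OF f] x])
    (simp add: frechet_derivative_inner smooth_differentiable[OF f])
  finally show ?thesis .
 qed
 show "FD (%z. FD f z u) x v \<bullet> b =
   FD (%z. FD f z v) x u \<bullet> b"
  unfolding * by (rule second_derivative_symmetric_real[OF smooth_inner_const[OF f] x])
qed

text \<open>Continuity of \<open>q\<close> suffices: since \<open>f\<close> vanishes at
  \<open>x\<close>, the error made by freezing \<open>q\<close> at \<open>x\<close> is small
  compared with the distance. This turns continuity into differentiability, for inverses of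
  operators as well as for solutions that depend on parameters.\<close>

lemma has_derivative_scaleR_vanishing:
 fixes f :: "'a::real_normed_vector => real" and q :: "'a => 'b::real_normed_vector"
 assumes f: "(f has_derivative f') (at x)" and 0: "f x = 0" and q: "isCont q x"
 shows "((%y. f y *R q y) has_derivative (%d. f' d *R q x)) (at x)"
proof -
 have "((%y. f y *R (q y - q x)) has_derivative (%d. 0)) (at x)"
  unfolding has_derivative_at_alt
 proof (intro conjI allI impI)
  fix e :: real assume e: "0 < e"
  have bl: "bounded_linear f'" using f by (rule has_derivative_bounded_linear)
  obtain B where B: "0 < B" "!!y. norm (f' y) <= norm y * B" using bounded_linear.pos_bounded[OF bl] by blast
  obtain d1 where d1: "0 < d1" "!!y. norm (y - x) < d1 ==> norm (f y - f x - f' (y - x)) <= 1 * norm (y - x)"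
   using f unfolding has_derivative_at_alt by (meson zero_less_one)
  have "0 < e / (1 + B)" using e B by simp
  then obtain d2 where d2: "0 < d2" "!!y. dist y x < d2 ==> dist (q y) (q x) < e / (1 + B)"
   using q unfolding continuous_at_eps_delta dist_norm by blast
  show "EX d>0. ALL y. norm (y - x) < d -->
    norm (f y *R (q y - q x) - f x *R (q x - q x) - 0) <= e * norm (y - x)"
  proof (intro exI[of _ "min d1 d2"] conjI allI impI)
   fix y assume y: "norm (y - x) < min d1 d2"
   have "norm (f y) <= norm (f y - f x - f' (y - x)) + norm (f' (y - x))"
    using 0 by (smt (verit) norm_triangle_sub real_norm_def)
   also have "... <= (1 + B) * norm (y - x)"
    using d1(2)[of y] B(2)[of "y - x"] y by (simp add: algebra_simps)
   finally have 1: "norm (f y) <= (1 + B) * norm (y - x)" .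
   have 2: "norm (q y - q x) <= e / (1 + B)"
    using d2(2)[of y] y by (simp add: dist_norm)
   have "norm (f y *R (q y - q x)) <= ((1 + B) * norm (y - x)) * (e / (1 + B))"
    unfolding norm_scaleR using 1 2 by (intro mult_mono) auto
   also have "... = e * norm (y - x)" using B by simp
   finally show "norm (f y *R (q y - q x) - f x *R (q x - q x) - 0) <= e * norm (y - x)" by simp
  qed (use d1 d2 in auto)
 qed auto
 from has_derivative_add[OF this has_derivative_scaleR_left[OF f, of "q x"]] show ?thesis by (simp add: scaleR_diff_right)
qed

section \<open>Inverses of families of linear operators and of smooth maps\<close>

lemma linear_basis_expand:
 fixes f :: "'a::euclidean_space => 'b::real_normed_vector"
 assumes "linear f" shows "f v = (SUM b:Basis. (v \<bullet> b) *R f b)"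
proof -
 have "f (SUM b:Basis. (v \<bullet> b) *R b) = (SUM b:Basis. (v \<bullet> b) *R f b)"
  using assms by (simp add: linear_sum linear_cmul)
 thus ?thesis by (simp add: euclidean_representation)
qed

lemma linear_inj_inv:
 fixes f :: "'a::euclidean_space => 'a"
 assumes "linear f" "inj f"
 shows "linear (inv f)" "f (inv f x) = x" "inv f (f x) = x"
proof -
 have "surj f" using assms linear_injective_imp_surjective by blast
 hence s: "f (inv f x) = x" for x by (simp add: surj_f_inv_f)
 show "f (inv f x) = x" "inv f (f x) = x" using s assms(2) by auto
 show "linear (inv f)"
 proof (rule linearI)
  show "inv f (a + b) = inv f a + inv f b" for a b by (rule injD[OF assms(2)]) (simp add: s linear_add[OF assms(1)])
  show "inv f (c *R a) = c *R inv f a" for a c by (rule injD[OF assms(2)]) (simp add: s linear_cmul[OF assms(1)])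
 qed
qed

text \<open>A lower bound \<open>c * norm w <= norm (L x w)\<close> survives with
  \<open>c / 2\<close> near \<open>x\<close>; it turns the defect of \<open>L y\<close> against
  \<open>L x\<close> at \<open>inv (L x) z\<close> into a bound for the difference of the
  inverses.\<close>

lemma isCont_inv_linear:
 fixes L :: "'p::real_normed_vector => 'e::euclidean_space => 'e"
 assumes S: "open S" "x : S" and lin: "!!y. y : S ==> linear (L y)" "!!y. y : S ==> inj (L y)"
  and cL: "!!b. b : Basis ==> isCont (%y. L y b) x"
 shows "isCont (%y. inv (L y) z) x"
proof -
 note inv = linear_inj_inv[OF lin(1) lin(2)]
 define de where "de y = (SUM b:Basis. norm (L y b - L x b))" for y
 have cde: "isCont de x" unfolding de_def by (intro continuous_intros cL) auto
 have de: "norm (L y w - L x w) <= de y * norm w" if "y : S" for y w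
 proof -
  have "L y w - L x w = (SUM b:Basis. (w \<bullet> b) *R (L y b - L x b))"
   using linear_basis_expand[OF lin(1)[OF that], of w] linear_basis_expand[OF lin(1)[OF S(2)], of w] by (simp add: sum_subtractf scaleR_diff_right)
  also have "norm ... <= (SUM b:Basis. \<bar>w \<bullet> b\<bar> * norm (L y b - L x b))" by (rule order_trans[OF norm_sum]) simp
  also have "... <= (SUM b:Basis. norm w * norm (L y b - L x b))" by (intro sum_mono mult_right_mono Basis_le_norm) auto
  finally show ?thesis by (simp add: de_def sum_distrib_left mult.commute)
 qed
 obtain c where c: "0 < c" "!!w. c * norm w <= norm (L x w)"
  using linear_inj_bounded_below_pos[OF lin(1)[OF S(2)] lin(2)[OF S(2)]] by blast
 have bnd: "\<forall>\<^sub>F y in at x. norm (inv (L y) z - inv (L x) z) <= (2 / c) * (de y * norm (inv (L x) z))"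
 proof -
  have "(de \<longlongrightarrow> de x) (at x)" using cde isCont_def by blast
  moreover have "de x < c / 2" using c(1) by (simp add: de_def)
  ultimately have "\<forall>\<^sub>F y in at x. de y < c / 2" by (rule order_tendstoD(2))
  moreover have "\<forall>\<^sub>F y in at x. y : S" using S eventually_at_topological by blast
  ultimately show ?thesis
  proof eventually_elim
   case (elim y)
   have low: "c / 2 * norm w <= norm (L y w)" for w
   proof -
    have "c * norm w <= norm (L y w) + norm (L y w - L x w)"
     using c(2)[of w] norm_triangle_sub[of "L x w" "L y w"] by (simp add: norm_minus_commute)
    also have "norm (L y w - L x w) <= c / 2 * norm w"
     using de[OF elim(2), of w] mult_right_mono[of "de y" "c/2" "norm w"] elim(1) by simp
    finally show ?thesis by (simp add: field_simps)
   qed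
   have "c / 2 * norm (inv (L y) z - inv (L x) z) <= norm (L y (inv (L y) z - inv (L x) z))" by (rule low)
   also have "L y (inv (L y) z - inv (L x) z) = - (L y (inv (L x) z) - L x (inv (L x) z))"
    using inv[OF elim(2) elim(2)] inv[OF S(2) S(2)] by (simp add: linear_diff[OF lin(1)[OF elim(2)]])
   also have "norm ... <= de y * norm (inv (L x) z)" unfolding norm_minus_cancel by (rule de[OF elim(2)])
   finally show ?case using c(1) by (simp add: field_simps)
  qed
 qed
 have "((%y. (2 / c) * (de y * norm (inv (L x) z))) \<longlongrightarrow> (2 / c) * (de x * norm (inv (L x) z))) (at x)"
  using cde unfolding isCont_def by (intro tendsto_intros)
 hence "((%y. (2 / c) * (de y * norm (inv (L x) z))) \<longlongrightarrow> 0) (at x)" by (simp add: de_def)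
 hence "((%y. inv (L y) z - inv (L x) z) \<longlongrightarrow> 0) (at x)"
  using bnd by (rule Lim_null_comparison[rotated])
 thus ?thesis unfolding isCont_def by (simp add: LIM_zero_iff)
qed

text \<open>With \<open>w = inv (L x) v\<close> one has
  \<open>inv (L y) v = w - inv (L y) (L y w - v)\<close>. The bracket vanishes at
  \<open>y = x\<close>, so continuity of the inverse is all that is needed to differentiate.\<close>

lemma has_derivative_inv_linear:
 fixes L :: "'p::real_normed_vector => 'e::euclidean_space => 'e"
 assumes S: "open S" "x : S" and lin: "!!y. y : S ==> linear (L y)" "!!y. y : S ==> inj (L y)"
  and d: "!!b. b : Basis ==> ((%y. L y b) has_derivative D b) (at x)"
 shows "((%y. inv (L y) v) has_derivative
  (%d. - inv (L x) (SUM b:Basis. (inv (L x) v \<bullet> b) *R D b d))) (at x)"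
proof -
 note inv = linear_inj_inv[OF lin(1) lin(2)]
 have cinv: "isCont (%y. inv (L y) z) x" for z by (rule isCont_inv_linear[OF S lin]) (use has_derivative_continuous[OF d] in auto)
 define w where "w = inv (L x) v"
 define h where "h y = (SUM b:Basis. (w \<bullet> b) *R L y b)" for y
 define h' where "h' d = (SUM b:Basis. (w \<bullet> b) *R D b d)" for d
 have hL: "h y = L y w" if "y : S" for y
  unfolding h_def using linear_basis_expand[OF lin(1)[OF that], of w] by simp
 have hx: "h x = v" using hL[OF S(2)] inv[OF S(2) S(2)] by (simp add: w_def)
 have dh: "(h has_derivative h') (at x)"
  unfolding h_def h'_def by (intro has_derivative_sum has_derivative_scaleR_right d)
 have dk: "((%y. (h y - v) \<bullet> b) has_derivative (%d. h' d \<bullet> b)) (at x)" for b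
 proof -
  have "((%y. h y - v) has_derivative h') (at x)"
   using has_derivative_diff[OF dh has_derivative_const[of v]] by simp
  thus ?thesis by (rule has_derivative_inner_left)
 qed
 have "((%y. w - (SUM b:Basis. ((h y - v) \<bullet> b) *R inv (L y) b)) has_derivative
   (%d. 0 - (SUM b:Basis. (h' d \<bullet> b) *R inv (L x) b))) (at x)" by (intro has_derivative_diff has_derivative_const has_derivative_sum
    has_derivative_scaleR_vanishing dk cinv) (simp add: hx)
 moreover have "0 - (SUM b:Basis. (h' d \<bullet> b) *R inv (L x) b) = - inv (L x) (h' d)" for d
  using linear_basis_expand[OF inv(1)[OF S(2) S(2)], of "h' d"] by simp
 ultimately have "((%y. w - (SUM b:Basis. ((h y - v) \<bullet> b) *R inv (L y) b)) has_derivative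
   (%d. - inv (L x) (h' d))) (at x)" by simp
 moreover have "w - (SUM b:Basis. ((h y - v) \<bullet> b) *R inv (L y) b) = inv (L y) v" if y: "y : S" for y
 proof -
  have "(SUM b:Basis. ((h y - v) \<bullet> b) *R inv (L y) b) = inv (L y) (L y w - v)"
   using linear_basis_expand[OF inv(1)[OF y y], of "h y - v"] hL[OF y] by simp
  also have "... = w - inv (L y) v" using inv[OF y y] by (simp add: linear_diff)
  finally show ?thesis by simp
 qed
 ultimately show ?thesis
  unfolding h'_def[abs_def] w_def[symmetric] by (rule has_derivative_transform_within_open[OF _ S])
qed

lemma Ck_on_inv_linear:
 fixes L :: "'p::euclidean_space => 'e::euclidean_space => 'e"
 assumes S: "open S" and lin: "!!y. y : S ==> linear (L y)" "!!y. y : S ==> inj (L y)"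
  and d: "!!b. b : Basis ==> Ck_on k S (%y. L y b)"
 shows "Ck_on k S (%y. inv (L y) v)"
proof -
 note inv = linear_inj_inv[OF lin(1) lin(2)]
 show ?thesis using d
 proof (induction k arbitrary: v)
  case 0
  have "isCont (%y. inv (L y) v) x" if "x : S" for x
   by (rule isCont_inv_linear[OF S that lin]) (use 0 S that in "auto simp: continuous_on_eq_continuous_at")
  thus ?case by (simp add: continuous_at_imp_continuous_on)
 next
  case (Suc k)
  have db: "((%y. L y b) has_derivative FD (%y. L y b) x) (at x)"
   if "b : Basis" "x : S" for b x
   using Suc.prems[OF that(1)] that(2) by (simp add: frechet_derivative_works[symmetric])
  note der = has_derivative_inv_linear[OF S _ lin db]
  have Ck: "Ck_on k S (%y. L y b)" if "b : Basis" for b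
   using Suc.prems[OF that] by (rule Ck_on_Suc_imp)
  have IH: "Ck_on k S (%y. inv (L y) v)" for v using Suc.IH Ck by blast
  show ?case
  proof (rule Ck_on_has_derivativeI[OF S der])
   fix w
   have "Ck_on k S (%x. inv (L x) (SUM b:Basis. (inv (L x) v \<bullet> b) *R FD (%y. L y b) x w))"
    by (rule Ck_on_linear_apply[where L = "%x. inv (L x)", OF S inv(1) IH])
     (use Suc.prems IH in "auto intro!: Ck_on_sum[OF S] Ck_on_bilinear[OF bounded_bilinear_scaleR S]
      Ck_on_bounded_linear[OF bounded_linear_inner_left S]")
   thus "Ck_on k S (%x. - inv (L x) (SUM b:Basis. (inv (L x) v \<bullet> b) *R FD (%y. L y b) x w))"
    by (rule Ck_on_bounded_linear[OF bounded_linear_minus[OF bounded_linear_ident] S])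
  qed
 qed
qed

lemma smooth_inv_linear:
 fixes L :: "'p::euclidean_space => 'e::euclidean_space => 'e"
 assumes "open S" "!!y. y : S ==> linear (L y)" "!!y. y : S ==> inj (L y)"
  and "!!b. b : Basis ==> smooth_on S (%y. L y b)"
 shows "smooth_on S (%y. inv (L y) v)"
proof -
 have "Ck_on k S (%y. inv (L y) v)" for k by (rule Ck_on_inv_linear[OF assms(1-3) smooth_onD[OF assms(4)]])
 thus ?thesis using assms(1) unfolding smooth_on_def by simp
qed

text \<open>Openness of the image is invariance of domain. The derivative of the inverse is the
  inverse operator taken at the inverse point, so each order of differentiability of the inverse
  yields the next.\<close>

lemma smooth_inverse_function:
 fixes f :: "'e::euclidean_space => 'e"
 assumes f: "smooth_on S f" and inj: "inj_on f S" and d: "!!x. x : S ==> inj (FD f x)"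
 shows "open (f ` S)" "smooth_on (f ` S) (inv_into S f)"
proof -
 have S: "open S" by (rule smooth_open[OF f])
 have fS: "open (f ` S)" by (rule invariance_of_domain[OF smooth_cont[OF f] S inj])
 thus "open (f ` S)" .
 define g where "g = inv_into S f"
 have gS: "g y : S" "f (g y) = y" if "y : f ` S" for y
  using that by (auto simp: g_def inv_into_into f_inv_into_f)
 have lin: "linear (FD f x)" if "x : S" for x by (rule smooth_FD_linear[OF f that])
 have der: "(g has_derivative inv (FD f (g y))) (at y)" if y: "y : f ` S" for y
 proof -
  have "(g has_derivative inv (FD f (g y))) (at (f (g y)))"
  proof (rule has_derivative_inverse_strong[OF S gS(1)[OF y] smooth_cont[OF f]])
   show "g (f x) = x" if "x : S" for x using that inj by (simp add: g_def)
   show "(f has_derivative FD f (g y)) (at (g y))" by (rule smooth_has_derivative[OF f gS(1)[OF y]])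
   show "FD f (g y) o inv (FD f (g y)) = id"
    using linear_inj_inv(2)[OF lin[OF gS(1)[OF y]] d[OF gS(1)[OF y]]] by auto
  qed
  thus ?thesis using gS(2)[OF y] by simp
 qed
 have "Ck_on k (f ` S) g" for k
 proof (induction k)
  case 0
  show ?case using der has_derivative_continuous by (fastforce intro: continuous_at_imp_continuous_on)
 next
  case (Suc k)
  show ?case
  proof (rule Ck_on_has_derivativeI[OF fS der])
   fix v
   have "smooth_on S (%x. inv (FD f x) v)" by (rule smooth_inv_linear[OF S lin d smooth_deriv[OF f]])
   thus "Ck_on k (f ` S) (%y. inv (FD f (g y)) v)"
    using Ck_on_comp[OF fS S Suc, of "%x. inv (FD f x) v"] gS(1) smooth_onD by blast
  qed
 qed
 thus "smooth_on (f ` S) (inv_into S f)" using fS unfolding smooth_on_def g_def by simp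
qed

lemma smooth_local_injective:
 fixes f :: "'e::euclidean_space => 'e"
 assumes f: "smooth_on S f" and x: "x : S" and d: "inj (FD f x)"
 obtains r where "0 < r" "ball x r <= S" "inj_on f (ball x r)"
  "!!y. y : ball x r ==> inj (FD f y)"
proof -
 have S: "open S" by (rule smooth_open[OF f])
 have lin: "linear (FD f x)" if "x : S" for x by (rule smooth_FD_linear[OF f that])
 define de where "de y = (SUM b:Basis. norm (FD f y b - FD f x b))" for y
 have de: "norm (FD f y w - FD f x w) <= de y * norm w"
  if "y : S" for y w
 proof -
  have "FD f y w - FD f x w
    = (SUM b:Basis. (w \<bullet> b) *R (FD f y b - FD f x b))"
   using linear_basis_expand[OF lin[OF that], of w] linear_basis_expand[OF lin[OF x], of w] by (simp add: sum_subtractf scaleR_diff_right)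
  also have "norm ... <= (SUM b:Basis. \<bar>w \<bullet> b\<bar> * norm (FD f y b - FD f x b))" by (rule order_trans[OF norm_sum]) simp
  also have "... <= (SUM b:Basis. norm w * norm (FD f y b - FD f x b))" by (intro sum_mono mult_right_mono Basis_le_norm) auto
  finally show ?thesis by (simp add: de_def sum_distrib_left mult.commute)
 qed
 have cde: "continuous_on S de"
  unfolding de_def by (intro continuous_intros smooth_cont smooth_deriv f)
 have small: "EX d>0. ALL y. dist x y < d --> y : S & de y < e" if "0 < e" for e
 proof -
  have "open {y : S. de y < e}"
   using continuous_open_preimage[OF cde S, of "{..<e}"] by (simp add: vimage_def Int_def)
  moreover have "x : {y : S. de y < e}" using x that by (simp add: de_def)
  ultimately show ?thesis unfolding open_contains_ball by (fastforce simp: subset_iff)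
 qed
 obtain r1 where r1: "0 < r1" "ball x r1 <= S" "inj_on f (ball x r1)"
 proof (rule has_derivative_locally_injective[OF x S, of "inv (FD f x)"
    "%x. FD f x" f])
  show "bounded_linear (inv (FD f x))"
   using linear_inj_inv(1)[OF lin[OF x] d] linear_conv_bounded_linear by blast
  show "inv (FD f x) o FD f x = id"
   using linear_inj_inv(3)[OF lin[OF x] d] by auto
  fix e :: real assume e: "0 < e"
  obtain d where d: "0 < d" "!!y. dist x y < d ==> y : S & de y < e / 2" using small[of "e/2"] e by auto
  have "onorm (%v. FD f y v - FD f x v) < e" if "dist x y < d" for y
  proof -
   have "onorm (%v. FD f y v - FD f x v) <= de y" by (rule onorm_bound) (use de d(2)[OF that] in "auto simp: de_def sum_nonneg")
   thus ?thesis using d(2)[OF that] e by linarith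
  qed
  thus "EX d>0. ALL y. dist x y < d -->
    onorm (%v. FD f y v - FD f x v) < e"
   using d(1) by blast
 qed (use smooth_has_derivative[OF f] in auto)
 obtain c where c: "0 < c" "!!w. c * norm w <= norm (FD f x w)"
  using linear_inj_bounded_below_pos[OF lin[OF x] d] by blast
 obtain r2 where r2: "0 < r2" "!!y. dist x y < r2 ==> y : S & de y < c" using small[OF c(1)] by auto
 have "inj (FD f y)" if "y : ball x (min r1 r2)" for y
 proof -
  have y: "y : S" "de y < c" using r2(2)[of y] that by auto
  have "w = 0" if "FD f y w = 0" for w
  proof (rule ccontr)
   assume "w ~= 0"
   hence "de y * norm w < c * norm w" using y(2) by simp
   thus False using de[OF y(1), of w] c(2)[of w] that by simp
  qed
  thus ?thesis using linear_injective_0[OF lin[OF y(1)]] by blast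
 qed
 thus ?thesis
  using r1 r2(1) by (intro that[of "min r1 r2"]) (auto intro: inj_on_subset[OF r1(3)])
qed

section \<open>Cut-off functions and parameter integrals\<close>

text \<open>The classical flat function exp(-1/x) with additional powers of 1/x, which make the
  family closed under differentiation, as \<open>Ck_on_selfderiv\<close> requires.\<close>

definition flat_exp :: "nat => real => real" where
 "flat_exp n x = (if x <= 0 then 0 else exp (- inverse x) * inverse x ^ n)"

text \<open>One keeps the term of order \<open>n + 2\<close> in the series of exp(1/x). The two
  surplus powers of \<open>x\<close> make the difference quotients at 0 tend to 0.\<close>

lemma flat_exp_le: "\<bar>flat_exp n x\<bar> <= fact (n + 2) * x\<^sup>2"
proof (cases "x <= 0")
 case False
 hence x: "0 < x" by simp
 have "inverse x ^ (n + 2) / fact (n + 2) <= exp (inverse x)"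
 proof -
  have s: "(%k. inverse x ^ k /\<^sub>R fact k) sums exp (inverse x)" by (rule exp_converges)
  have "sum (%k. inverse x ^ k /\<^sub>R fact k) {n + 2} <= (\<Sum>k. inverse x ^ k /\<^sub>R fact k)"
   by (rule sum_le_suminf[OF sums_summable[OF s]]) (use x in auto)
  thus ?thesis using sums_unique[OF s] by (simp add: divide_inverse mult.commute)
 qed
 hence "inverse x ^ (n + 2) <= fact (n + 2) * exp (inverse x)" by (simp add: divide_le_eq mult.commute)
 hence "exp (- inverse x) * inverse x ^ (n + 2) <= exp (- inverse x) * (fact (n + 2) * exp (inverse x))" by (rule mult_left_mono) simp
 also have "... = fact (n + 2)" by (simp add: exp_minus)
 finally have "exp (- inverse x) * inverse x ^ (n + 2) <= fact (n + 2)" .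
 hence "exp (- inverse x) * inverse x ^ (n + 2) * x\<^sup>2 <= fact (n + 2) * x\<^sup>2" by (rule mult_right_mono) simp
 moreover have "exp (- inverse x) * inverse x ^ (n + 2) * x\<^sup>2 = flat_exp n x"
  using x by (simp add: flat_exp_def power_add power2_eq_square field_simps)
 moreover have "0 <= flat_exp n x" using x by (simp add: flat_exp_def)
 ultimately show ?thesis by simp
qed (simp add: flat_exp_def)

lemma flat_exp_deriv:
 "(flat_exp n has_real_derivative (flat_exp (n + 2) x - real n * flat_exp (n + 1) x)) (at x)"
proof -
 consider "x < 0" | "x > 0" | "x = 0" by linarith
 thus ?thesis
 proof cases
  case 1
  have "((%x. 0) has_real_derivative 0) (at x)" by simp
  hence "(flat_exp n has_real_derivative 0) (at x)"
   by (rule has_field_derivative_transform_within_open[where S = "{..<0}"]) (use 1 in "auto simp: flat_exp_def")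
  thus ?thesis using 1 by (simp add: flat_exp_def)
 next
  case 2
  have "((%x. exp (- inverse x) * inverse x ^ n) has_real_derivative
    (exp (- inverse x) * inverse x ^ (n + 2) - real n * (exp (- inverse x) * inverse x ^ (n + 1)))) (at x)"
  proof -
   have d: "((%x. exp (- inverse x) * inverse x ^ n) has_real_derivative
    (exp (- inverse x) * (inverse x * 1 * inverse x)) * inverse x ^ n
    + (real n * inverse x ^ (n - Suc 0) * - (inverse x * 1 * inverse x)) * exp (- inverse x)) (at x)"
    by (rule derivative_eq_intros refl | use 2 in simp)+
   have e: "(exp (- inverse x) * (inverse x * 1 * inverse x)) * inverse x ^ n
    + (real n * inverse x ^ (n - Suc 0) * - (inverse x * 1 * inverse x)) * exp (- inverse x)
    = exp (- inverse x) * inverse x ^ (n + 2) - real n * (exp (- inverse x) * inverse x ^ (n + 1))" by (cases n) (auto simp: algebra_simps)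
   show ?thesis using d unfolding e .
  qed
  hence "(flat_exp n has_real_derivative
    (exp (- inverse x) * inverse x ^ (n + 2) - real n * (exp (- inverse x) * inverse x ^ (n + 1)))) (at x)"
   by (rule has_field_derivative_transform_within_open[where S = "{0<..}"]) (use 2 in "auto simp: flat_exp_def")
  thus ?thesis using 2 by (simp add: flat_exp_def)
 next
  case 3
  have "(flat_exp n has_real_derivative 0) (at 0)"
   unfolding DERIV_def
  proof (rule Lim_null_comparison[where g = "%h. fact (n + 2) * \<bar>h\<bar>"])
   show "\<forall>\<^sub>F h in at 0. norm ((flat_exp n (0 + h) - flat_exp n 0) / h) <= fact (n + 2) * \<bar>h\<bar>"
   proof (rule eventually_at_filter[THEN iffD2], rule always_eventually, intro allI impI)
    fix h :: real assume "h ~= 0"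
    thus "norm ((flat_exp n (0 + h) - flat_exp n 0) / h) <= fact (n + 2) * \<bar>h\<bar>"
     using flat_exp_le[of n h] by (simp add: flat_exp_def[of n 0] abs_mult divide_le_eq power2_eq_square abs_mult_self_eq mult.assoc)
   qed
   show "((%h. fact (n + 2) * \<bar>h\<bar>) \<longlongrightarrow> (0::real)) (at 0)" by (rule tendsto_eq_intros refl | simp)+
  qed
  thus ?thesis using 3 by (simp add: flat_exp_def)
 qed
qed

lemma smooth_flat_exp: "smooth_on UNIV (flat_exp n)"
proof (rule Ck_on_selfderiv[where I = "%n. {n + 1, n + 2}" and c = "%n i. if i = n + 2 then 1 else - real n"])
 show "!!n x. (flat_exp n has_real_derivative
   (SUM i:{n + 1, n + 2}. (if i = n + 2 then 1 else - real n) * flat_exp i x)) (at x)"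
  using flat_exp_deriv by simp
qed simp

definition smooth_step :: "real => real" where
 "smooth_step x = flat_exp 0 x / (flat_exp 0 x + flat_exp 0 (1 - x))"

lemma flat_exp_pos: "0 < x ==> 0 < flat_exp n x"
 and flat_exp_zero: "x <= 0 ==> flat_exp n x = 0"
 and flat_exp_nonneg: "0 <= flat_exp n x" by (auto simp: flat_exp_def)

lemma smooth_step_denom: "0 < flat_exp 0 x + flat_exp 0 (1 - x)"
 using flat_exp_pos[of x 0] flat_exp_pos[of "1 - x" 0] flat_exp_nonneg[of 0 x] flat_exp_nonneg[of 0 "1 - x"] by (cases "0 < x") auto

lemma smooth_smooth_step: "smooth_on UNIV smooth_step"
proof -
 have 1: "smooth_on UNIV (%x::real. flat_exp 0 (1 - x))"
  by (rule smooth_comp[OF smooth_flat_exp]) (auto intro!: smooth_diff smooth_const smooth_ident)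
 show ?thesis
  unfolding smooth_step_def[abs_def]
  by (intro smooth_divide smooth_add smooth_flat_exp 1) (use smooth_step_denom in "auto simp: less_imp_neq[symmetric]")
qed

lemma smooth_step_0: "x <= 0 ==> smooth_step x = 0"
 and smooth_step_1: "1 <= x ==> smooth_step x = 1"
 and smooth_step_pos: "0 < x ==> 0 < smooth_step x"
 and smooth_step_nonneg: "0 <= smooth_step x"
 and smooth_step_le_1: "smooth_step x <= 1"
 and smooth_step_less_1: "x < 1 ==> smooth_step x < 1"
proof -
 show "x <= 0 ==> smooth_step x = 0" by (simp add: smooth_step_def flat_exp_zero)
 show "1 <= x ==> smooth_step x = 1"
  using flat_exp_pos[of x 0] by (simp add: smooth_step_def flat_exp_zero)
 show "0 < x ==> 0 < smooth_step x"
  using smooth_step_denom[of x] flat_exp_pos[of x 0] by (simp add: smooth_step_def)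
 show "0 <= smooth_step x"
  using smooth_step_denom[of x] flat_exp_nonneg[of 0 x] by (simp add: smooth_step_def)
 show "smooth_step x <= 1"
  using smooth_step_denom[of x] flat_exp_nonneg[of 0 "1-x"] by (simp add: smooth_step_def divide_le_eq)
 show "x < 1 ==> smooth_step x < 1"
  using smooth_step_denom[of x] flat_exp_pos[of "1-x" 0] by (simp add: smooth_step_def divide_less_eq)
qed

text \<open>Strict growth inside the unit interval lets \<open>collar\<close> produce a function
  that increases along the given field wherever its value lies strictly between 0 and 1.\<close>

lemma smooth_step_deriv_pos:
 assumes "0 < x" "x < 1"
 shows "EX d>0. (smooth_step has_real_derivative d) (at x)"
proof -
 let ?a = "flat_exp 0 x" and ?b = "flat_exp 0 (1 - x)"
 have b: "((%x. flat_exp 0 (1 - x)) has_real_derivative - flat_exp 2 (1 - x)) (at x)"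
 proof -
  have "((%x. 1 - x) has_real_derivative -1) (at x)" by (auto intro!: derivative_eq_intros)
  from DERIV_chain2[where f = "flat_exp 0" and g = "%x. 1 - x", OF flat_exp_deriv this]
  show ?thesis by (simp add: numeral_2_eq_2)
 qed
 have a: "(flat_exp 0 has_real_derivative flat_exp 2 x) (at x)" using flat_exp_deriv[of 0 x] by (simp add: numeral_2_eq_2)
 have "(smooth_step has_real_derivative (flat_exp 2 x * (?a + ?b) - ?a * (flat_exp 2 x + - flat_exp 2 (1 - x)))
   / ((?a + ?b) * (?a + ?b))) (at x)"
  unfolding smooth_step_def[abs_def] by (rule DERIV_divide[OF a DERIV_add[OF a b]]) (use smooth_step_denom[of x] in simp)
 moreover have "0 < (flat_exp 2 x * (?a + ?b) - ?a * (flat_exp 2 x + - flat_exp 2 (1 - x)))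
   / ((?a + ?b) * (?a + ?b))"
 proof (rule divide_pos_pos)
  have "flat_exp 2 x * (?a + ?b) - ?a * (flat_exp 2 x + - flat_exp 2 (1 - x)) = flat_exp 2 x * ?b + ?a * flat_exp 2 (1 - x)"
   by (simp add: algebra_simps)
  also have "... > 0" using assms by (intro add_pos_pos mult_pos_pos flat_exp_pos) auto
  finally show "0 < flat_exp 2 x * (?a + ?b) - ?a * (flat_exp 2 x + - flat_exp 2 (1 - x))" .
 qed (use smooth_step_denom[of x] in simp)
 ultimately show ?thesis by blast
qed

lemma bump_exists:
 fixes x0 :: "'e::euclidean_space"
 assumes "0 < r1" "r1 < r2"
 obtains be :: "'e => real" where "smooth_on UNIV be" "!!x. 0 <= be x" "!!x. be x <= 1"
  "!!x. x : cball x0 r1 ==> be x = 1" "!!x. x ~: ball x0 r2 ==> be x = 0"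
proof -
 define q where "q x = (r2\<^sup>2 - (x - x0) \<bullet> (x - x0)) * inverse (r2\<^sup>2 - r1\<^sup>2)" for x
 have r: "0 < r2\<^sup>2 - r1\<^sup>2" using assms by (simp add: power_strict_mono)
 have "smooth_on UNIV (%x. smooth_step (q x))"
  unfolding q_def by (rule smooth_comp[OF smooth_smooth_step])
   (auto intro!: smooth_mult smooth_diff smooth_inner smooth_const smooth_ident)
 moreover have "smooth_step (q x) = 1" if "x : cball x0 r1" for x
 proof (rule smooth_step_1)
  have "(x - x0) \<bullet> (x - x0) <= r1\<^sup>2"
   using that by (auto simp: power2_norm_eq_inner[symmetric] dist_norm norm_minus_commute intro: power_mono)
  thus "1 <= q x" using r by (simp add: q_def divide_inverse[symmetric] le_divide_eq)
 qed
 moreover have "smooth_step (q x) = 0" if "x ~: ball x0 r2" for x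
 proof (rule smooth_step_0)
  have "r2 <= norm (x - x0)" using that by (simp add: dist_norm norm_minus_commute)
  hence "r2\<^sup>2 <= (x - x0) \<bullet> (x - x0)"
   unfolding power2_norm_eq_inner[symmetric] using assms by (intro power_mono) auto
  thus "q x <= 0" using r by (simp add: q_def mult_nonpos_nonneg)
 qed
 ultimately show ?thesis using smooth_step_nonneg smooth_step_le_1 by (intro that[of "%x. smooth_step (q x)"]) auto
qed

section \<open>Differentiation under the integral sign\<close>

lemma has_derivative_param_integral:
 fixes F :: "real \<times> 'p::euclidean_space => 'c::euclidean_space"
 assumes F: "Ck_on (Suc 0) W F" and W: "open W" and S: "open S" "{a..b} \<times> S <= W" and x: "x : S"
 shows "((%x. integral {a..b} (%t. F (t, x))) has_derivative
  (%v. integral {a..b} (%t. FD F (t, x) (0, v)))) (at x)"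
proof -
 obtain r where r: "0 < r" "ball x r <= S" using S(1) x open_contains_ball by blast
 have inW: "(t, y) : W" if "t : {a..b}" "y : ball x r" for t y using that S(2) r(2) by blast
 have dF: "(F has_derivative FD F z) (at z)" if "z : W" for z
  using F that by (simp add: frechet_derivative_works[symmetric])
 have cF: "continuous_on W F" using Ck_on_cont[OF F] .
 have cdF: "continuous_on W (%z. FD F z v)" for v
  using F by (cases v) simp
 define fx where "fx y t = Blinfun (%v. FD F (t, y) (0, v))" for y t
 have bl: "bounded_linear (%v. FD F (t, y) (0, v))" if "(t, y) : W" for t y
  by (rule bounded_linear_compose[where f = "FD F (t, y)" and g = "%v. (0, v)",
     OF has_derivative_bounded_linear[OF dF[OF that]]])
   (rule bounded_linear_Pair[OF bounded_linear_zero bounded_linear_ident])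
 have fx: "blinfun_apply (fx y t) = (%v. FD F (t, y) (0, v))" if "(t, y) : W" for t y
  unfolding fx_def by (rule bounded_linear_Blinfun_apply[OF bl[OF that]])
 have cfx: "continuous_on (ball x r \<times> cbox a b) (%(y, t). fx y t)"
 proof (rule continuous_on_blinfun_componentwise)
  fix i :: 'p assume "i : Basis"
  have "continuous_on (ball x r \<times> cbox a b) (%z. FD F (snd z, fst z) (0, i))"
   by (rule continuous_on_compose2[OF cdF, of _ "%z. (snd z, fst z)"])
    (use inW in "auto intro!: continuous_intros")
  thus "continuous_on (ball x r \<times> cbox a b) (%z. blinfun_apply (case z of (y, t) => fx y t) i)"
   by (rule continuous_on_eq) (use inW fx in auto)
 qed
 have "((%x. integral (cbox a b) (%t. F (t, x))) has_derivative integral (cbox a b) (fx x)) (at x within ball x r)"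
 proof (rule leibniz_rule[OF _ _ cfx])
  fix y t assume yt: "y : ball x r" "t : cbox a b"
  have "((%y. (t, y)) has_derivative (%v. (0, v))) (at y within ball x r)" by (auto intro!: derivative_eq_intros)
  hence "((%y. F (t, y)) has_derivative (%v. FD F (t, y) (0, v))) (at y within ball x r)"
   by (rule has_derivative_compose[OF _ dF]) (use inW yt in auto)
  thus "((%y. F (t, y)) has_derivative blinfun_apply (fx y t)) (at y within ball x r)"
   using fx[of t y] inW yt by simp
 next
  fix y assume y: "y : ball x r"
  show "(%t. F (t, y)) integrable_on cbox a b" by (rule integrable_continuous, rule continuous_on_compose2[OF cF])
    (use inW y in "auto intro!: continuous_intros")
 qed (use r in auto)
 moreover have "blinfun_apply (integral (cbox a b) (fx x)) = (%v. integral {a..b} (%t. FD F (t, x) (0, v)))"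
 proof
  fix v
  have "continuous_on (cbox a b) (fx x)"
  proof -
   have "continuous_on (cbox a b) (%t. (x, t))" by (intro continuous_intros)
   moreover have "(%t. (x, t)) ` cbox a b <= ball x r \<times> cbox a b" using r by auto
   ultimately show ?thesis using continuous_on_compose2[OF cfx] by fastforce
  qed
  hence "fx x integrable_on cbox a b" by (rule integrable_continuous)
  hence "blinfun_apply (integral (cbox a b) (fx x)) v = integral (cbox a b) (%t. fx x t v)" by (rule blinfun_apply_integral)
  also have "... = integral (cbox a b) (%t. FD F (t, x) (0, v))" by (rule integral_cong) (use fx inW r in auto)
  finally show "blinfun_apply (integral (cbox a b) (fx x)) v = integral {a..b} (%t. FD F (t, x) (0, v))" by simp
 qed
 ultimately show ?thesis using r by (simp add: at_within_open[of x "ball x r"])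
qed

lemma Ck_on_param_integral:
 fixes F :: "real \<times> 'p::euclidean_space => 'c::euclidean_space"
 assumes W: "open W" and S: "open S" "{a..b} \<times> S <= W" and F: "Ck_on k W F"
 shows "Ck_on k S (%x. integral {a..b} (%t. F (t, x)))"
 using F
proof (induction k arbitrary: F)
 case 0
 have "continuous_on (S \<times> cbox a b) (%(x, t). F (t, x))"
  unfolding case_prod_beta by (rule continuous_on_compose2[where g = F and t = W]) (use 0 S(2) in "auto intro!: continuous_intros")
 from integral_continuous_on_param[OF this] show ?case by simp
next
 case (Suc k)
 have 1: "Ck_on (Suc 0) W F"
  using Suc.prems Ck_on_cont unfolding Ck_on.simps(2)[of k] Ck_on.simps(2)[of 0] Ck_on.simps(1) by blast
 show ?case
 proof (rule Ck_on_has_derivativeI[OF S(1) has_derivative_param_integral[OF 1 W S]])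
  fix v :: 'p
  have "Ck_on k W (%z. FD F z (0, v))"
   using Suc.prems unfolding Ck_on.simps(2)[of k] by blast
  thus "Ck_on k S (%x. integral {a..b} (%t. FD F (t, x) (0, v)))" by (rule Suc.IH)
 qed
qed

lemma smooth_param_integral:
 fixes F :: "real \<times> 'p::euclidean_space => 'c::euclidean_space"
 assumes F: "smooth_on W F" and S: "open S" "{a..b} \<times> S <= W"
 shows "smooth_on S (%x. integral {a..b} (%t. F (t, x)))"
proof -
 have "Ck_on k S (%x. integral {a..b} (%t. F (t, x)))" for k by (rule Ck_on_param_integral[OF smooth_open[OF F] S smooth_onD[OF F]])
 thus ?thesis using S(1) unfolding smooth_on_def by simp
qed

text \<open>The factors \<open>h b\<close> are averages of partial derivatives over the segment from
  \<open>p\<close> to \<open>x\<close>. This is the analytic core of the identification of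
  derivations with coordinate vectors.\<close>

lemma hadamard:
 fixes f :: "'e::euclidean_space => real"
 assumes f: "smooth_on (ball p r) f" and r: "0 < r"
 obtains h where "!!b. smooth_on (ball p r) (h b)" "!!b. h b p = FD f p b"
  "!!x. x : ball p r ==> f x = f p + (SUM b:Basis. ((x - p) \<bullet> b) * h b x)"
proof -
 define W where "W = (%z::real \<times> 'e. p + fst z *R (snd z - p)) -` ball p r"
 have W: "open W" unfolding W_def by (rule continuous_open_vimage) (auto intro!: continuous_intros)
 have inW: "{0..1} \<times> ball p r <= W"
 proof clarify
  fix t :: real and x assume t: "t : {0..1}" and x: "x : ball p r"
  have "norm (t *R (x - p)) <= 1 * norm (x - p)" unfolding norm_scaleR using t by (intro mult_right_mono) auto
  thus "(t, x) : W" using x by (simp add: W_def dist_norm norm_minus_commute)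
 qed
 have path: "p + t *R (x - p) : ball p r" if "t : {0..1}" "x : ball p r" for t x
  using subsetD[OF inW, of "(t, x)"] that by (simp add: W_def)
 define h where "h b x = integral {0..1} (%t. FD f (p + t *R (x - p)) b)" for b x
 have sF: "smooth_on W (%z. FD f (p + fst z *R (snd z - p)) b)" for b by (rule smooth_comp[OF smooth_deriv[OF f]])
   (auto simp: W_def[symmetric] intro!: W smooth_add smooth_const smooth_scaleR smooth_diff
    smooth_fst smooth_snd smooth_ident, auto simp: W_def)
 have "smooth_on (ball p r) (h b)" for b
  using smooth_param_integral[OF sF, of "ball p r" 0 1 b] inW by (simp add: h_def[abs_def])
 moreover have "h b p = FD f p b" for b by (simp add: h_def)
 moreover have "f x = f p + (SUM b:Basis. ((x - p) \<bullet> b) * h b x)" if x: "x : ball p r" for x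
 proof -
  have lin: "linear (FD f (p + t *R (x - p)))" if "t : {0..1}" for t by (rule smooth_FD_linear[OF f path[OF that x]])
  have "((%t. FD f (p + t *R (x - p)) (x - p)) has_integral
    f (p + 1 *R (x - p)) - f (p + 0 *R (x - p))) {0..1}" by (rule fundamental_theorem_of_calculus)
    (auto intro!: has_vector_derivative_at_within smooth_compose_line[OF f] path x simp del: mem_ball)
  hence "f x - f p = integral {0..1} (%t. FD f (p + t *R (x - p)) (x - p))" by (simp add: integral_unique)
  also have "... = integral {0..1} (%t. SUM b:Basis. ((x - p) \<bullet> b) * FD f (p + t *R (x - p)) b)"
   by (rule integral_cong) (simp add: linear_basis_expand[OF lin, of _ "x - p"])
  also have "... = (SUM b:Basis. integral {0..1} (%t. ((x - p) \<bullet> b) * FD f (p + t *R (x - p)) b))"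
  proof (rule integral_sum)
   fix b :: 'e
   have "continuous_on {0..1} (%t. FD f (p + fst (t, x) *R (snd (t, x) - p)) b)"
    by (rule continuous_on_compose2[OF smooth_cont[OF sF], of _ "%t. (t, x)"])
     (use inW x in "auto intro!: continuous_intros")
   thus "(%t. ((x - p) \<bullet> b) * FD f (p + t *R (x - p)) b) integrable_on {0..1}"
    by (intro integrable_continuous_interval continuous_intros) simp
  qed simp
  also have "... = (SUM b:Basis. ((x - p) \<bullet> b) * h b x)" by (simp add: h_def)
  finally show ?thesis by simp
 qed
 ultimately show ?thesis by (rule that)
qed

section \<open>Ordinary differential equations\<close>

lemma continuous_on_linear_apply:
 fixes L :: "'a::topological_space => 'b::euclidean_space => 'c::real_normed_vector"
 assumes "!!x. x : S ==> linear (L x)" "!!v. v : Basis ==> continuous_on S (%x. L x v)" "continuous_on S f"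
 shows "continuous_on S (%x. L x (f x))"
proof -
 have "continuous_on S (%x. SUM b:Basis. (f x \<bullet> b) *R L x b)" by (intro continuous_intros assms)
 thus ?thesis by (rule continuous_on_eq) (simp add: linear_basis_expand[OF assms(1), symmetric])
qed

text \<open>To the right of \<open>t0\<close> the squared norm times exp(-2Lt) does not increase, to
  the left the squared norm times exp(2Lt) does not decrease; both vanish at
  \<open>t0\<close>.\<close>

lemma gronwall_zero:
 fixes de :: "real => 'a::real_inner"
 assumes I: "is_interval I" "t0 : I" "t : I"
  and d: "!!t. t : I ==> (de has_vector_derivative de' t) (at t)"
  and le: "!!t. t : I ==> norm (de' t) <= L * norm (de t)" and 0: "de t0 = 0"
 shows "de t = 0"
proof -
 have inI: "s : I" if "min t0 t <= s" "s <= max t0 t" for s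
  using I that unfolding is_interval_1 by (metis max_def min_def)
 have der: "((%t. exp (c * t) * (de t \<bullet> de t)) has_real_derivative
   exp (c * t) * (c * (de t \<bullet> de t) + 2 * (de t \<bullet> de' t))) (at t)" if "t : I" for c t
 proof -
  have "((%t. de t \<bullet> de t) has_real_derivative 2 * (de t \<bullet> de' t)) (at t)"
  proof -
   have h: "(de has_derivative (%s. s *R de' t)) (at t)"
    using d[OF that] by (simp add: has_vector_derivative_def)
   from has_derivative_inner[OF h h] show ?thesis
    unfolding has_field_derivative_def by (rule has_derivative_eq_rhs) (simp add: fun_eq_iff inner_commute algebra_simps)
  qed
  thus ?thesis by (auto intro!: derivative_eq_intros simp: algebra_simps)
 qed
 have cs: "\<bar>de s \<bullet> de' s\<bar> <= L * (de s \<bullet> de s)" if "s : I" for s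
 proof -
  have "\<bar>de s \<bullet> de' s\<bar> <= norm (de s) * norm (de' s)" by (rule Cauchy_Schwarz_ineq2)
  also have "... <= norm (de s) * (L * norm (de s))" using le[OF that] by (rule mult_left_mono) simp
  also have "... = L * (de s \<bullet> de s)" by (simp add: power2_norm_eq_inner[symmetric] power2_eq_square)
  finally show ?thesis .
 qed
 have "EX c. exp (c * t) * (de t \<bullet> de t) <= exp (c * t0) * (de t0 \<bullet> de t0)"
 proof (cases "t0 <= t")
  case True
  have "exp (- (2 * L) * t) * (de t \<bullet> de t) <= exp (- (2 * L) * t0) * (de t0 \<bullet> de t0)"
  proof (rule DERIV_nonpos_imp_nonincreasing[where f = "%t. exp (- (2 * L) * t) * (de t \<bullet> de t)", OF True])
   fix s assume "t0 <= s" "s <= t"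
   hence s: "s : I" using inI[of s] by simp
   have "exp (- (2 * L) * s) * (- (2 * L) * (de s \<bullet> de s) + 2 * (de s \<bullet> de' s)) <= 0"
    using cs[OF s] by (intro mult_nonneg_nonpos) auto
   thus "EX y. ((%t. exp (- (2 * L) * t) * (de t \<bullet> de t)) has_real_derivative y) (at s) & y <= 0"
    using der[OF s] by blast
  qed
  thus ?thesis by blast
 next
  case False
  have "exp ((2 * L) * t) * (de t \<bullet> de t) <= exp ((2 * L) * t0) * (de t0 \<bullet> de t0)"
  proof (rule DERIV_nonneg_imp_nondecreasing[where f = "%t. exp ((2 * L) * t) * (de t \<bullet> de t)"])
   show "t <= t0" using False by simp
   fix s assume "t <= s" "s <= t0"
   hence s: "s : I" using inI[of s] by simp
   have "0 <= exp ((2 * L) * s) * ((2 * L) * (de s \<bullet> de s) + 2 * (de s \<bullet> de' s))"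
    using cs[OF s] by (intro mult_nonneg_nonneg) auto
   thus "EX y. ((%t. exp ((2 * L) * t) * (de t \<bullet> de t)) has_real_derivative y) (at s) & 0 <= y"
    using der[OF s] by blast
  qed
  thus ?thesis by blast
 qed
 then obtain c where "exp (c * t) * (de t \<bullet> de t) <= 0" using 0 by auto
 hence "de t \<bullet> de t <= 0" by (simp add: mult_le_0_iff)
 thus ?thesis by (metis inner_eq_zero_iff inner_ge_zero order_antisym)
qed

lemma vector_mvt_bound_within:
 fixes f :: "real => 'a::real_normed_vector"
 assumes "convex I" "!!t. t : I ==> (f has_vector_derivative f' t) (at t within I)" "!!t. t : I ==> norm (f' t) <= B"
  and st: "s : I" "t : I"
 shows "norm (f t - f s) <= B * \<bar>t - s\<bar>"
proof -
 have "norm (f t - f s) <= B * norm (t - s)"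
 proof (rule differentiable_bound[OF assms(1), of f "%t h. h *R f' t"])
  fix x assume x: "x : I"
  show "(f has_derivative (%h. h *R f' x)) (at x within I)"
   using assms(2)[OF x] by (simp add: has_vector_derivative_def)
  show "onorm (%h. h *R f' x) <= B"
   using assms(3)[OF x] by (intro onorm_bound) (auto simp: mult.commute[of _ "\<bar>_\<bar>"] mult_left_mono intro: order_trans[OF norm_ge_zero])
 qed (use st in auto)
 thus ?thesis by simp
qed

lemmas vector_mvt_bound = vector_mvt_bound_within[OF _ has_vector_derivative_at_within]

lemma vector_derivative_bound:
 assumes u: "!!s. \<bar>s\<bar> <= T ==> (u has_vector_derivative h s) (at s within {-T..T})"
  and h: "!!s. \<bar>s\<bar> <= T ==> norm (h s) <= B" and t: "\<bar>t\<bar> <= T"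
 shows "norm (u t - u 0) <= B * T"
proof -
 have "norm (u t - u 0) <= B * \<bar>t - 0\<bar>" by (rule vector_mvt_bound_within[of "{-T..T}" u h]) (use u h t in "auto simp: abs_le_iff")
 also have "... <= B * T" using t order_trans[OF norm_ge_zero h[OF t]] by (intro mult_left_mono) auto
 finally show ?thesis .
qed

text \<open>When \<open>T * L <= 1/2\<close>, the maximum of the norm is bounded by the data plus
  half of itself and can be absorbed, without exponential factors. Existence and dependence on
  parameters are developed on such short intervals.\<close>

lemma small_gronwall:
 fixes de :: "real => 'a::real_normed_vector"
 assumes d: "!!t. \<bar>t\<bar> <= T ==> (de has_vector_derivative de' t) (at t)"
  and le: "!!t. \<bar>t\<bar> <= T ==> norm (de' t) <= L * norm (de t) + ep"
  and L: "0 <= L" "T * L <= 1/2" and t: "\<bar>t\<bar> <= T"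
 shows "norm (de t) <= 2 * (norm (de 0) + T * ep)"
proof -
 have c: "continuous_on {-T..T} de" by (intro continuous_at_imp_continuous_on ballI has_vector_derivative_continuous[OF d]) auto
 have "{-T..T} ~= {}" using t by auto
 from continuous_attains_sup[OF compact_Icc this continuous_on_norm[OF c]]
 obtain m where "m : {-T..T}" "ALL s:{-T..T}. norm (de s) <= norm (de m)" by blast
 hence m: "\<bar>m\<bar> <= T" "!!s. \<bar>s\<bar> <= T ==> norm (de s) <= norm (de m)" by (auto simp: abs_le_iff)
 have "norm (de m - de 0) <= (L * norm (de m) + ep) * T"
 proof (rule vector_derivative_bound[OF has_vector_derivative_at_within[OF d] _ m(1)])
  show "norm (de' s) <= L * norm (de m) + ep" if "\<bar>s\<bar> <= T" for s
   using le[OF that] mult_left_mono[OF m(2)[OF that] L(1)] by linarith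
 qed
 also have "... <= norm (de m) / 2 + T * ep"
  using mult_right_mono[OF L(2), of "norm (de m)"] by (simp add: algebra_simps)
 finally have "norm (de m) <= 2 * (norm (de 0) + T * ep)" using norm_triangle_ineq2[of "de m" "de 0"] by simp
 thus ?thesis using m(2)[OF t] by simp
qed

lemma ode_exists_closed:
 fixes G :: "real => 'd::euclidean_space => 'd"
 assumes cont: "continuous_on ({-T..T} \<times> UNIV) (%(t, x). G t x)"
  and lip: "!!t x y. \<bar>t\<bar> <= T ==> norm (G t x - G t y) <= L * norm (x - y)"
  and T: "0 < T" "0 <= L" "T * L <= 1/2"
 shows "EX x. x 0 = w & (ALL t. \<bar>t\<bar> < T --> (x has_vector_derivative G t (x t)) (at t))"
proof -
 \<comment> \<open>The primitive that vanishes at 0, written with integrals from \<open>-T\<close>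
   so that negative times need no separate treatment.\<close>
 define Ph where "Ph g t = integral {-T..t} g - integral {-T..0} g" for g :: "real => 'd" and t
 have dPh: "(Ph g has_vector_derivative g t) (at t within {-T..T})" if "continuous_on {-T..T} g" "\<bar>t\<bar> <= T" for g t
  unfolding Ph_def using integral_has_vector_derivative[OF that(1), of t] that(2)
  by (auto intro!: derivative_eq_intros simp: abs_le_iff minus_le_iff)
 have Ph0: "Ph g 0 = 0" for g by (simp add: Ph_def)
 \<comment> \<open>Clamping the time to the interval extends candidate solutions to bounded
   continuous functions on the whole line, a complete space on which the Picard operator contracts
   by 1/2.\<close>
 define c where "c t = max (-T) (min T t)" for t
 have c: "\<bar>c t\<bar> <= T" for t using T by (auto simp: c_def)
 have ccont: "continuous_on UNIV c" unfolding c_def by (intro continuous_intros)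
 define g where "g ps s = G s (apply_bcontfun ps s)" for ps s
 have gc: "continuous_on {-T..T} (g ps)" for ps
 proof -
  have "continuous_on {-T..T} (%s. (%(t, x). G t x) (s, apply_bcontfun ps s))"
   by (rule continuous_on_compose2[OF cont]) (auto intro!: continuous_intros)
  thus ?thesis by (simp add: g_def[abs_def])
 qed
 have T0: "(%t. w + Ph (g ps) (c t)) : bcontfun" for ps
 proof -
  have "continuous_on {-T..T} (Ph (g ps))"
   unfolding continuous_on_eq_continuous_within using has_vector_derivative_continuous[OF dPh[OF gc]] by auto
  hence cc: "continuous_on UNIV (%t. w + Ph (g ps) (c t))"
   using c by (intro continuous_intros continuous_on_compose2[OF _ ccont]) (auto simp: abs_le_iff minus_le_iff)
  obtain B where "ALL s:{-T..T}. norm (g ps s) <= B"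
   using compact_imp_bounded[OF compact_continuous_image[OF gc[of ps] compact_Icc]] unfolding bounded_iff by auto
  hence "norm (g ps s) <= B" if "\<bar>s\<bar> <= T" for s using that by (simp add: abs_le_iff)
  from vector_derivative_bound[OF dPh[OF gc] this c] show ?thesis
   by (intro bcontfun_normI[OF cc, of "norm w + B * T"] norm_triangle_le add_mono order_refl) (simp add: Ph0)
 qed
 define S where "S ps = Bcontfun (%t. w + Ph (g ps) (c t))" for ps
 have S: "apply_bcontfun (S ps) t = w + Ph (g ps) (c t)" for ps t
  unfolding S_def by (simp add: Bcontfun_inverse T0)
 have "EX! ps. S ps = ps"
 proof (rule banach_fix_type[of "1/2" S])
  show "ALL ps xx. dist (S ps) (S xx) <= 1/2 * dist ps xx"
  proof (intro allI dist_bound)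
   fix ps xx t
   have "norm (g ps s - g xx s) <= L * dist ps xx" if "\<bar>s\<bar> <= T" for s
    using lip[OF that, of "apply_bcontfun ps s" "apply_bcontfun xx s"] mult_left_mono[OF dist_bounded[of ps s xx] T(2)]
    by (simp add: g_def dist_norm)
   from vector_derivative_bound[OF has_vector_derivative_diff[OF dPh[OF gc] dPh[OF gc]] this c]
   have "norm (Ph (g ps) (c t) - Ph (g xx) (c t)) <= L * dist ps xx * T" by (simp add: Ph0)
   also have "... <= 1/2 * dist ps xx" using mult_right_mono[OF T(3), of "dist ps xx"] by (simp add: mult_ac)
   finally show "dist (apply_bcontfun (S ps) t) (apply_bcontfun (S xx) t) <= 1/2 * dist ps xx" by (simp add: S dist_norm)
  qed
 qed auto
 then obtain ps where ps: "S ps = ps" by blast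
 have "(apply_bcontfun ps has_vector_derivative G t (apply_bcontfun ps t)) (at t)" if t: "\<bar>t\<bar> < T" for t
 proof (rule has_vector_derivative_transform_within_open[where S = "{-T<..<T}"])
  have "(Ph (g ps) has_vector_derivative g ps t) (at t)"
   using dPh[OF gc, of t ps] t at_within_interior[of t "{-T..T}"] by (simp add: abs_less_iff)
  thus "((%t. w + Ph (g ps) t) has_vector_derivative G t (apply_bcontfun ps t)) (at t)" by (auto intro!: derivative_eq_intros simp: g_def)
  show "w + Ph (g ps) s = apply_bcontfun ps s" if "s : {-T<..<T}" for s
   using S[of ps s] ps that by (simp add: c_def)
 qed (use t in auto)
 moreover have "apply_bcontfun ps 0 = w" using S[of ps 0] ps T(1) by (simp add: c_def Ph0)
 ultimately show ?thesis by blast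
qed

lemma ode_exists:
 fixes G :: "real => 'd::euclidean_space => 'd"
 assumes I: "I = {-ta<..<ta}" and cont: "continuous_on (I \<times> UNIV) (%(t, x). G t x)"
  and lip: "!!t x y. t : I ==> norm (G t x - G t y) <= L * norm (x - y)"
  and ta: "0 <= L" "ta * L <= 1/2"
 shows "EX x. x 0 = w & (ALL t:I. (x has_vector_derivative G t (x t)) (at t))"
proof -
 have TL: "T * L <= 1/2" if "T < ta" for T using mult_right_mono[of T ta L] that ta by linarith
 define sol where "sol T x \<longleftrightarrow> x 0 = w & (ALL t. \<bar>t\<bar> < T --> (x has_vector_derivative G t (x t)) (at t))" for T x
 have "EX x. sol T x" if T: "0 < T" "T < ta" for T
  unfolding sol_def
 proof (rule ode_exists_closed[where L = L, OF _ lip T(1) ta(1) TL[OF T(2)]])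
  show "continuous_on ({-T..T} \<times> UNIV) (%(t, x). G t x)" by (rule continuous_on_subset[OF cont]) (use T I in auto)
 qed (use T I in auto)
 then obtain x where x: "!!T. 0 < T ==> T < ta ==> sol T (x T)" by metis
 have uniq: "x T s = x T' s" if "\<bar>s\<bar> < T" "T < ta" "\<bar>s\<bar> < T'" "T' < ta" for T T' s
 proof -
  have "norm (x T s - x T' s) <= 2 * (norm (x T 0 - x T' 0) + \<bar>s\<bar> * 0)"
  proof (rule small_gronwall[where T = "\<bar>s\<bar>" and L = L and de' = "%r. G r (x T r) - G r (x T' r)"])
   fix r assume r: "\<bar>r\<bar> <= \<bar>s\<bar>"
   thus "((%s. x T s - x T' s) has_vector_derivative G r (x T r) - G r (x T' r)) (at r)"
    using x[of T] x[of T'] that by (intro has_vector_derivative_diff) (auto simp: sol_def)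
   have "r : I" using r that I by auto
   thus "norm (G r (x T r) - G r (x T' r)) <= L * norm (x T r - x T' r) + 0" using lip by simp
  qed (use TL that ta in auto)
  moreover have "x T 0 = w" "x T' 0 = w" using x[of T] x[of T'] that by (auto simp: sol_def)
  ultimately show ?thesis by simp
 qed
 \<comment> \<open>The time \<open>t\<close> is handled by the solution on a slightly longer
   interval; by \<open>uniq\<close> the glued function agrees with that solution near
   \<open>t\<close>.\<close>
 define e where "e t = (\<bar>t\<bar> + ta) / 2" for t
 have e: "\<bar>t\<bar> < e t" "e t < ta" if "t : I" for t using that I by (auto simp: e_def)
 have "((%t. x (e t) t) has_vector_derivative G t (x (e t) t)) (at t)" if t: "t : I" for t
 proof (rule has_vector_derivative_transform_within_open[where S = "{- e t<..<e t}" and f = "x (e t)"])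
  show "(x (e t) has_vector_derivative G t (x (e t) t)) (at t)" using x[of "e t"] e[OF t] by (auto simp: sol_def)
  fix s assume s: "s : {- e t<..<e t}"
  hence "s : I" using e[OF t] I by auto
  thus "x (e t) s = x (e s) s" using uniq[of s "e t" "e s"] e[OF t] e[of s] s by (simp add: abs_less_iff)
 qed (use e[OF t] in auto)
 moreover have "x (e 0) 0 = w" if "0 : I" using x[of "e 0"] e[OF that] by (simp add: sol_def)
 \<comment> \<open>If \<open>ta\<close> is not positive, \<open>I\<close> is empty and only the
   initial value is asked for.\<close>
 ultimately show ?thesis
  using I by (intro exI[of _ "%t. if 0 : I then x (e t) t else w"]) auto
qed

lemma lipschitz_derivative_bound:
 assumes F: "(F has_derivative F') (at x)" and lip: "!!y. norm (F y - F x) <= L * norm (y - x)"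
 shows "norm (F' w) <= L * norm w"
proof (rule field_le_epsilon)
 fix e :: real assume e: "0 < e"
 have lin: "linear F'" by (rule has_derivative_linear[OF F])
 show "norm (F' w) <= L * norm w + e"
 proof (cases "w = 0")
  case True thus ?thesis using e by (simp add: linear_0[OF lin])
 next
  case False
  hence e': "0 < e / norm w" using e by simp
  obtain d where d: "0 < d" "!!y. norm (y - x) < d ==> norm (F y - F x - F' (y - x)) <= e / norm w * norm (y - x)"
   using F e' unfolding has_derivative_at_alt by blast
  define t where "t = d / (2 * norm w)"
  have t: "0 < t" using d False by (simp add: t_def)
  have tw: "norm (t *R w) < d" using d False by (simp add: t_def)
  have "norm (F' (t *R w)) <= norm (F (x + t *R w) - F x) + norm (F (x + t *R w) - F x - F' (t *R w))"
   by (metis norm_triangle_sub norm_minus_commute)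
  also have "... <= L * norm (t *R w) + e / norm w * norm (t *R w)"
   using d(2)[of "x + t *R w"] lip[of "x + t *R w"] tw by simp
  finally have "t * norm (F' w) <= t * (L * norm w + e)"
   using t False by (simp add: linear_cmul[OF lin] algebra_simps)
  thus ?thesis using t by simp
 qed
qed

section \<open>Dependence of solutions on parameters\<close>

lemma ode_continuous:
 fixes G :: "'p::euclidean_space \<times> real \<times> 'd::euclidean_space => 'd" and y :: "'p => real => 'd"
 assumes I: "I = {-ta<..<ta}" and G: "continuous_on (UNIV \<times> I \<times> UNIV) G"
  and lip: "!!z t x x'. t : I ==> norm (G (z, t, x) - G (z, t, x')) <= L * norm (x - x')"
  and ta: "0 <= L" "ta * L <= 1/2"
  and y: "!!z. y z 0 = w" "!!z t. t : I ==> (y z has_vector_derivative G (z, t, y z t)) (at t)"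
 shows "continuous_on (UNIV \<times> I) (%q. y (fst q) (snd q))"
 unfolding continuous_on_iff
proof (intro ballI allI impI)
 fix q :: "'p \<times> real" and ep :: real assume q: "q : UNIV \<times> I" and ep: "0 < ep"
 obtain z0 t0 where zt: "q = (z0, t0)" "t0 : I" using q by auto
 define T where "T = (\<bar>t0\<bar> + ta) / 2"
 have T: "\<bar>t0\<bar> < T" "T < ta" "0 < T" using zt I by (auto simp: T_def)
 have TI: "\<bar>t\<bar> <= T ==> t : I" for t using T I by auto
 have TL: "T * L <= 1/2" using mult_right_mono[of T ta L] T ta by linarith
 define H where "H p = G (fst p, snd p, y z0 (snd p))" for p
 have cy: "continuous_on I (y z0)"
  using y(2) has_vector_derivative_continuous by (blast intro: continuous_at_imp_continuous_on)
 have cH: "continuous_on (UNIV \<times> I) H"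
  unfolding H_def by (rule continuous_on_compose2[OF G]) (auto intro!: continuous_intros continuous_on_compose2[OF cy])
 define d where "d = ep / (8 * T)"
 have d: "0 < d" using ep T by (simp add: d_def)
 have "uniformly_continuous_on (cball z0 1 \<times> {-T..T}) H"
  by (rule compact_uniformly_continuous[OF continuous_on_subset[OF cH]]) (use TI in "auto intro!: compact_Times")
 from this[unfolded uniformly_continuous_on_def, rule_format, OF d]
 obtain r where r: "0 < r" "!!p p'. p : cball z0 1 \<times> {-T..T} ==> p' : cball z0 1 \<times> {-T..T} ==> dist p' p < r ==> dist (H p') (H p) < d"
  by metis
 have close: "dist (y z t) (y z0 t) <= ep / 4" if z: "dist z z0 < min r 1" and t: "\<bar>t\<bar> <= T" for z t
 proof -
  have "norm (y z t - y z0 t) <= 2 * (norm (y z 0 - y z0 0) + T * d)"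
  proof (rule small_gronwall[where de = "%t. y z t - y z0 t" and L = L and de' = "%t. G (z, t, y z t) - G (z0, t, y z0 t)", OF _ _ ta(1) TL t])
   fix s assume s: "\<bar>s\<bar> <= T"
   show "((%t. y z t - y z0 t) has_vector_derivative G (z, s, y z s) - G (z0, s, y z0 s)) (at s)" by (intro has_vector_derivative_diff y TI s)
   have "norm (H (z, s) - H (z0, s)) < d" using r(2)[of "(z0, s)" "(z, s)"] z s by (auto simp: dist_Pair_Pair dist_norm norm_minus_commute abs_le_iff)
   thus "norm (G (z, s, y z s) - G (z0, s, y z0 s)) <= L * norm (y z s - y z0 s) + d"
    using norm_triangle_ineq[of "G (z, s, y z s) - G (z, s, y z0 s)" "G (z, s, y z0 s) - G (z0, s, y z0 s)"] lip[OF TI[OF s], of z "y z s" "y z0 s"]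
    by (simp add: H_def)
  qed
  thus ?thesis using T(3) by (simp add: y(1) d_def dist_norm)
 qed
 obtain r' where r': "0 < r'" "!!t. t : I ==> dist t t0 < r' ==> dist (y z0 t) (y z0 t0) < ep / 4"
  using cy zt(2) ep unfolding continuous_on_iff by (metis divide_pos_pos zero_less_numeral)
 show "EX r>0. ALL q':UNIV \<times> I. dist q' q < r --> dist (y (fst q') (snd q')) (y (fst q) (snd q)) < ep"
 proof (intro exI[of _ "min (min r 1) (min r' (T - \<bar>t0\<bar>))"] conjI ballI impI)
  fix q' assume q': "q' : UNIV \<times> I" and near: "dist q' q < min (min r 1) (min r' (T - \<bar>t0\<bar>))"
  have 1: "dist (fst q') z0 < min r 1" and 2: "dist (snd q') t0 < min r' (T - \<bar>t0\<bar>)"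
   using near dist_fst_le[of q' q] dist_snd_le[of q' q] zt by auto
  have "\<bar>snd q'\<bar> <= T" using 2 by (simp add: dist_real_def abs_le_iff abs_less_iff) linarith
  from close[OF 1 this] r'(2)[of "snd q'"] q' 2
  have "dist (y (fst q') (snd q')) (y z0 t0) <= ep / 4 + ep / 4"
   by (intro order_trans[OF dist_triangle[of _ _ "y z0 (snd q')"]] add_mono) (auto intro: less_imp_le)
  thus "dist (y (fst q') (snd q')) (y (fst q) (snd q)) < ep" using zt ep by simp
 qed (use r r' T in auto)
qed

text \<open>For two parameters the difference of the right-hand sides is \<open>B (z, z') t\<close>
  applied to the exact increment, where \<open>B\<close> averages the derivative of \<open>G\<close>
  over the segment between the two solutions. The solutions \<open>X e (z, z')\<close> of the linear
  equations with these coefficients express \<open>y z' t - y z t\<close> exactly, as a sum of the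
  coordinates of \<open>z' - z\<close> times \<open>X e (z, z') t\<close>. Continuity of
  \<open>X\<close> in the pair then gives the derivative at \<open>z' = z\<close>, and no remainder
  has to be estimated.\<close>

lemma parameter_derivative:
 fixes G :: "'p::euclidean_space \<times> real \<times> 'd::euclidean_space => 'd" and y :: "'p => real => 'd"
 assumes I: "I = {-ta<..<ta}" and G: "Ck_on (Suc 0) (UNIV \<times> I \<times> UNIV) G"
  and lip: "!!z t x x'. t : I ==> norm (G (z, t, x) - G (z, t, x')) <= L * norm (x - x')"
  and ta: "0 <= L" "ta * L <= 1/2"
  and y: "!!z. y z 0 = w" "!!z t. t : I ==> (y z has_vector_derivative G (z, t, y z t)) (at t)"
 defines "D == %z t. FD G (z, t, y z t)"
 obtains Y where "!!e z. Y e z 0 = 0"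
  "!!e z t. t : I ==> (Y e z has_vector_derivative D z t (0, 0, Y e z t) + D z t (e, 0, 0)) (at t)"
  "!!q. q : UNIV \<times> I ==> ((%q. y (fst q) (snd q)) has_derivative
   (%v. (SUM e:Basis. (fst v \<bullet> e) *R Y e (fst q) (snd q)) + snd v *R G (fst q, snd q, y (fst q) (snd q)))) (at q)"
proof -
 let ?Om = "UNIV \<times> I \<times> UNIV :: ('p \<times> real \<times> 'd) set"
 have oI: "open I" "convex I" using I by auto
 have dG: "(G has_derivative FD G q) (at q)" if "q : ?Om" for q
  using G that by (cases q) (auto simp: frechet_derivative_works[symmetric])
 have cG: "continuous_on ?Om G" and cD: "continuous_on ?Om (%q. FD G q v)" for v
  using G Ck_on_cont[OF G] by (auto simp: prod.split_sel_asm) (cases v, auto)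
 have linD: "linear (FD G q)" if "q : ?Om" for q by (rule has_derivative_linear[OF dG[OF that]])
 have bD: "norm (FD G (z, t, x) (0, 0, w)) <= L * norm w" if t: "t : I" for z t x w
 proof -
  have "((%x. (z, t, x)) has_derivative (%h. (0, 0, h))) (at x)" by (auto intro!: derivative_eq_intros)
  from has_derivative_compose[OF this dG] t have "((%x. G (z, t, x)) has_derivative (%h. FD G (z, t, x) (0, 0, h))) (at x)" by simp
  from lipschitz_derivative_bound[OF this lip[OF t]] show ?thesis .
 qed
 note cy = ode_continuous[OF I cG lip ta y]
 define s where "s p t te = (fst p + te *R (snd p - fst p), t, y (fst p) t + te *R (y (snd p) t - y (fst p) t))" for p t and te :: real
 define B where "B p t v = integral {0..1} (%te. FD G (s p t te) v)" for p t v
 have s: "s p t te : ?Om" if "t : I" for p t te using that by (simp add: s_def)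
 have ci: "continuous_on {0..1} (%te. FD G (s p t te) v)" if "t : I" for p t v
  by (rule continuous_on_compose2[OF cD]) (use that s in "auto simp: s_def intro!: continuous_intros")
 note ii = integrable_continuous_interval[OF ci]
 have linB: "linear (B p t)" if t: "t : I" for p t
  by (rule linearI) (simp_all add: B_def linear_add[OF linD[OF s[OF t]]] linear_cmul[OF linD[OF s[OF t]]] integral_add[OF ii[OF t] ii[OF t]])
 have bB: "norm (B p t (0, 0, w)) <= L * norm w" if "t : I" for p t w
  unfolding B_def using integral_bound[OF _ ci[OF that], where B = "L * norm w"] bD[OF that] by (simp add: s_def)
 have cB: "continuous_on (UNIV \<times> I) (%q. B (fst q) (snd q) v)" for v
 proof -
  have c1: "continuous_on ((UNIV \<times> I) \<times> cbox 0 1) (%x::(('p \<times> 'p) \<times> real) \<times> real. y (f (fst (fst x))) (snd (fst x)))"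
   if "f = fst | f = snd" for f by (rule continuous_on_compose2[OF cy, of _ "%x. (f (fst (fst x)), snd (fst x))", simplified])
    (use that in "auto intro!: continuous_intros")
  have "continuous_on ((UNIV \<times> I) \<times> cbox 0 1) (%(q, te). FD G (s (fst q) (snd q) te) v)"
   unfolding case_prod_beta by (rule continuous_on_compose2[OF cD])
    (use s c1[of fst, unfolded cbox_interval] c1[of snd, unfolded cbox_interval] in "auto simp: s_def intro!: continuous_intros")
  from integral_continuous_on_param[OF this] show ?thesis by (simp add: B_def)
 qed
 have inc: "G (z', t, y z' t) - G (z, t, y z t) = B (z, z') t (z' - z, 0, y z' t - y z t)" if t: "t : I" for z z' t
 proof -
  let ?v = "(z' - z, 0, y z' t - y z t)"
  have "((%te. G (s (z, z') t te)) has_vector_derivative FD G (s (z, z') t te) ?v) (at te)" for te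
  proof -
   have "(s (z, z') t has_derivative (%r. r *R ?v)) (at te)"
    unfolding s_def by (auto intro!: derivative_eq_intros simp: fun_eq_iff)
   from has_derivative_compose[OF this dG[OF s[OF t]]] show ?thesis
    unfolding has_vector_derivative_def linear_cmul[OF linD[OF s[OF t]]] .
  qed
  hence "((%te. FD G (s (z, z') t te) ?v) has_integral G (s (z, z') t 1) - G (s (z, z') t 0)) {0..1}"
   by (intro fundamental_theorem_of_calculus) (auto intro: has_vector_derivative_at_within)
  from integral_unique[OF this] show ?thesis by (simp add: B_def s_def)
 qed
 define F where "F e = (%(p, t, x). B p t (0, 0, x) + B p t (e, 0, 0))" for e
 have lF: "norm (F e (p, t, x) - F e (p, t, x')) <= L * norm (x - x')" if "t : I" for e p t x x'
  using bB[OF that, of p "x - x'"] linear_diff[OF linB[OF that], of p "(0, 0, x)" "(0, 0, x')"] by (simp add: F_def)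
 have cF: "continuous_on (UNIV \<times> I \<times> UNIV) (F e)" for e
 proof -
  have 1: "continuous_on (UNIV \<times> I \<times> UNIV) (%q::('p \<times> 'p) \<times> real \<times> 'd. B (fst q) (fst (snd q)) v)" for v
   by (rule continuous_on_compose2[OF cB, of _ "%q. (fst q, fst (snd q))", simplified]) (auto intro!: continuous_intros)
  have "continuous_on (UNIV \<times> I \<times> UNIV) (%q::('p \<times> 'p) \<times> real \<times> 'd. B (fst q) (fst (snd q)) (0, 0, snd (snd q)) + B (fst q) (fst (snd q)) (e, 0, 0))"
   by (intro continuous_on_add 1 continuous_on_linear_apply[OF _ 1]) (auto intro!: linB continuous_intros)
  thus ?thesis by (simp add: F_def case_prod_beta)
 qed
 have "EX x. x 0 = 0 & (ALL t:I. (x has_vector_derivative F e (p, t, x t)) (at t))" for e p by (rule ode_exists[OF I _ lF ta])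
   (auto simp: case_prod_beta intro!: continuous_on_compose2[OF cF] continuous_intros)
 then obtain X where X: "!!e p. X e p 0 = 0" "!!e p t. t : I ==> (X e p has_vector_derivative F e (p, t, X e p t)) (at t)" by metis
 note cX = ode_continuous[OF I cF lF ta X]
 have diff: "y z' t = y z t + (SUM e:Basis. ((z' - z) \<bullet> e) *R X e (z, z') t)" if t: "t : I" for z z' t
 proof -
  let ?S = "%t. SUM e:Basis. ((z' - z) \<bullet> e) *R X e (z, z') t"
  let ?de = "%t. y z' t - y z t - ?S t"
  have "norm (?de t) <= 2 * (norm (?de 0) + \<bar>t\<bar> * 0)"
  proof (rule small_gronwall[where T = "\<bar>t\<bar>" and L = L and de = ?de and de' = "%s. B (z, z') s (0, 0, ?de s)"])
   fix s assume "\<bar>s\<bar> <= \<bar>t\<bar>"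
   hence s: "s : I" using t I by auto
   let ?B = "B (z, z') s"
   note l = linB[OF s, of "(z, z')"]
   have l1: "linear (%v. ?B (v, 0, 0))" and l2: "linear (%v. ?B (0, 0, v))"
    using linear_compose[OF _ l, of "%v. (v, 0, 0)"] linear_compose[OF _ l, of "%v. (0, 0, v)"] by (auto simp: o_def linear_iff)
   have "?B (z' - z, 0, y z' s - y z s) = ?B (z' - z, 0, 0) + ?B (0, 0, y z' s - y z s)" by (simp add: linear_add[OF l, symmetric])
   hence "?B (z' - z, 0, y z' s - y z s) - (SUM e:Basis. ((z' - z) \<bullet> e) *R F e ((z, z'), s, X e (z, z') s)) = ?B (0, 0, ?de s)"
    using linear_basis_expand[OF l1, of "z' - z"]
    by (simp add: F_def linear_diff[OF l2] linear_sum[OF l2] linear_cmul[OF l2] scaleR_add_right sum.distrib)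
   moreover have "(?de has_vector_derivative G (z', s, y z' s) - G (z, s, y z s) - (SUM e:Basis. ((z' - z) \<bullet> e) *R F e ((z, z'), s, X e (z, z') s))) (at s)"
    by (intro has_vector_derivative_diff y(2) s has_vector_derivative_sum
      bounded_linear.has_vector_derivative[OF bounded_linear_scaleR_right] X(2))
   ultimately show "(?de has_vector_derivative ?B (0, 0, ?de s)) (at s)" unfolding inc[OF s] by simp
   show "norm (?B (0, 0, ?de s)) <= L * norm (?de s) + 0" using bB[OF s] by simp
  qed (use t I ta mult_right_mono[of "\<bar>t\<bar>" ta L] in "auto simp: abs_le_iff")
  moreover have "?de 0 = 0" by (simp add: X(1) y(1))
  ultimately show ?thesis by (simp add: algebra_simps)
 qed
 have zder: "((%z. y z t) has_derivative (%v. SUM e:Basis. (v \<bullet> e) *R X e (z, z) t)) (at z)" if t: "t : I" for z t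
 proof -
  have "continuous_on UNIV (%z'. X e (z, z') t)" for e
   by (rule continuous_on_compose2[OF cX[of e], of _ "%z'. ((z, z'), t)", simplified]) (use t in "auto intro!: continuous_intros")
  hence c: "isCont (%z'. X e (z, z') t) z" for e by (simp add: continuous_on_eq_continuous_at)
  have "((%z'. y z t + (SUM e:Basis. ((z' - z) \<bullet> e) *R X e (z, z') t)) has_derivative
    (%v. 0 + (SUM e:Basis. (v \<bullet> e) *R X e (z, z) t))) (at z)"
   by (intro has_derivative_add has_derivative_const has_derivative_sum has_derivative_scaleR_vanishing c)
    (auto intro!: derivative_eq_intros)
  thus ?thesis unfolding diff[OF t, symmetric] by simp
 qed
 show ?thesis
 proof (rule that[of "%e z. X e (z, z)"])
  show "X e (z, z) 0 = 0" for e z by (rule X)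
  have Bzz: "B (z, z) t v = D z t v" for z t v by (simp add: B_def s_def D_def)
  show "(X e (z, z) has_vector_derivative D z t (0, 0, X e (z, z) t) + D z t (e, 0, 0)) (at t)" if "t : I" for e z t
   using X(2)[OF that, of e "(z, z)"] by (simp add: F_def Bzz)
  fix q :: "'p \<times> real" assume q: "q : UNIV \<times> I"
  obtain z t where zt: "q = (z, t)" "t : I" using q by auto
  let ?f = "%z t. blinfun_scaleR_left (G (z, t, y z t))"
  have "((%(z, t). y z t) has_derivative (%(tx, ty). (SUM e:Basis. (tx \<bullet> e) *R X e (z, z) t) + ?f z t ty)) (at (z, t) within UNIV \<times> I)"
  proof (rule has_derivative_partialsI[where fy = ?f])
   show "((%z. y z t) has_derivative (%v. SUM e:Basis. (v \<bullet> e) *R X e (z, z) t)) (at z within UNIV)" using zder[OF zt(2)] by simp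
   show "((%t. y z t) has_derivative blinfun_apply (?f z t)) (at t within I)" if "t : I" for z t
    using y(2)[OF that, of z] by (auto simp: has_vector_derivative_def intro: has_derivative_at_withinI)
   have "continuous_on (UNIV \<times> I) (%q. ?f (fst q) (snd q))"
    by (intro continuous_intros continuous_on_compose2[OF cG]) (auto intro!: continuous_intros cy)
   thus "continuous (at (z, t) within UNIV \<times> I) (%(z, t). ?f z t)"
    unfolding continuous_on_eq_continuous_within case_prod_beta using zt(2) by blast
  qed (use zt oI in auto)
  thus "((%q. y (fst q) (snd q)) has_derivative
   (%v. (SUM e:Basis. (fst v \<bullet> e) *R X e (fst q, fst q) (snd q)) + snd v *R G (fst q, snd q, y (fst q) (snd q)))) (at q)"
   using zt oI at_within_open[of "(z, t)" "UNIV \<times> I"] by (simp add: open_Times case_prod_unfold)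
 qed
qed

text \<open>The derivative of a solution with respect to the parameter solves a linear equation with the same
 operator \<open>A\<close> and a new inhomogeneity; the induction on \<open>k\<close> is therefore over all inhomogeneities.\<close>

lemma linear_ode_Ck:
 fixes A :: "'p::euclidean_space => real => 'd::euclidean_space => 'd"
 assumes I: "I = {-ta<..<ta}" and lin: "!!z t. t : I ==> linear (A z t)" and bnd: "!!z t w. t : I ==> norm (A z t w) <= L * norm w"
  and ta: "0 <= L" "ta * L <= 1/2"
  and A: "!!w. Ck_on k (UNIV \<times> I) (%q. A (fst q) (snd q) w)" and b: "Ck_on k (UNIV \<times> I) b"
  and y: "!!z. y z 0 = 0" "!!z t. t : I ==> (y z has_vector_derivative A z t (y z t) + b (z, t)) (at t)"
 shows "Ck_on k (UNIV \<times> I) (%q. y (fst q) (snd q))"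
proof -
 let ?Om = "UNIV \<times> I \<times> UNIV :: ('p \<times> real \<times> 'd) set" and ?Om' = "UNIV \<times> I :: ('p \<times> real) set"
 let ?G = "%b q. A (fst q) (fst (snd q)) (snd (snd q)) + b (fst q, fst (snd q))"
 have op: "open ?Om" "open ?Om'" using I by (auto intro!: open_Times)
 have G: "Ck_on j ?Om (?G b)" if A: "!!w. Ck_on j ?Om' (%q. A (fst q) (snd q) w)" and b: "Ck_on j ?Om' b" for j b
 proof (rule Ck_on_add[OF op(1) Ck_on_linear_apply[OF op(1), where L = "%q. A (fst q) (fst (snd q))" and f = "%q. snd (snd q)"]])
  have pr: "Ck_on j ?Om (%q. (fst q, fst (snd q)))"
   by (auto intro!: Ck_on_bounded_linear[OF _ op(1) Ck_on_ident[OF op(1)]] simp: linear_conv_bounded_linear[symmetric] linear_iff)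
  have i: "(%q. (fst q, fst (snd q))) ` ?Om <= ?Om'" by auto
  show "Ck_on j ?Om (%q. A (fst q) (fst (snd q)) w)" for w using Ck_on_comp[OF op pr A i] by simp
  show "Ck_on j ?Om (%q. b (fst q, fst (snd q)))" by (rule Ck_on_comp[OF op pr b i])
  show "Ck_on j ?Om (%q. snd (snd q))"
   by (auto intro!: Ck_on_bounded_linear[OF _ op(1) Ck_on_ident[OF op(1)]] simp: linear_conv_bounded_linear[symmetric] linear_iff)
 qed (auto simp: lin)
 have lip: "norm (?G b (z, t, x) - ?G b (z, t, x')) <= L * norm (x - x')" if "t : I" for b z t x x'
  using bnd[OF that, of z "x - x'"] by (simp add: linear_diff[OF lin[OF that]])
 show ?thesis
 using A b y
proof (induction k arbitrary: b y)
 case (0 b y)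
 have y: "(y z has_vector_derivative ?G b (z, t, y z t)) (at t)" if "t : I" for z t using 0(4)[OF that] by simp
 from ode_continuous[OF I Ck_on_cont[OF G[OF 0(1,2)]] lip ta 0(3) y] show ?case by simp
next
 case (Suc k b y)
 note GS = G[OF Suc(2,3)]
 have G1: "Ck_on (Suc 0) ?Om (?G b)" using GS by (auto simp del: split_paired_All intro: Ck_on_cont)
 define D where "D z t = FD (?G b) (z, t, y z t)" for z t
 have D: "D z t (0, 0, w) = A z t w" if t: "t : I" for z t w
 proof -
  have "((%x. (z, t, x)) has_derivative (%h. (0, 0, h))) (at (y z t))" by (auto intro!: derivative_eq_intros)
  moreover have "(?G b has_derivative D z t) (at (z, t, y z t))"
   using G1 t by (auto simp: D_def frechet_derivative_works[symmetric])
  ultimately have "((%x. A z t x + b (z, t)) has_derivative (%h. D z t (0, 0, h))) (at (y z t))"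
   using has_derivative_compose[of "%x. (z, t, x)" _ "y z t" UNIV "?G b"] by simp
  moreover have "((%x. A z t x + b (z, t)) has_derivative A z t) (at (y z t))"
   using linear_imp_has_derivative[OF lin[OF t]] by (auto intro!: derivative_eq_intros)
  ultimately show ?thesis by (metis has_derivative_unique)
 qed
 have y: "(y z has_vector_derivative ?G b (z, t, y z t)) (at t)" if "t : I" for z t using Suc(5)[OF that] by simp
 obtain Y where Y: "!!e z. Y e z 0 = 0"
  "!!e z t. t : I ==> (Y e z has_vector_derivative FD (?G b) (z, t, y z t) (0, 0, Y e z t) + FD (?G b) (z, t, y z t) (e, 0, 0)) (at t)"
  "!!q. q : ?Om' ==> ((%q. y (fst q) (snd q)) has_derivative
   (%v. (SUM e:Basis. (fst v \<bullet> e) *R Y e (fst q) (snd q)) + snd v *R ?G b (fst q, snd q, y (fst q) (snd q)))) (at q)"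
 proof (rule parameter_derivative[OF I G1 lip ta Suc(4) y], goal_cases)
  case (3 Y) show ?case by (rule that; rule 3; assumption)
 qed
 have AC: "Ck_on k ?Om' (%q. A (fst q) (snd q) w)" for w by (rule Ck_on_Suc_imp[OF Suc(2)])
 have yk: "Ck_on k ?Om' (%q. y (fst q) (snd q))" by (rule Suc(1)[OF AC Ck_on_Suc_imp[OF Suc(3)] Suc(4,5)])
 have gr: "Ck_on k ?Om' (%q. (fst q, snd q, y (fst q) (snd q)))"
 proof -
  have "bounded_linear (%q::'p \<times> real. (fst q, snd q, 0::'d))" "bounded_linear (%x::'d. (0::'p, 0::real, x))"
   by (simp_all add: linear_conv_bounded_linear[symmetric] linear_iff)
  from Ck_on_add[OF op(2) Ck_on_bounded_linear[OF this(1) op(2) Ck_on_ident[OF op(2)]] Ck_on_bounded_linear[OF this(2) op(2) yk]]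
  show ?thesis by simp
 qed
 have DC: "Ck_on k ?Om' (%q. D (fst q) (snd q) v)" for v
  unfolding D_def by (rule Ck_on_comp[OF op(2,1) gr]) (use GS in "cases v, auto")
 have Yk: "Ck_on k ?Om' (%q. Y e (fst q) (snd q))" for e
  by (rule Suc(1)[OF AC, of "%q. D (fst q) (snd q) (e, 0, 0)"]) (use Y(1,2) D DC in "auto simp: D_def")
 have "Ck_on k ?Om' (%q. A (fst q) (snd q) (y (fst q) (snd q)))" by (rule Ck_on_linear_apply[OF op(2) _ AC yk]) (auto simp: lin)
 thus ?case by (intro Ck_on_has_derivativeI[OF op(2) Y(3)])
   (auto intro!: Ck_on_add Ck_on_sum op Ck_on_bounded_linear[OF bounded_linear_scaleR_right op(2)] Yk Ck_on_Suc_imp[OF Suc(3)])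
qed
qed

text \<open>Subtracting the initial point makes it a parameter of an equation with initial value 0.
  If the solution is of class \<open>k\<close> in time and parameter, so are the coefficients of the
  linear equation for its parameter derivatives; \<open>linear_ode_Ck\<close> puts these derivatives
  in class \<open>k\<close>, hence the solution in the next class.\<close>

lemma flow_exists:
 fixes F :: "'d::euclidean_space => 'd"
 assumes F: "smooth_on UNIV F" and lip: "!!x y. norm (F x - F y) <= L * norm (x - y)"
  and ta: "0 < ta" "0 <= L" "ta * L <= 1/2"
 obtains fi where "smooth_on (UNIV \<times> {-ta<..<ta}) (%q. fi (fst q) (snd q))" "!!z. fi z 0 = z"
  "!!z t. \<bar>t\<bar> < ta ==> (fi z has_vector_derivative F (fi z t)) (at t)"
proof -
 define I where "I = {-ta<..<ta}"
 let ?Om = "UNIV \<times> I \<times> UNIV :: ('d \<times> real \<times> 'd) set" and ?Om' = "UNIV \<times> I :: ('d \<times> real) set"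
 let ?G = "%q::'d \<times> real \<times> 'd. F (fst q + snd (snd q))"
 have op: "open ?Om" "open ?Om'" by (auto simp: I_def intro!: open_Times)
 have G: "Ck_on k ?Om ?G" for k by (rule Ck_on_comp[OF op(1) open_UNIV _ smooth_onD[OF F]])
   (auto intro!: Ck_on_bounded_linear[OF _ op(1) Ck_on_ident[OF op(1)]] simp: linear_conv_bounded_linear[symmetric] linear_iff algebra_simps)
 have lip': "norm (?G (z, t, x) - ?G (z, t, x')) <= L * norm (x - x')" for z t x x' using lip[of "z + x" "z + x'"] by simp
 have "EX x. x 0 = 0 & (ALL t:I. (x has_vector_derivative ?G (z, t, x t)) (at t))" for z by (rule ode_exists[OF I_def _ lip' ta(2,3)])
   (auto simp: case_prod_beta intro!: continuous_on_compose2[OF smooth_cont[OF F]] continuous_intros)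
 then obtain y where y: "!!z. y z 0 = 0" "!!z t. t : I ==> (y z has_vector_derivative ?G (z, t, y z t)) (at t)" by metis
 have dF: "(F has_derivative FD F x) (at x)" for x by (rule smooth_has_derivative[OF F]) simp
 have D: "FD ?G (z, t, x) (u, 0, v) = FD F (z + x) (u + v)" for z t x u v
 proof -
  have "((%q::'d \<times> real \<times> 'd. fst q + snd (snd q)) has_derivative (%q. fst q + snd (snd q))) (at (z, t, x))"
   by (auto intro!: derivative_eq_intros)
  from has_derivative_frechet[OF has_derivative_compose[OF this dF]] show ?thesis by simp
 qed
 obtain Y where Y: "!!e z. Y e z 0 = 0"
  "!!e z t. t : I ==> (Y e z has_vector_derivative FD ?G (z, t, y z t) (0, 0, Y e z t) + FD ?G (z, t, y z t) (e, 0, 0)) (at t)"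
  "!!q. q : ?Om' ==> ((%q. y (fst q) (snd q)) has_derivative
   (%v. (SUM e:Basis. (fst v \<bullet> e) *R Y e (fst q) (snd q)) + snd v *R ?G (fst q, snd q, y (fst q) (snd q)))) (at q)"
  proof (rule parameter_derivative[OF I_def G lip' ta(2,3) y], goal_cases)
  case (2 Y) show ?case by (rule that; rule 2; assumption)
 qed
 have "Ck_on k ?Om' (%q. y (fst q) (snd q))" for k
 proof (induction k)
  case 0
  thus ?case using ode_continuous[OF I_def Ck_on_cont[OF G] lip' ta(2,3) y] by simp
 next
  case (Suc k)
  have zy: "Ck_on k ?Om' (%q. fst q + y (fst q) (snd q))"
   by (intro Ck_on_add op Suc Ck_on_bounded_linear[OF bounded_linear_fst op(2) Ck_on_ident[OF op(2)]])
  have DFk: "Ck_on k ?Om' (%q. FD F (fst q + y (fst q) (snd q)) w)" for w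
   by (rule Ck_on_comp[OF op(2) open_UNIV zy smooth_onD[OF smooth_deriv[OF F]]]) simp
  have Yk: "Ck_on k ?Om' (%q. Y e (fst q) (snd q))" for e by (rule linear_ode_Ck[where A = "%z t. FD F (z + y z t)", OF I_def
    has_derivative_linear[OF dF] lipschitz_derivative_bound[OF dF lip] ta(2,3) DFk DFk[of e]])
    (use Y(1,2) in "auto simp: D")
  have "Ck_on k ?Om' (%q. F (fst q + y (fst q) (snd q)))" by (rule Ck_on_comp[OF op(2) open_UNIV zy smooth_onD[OF F]]) simp
  thus ?case by (intro Ck_on_has_derivativeI[OF op(2) Y(3)])
    (auto intro!: Ck_on_add Ck_on_sum op Ck_on_bounded_linear[OF bounded_linear_scaleR_right op(2)] Yk)
 qed
 hence "smooth_on ?Om' (%q. fst q + y (fst q) (snd q))"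
  using op(2) by (auto simp: smooth_on_def intro!: Ck_on_add Ck_on_bounded_linear[OF bounded_linear_fst] Ck_on_ident)
 thus ?thesis by (intro that[of "%z t. z + y z t"]) (use y in "auto simp: I_def abs_less_iff intro!: derivative_eq_intros")
qed

section \<open>Riemannian geometry in coordinates\<close>

definition gram :: "('e::euclidean_space => 'e => real) => 'e => 'e" where
 "gram B w = (SUM b:Basis. B w b *R b)"

lemma gram_inner:
 assumes "bilinear B" shows "gram B w \<bullet> z = B w z"
proof -
 have "B w z = (SUM b:Basis. (z \<bullet> b) *R B w b)" by (rule linear_basis_expand) (use assms in "simp add: bilinear_def")
 thus ?thesis unfolding gram_def inner_sum_left by (simp add: inner_commute mult.commute)
qed

lemma linear_gram: "bilinear B ==> linear (gram B)" by (rule linearI)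
  (simp_all add: gram_def bilinear_ladd bilinear_lmul scaleR_add_left sum.distrib scaleR_sum_right)

definition nondegenerate :: "('e::euclidean_space => 'e => real) => bool" where
 "nondegenerate B \<longleftrightarrow> (ALL w. (ALL z. B w z = 0) --> w = 0)"

lemma inj_gram:
 assumes B: "bilinear B" and nd: "nondegenerate B"
 shows "inj (gram B)"
proof -
 have "w = 0" if "gram B w = 0" for w
  using nd gram_inner[OF B, of w] that unfolding nondegenerate_def by simp
 thus ?thesis using linear_injective_0[OF linear_gram[OF B]] by blast
qed

lemma smooth_gram:
 assumes "open S" "!!u v. smooth_on S (%x. B x u v)"
 shows "smooth_on S (%x. gram (B x) w)"
 unfolding gram_def by (intro smooth_sum smooth_scaleR smooth_const assms)

text \<open>Expansion in the basis reduces this to the product rule; the three terms come from the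
  motion of the base point and of the two arguments.\<close>

lemma has_derivative_bilinear_field:
 fixes T :: "'a::euclidean_space => 'b::euclidean_space => 'd::euclidean_space => 'c::real_normed_vector"
 assumes bil: "!!y. y : S ==> bilinear (T y)" and sm: "!!u v. smooth_on S (%y. T y u v)"
  and x: "ps x : S" and ps: "(ps has_derivative ps') (at x)"
  and a: "(a has_derivative a') (at x)" and b: "(b has_derivative b') (at x)"
 shows "((%x. T (ps x) (a x) (b x)) has_derivative
  (%h. FD (%y. T y (a x) (b x)) (ps x) (ps' h) + T (ps x) (a' h) (b x) + T (ps x) (a x) (b' h))) (at x)"
proof -
 define E where "E y u v = (SUM i:Basis. SUM j:Basis. ((u \<bullet> i) * (v \<bullet> j)) *R T y i j)" for y u v
 have TE: "T y u v = E y u v" if "y : S" for y u v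
 proof -
  have "T y u v = (SUM i:Basis. (u \<bullet> i) *R T y i v)"
   by (rule linear_basis_expand[where f = "%u. T y u v"]) (use bil[OF that] in "simp add: bilinear_def")
  also have "... = (SUM i:Basis. (u \<bullet> i) *R (SUM j:Basis. (v \<bullet> j) *R T y i j))"
   by (intro sum.cong refl arg_cong2[where f = scaleR] linear_basis_expand) (use bil[OF that] in "simp add: bilinear_def")
  finally show ?thesis by (simp add: E_def scaleR_sum_right)
 qed
 have op: "open S" by (rule smooth_open[OF sm])
 define D where "D i j = FD (%y. T y i j) (ps x)" for i j
 have dT: "((%y. T y i j) has_derivative D i j) (at (ps x))" for i j
  unfolding D_def by (rule smooth_has_derivative[OF sm x])
 have fE: "FD (%y. T y u v) (ps x) h = (SUM i:Basis. SUM j:Basis. ((u \<bullet> i) * (v \<bullet> j)) *R D i j h)" for u v h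
 proof -
  have "((%y. E y u v) has_derivative (%h. SUM i:Basis. SUM j:Basis. ((u \<bullet> i) * (v \<bullet> j)) *R D i j h)) (at (ps x))"
   unfolding E_def by (intro has_derivative_sum has_derivative_scaleR_right dT)
  hence "((%y. T y u v) has_derivative (%h. SUM i:Basis. SUM j:Basis. ((u \<bullet> i) * (v \<bullet> j)) *R D i j h)) (at (ps x))"
   by (rule has_derivative_transform_within_open[OF _ op x]) (simp add: TE)
  thus ?thesis by (simp add: has_derivative_frechet)
 qed
 have "((%x. E (ps x) (a x) (b x)) has_derivative (%h. SUM i:Basis. SUM j:Basis.
   ((a x \<bullet> i) * (b x \<bullet> j)) *R D i j (ps' h) + ((a x \<bullet> i) * (b' h \<bullet> j) + (a' h \<bullet> i) * (b x \<bullet> j)) *R T (ps x) i j)) (at x)"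
  unfolding E_def by (intro has_derivative_sum has_derivative_scaleR has_derivative_mult has_derivative_inner_left a b
    has_derivative_compose[OF ps dT])
 moreover have "(SUM i:Basis. SUM j:Basis.
   ((a x \<bullet> i) * (b x \<bullet> j)) *R D i j (ps' h) + ((a x \<bullet> i) * (b' h \<bullet> j) + (a' h \<bullet> i) * (b x \<bullet> j)) *R T (ps x) i j)
  = FD (%y. T y (a x) (b x)) (ps x) (ps' h) + T (ps x) (a' h) (b x) + T (ps x) (a x) (b' h)" for h
  unfolding fE TE[OF x, of "a' h" "b x"] TE[OF x, of "a x" "b' h"] E_def by (simp add: sum.distrib scaleR_add_left algebra_simps)
 ultimately have "((%x. E (ps x) (a x) (b x)) has_derivative
  (%h. FD (%y. T y (a x) (b x)) (ps x) (ps' h) + T (ps x) (a' h) (b x) + T (ps x) (a x) (b' h))) (at x)" by simp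
 moreover have "\<forall>\<^sub>F z in at x. E (ps z) (a z) (b z) = T (ps z) (a z) (b z)"
 proof -
  have "(ps \<longlongrightarrow> ps x) (at x)" using has_derivative_continuous[OF ps] isCont_def by blast
  from topological_tendstoD[OF this op x] show ?thesis by eventually_elim (simp add: TE)
 qed
 ultimately show ?thesis by (rule has_derivative_transform_eventually) (simp_all add: TE[OF x])
qed

lemma bilinear_frechet_derivative:
 fixes T :: "'a::euclidean_space => 'b::euclidean_space => 'd::euclidean_space => 'c::real_normed_vector"
 assumes bil: "!!y. y : S ==> bilinear (T y)" and sm: "!!u v. smooth_on S (%y. T y u v)" and x: "x : S"
 shows "bilinear (%u v. FD (%y. T y u v) x h)"
proof -
 have op: "open S" by (rule smooth_open[OF sm])
 have d: "((%y. T y u v) has_derivative FD (%y. T y u v) x) (at x)" for u v by (rule smooth_has_derivative[OF sm x])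
 have eq: "FD f x = D" if "(g has_derivative D) (at x)" "!!y. y : S ==> g y = f y"
  for f g :: "'a => 'c" and D by (rule has_derivative_frechet[OF has_derivative_transform_within_open[OF that(1) op x that(2)]])
 show ?thesis
  unfolding bilinear_def
 proof (intro conjI allI linearI)
  show "FD (%y. T y u (v + w)) x h = FD (%y. T y u v) x h + FD (%y. T y u w) x h" for u v w
   by (subst eq[OF has_derivative_add[OF d[of u v] d[of u w]]]) (simp_all add: bilinear_radd[OF bil])
  show "FD (%y. T y u (c *R v)) x h = c *R FD (%y. T y u v) x h" for u v c
   by (subst eq[OF has_derivative_scaleR_right[OF d[of u v], of c]]) (simp_all add: bilinear_rmul[OF bil])
  show "FD (%y. T y (u + w) v) x h = FD (%y. T y u v) x h + FD (%y. T y w v) x h" for u v w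
   by (subst eq[OF has_derivative_add[OF d[of u v] d[of w v]]]) (simp_all add: bilinear_ladd[OF bil])
  show "FD (%y. T y (c *R u) v) x h = c *R FD (%y. T y u v) x h" for u v c
   by (subst eq[OF has_derivative_scaleR_right[OF d[of u v], of c]]) (simp_all add: bilinear_lmul[OF bil])
 qed
qed

section \<open>The Levi-Civita connection of a metric on an open set\<close>

definition metric_on :: "'e::euclidean_space set => ('e => 'e => 'e => real) => bool" where
 "metric_on S G \<longleftrightarrow> (ALL x:S. bilinear (G x) & (ALL u v. G x u v = G x v u) & (ALL u. u ~= 0 --> 0 < G x u u)) &
  (ALL u v. smooth_on S (%x. G x u v))"

abbreviation dfield :: "('e::euclidean_space => 'e => 'e => 'c::real_normed_vector) => 'e => 'e => 'e => 'e => 'c" where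
 "dfield T x h u v == FD (%y. T y u v) x h"

lemma metric_onD:
 assumes "metric_on S G"
 shows "open S" "x : S ==> bilinear (G x)" "x : S ==> G x u v = G x v u"
  "x : S ==> u ~= 0 ==> 0 < G x u u" "smooth_on S (%x. G x u v)"
 using assms smooth_open unfolding metric_on_def by blast+

lemma metric_on_subset: "metric_on S G ==> open T ==> T <= S ==> metric_on T G"
 unfolding metric_on_def using smooth_subset by blast

lemma metric_on_ext:
 assumes "metric_on S G" "x : S" "!!z. G x w z = G x w' z"
 shows "w = w'"
proof (rule ccontr)
 assume "w ~= w'"
 hence "0 < G x (w - w') (w - w')" using metric_onD(4)[OF assms(1,2)] by simp
 thus False using assms(3)[of "w - w'"] by (simp add: bilinear_lsub[OF metric_onD(2)[OF assms(1,2)]])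
qed

text \<open>The Christoffel symbols of the first kind: the covector that
  \<open>christoffel G x u v\<close> represents through \<open>G x\<close>.\<close>

definition christoffel1 :: "('e::euclidean_space => 'e => 'e => real) => 'e => 'e => 'e => 'e => real" where
 "christoffel1 G x u v z = (dfield G x u v z + dfield G x v u z - dfield G x z u v) / 2"

lemma gram_solve:
 assumes B: "bilinear B" and nd: "nondegenerate B" and l: "linear l"
 shows "B (inv (gram B) (SUM b:Basis. l b *R b)) z = l z"
proof -
 have "B (inv (gram B) (SUM b:Basis. l b *R b)) z = (SUM b:Basis. l b *R b) \<bullet> z"
  unfolding gram_inner[OF B, symmetric] linear_inj_inv(2)[OF linear_gram[OF B] inj_gram[OF B nd]] ..
 also have "... = (SUM b:Basis. (z \<bullet> b) *R l b)"
  unfolding inner_sum_left by (simp add: inner_commute mult.commute)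
 also have "... = l z" by (rule linear_basis_expand[OF l, symmetric])
 finally show ?thesis .
qed

lemma metric_on_nondeg:
 assumes "metric_on S G" "x : S" shows "nondegenerate (G x)"
 unfolding nondegenerate_def using metric_onD(4)[OF assms] by (metis less_irrefl)

lemma christoffel_unfold:
 "christoffel G x u v = (THE w. ALL z. G x w z = christoffel1 G x u v z)" by (simp add: christoffel_def christoffel1_def)

lemma christoffel1_linear:
 assumes "metric_on S G" "x : S" shows "linear (christoffel1 G x u v)"
proof -
 have b: "linear (%z. dfield G x h w z)" for h w
  using bilinear_frechet_derivative[OF metric_onD(2,5)[OF assms(1)] assms(2)] by (simp add: bilinear_def)
 have l: "linear (%z. dfield G x z u v)" by (rule smooth_FD_linear[OF metric_onD(5)[OF assms(1)] assms(2)])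
 show ?thesis by (rule linearI)
   (simp_all add: christoffel1_def linear_add[OF b] linear_add[OF l] linear_cmul[OF b] linear_cmul[OF l]
    algebra_simps add_divide_distrib diff_divide_distrib)
qed

lemma christoffel_eqI:
 assumes "metric_on S G" "x : S" "!!z. G x w z = christoffel1 G x u v z"
 shows "christoffel G x u v = w"
 unfolding christoffel_unfold
proof (rule the_equality)
 fix w' assume "ALL z. G x w' z = christoffel1 G x u v z"
 thus "w' = w" using assms(3) by (intro metric_on_ext[OF assms(1,2)]) simp
qed (use assms(3) in simp)

lemma christoffel_eq:
 assumes "metric_on S G" "x : S"
 shows "christoffel G x u v = inv (gram (G x)) (SUM b:Basis. christoffel1 G x u v b *R b)" by (rule christoffel_eqI[OF assms])
  (rule gram_solve[OF metric_onD(2)[OF assms] metric_on_nondeg[OF assms] christoffel1_linear[OF assms]])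

lemma christoffel_works:
 assumes "metric_on S G" "x : S"
 shows "G x (christoffel G x u v) z = christoffel1 G x u v z"
 unfolding christoffel_eq[OF assms] by (rule gram_solve[OF metric_onD(2)[OF assms] metric_on_nondeg[OF assms] christoffel1_linear[OF assms]])

lemma christoffel_sym:
 assumes "metric_on S G" "x : S"
 shows "christoffel G x u v = christoffel G x v u"
proof (rule christoffel_eqI[OF assms])
 have "FD (%y. G y u v) x = FD (%y. G y v u) x" for u v by (rule frechet_derivative_cong_open[OF metric_onD(1)[OF assms(1)] assms(2)])
   (rule metric_onD(3)[OF assms(1)])
 thus "G x (christoffel G x v u) z = christoffel1 G x u v z" for z by (simp add: christoffel_works[OF assms] christoffel1_def)
qed

lemma bilinear_christoffel:
 assumes "metric_on S G" "x : S"
 shows "bilinear (christoffel G x)"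
proof -
 note b = bilinear_frechet_derivative[OF metric_onD(2,5)[OF assms(1)] assms(2)]
 have l: "linear (%z. dfield G x z u v)" for u v by (rule smooth_FD_linear[OF metric_onD(5)[OF assms(1)] assms(2)])
 note G = metric_onD(2)[OF assms]
 have "christoffel G x u (v + w) = christoffel G x u v + christoffel G x u w" for u v w by (rule christoffel_eqI[OF assms])
   (simp add: bilinear_ladd[OF G] christoffel_works[OF assms] christoffel1_def bilinear_ladd[OF b] bilinear_radd[OF b]
    linear_add[OF l] algebra_simps add_divide_distrib diff_divide_distrib)
 moreover have "christoffel G x u (c *R v) = c *R christoffel G x u v" for u v c by (rule christoffel_eqI[OF assms])
   (simp add: bilinear_lmul[OF G] christoffel_works[OF assms] christoffel1_def bilinear_lmul[OF b] bilinear_rmul[OF b]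
    linear_cmul[OF l] algebra_simps)
 ultimately have l: "linear (christoffel G x u)" for u by (intro linearI)
 have "(%u. christoffel G x u v) = christoffel G x v" for v by (rule ext) (rule christoffel_sym[OF assms])
 thus ?thesis using l by (simp add: bilinear_def)
qed

lemma smooth_christoffel1:
 assumes "metric_on S G"
 shows "smooth_on S (%x. christoffel1 G x u v z)"
 unfolding christoffel1_def divide_inverse
 by (intro smooth_mult smooth_diff smooth_add smooth_deriv metric_onD(5)[OF assms] smooth_const metric_onD(1)[OF assms])

lemma smooth_christoffel:
 assumes "metric_on S G"
 shows "smooth_on S (%x. christoffel G x u v)"
proof -
 note op = metric_onD(1)[OF assms]
 note lin = linear_gram[OF metric_onD(2)[OF assms]]
 have inj: "inj (gram (G x))" if "x : S" for x by (rule inj_gram[OF metric_onD(2)[OF assms that] metric_on_nondeg[OF assms that]])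
 have "smooth_on S (%x. inv (gram (G x)) (SUM b:Basis. christoffel1 G x u v b *R b))"
 proof (rule smooth_linear_apply[where L = "%x. inv (gram (G x))"])
  show "linear (inv (gram (G x)))" if "x : S" for x by (rule linear_inj_inv(1)[OF lin[OF that] inj[OF that]])
  show "smooth_on S (%x. inv (gram (G x)) w)" for w by (rule smooth_inv_linear[OF op lin inj smooth_gram[OF op metric_onD(5)[OF assms]]])
  show "smooth_on S (%x. SUM b:Basis. christoffel1 G x u v b *R b)"
   by (intro smooth_sum smooth_scaleR smooth_const op smooth_christoffel1[OF assms])
 qed
 thus ?thesis by (rule smooth_cong) (simp add: christoffel_eq[OF assms])
qed

section \<open>Metric compatibility and curvature bounds\<close>

lemma metric_compatible:
 assumes "metric_on S G" "x : S"
 shows "dfield G x u v w = G x (christoffel G x u v) w + G x v (christoffel G x u w)"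
proof -
 have s: "dfield G x u v w = dfield G x u w v" for u v w
  using frechet_derivative_cong_open[OF metric_onD(1)[OF assms(1)] assms(2), of "%y. G y v w" "%y. G y w v"]
   metric_onD(3)[OF assms(1)] by simp
 show ?thesis
  using s[where u=u and v=v and w=w] s[where u=v and v=u and w=w] s[where u=w and v=u and w=v] metric_onD(3)[OF assms, of v "christoffel G x u w"]
  by (simp add: christoffel_works[OF assms] christoffel1_def field_simps)
qed

text \<open>Metric compatibility expresses the second derivatives of \<open>G y w w\<close> through
  Christoffel terms. Antisymmetrising in the two directions gives twice the claimed quantity on one
  side and 0 on the other, by symmetry of second derivatives.\<close>

lemma riemann_tensor_skew:
 assumes G: "metric_on S G" and x: "x : S"
 shows "G x (riemann_tensor G x u v w) w = 0"
proof -
 note op = metric_onD(1)[OF G]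
 let ?Ga = "christoffel G"
 have d: "((%x. G x (?Ga x v w) w) has_derivative (%h. dfield G x h (?Ga x v w) w
   + G x (FD (%x. ?Ga x v w) x h) w + G x (?Ga x v w) 0)) (at x)" for v
  by (rule has_derivative_bilinear_field[where ps = "%x. x" and T = G, OF metric_onD(2,5)[OF G] x
   has_derivative_ident smooth_has_derivative[OF smooth_christoffel[OF G] x] has_derivative_const])
 have e: "FD (%y. dfield G y v w w) x u = 2 * (G x (?Ga x u (?Ga x v w)) w + G x (?Ga x v w) (?Ga x u w)
  + G x (FD (%x. ?Ga x v w) x u) w)" for u v
 proof -
  have "FD (%y. dfield G y v w w) x = FD (%y. 2 * G y (?Ga y v w) w) x" by (rule frechet_derivative_cong_open[OF op x])
    (simp add: metric_compatible[OF G] metric_onD(3)[OF G, of _ w])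
  also have "... = (%h. 2 * (dfield G x h (?Ga x v w) w
   + G x (FD (%x. ?Ga x v w) x h) w + G x (?Ga x v w) 0))" by (rule has_derivative_frechet[OF has_derivative_mult_right[OF d]])
  finally show ?thesis by (simp add: metric_compatible[OF G x] bilinear_rzero[OF metric_onD(2)[OF G x]])
 qed
 have "FD (%y. dfield G y v w w) x u = FD (%y. dfield G y u w w) x v" by (rule second_derivative_symmetric[OF metric_onD(5)[OF G] x])
 thus ?thesis
  unfolding e riemann_tensor_def
  using metric_onD(3)[OF G x, of "?Ga x v w" "?Ga x u w"]
  by (simp add: bilinear_ladd[OF metric_onD(2)[OF G x]] bilinear_lsub[OF metric_onD(2)[OF G x]])
qed

lemma metric_cauchy_schwarz:
 assumes "metric_on S G" "x : S"
 shows "(G x u v)\<^sup>2 <= G x u u * G x v v"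
proof (cases "v = 0")
 case True
 thus ?thesis by (simp add: bilinear_rzero[OF metric_onD(2)[OF assms]])
next
 case False
 note b = metric_onD(2)[OF assms]
 have v: "0 < G x v v" by (rule metric_onD(4)[OF assms False])
 define c where "c = G x u v / G x v v"
 have "0 <= G x (u - c *R v) (u - c *R v)"
  using metric_onD(4)[OF assms, of "u - c *R v"] bilinear_lzero[OF b] by (cases "u - c *R v = 0") auto
 also have "... = G x u u - (G x u v)\<^sup>2 / G x v v"
  using v metric_onD(3)[OF assms, of v u]
  by (simp add: bilinear_lsub[OF b] bilinear_rsub[OF b] bilinear_lmul[OF b] bilinear_rmul[OF b] c_def field_simps power2_eq_square)
 finally show ?thesis using v by (simp add: field_simps)
qed

text \<open>Replacing \<open>u\<close> by its component \<open>u'\<close> orthogonal to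
  \<open>v\<close> changes neither numerator nor denominator, by the skew symmetries of the
  curvature tensor. The denominator becomes \<open>G x u' u' * G x v v\<close>, which the Euclidean
  comparison bounds below; this keeps the quotient under control for nearly dependent
  vectors.\<close>

lemma sectional_curvature_bound:
 assumes G: "metric_on S G" and x: "x : S" and a: "0 < a" "!!u. a * (norm u)\<^sup>2 <= G x u u"
  and b: "!!u. G x u u <= b * (norm u)\<^sup>2" and K: "0 <= K"
  and Ga: "!!u v. norm (christoffel G x u v) <= K * norm u * norm v"
  and dGa: "!!h u v. norm (dfield (christoffel G) x h u v) <= K * norm h * norm u * norm v"
 shows "sectional_curvature G x u v <= b * (2 * K + 2 * K\<^sup>2) / a\<^sup>2"
proof -
 note bl = metric_onD(2)[OF G x] and sy = metric_onD(3)[OF G x]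
 note bG = bilinear_christoffel[OF G x]
 let ?R = "riemann_tensor G x"
 have pos: "0 <= G x u u" for u using a(1) order_trans[OF _ a(2)[of u]] by simp
 obtain e :: 'a where e: "e : Basis" using nonempty_Basis by blast
 have b0: "0 < b" using a(1) order_trans[OF a(2)[of e] b[of e]] e by simp
 have bd: "norm (?R u v w) <= (2 * K + 2 * K\<^sup>2) * norm u * norm v * norm w" for u v w
 proof -
  have 1: "norm (christoffel G x u (christoffel G x v w)) <= K\<^sup>2 * norm u * norm v * norm w" for u v w
  proof -
   have "norm (christoffel G x u (christoffel G x v w)) <= K * norm u * norm (christoffel G x v w)" by (rule Ga)
   also have "... <= K * norm u * (K * norm v * norm w)" using K by (intro mult_left_mono Ga) auto
   finally show ?thesis by (simp add: power2_eq_square mult_ac)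
  qed
  have "norm (?R u v w) <= norm (dfield (christoffel G) x u v w) + norm (dfield (christoffel G) x v u w)
   + norm (christoffel G x u (christoffel G x v w)) + norm (christoffel G x v (christoffel G x u w))"
   unfolding riemann_tensor_def by (intro norm_triangle_le_diff norm_triangle_le add_mono order_refl)
  also have "... <= K * norm u * norm v * norm w + K * norm v * norm u * norm w + K\<^sup>2 * norm u * norm v * norm w + K\<^sup>2 * norm v * norm u * norm w"
   by (intro add_mono dGa 1)
  finally show ?thesis by (simp add: algebra_simps)
 qed
 have Rl: "?R (u - c *R v) v w = ?R u v w" for c w
 proof -
  have l: "linear (%h. dfield (christoffel G) x h v w)" by (rule smooth_FD_linear[OF smooth_christoffel[OF G] x])
  have b': "bilinear (%u w. dfield (christoffel G) x v u w)"
   by (rule bilinear_frechet_derivative[OF bilinear_christoffel[OF G] smooth_christoffel[OF G] x])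
  show ?thesis
   unfolding riemann_tensor_def by (simp add: linear_diff[OF l] linear_cmul[OF l] bilinear_lsub[OF b'] bilinear_lmul[OF b'] bilinear_lsub[OF bG]
     bilinear_rsub[OF bG] bilinear_lmul[OF bG] bilinear_rmul[OF bG] algebra_simps)
 qed
 have C0: "0 <= b * (2 * K + 2 * K\<^sup>2) / a\<^sup>2" using b0 K by simp
 define den where "den = G x u u * G x v v - (G x u v)\<^sup>2"
 have den: "0 <= den" using metric_cauchy_schwarz[OF G x, of u v] by (simp add: den_def)
 show ?thesis
 proof (cases "den = 0")
  case True
  \<comment> \<open>Division by zero makes the curvature 0 here.\<close>
  thus ?thesis using C0 by (simp add: sectional_curvature_def den_def)
 next
  case False
  hence v: "v ~= 0" using bilinear_rzero[OF bl] by (auto simp: den_def)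
  have gv: "0 < G x v v" by (rule metric_onD(4)[OF G x v])
  define c where "c = G x u v / G x v v"
  define u' where "u' = u - c *R v"
  have den': "den = G x u' u' * G x v v"
   using gv sy[of v u]
   by (simp add: den_def u'_def bilinear_lsub[OF bl] bilinear_rsub[OF bl] bilinear_lmul[OF bl] bilinear_rmul[OF bl] c_def field_simps power2_eq_square)
  have "G x (?R u v v) u = G x (?R u' v v) (u' + c *R v)" unfolding u'_def Rl by simp
  also have "... = G x (?R u' v v) u'" by (simp add: bilinear_radd[OF bl] bilinear_rmul[OF bl] riemann_tensor_skew[OF G x])
  also have "... <= b * (2 * K + 2 * K\<^sup>2) * (norm u')\<^sup>2 * (norm v)\<^sup>2"
  proof -
   have cs: "\<bar>G x p q\<bar> <= b * norm p * norm q" for p q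
   proof (rule power2_le_imp_le)
    have "\<bar>G x p q\<bar>\<^sup>2 <= G x p p * G x q q" using metric_cauchy_schwarz[OF G x] by simp
    also have "... <= (b * (norm p)\<^sup>2) * (b * (norm q)\<^sup>2)" using b0 by (intro mult_mono b pos) auto
    finally show "\<bar>G x p q\<bar>\<^sup>2 <= (b * norm p * norm q)\<^sup>2" by (simp add: power2_eq_square mult_ac)
   qed (use b0 in simp)
   have "G x (?R u' v v) u' <= b * norm (?R u' v v) * norm u'" using cs[of "?R u' v v" u'] by simp
   also have "... <= b * ((2 * K + 2 * K\<^sup>2) * norm u' * norm v * norm v) * norm u'"
    using b0 by (intro mult_right_mono mult_left_mono bd) auto
   finally show ?thesis by (simp add: power2_eq_square mult_ac)
  qed
  also have "... = b * (2 * K + 2 * K\<^sup>2) / a\<^sup>2 * ((a * (norm u')\<^sup>2) * (a * (norm v)\<^sup>2))"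
   using a(1) by (simp add: field_simps power2_eq_square)
  also have "... <= b * (2 * K + 2 * K\<^sup>2) / a\<^sup>2 * den"
   unfolding den' using C0 a by (intro mult_left_mono mult_mono a(2) pos) auto
  finally show ?thesis
   using den False by (simp add: sectional_curvature_def den_def[symmetric] divide_le_eq)
 qed
qed

text \<open>Applied with \<open>ps\<close> a change of charts, so that the geodesic equation and the
  curvature bound need to be checked in one chart around each point only.\<close>

locale local_isometry =
 fixes S1 :: "'e::euclidean_space set" and S2 G1 G2 ps
 assumes G1: "metric_on S1 G1" and G2: "metric_on S2 G2"
  and ps: "smooth_on S1 ps" "ps ` S1 <= S2"
  and surj: "!!x. x : S1 ==> surj (FD ps x)"
  and iso: "!!x u v. x : S1 ==> G1 x u v = G2 (ps x) (FD ps x u) (FD ps x v)"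
begin

abbreviation "Lm x == FD ps x"
abbreviation "HH x u v == FD (%x. Lm x v) x u"

lemma dps: "x : S1 ==> (ps has_derivative Lm x) (at x)" by (rule smooth_has_derivative[OF ps(1)])

lemma linLm: "x : S1 ==> linear (Lm x)" by (rule has_derivative_linear[OF dps])

lemma dLm: "x : S1 ==> ((%x. Lm x v) has_derivative (%h. HH x h v)) (at x)" by (rule smooth_has_derivative[OF smooth_deriv[OF ps(1)]])

lemma inS2: "x : S1 ==> ps x : S2" using ps(2) by blast

text \<open>Both sides are paired with the vectors \<open>Lm x z\<close>, which exhaust the space.
  Differentiating the isometry relation produces second derivatives of \<open>ps\<close>; by their
  symmetry all of these cancel except the one paired with \<open>Lm x z\<close>.\<close>

lemma christoffel_transform:
 assumes x: "x : S1"
 shows "Lm x (christoffel G1 x u v) = christoffel G2 (ps x) (Lm x u) (Lm x v) + HH x u v"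
proof -
 note bl = metric_onD(2)[OF G2 inS2[OF x]] and sy = metric_onD(3)[OF G2 inS2[OF x]]
 have dG: "dfield G1 x h v z = dfield G2 (ps x) (Lm x h) (Lm x v) (Lm x z)
   + G2 (ps x) (HH x h v) (Lm x z) + G2 (ps x) (Lm x v) (HH x h z)" for h v z
 proof -
  have "FD (%y. G1 y v z) x = FD (%y. G2 (ps y) (Lm y v) (Lm y z)) x" by (rule frechet_derivative_cong_open[OF metric_onD(1)[OF G1] x]) (rule iso)
  also have "... = (%h. dfield G2 (ps x) (Lm x h) (Lm x v) (Lm x z)
   + G2 (ps x) (HH x h v) (Lm x z) + G2 (ps x) (Lm x v) (HH x h z))" by (rule has_derivative_frechet)
    (rule has_derivative_bilinear_field[OF metric_onD(2,5)[OF G2] inS2[OF x] dps[OF x] dLm[OF x] dLm[OF x]])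
  finally show ?thesis by simp
 qed
 have HHs: "HH x u v = HH x v u" for u v by (rule second_derivative_symmetric[OF ps(1) x])
 show ?thesis
 proof (rule metric_on_ext[OF G2 inS2[OF x]])
  fix z'
  obtain z where z: "z' = Lm x z" using surj[OF x] by blast
  have "G2 (ps x) (Lm x (christoffel G1 x u v)) z' = christoffel1 G1 x u v z"
   unfolding z iso[OF x, symmetric] by (rule christoffel_works[OF G1 x])
  also have "... = christoffel1 G2 (ps x) (Lm x u) (Lm x v) (Lm x z) + G2 (ps x) (HH x u v) (Lm x z)"
   unfolding christoffel1_def dG
   using HHs[of u v] HHs[of u z] HHs[of v z] sy[of "Lm x u" "HH x v z"] sy[of "Lm x v" "HH x u z"] by (simp add: field_simps)
  finally show "G2 (ps x) (Lm x (christoffel G1 x u v)) z' = G2 (ps x) (christoffel G2 (ps x) (Lm x u) (Lm x v) + HH x u v) z'"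
   by (simp add: z bilinear_ladd[OF bl] christoffel_works[OF G2 inS2[OF x]])
 qed
qed

text \<open>Differentiate the transformation law of the Christoffel symbols. The third derivatives
  of \<open>ps\<close> are symmetric in \<open>u\<close> and \<open>v\<close>, and the terms with
  second derivatives cancel in the antisymmetrisation.\<close>

lemma riemann_transform:
 assumes x: "x : S1"
 shows "Lm x (riemann_tensor G1 x u v w) = riemann_tensor G2 (ps x) (Lm x u) (Lm x v) (Lm x w)"
proof -
 let ?A = "christoffel G1" and ?B = "christoffel G2"
 note bA = bilinear_christoffel[OF G1 x] and bB = bilinear_christoffel[OF G2 inS2[OF x]]
 note op = metric_onD(1)[OF G1] and la = linLm[OF x]
 have bHH: "linear (HH x h)" for h
 proof -
  have "linear (HH x h)" if "!!v w. HH x h (v + w) = HH x h v + HH x h w" "!!c v. HH x h (c *R v) = c *R HH x h v"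
   using that by (rule linearI)
  moreover have "HH x h v = HH x v h" for v by (rule second_derivative_symmetric[OF ps(1) x])
  moreover have "linear (%v. HH x v h)" by (rule has_derivative_linear[OF dLm[OF x]])
  ultimately show ?thesis by (simp add: linear_add linear_cmul)
 qed
 have e: "HH x u (?A x v w) + Lm x (dfield ?A x u v w) = dfield ?B (ps x) (Lm x u) (Lm x v) (Lm x w)
  + ?B (ps x) (HH x u v) (Lm x w) + ?B (ps x) (Lm x v) (HH x u w) + FD (%x. HH x v w) x u" for u v w
 proof -
  have "((%x. Lm x (?A x v w)) has_derivative (%h. HH x h (?A x v w) + Lm x (dfield ?A x h v w))) (at x)"
  proof -
   have "((%y. (%y a c. c *R Lm y a) y (?A y v w) (1::real)) has_derivative (%h. FD (%y. 1 *R Lm y (?A x v w)) x h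
     + 1 *R Lm x (dfield ?A x h v w) + 0 *R Lm x (?A x v w))) (at x)"
   proof (rule has_derivative_bilinear_field[where T = "%y a c. c *R Lm y a" and ps = "%x. x", OF _ _ x has_derivative_ident
      smooth_has_derivative[OF smooth_christoffel[OF G1] x] has_derivative_const])
    show "bilinear (%a c::real. c *R Lm y a)" if "y : S1" for y
     using linLm[OF that] unfolding bilinear_def by (auto simp: linear_iff algebra_simps)
    show "smooth_on S1 (%y. v *R Lm y u)" for u and v :: real by (intro smooth_scaleR smooth_const op smooth_deriv ps)
   qed
   thus ?thesis by simp
  qed
  hence "((%x. ?B (ps x) (Lm x v) (Lm x w) + HH x v w) has_derivative (%h. HH x h (?A x v w) + Lm x (dfield ?A x h v w))) (at x)"
   by (rule has_derivative_transform_within_open[OF _ op x]) (rule christoffel_transform)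
  moreover have "((%x. ?B (ps x) (Lm x v) (Lm x w) + HH x v w) has_derivative
   (%h. (dfield ?B (ps x) (Lm x h) (Lm x v) (Lm x w) + ?B (ps x) (HH x h v) (Lm x w) + ?B (ps x) (Lm x v) (HH x h w))
    + FD (%x. HH x v w) x h)) (at x)" by (intro has_derivative_add smooth_has_derivative[OF smooth_deriv[OF smooth_deriv[OF ps(1)]] x]
    has_derivative_bilinear_field[OF bilinear_christoffel[OF G2] smooth_christoffel[OF G2] inS2[OF x] dps[OF x] dLm[OF x] dLm[OF x]])
  ultimately show ?thesis by (metis (no_types, lifting) has_derivative_unique)
 qed
 have d3: "FD (%x. HH x v w) x u = FD (%x. HH x u w) x v" by (rule second_derivative_symmetric[OF smooth_deriv[OF ps(1)] x])
 have HHs: "HH x u v = HH x v u" by (rule second_derivative_symmetric[OF ps(1) x])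
 have D: "Lm x (dfield ?A x u v w) = dfield ?B (ps x) (Lm x u) (Lm x v) (Lm x w)
  + ?B (ps x) (HH x u v) (Lm x w) + ?B (ps x) (Lm x v) (HH x u w) + FD (%x. HH x v w) x u - HH x u (?A x v w)" for u v w
  using e[where u=u and v=v and w=w] by (simp add: algebra_simps)
 have GG: "Lm x (?A x u (?A x v w)) = ?B (ps x) (Lm x u) (?B (ps x) (Lm x v) (Lm x w)) + ?B (ps x) (Lm x u) (HH x v w) + HH x u (?A x v w)" for u v w
  by (simp add: christoffel_transform[OF x] bilinear_radd[OF bB])
 show ?thesis
  unfolding riemann_tensor_def linear_add[OF la] linear_diff[OF la] D GG
  using d3 HHs by (simp add: algebra_simps)
qed

lemma sectional_curvature_transform:
 assumes x: "x : S1"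
 shows "sectional_curvature G1 x u v = sectional_curvature G2 (ps x) (Lm x u) (Lm x v)"
 by (simp add: sectional_curvature_def iso[OF x] riemann_transform[OF x])

end

section \<open>The exponential map in coordinates\<close>

lemma frechet_bound_basis:
 assumes "linear D" shows "norm (D w) <= (SUM b:Basis. norm (D b)) * norm w"
proof -
 have "norm (D w) <= (SUM b:Basis. norm ((w \<bullet> b) *R D b))"
  unfolding linear_basis_expand[OF assms, of w] by (rule norm_sum)
 also have "... <= (SUM b:Basis. norm w * norm (D b))" by (intro sum_mono) (simp add: Basis_le_norm mult_right_mono)
 finally show ?thesis by (simp add: sum_distrib_left mult.commute)
qed

lemma smooth_locally_lipschitz:
 fixes F :: "'a::euclidean_space => 'b::real_normed_vector"
 assumes F: "smooth_on S F" and p: "p : S"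
 obtains r L where "0 < r" "ball p r <= S"
  "!!x y. x : ball p r ==> y : ball p r ==> norm (F x - F y) <= L * norm (x - y)"
proof -
 define B where "B x = (SUM b:Basis. norm (FD F x b))" for x
 have op: "open S" by (rule smooth_open[OF F])
 have cB: "continuous_on S B"
  unfolding B_def by (intro continuous_intros smooth_cont smooth_deriv F)
 have "open {x : S. B x < B p + 1}"
  using continuous_open_preimage[OF cB op, of "{..<B p + 1}"] by (simp add: vimage_def Int_def)
 moreover have "p : {x : S. B x < B p + 1}" using p by simp
 ultimately obtain r where r: "0 < r" "ball p r <= {x : S. B x < B p + 1}"
  using open_contains_ball by blast
 have "norm (F x - F y) <= (B p + 1) * norm (x - y)" if "x : ball p r" "y : ball p r" for x y
 proof (rule differentiable_bound[OF convex_ball _ _ that])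
  fix z assume z: "z : ball p r"
  hence zS: "z : S" "B z < B p + 1" using r(2) by auto
  have d: "(F has_derivative FD F z) (at z)" by (rule smooth_has_derivative[OF F zS(1)])
  thus "(F has_derivative FD F z) (at z within ball p r)" by (rule has_derivative_at_withinI)
  have lin: "linear (FD F z)" by (rule has_derivative_linear[OF d])
  show "onorm (FD F z) <= B p + 1"
  proof (rule onorm_bound)
   show "0 <= B p + 1" using zS(2) by (simp add: B_def sum_nonneg add_nonneg_nonneg)
   show "norm (FD F z w) <= (B p + 1) * norm w" for w
    using frechet_bound_basis[OF lin, of w] zS(2) mult_right_mono[of "B z" "B p + 1" "norm w"] by (simp add: B_def)
  qed
 qed
 thus ?thesis using r by (intro that[of r "B p + 1"]) auto
qed

lemma ode_unique:
 fixes F :: "'d::euclidean_space => 'd"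
 assumes F: "smooth_on Om F" and J: "open J" "is_interval J" "t0 : J" "t : J"
  and z1: "!!t. t : J ==> z1 t : Om" "!!t. t : J ==> (z1 has_vector_derivative F (z1 t)) (at t)"
  and z2: "!!t. t : J ==> z2 t : Om" "!!t. t : J ==> (z2 has_vector_derivative F (z2 t)) (at t)"
  and init: "z1 t0 = z2 t0"
 shows "z1 t = z2 t"
proof -
 define A where "A = {t : J. z1 t - z2 t = 0}"
 have c: "continuous_on J z1" "continuous_on J z2"
  by (rule continuous_at_imp_continuous_on, rule ballI, rule has_vector_derivative_continuous, erule z1(2) z2(2))+
 have cl: "closedin (top_of_set J) A"
  unfolding A_def by (rule continuous_closedin_preimage_constant) (intro continuous_intros c)
 have "open A"
  unfolding open_contains_ball
 proof
  fix s assume s: "s : A"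
  hence sJ: "s : J" "z1 s = z2 s" by (auto simp: A_def)
  obtain r L where rL: "0 < r" "ball (z1 s) r <= Om"
   "!!x y. x : ball (z1 s) r ==> y : ball (z1 s) r ==> norm (F x - F y) <= L * norm (x - y)"
   using smooth_locally_lipschitz[OF F z1(1)[OF sJ(1)]] by metis
  have "open {t : J. z1 t : ball (z1 s) r}" "open {t : J. z2 t : ball (z1 s) r}"
   using continuous_open_preimage[OF c(1) J(1), of "ball (z1 s) r"]
    continuous_open_preimage[OF c(2) J(1), of "ball (z1 s) r"] by (auto simp: vimage_def Int_def)
  hence "open ({t : J. z1 t : ball (z1 s) r} Int {t : J. z2 t : ball (z1 s) r})" by (rule open_Int)
  moreover have "s : {t : J. z1 t : ball (z1 s) r} Int {t : J. z2 t : ball (z1 s) r}"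
   using sJ rL(1) by simp
  ultimately obtain e where e: "0 < e" "ball s e <= {t : J. z1 t : ball (z1 s) r} Int {t : J. z2 t : ball (z1 s) r}"
   using open_contains_ball by blast
  have "z1 t - z2 t = 0" if t: "t : ball s e" for t
  proof (rule gronwall_zero[of "ball s e" s t "%t. z1 t - z2 t" "%t. F (z1 t) - F (z2 t)" L])
   show "is_interval (ball s e)" by (simp add: ball_eq_greaterThanLessThan is_interval_oo)
   fix t assume "t : ball s e"
   hence t: "t : J" "z1 t : ball (z1 s) r" "z2 t : ball (z1 s) r" using e(2) by auto
   show "((%t. z1 t - z2 t) has_vector_derivative F (z1 t) - F (z2 t)) (at t)" by (intro has_vector_derivative_diff z1 z2 t)
   show "norm (F (z1 t) - F (z2 t)) <= L * norm (z1 t - z2 t)" by (rule rL(3)[OF t(2,3)])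
  qed (use t e sJ in auto)
  thus "EX e>0. ball s e <= A" using e by (intro exI[of _ e]) (auto simp: A_def)
 qed
 hence "openin (top_of_set J) A" using openin_open_eq[OF J(1)] by (auto simp: A_def)
 moreover have "A ~= {}" using init J(3) by (auto simp: A_def)
 moreover have "connected J" using J(2) by (simp add: is_interval_connected_1)
 ultimately have "A = J" using cl connected_clopen by blast
 thus ?thesis using J(4) by (auto simp: A_def)
qed

lemma compact_support_lipschitz:
 fixes F :: "'a::euclidean_space => 'b::real_normed_vector"
 assumes F: "smooth_on UNIV F" and 0: "!!x. x ~: ball 0 R ==> F x = 0"
 obtains C where "1 <= C" "!!x y. norm (F x - F y) <= C * norm (x - y)"
proof -
 define B where "B x = (SUM b:Basis. norm (FD F x b))" for x
 have cB: "continuous_on (cball 0 R) B"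
  unfolding B_def by (intro continuous_intros continuous_on_subset[OF smooth_cont[OF smooth_deriv[OF F]] subset_UNIV])
 obtain C where C: "!!x. x : cball 0 R ==> norm (B x) <= C"
  using compact_imp_bounded[OF compact_continuous_image[OF cB compact_cball]] unfolding bounded_iff by blast
 have d: "(F has_derivative FD F z) (at z)" for z by (rule smooth_has_derivative[OF F]) simp
 have C': "B x <= max 1 C" for x
 proof (cases "x : cball 0 R")
  case True thus ?thesis using C[of x] by simp
 next
  case False
  have "FD F x = FD (%x. 0) x" by (rule frechet_derivative_cong_open[of "- cball 0 R"]) (use False 0 in auto)
  thus ?thesis by (simp add: B_def)
 qed
 have "norm (F x - F y) <= max 1 C * norm (x - y)" for x y
 proof (rule differentiable_bound[OF convex_UNIV])
  fix z
  show "(F has_derivative FD F z) (at z within UNIV)" using d by simp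
  have lin: "linear (FD F z)" by (rule has_derivative_linear[OF d])
  show "onorm (FD F z) <= max 1 C"
  proof (rule onorm_bound)
   show "norm (FD F z w) <= max 1 C * norm w" for w
    using frechet_bound_basis[OF lin, of w] C'[of z] mult_right_mono[of "B z" "max 1 C" "norm w"] by (simp add: B_def)
  qed simp
 qed auto
 thus ?thesis by (intro that[of "max 1 C"]) auto
qed

text \<open>Composition with \<open>ka\<close> turns data on a ball of radius 4 into global data,
  because its values stay within radius 3; curves that remain within radius 2 do not notice the
  truncation.\<close>

lemma truncation_exists:
 obtains ka :: "'e::euclidean_space => 'e" and C :: real where "smooth_on UNIV ka" "1 <= C"
  "!!x y. norm (ka x - ka y) <= C * norm (x - y)" "!!x. norm x <= 2 ==> ka x = x" "!!x. norm (ka x) <= 3"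
proof -
 obtain be :: "'e => real" where be: "smooth_on UNIV be" "!!x. 0 <= be x" "!!x. be x <= 1"
  "!!x. x : cball 0 2 ==> be x = 1" "!!x. x ~: ball 0 3 ==> be x = 0"
  using bump_exists[of 2 3 "0 :: 'e"] by auto
 have s: "smooth_on UNIV (%x. be x *R x)" by (intro smooth_scaleR be smooth_ident) simp
 obtain C where C: "1 <= C" "!!x y. norm (be x *R x - be y *R y) <= C * norm (x - y)"
  using compact_support_lipschitz[OF s, of 3] be(5) by (metis scaleR_zero_left)
 have "norm (be x *R x) <= 3" for x
 proof (cases "x : ball 0 3")
  case True
  hence "be x * norm x <= 1 * 3" using be by (intro mult_mono) auto
  thus ?thesis using be(2) by simp
 qed (use be(5) in simp)
 thus ?thesis using s C be(4) by (intro that[of "%x. be x *R x" C]) auto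
qed

text \<open>The situation normalised to unit scale: on a ball of radius 4 the Christoffel operators
  and their Lipschitz constants are at most \<open>et\<close>. The factor 1000 is a generous margin
  for the estimates that follow.\<close>

context
 fixes ka :: "'e::euclidean_space => 'e" and C :: real and Ga :: "'e => 'e => 'e => 'e" and et :: real
 assumes ka: "smooth_on UNIV ka" "1 <= C"
  "!!x y. norm (ka x - ka y) <= C * norm (x - y)" "!!x. norm x <= 2 ==> ka x = x" "!!x. norm (ka x) <= 3"
  and et: "0 <= et" "et * (1000 * C\<^sup>2) <= 1"
  and Ga: "!!x. x : ball 0 4 ==> bilinear (Ga x)" "!!u v. smooth_on (ball 0 4) (%x. Ga x u v)"
   "!!x u v. x : ball 0 4 ==> norm (Ga x u v) <= et * norm u * norm v"
   "!!x y u v. x : ball 0 4 ==> y : ball 0 4 ==> norm (Ga x u v - Ga y u v) <= et * norm (x - y) * norm u * norm v"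
begin

lemma et_small: "1000 * et <= 1" "1000 * et * C <= 1"
proof -
 have c: "1 <= C\<^sup>2" "C <= C\<^sup>2" using ka(2) mult_mono[of 1 C 1 C] by (auto simp: power2_eq_square)
 have "1000 * et * 1 <= 1000 * et * C\<^sup>2" "1000 * et * C <= 1000 * et * C\<^sup>2"
  using c et(1) by (intro mult_left_mono; simp)+
 thus "1000 * et <= 1" "1000 * et * C <= 1" using et(2) by (simp_all add: mult_ac)
qed

lemma ka_ball: "ka x : ball 0 4" using ka(5)[of x] by simp

lemma Ga_difference:
 assumes "x : ball 0 4" "y : ball 0 4" "norm u <= m" "norm v <= m"
 shows "norm (Ga x u u - Ga y v v) <= et * m * m * norm (x - y) + 2 * et * m * norm (u - v)"
proof -
 have m: "0 <= m" using assms(3) norm_ge_zero order_trans by blast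
 have "Ga x u u - Ga y v v = (Ga x u u - Ga y u u) + Ga y (u - v) u + Ga y v (u - v)"
  by (simp add: bilinear_lsub[OF Ga(1)[OF assms(2)]] bilinear_rsub[OF Ga(1)[OF assms(2)]])
 also have "norm ... <= et * norm (x - y) * norm u * norm u + et * norm (u - v) * norm u + et * norm v * norm (u - v)"
  by (intro norm_triangle_le add_mono Ga assms)
 also have "... <= et * norm (x - y) * m * m + et * norm (u - v) * m + et * m * norm (u - v)"
  using et(1) m assms(3,4) by (intro add_mono mult_mono mult_nonneg_nonneg) auto
 finally show ?thesis by (simp add: algebra_simps)
qed

text \<open>In the variables \<open>(x, w)\<close> with \<open>w = 8 C x'\<close> the truncated geodesic equation has a small
 Lipschitz constant, so that a single contraction covers the time interval.\<close>

definition gfield :: "'e \<times> 'e => 'e \<times> 'e" where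
 "gfield z = (ka (snd z /\<^sub>R (8 * C)), - (8 * C) *R Ga (ka (fst z)) (ka (snd z /\<^sub>R (8 * C))) (ka (snd z /\<^sub>R (8 * C))))"

lemma smooth_gfield: "smooth_on UNIV gfield"
proof -
 have i: "smooth_on UNIV (%z::'e \<times> 'e. z)" by (simp add: smooth_ident)
 have 1: "smooth_on UNIV (%z::'e \<times> 'e. ka (snd z /\<^sub>R (8 * C)))"
  by (rule smooth_comp[OF ka(1)]) (auto intro!: smooth_scaleR smooth_const smooth_snd[OF i])
 have 2: "smooth_on UNIV (%z::'e \<times> 'e. ka (fst z))" by (rule smooth_comp[OF ka(1) smooth_fst[OF i]]) auto
 have 3: "smooth_on UNIV (%z::'e \<times> 'e. Ga (ka (fst z)) (ka (snd z /\<^sub>R (8 * C))) (ka (snd z /\<^sub>R (8 * C))))"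
 proof (rule smooth_bilinear_apply[where L = "%z. Ga (ka (fst z))", OF _ _ 1 1])
  show "smooth_on UNIV (%z::'e \<times> 'e. Ga (ka (fst z)) v w)" for v w by (rule smooth_comp[OF Ga(2) 2]) (use ka_ball in blast)
 qed (rule Ga(1)[OF ka_ball])
 show ?thesis
  unfolding gfield_def by (intro smooth_Pair 1 smooth_scaleR smooth_const 3) auto
qed

text \<open>The constant 1/4 lets \<open>flow_exists\<close> cover all times up to 2 at once. The
  scaling of the velocity by \<open>8 * C\<close> gives the first component the constant 1/8; the
  second is small because \<open>et * C\<^sup>2\<close> is.\<close>

lemma lipschitz_gfield: "norm (gfield z - gfield z') <= 1/4 * norm (z - z')"
proof -
 obtain x w x' w' where z: "z = (x, w)" "z' = (x', w')" by fastforce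
 have C0: "0 < C" using ka(2) by simp
 let ?v = "ka (w /\<^sub>R (8 * C))" and ?v' = "ka (w' /\<^sub>R (8 * C))"
 have v: "norm (?v - ?v') <= norm (w - w') / 8"
 proof -
  have "norm (?v - ?v') <= C * norm (w /\<^sub>R (8 * C) - w' /\<^sub>R (8 * C))" by (rule ka(3))
  also have "w /\<^sub>R (8 * C) - w' /\<^sub>R (8 * C) = (w - w') /\<^sub>R (8 * C)" by (simp add: scaleR_diff_right)
  also have "C * norm ... = norm (w - w') / 8" unfolding norm_scaleR using C0 by (simp add: field_simps)
  finally show ?thesis .
 qed
 have "norm (Ga (ka x) ?v ?v - Ga (ka x') ?v' ?v') <= et * 3 * 3 * norm (ka x - ka x') + 2 * et * 3 * norm (?v - ?v')"
  by (rule Ga_difference[OF ka_ball ka_ball ka(5) ka(5)])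
 also have "... <= et * 3 * 3 * (C * norm (x - x')) + 2 * et * 3 * (norm (w - w') / 8)"
  using et(1) by (intro add_mono mult_left_mono ka(3) v) auto
 finally have "8 * C * norm (Ga (ka x) ?v ?v - Ga (ka x') ?v' ?v') <= 8 * C * (et * 3 * 3 * (C * norm (x - x')) + 2 * et * 3 * (norm (w - w') / 8))"
  using C0 by (intro mult_left_mono) auto
 also have "... = (72 * (et * C\<^sup>2)) * norm (x - x') + (6 * (et * C)) * norm (w - w')" by (simp add: power2_eq_square algebra_simps)
 also have "... <= (1/10) * norm (x - x') + (1/100) * norm (w - w')"
 proof -
  have "72 * (et * C\<^sup>2) <= 1/10" using et(2) by (simp add: mult_ac)
  moreover have "6 * (et * C) <= 1/100" using et_small(2) by (simp add: mult_ac)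
  ultimately show ?thesis by (intro add_mono mult_right_mono) auto
 qed
 finally have 2: "norm ((8 * C) *R (Ga (ka x) ?v ?v - Ga (ka x') ?v' ?v')) <= (1/10) * norm (x - x') + (1/100) * norm (w - w')"
  using C0 by simp
 have "norm (gfield z - gfield z') <= norm (fst (gfield z - gfield z')) + norm (snd (gfield z - gfield z'))" by (metis norm_Pair_le prod.collapse)
 also have "... = norm (?v - ?v') + norm ((8 * C) *R (Ga (ka x) ?v ?v - Ga (ka x') ?v' ?v'))"
  unfolding z gfield_def by (simp add: scaleR_diff_right norm_minus_commute)
 also have "... <= norm (w - w') / 8 + ((1/10) * norm (x - x') + (1/100) * norm (w - w'))" by (intro add_mono v 2)
 also have "... <= 1/4 * norm (z - z')"
 proof -
  have "norm (x - x') <= norm (z - z')" "norm (w - w') <= norm (z - z')"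
   using norm_fst_le[of "x - x'" "w - w'"] norm_snd_le[of "w - w'" "x - x'"] by (auto simp: z)
  thus ?thesis using norm_ge_zero[of "z - z'"] by linarith
 qed
 finally show ?thesis .
qed

text \<open>Initial speed below 1 and small acceleration keep the speed below 5/4 and the position
  within radius 2 up to time 3/2. There the truncation is the identity, so the truncated flow
  consists of true solutions. The time map at 1, an interior time, is the identity up to a map of
  Lipschitz constant 1/2.\<close>

lemma unit_exponential:
 obtains xx nv :: "'e => real => 'e" where
  "smooth_on (ball 0 1 \<times> {-3/2<..<3/2}) (%q. xx (fst q) (snd q))"
  "!!a. xx a 0 = 0" "!!a. nv a 0 = a"
  "!!a t. a : ball 0 1 ==> t : {-3/2<..<3/2} ==> (xx a has_vector_derivative nv a t) (at t)"
  "!!a t. a : ball 0 1 ==> t : {-3/2<..<3/2} ==> (nv a has_vector_derivative - Ga (xx a t) (nv a t) (nv a t)) (at t)"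
  "!!a t. a : ball 0 1 ==> t : {-3/2<..<3/2} ==> norm (xx a t) <= 2"
  "!!a b. a : ball 0 1 ==> b : ball 0 1 ==> norm ((xx a 1 - xx b 1) - (a - b)) <= 1/2 * norm (a - b)"
proof -
 obtain fi where fi: "smooth_on (UNIV \<times> {-2<..<2}) (%q. fi (fst q) (snd q))" "!!z. fi z 0 = z"
  "!!z t. \<bar>t\<bar> < 2 ==> (fi z has_vector_derivative gfield (fi z t)) (at t)"
  using flow_exists[OF smooth_gfield lipschitz_gfield, of 2] by auto
 have C0: "0 < C" using ka(2) by simp
 define I where "I = {-3/2<..<3/2::real}"
 have I: "convex I" "0 : I" "1 : I" by (auto simp: I_def)
 define xx where "xx a t = fst (fi (0, (8 * C) *R a) t)" for a t
 define nv where "nv a t = snd (fi (0, (8 * C) *R a) t) /\<^sub>R (8 * C)" for a t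
 have xxd: "(xx a has_vector_derivative ka (nv a t)) (at t)"
  and nvd: "(nv a has_vector_derivative - Ga (ka (xx a t)) (ka (nv a t)) (ka (nv a t))) (at t)" if "t : I" for a t
 proof -
  have d: "(fi (0, (8 * C) *R a) has_vector_derivative gfield (fi (0, (8 * C) *R a) t)) (at t)"
   using fi(3) that by (auto simp: I_def)
  show "(xx a has_vector_derivative ka (nv a t)) (at t)"
   using bounded_linear.has_vector_derivative[OF bounded_linear_fst d] by (simp add: xx_def[abs_def] nv_def gfield_def)
  have "((%t. snd (fi (0, (8 * C) *R a) t) /\<^sub>R (8 * C)) has_vector_derivative snd (gfield (fi (0, (8 * C) *R a) t)) /\<^sub>R (8 * C)) (at t)"
   by (intro bounded_linear.has_vector_derivative[OF bounded_linear_scaleR_right]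
     bounded_linear.has_vector_derivative[OF bounded_linear_snd d])
  thus "(nv a has_vector_derivative - Ga (ka (xx a t)) (ka (nv a t)) (ka (nv a t))) (at t)"
   using C0 by (simp add: nv_def[abs_def] xx_def gfield_def)
 qed
 have init: "xx a 0 = 0" "nv a 0 = a" for a using C0 by (auto simp: xx_def nv_def fi(2))
 have nvs: "norm (nv a t) <= 5/4" if a: "a : ball 0 1" and t: "t : I" for a t
 proof -
  have "norm (nv a t - nv a 0) <= (et * 3 * 3) * \<bar>t - 0\<bar>"
  proof (rule vector_mvt_bound[OF I(1) nvd _ I(2) t])
   fix s
   have "norm (Ga (ka (xx a s)) (ka (nv a s)) (ka (nv a s))) <= et * norm (ka (nv a s)) * norm (ka (nv a s))" by (rule Ga(3)[OF ka_ball])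
   also have "... <= et * 3 * 3" using et(1) ka(5) by (intro mult_mono) auto
   finally show "norm (- Ga (ka (xx a s)) (ka (nv a s)) (ka (nv a s))) <= et * 3 * 3" by simp
  qed
  also have "... <= (et * 3 * 3) * 2" using t et(1) by (intro mult_left_mono) (auto simp: I_def)
  also have "... <= 1/4" using et_small(1) by simp
  finally have "norm (nv a t - a) <= 1/4" by (simp add: init)
  moreover have "norm (nv a t) <= norm a + norm (nv a t - a)" by (metis norm_triangle_sub)
  ultimately show ?thesis using a by simp
 qed
 have kanv: "ka (nv a t) = nv a t" if "a : ball 0 1" "t : I" for a t
  using ka(4)[of "nv a t"] nvs[OF that] by simp
 have xxs: "norm (xx a t) <= 2" if a: "a : ball 0 1" and t: "t : I" for a t
 proof -
  have "norm (xx a t - xx a 0) <= 5/4 * \<bar>t - 0\<bar>"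
  proof (rule vector_mvt_bound[OF I(1) xxd _ I(2) t])
   show "norm (ka (nv a s)) <= 5/4" if "s : I" for s unfolding kanv[OF a that] by (rule nvs[OF a that])
  qed
  also have "... <= 5/4 * (3/2)" using t by (intro mult_left_mono) (auto simp: I_def)
  finally show ?thesis by (simp add: init)
 qed
 have kaxx: "ka (xx a t) = xx a t" if "a : ball 0 1" "t : I" for a t
  using ka(4)[of "xx a t"] xxs[OF that] by simp
 have sm: "smooth_on (ball 0 1 \<times> I) (%q. xx (fst q) (snd q))"
 proof -
  have op: "open (ball (0::'e) 1 \<times> I)" by (intro open_Times) (auto simp: I_def)
  have i: "smooth_on (ball (0::'e) 1 \<times> I) (%z. z)" by (rule smooth_ident[OF op])
  have "smooth_on (ball 0 1 \<times> I) (%q. (%q. fi (fst q) (snd q)) ((0, (8 * C) *R fst q), snd q))"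
  proof (rule smooth_comp[OF fi(1)])
   show "smooth_on (ball 0 1 \<times> I) (%q::'e \<times> real. ((0::'e, (8 * C) *R fst q), snd q))"
    by (intro smooth_Pair smooth_const op smooth_scaleR smooth_fst smooth_snd i)
  qed (auto simp: I_def)
  from smooth_fst[OF this] show ?thesis by (simp add: xx_def)
 qed
 \<comment> \<open>The maximum \<open>m\<close> of the velocity difference over the unit interval
   bounds the difference of positions. The velocity difference deviates from \<open>a - b\<close> by
   at most \<open>8 * et * m\<close>, hence by at most \<open>m / 100\<close>, so that
   \<open>m\<close> is absorbed into \<open>2 * norm (a - b)\<close>.\<close>
 have close: "norm ((xx a 1 - xx b 1) - (a - b)) <= 1/2 * norm (a - b)" if a: "a : ball 0 1" and b: "b : ball 0 1" for a b
 proof -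
  have sub: "{0..1} <= I" by (auto simp: I_def)
  have "continuous_on {0..1} (%t. norm (nv a t - nv b t))"
  proof (intro continuous_intros continuous_at_imp_continuous_on ballI)
   show "isCont (nv a) t" "isCont (nv b) t" if "t : {0..1}" for t
    using has_vector_derivative_continuous[OF nvd] sub that by blast+
  qed
  from continuous_attains_sup[OF _ _ this] obtain s where s: "s : {0..1}"
   "!!t. t : {0..1} ==> norm (nv a t - nv b t) <= norm (nv a s - nv b s)" by auto
  define m where "m = norm (nv a s - nv b s)"
  have m: "norm (nv a t - nv b t) <= m" if "t : {0..1}" for t using s(2)[OF that] by (simp add: m_def)
  have m0: "0 <= m" by (simp add: m_def)
  have cv: "convex {0..1::real}" by simp
  have dxx: "norm (xx a t - xx b t) <= m" if t: "t : {0..1}" for t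
  proof -
   have "norm ((xx a t - xx b t) - (xx a 0 - xx b 0)) <= m * \<bar>t - 0\<bar>"
   proof (rule vector_mvt_bound[OF cv _ _ _ t])
    fix r :: real assume r: "r : {0..1}"
    hence rI: "r : I" using sub by blast
    show "((%t. xx a t - xx b t) has_vector_derivative nv a r - nv b r) (at r)"
     using has_vector_derivative_diff[OF xxd[OF rI, of a] xxd[OF rI, of b]] by (simp add: kanv[OF a rI] kanv[OF b rI])
    show "norm (nv a r - nv b r) <= m" by (rule m[OF r])
   qed simp
   also have "... <= m * 1" using t m0 by (intro mult_left_mono) auto
   finally show ?thesis by (simp add: init)
  qed
  have dnv: "norm ((nv a t - nv b t) - (a - b)) <= 8 * et * m" if t: "t : {0..1}" for t
  proof -
   have "norm ((nv a t - nv b t) - (nv a 0 - nv b 0)) <= (8 * et * m) * \<bar>t - 0\<bar>"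
   proof (rule vector_mvt_bound[OF cv _ _ _ t])
    fix r :: real assume r: "r : {0..1}"
    hence rI: "r : I" using sub by blast
    show "((%t. nv a t - nv b t) has_vector_derivative - (Ga (xx a r) (nv a r) (nv a r) - Ga (xx b r) (nv b r) (nv b r))) (at r)"
     using has_vector_derivative_diff[OF nvd[OF rI, of a] nvd[OF rI, of b]]
     by (simp add: kanv[OF a rI] kanv[OF b rI] kaxx[OF a rI] kaxx[OF b rI])
    have "norm (Ga (xx a r) (nv a r) (nv a r) - Ga (xx b r) (nv b r) (nv b r))
      <= et * 2 * 2 * norm (xx a r - xx b r) + 2 * et * 2 * norm (nv a r - nv b r)"
     using xxs[OF a rI] xxs[OF b rI] nvs[OF a rI] nvs[OF b rI] by (intro Ga_difference) auto
    also have "... <= et * 2 * 2 * m + 2 * et * 2 * m"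
     using et(1) by (intro add_mono mult_left_mono dxx[OF r] m[OF r]) auto
    finally show "norm (- (Ga (xx a r) (nv a r) (nv a r) - Ga (xx b r) (nv b r) (nv b r))) <= 8 * et * m"
     unfolding norm_minus_cancel by simp
   qed simp
   also have "... <= (8 * et * m) * 1" using t m0 et(1) by (intro mult_left_mono) auto
   finally show ?thesis by (simp add: init)
  qed
  have e8: "8 * et * m <= m / 100" using mult_right_mono[OF et_small(1) m0] mult_nonneg_nonneg[OF et(1) m0] by simp
  have "m <= norm (a - b) + norm ((nv a s - nv b s) - (a - b))"
   unfolding m_def by (metis norm_triangle_sub)
  hence mab: "m <= 2 * norm (a - b)" using dnv[OF s(1)] e8 m0 norm_ge_zero[of "a - b"] by linarith
  have "norm ((xx a 1 - xx b 1 - 1 *R (a - b)) - (xx a 0 - xx b 0 - 0 *R (a - b))) <= (8 * et * m) * \<bar>1 - 0\<bar>"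
  proof (rule vector_mvt_bound[where f = "%t. xx a t - xx b t - t *R (a - b)", OF cv])
   fix r :: real assume r: "r : {0..1}"
   hence rI: "r : I" using sub by blast
   have "((%t. t *R (a - b)) has_vector_derivative (a - b)) (at r)" by (auto intro!: derivative_eq_intros simp: has_vector_derivative_def)
   from has_vector_derivative_diff[OF has_vector_derivative_diff[OF xxd[OF rI, of a] xxd[OF rI, of b]] this]
   show "((%t. xx a t - xx b t - t *R (a - b)) has_vector_derivative nv a r - nv b r - (a - b)) (at r)" by (simp add: kanv[OF a rI] kanv[OF b rI])
   show "norm (nv a r - nv b r - (a - b)) <= 8 * et * m" by (rule dnv[OF r])
  qed auto
  hence "norm ((xx a 1 - xx b 1) - (a - b)) <= m / 100" using e8 by (simp add: init)
  thus ?thesis using mab norm_ge_zero[of "a - b"] by linarith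
 qed
 show ?thesis
 proof (rule that[of xx nv])
  show "(xx a has_vector_derivative nv a t) (at t)" "(nv a has_vector_derivative - Ga (xx a t) (nv a t) (nv a t)) (at t)"
   if "a : ball 0 1" "t : {-3/2<..<3/2}" for a t
   using xxd[of t a] nvd[of t a] kanv[OF that(1)] kaxx[OF that(1)] that(2) by (simp_all add: I_def)
 qed (use sm init xxs close in "simp_all add: I_def")
qed

end

text \<open>The threshold is attached to the type, that is, to the dimension, because it has to be
  fixed before any metric is constructed.\<close>

definition exp_radius_const :: "'e::euclidean_space itself => real => bool" where
 "exp_radius_const TYPE('e) et \<longleftrightarrow> (ALL (x0::'e) rh K Ga. 0 < rh & rh <= 1 & 0 <= K & rh * K <= et &
   (ALL x:ball x0 (4 * rh). bilinear (Ga x)) & (ALL u v. smooth_on (ball x0 (4 * rh)) (%x. Ga x u v)) &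
   (ALL x:ball x0 (4 * rh). ALL u v. norm (Ga x u v) <= K * norm u * norm v) &
   (ALL x:ball x0 (4 * rh). ALL y:ball x0 (4 * rh). ALL u v.
    norm (Ga x u v - Ga y u v) <= K * norm (x - y) * norm u * norm v) -->
   (EX ga ga' :: 'e => real => 'e.
    (ALL u:ball 0 rh. ga u 0 = x0 & ga' u 0 = u & smooth_on {-3/2<..<3/2} (ga u) &
     (ALL t:{-3/2<..<3/2}. ga u t : ball x0 (4 * rh) & (ga u has_vector_derivative ga' u t) (at t) &
      (ga' u has_vector_derivative - Ga (ga u t) (ga' u t) (ga' u t)) (at t))) &
    smooth_on (ball 0 rh) (%u. ga u 1) & inj_on (%u. ga u 1) (ball 0 rh) &
    (ALL u:ball 0 rh. inj (FD (%u. ga u 1) u))))"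

text \<open>Dilation by \<open>rh\<close> multiplies the Christoffel operators by \<open>rh\<close>
  and their Lipschitz constants by its square; as \<open>rh <= 1\<close>, both are then at most
  \<open>rh * K\<close>, and the estimates on unit scale apply.\<close>

lemma local_exponential:
 obtains et :: real where "0 < et" "exp_radius_const TYPE('e::euclidean_space) et"
proof -
 obtain ka :: "'e => 'e" and C :: real where ka: "smooth_on UNIV ka" "1 <= C"
  "!!x y. norm (ka x - ka y) <= C * norm (x - y)" "!!x. norm x <= 2 ==> ka x = x" "!!x. norm (ka x) <= 3"
  using truncation_exists by metis
 define et where "et = 1 / (1000 * C\<^sup>2)"
 have et: "0 < et" "et * (1000 * C\<^sup>2) <= 1" using ka(2) by (auto simp: et_def)
 show ?thesis
 proof (rule that[OF et(1)], unfold exp_radius_const_def, intro allI impI)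
  fix x0 :: 'e and rh K :: real and Ga :: "'e => 'e => 'e => 'e"
  assume asm: "0 < rh & rh <= 1 & 0 <= K & rh * K <= et &
   (ALL x:ball x0 (4 * rh). bilinear (Ga x)) & (ALL u v. smooth_on (ball x0 (4 * rh)) (%x. Ga x u v)) &
   (ALL x:ball x0 (4 * rh). ALL u v. norm (Ga x u v) <= K * norm u * norm v) &
   (ALL x:ball x0 (4 * rh). ALL y:ball x0 (4 * rh). ALL u v.
    norm (Ga x u v - Ga y u v) <= K * norm (x - y) * norm u * norm v)"
  have rh: "0 < rh" "rh <= 1" and K: "0 <= K" "rh * K <= et"
   and Ga: "!!x. x : ball x0 (4 * rh) ==> bilinear (Ga x)" "!!u v. smooth_on (ball x0 (4 * rh)) (%x. Ga x u v)"
    "!!x u v. x : ball x0 (4 * rh) ==> norm (Ga x u v) <= K * norm u * norm v"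
    "!!x y u v. x : ball x0 (4 * rh) ==> y : ball x0 (4 * rh) ==>
    norm (Ga x u v - Ga y u v) <= K * norm (x - y) * norm u * norm v"
   using asm by blast+
  define Ga1 where "Ga1 xx u v = rh *R Ga (x0 + rh *R xx) u v" for xx u v
  have inb: "x0 + rh *R xx : ball x0 (4 * rh)" if "xx : ball 0 4" for xx
   using that rh by (simp add: dist_norm)
  have 1: "bilinear (Ga1 xx)" if "xx : ball 0 4" for xx
   using Ga(1)[OF inb[OF that]] unfolding bilinear_def linear_iff Ga1_def by (simp add: algebra_simps)
  have 2: "smooth_on (ball 0 4) (%xx. Ga1 xx u v)" for u v
   unfolding Ga1_def by (intro smooth_scaleR smooth_const open_ball smooth_comp[OF Ga(2)])
    (use inb in "auto intro!: smooth_add smooth_scaleR smooth_const smooth_ident simp del: mem_ball")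
  have 3: "norm (Ga1 xx u v) <= et * norm u * norm v" if "xx : ball 0 4" for xx u v
  proof -
   have "norm (Ga1 xx u v) <= rh * (K * norm u * norm v)"
    using Ga(3)[OF inb[OF that]] rh by (simp add: Ga1_def mult_left_mono)
   also have "... = (rh * K) * norm u * norm v" by simp
   also have "... <= et * norm u * norm v" using K(2) by (intro mult_right_mono) auto
   finally show ?thesis .
  qed
  have 4: "norm (Ga1 xx u v - Ga1 ze u v) <= et * norm (xx - ze) * norm u * norm v"
   if "xx : ball 0 4" "ze : ball 0 4" for xx ze u v
  proof -
   have "norm (Ga1 xx u v - Ga1 ze u v) = rh * norm (Ga (x0 + rh *R xx) u v - Ga (x0 + rh *R ze) u v)"
    using rh by (simp add: Ga1_def scaleR_diff_right[symmetric])
   also have "... <= rh * (K * norm ((x0 + rh *R xx) - (x0 + rh *R ze)) * norm u * norm v)"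
    using rh by (intro mult_left_mono Ga(4)[OF inb[OF that(1)] inb[OF that(2)]]) auto
   also have "norm ((x0 + rh *R xx) - (x0 + rh *R ze)) = rh * norm (xx - ze)"
    using rh by (simp add: scaleR_diff_right[symmetric])
   also have "rh * (K * (rh * norm (xx - ze)) * norm u * norm v) = (rh * K) * rh * norm (xx - ze) * norm u * norm v" by simp
   also have "... <= et * 1 * norm (xx - ze) * norm u * norm v"
    using K rh et(1) by (intro mult_right_mono mult_mono) auto
   finally show ?thesis by simp
  qed
  obtain xx nv :: "'e => real => 'e" where e:
   "smooth_on (ball 0 1 \<times> {-3/2<..<3/2}) (%q. xx (fst q) (snd q))"
   "!!a. xx a 0 = 0" "!!a. nv a 0 = a"
   "!!a t. a : ball 0 1 ==> t : {-3/2<..<3/2} ==> (xx a has_vector_derivative nv a t) (at t)"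
   "!!a t. a : ball 0 1 ==> t : {-3/2<..<3/2} ==> (nv a has_vector_derivative - Ga1 (xx a t) (nv a t) (nv a t)) (at t)"
   "!!a t. a : ball 0 1 ==> t : {-3/2<..<3/2} ==> norm (xx a t) <= 2"
   "!!a b. a : ball 0 1 ==> b : ball 0 1 ==> norm ((xx a 1 - xx b 1) - (a - b)) <= 1/2 * norm (a - b)"
   using unit_exponential[OF ka less_imp_le[OF et(1)] et(2) 1 2 3 4] by blast
  define ga where "ga u t = x0 + rh *R xx (u /\<^sub>R rh) t" for u t
  define ga' where "ga' u t = rh *R nv (u /\<^sub>R rh) t" for u t
  have ub: "u /\<^sub>R rh : ball 0 1" if "u : ball 0 rh" for u :: 'e
  proof -
   have "norm (u /\<^sub>R rh) = norm u / rh" using rh by (simp add: divide_inverse mult.commute)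
   thus ?thesis using that rh by (simp add: dist_norm divide_less_eq)
  qed
  have smga: "smooth_on (ball 0 rh \<times> {-3/2<..<3/2}) (%q. ga (fst q) (snd q))"
  proof -
   have op: "open (ball (0::'e) rh \<times> {-3/2<..<3/2::real})" by (intro open_Times) auto
   have i: "smooth_on (ball (0::'e) rh \<times> {-3/2<..<3/2::real}) (%z. z)" by (rule smooth_ident[OF op])
   have "smooth_on (ball 0 rh \<times> {-3/2<..<3/2}) (%q. (%q. xx (fst q) (snd q)) (fst q /\<^sub>R rh, snd q))"
   proof (rule smooth_comp[OF e(1)])
    show "smooth_on (ball 0 rh \<times> {-3/2<..<3/2}) (%q::'e \<times> real. (fst q /\<^sub>R rh, snd q))"
     by (intro smooth_Pair smooth_scaleR smooth_const op smooth_fst smooth_snd i)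
    show "(%q::'e \<times> real. (fst q /\<^sub>R rh, snd q)) ` (ball 0 rh \<times> {-3/2<..<3/2}) <= ball 0 1 \<times> {-3/2<..<3/2}"
     using ub by (auto simp del: mem_ball)
   qed
   thus ?thesis unfolding ga_def by (intro smooth_add smooth_const op smooth_scaleR) simp
  qed
  have smE: "smooth_on (ball 0 rh) (%u. ga u 1)"
  proof -
   have "smooth_on (ball 0 rh) (%u::'e. (u, 1::real))" by (intro smooth_Pair smooth_const smooth_ident open_ball)
   from smooth_comp[OF smga this] show ?thesis by (simp add: image_subset_iff)
  qed
  have E: "norm ((ga u 1 - ga w 1) - (u - w)) <= 1/2 * norm (u - w)" if "u : ball 0 rh" "w : ball 0 rh" for u w
  proof -
   have "(ga u 1 - ga w 1) - (u - w) = rh *R ((xx (u /\<^sub>R rh) 1 - xx (w /\<^sub>R rh) 1) - (u /\<^sub>R rh - w /\<^sub>R rh))"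
    using rh by (simp add: ga_def scaleR_diff_right)
   also have "norm ... <= rh * (1/2 * norm (u /\<^sub>R rh - w /\<^sub>R rh))"
    using e(7)[OF ub[OF that(1)] ub[OF that(2)]] rh by (simp add: mult_left_mono)
   also have "... = 1/2 * norm (u - w)" using rh by (simp add: scaleR_diff_right[symmetric])
   finally show ?thesis .
  qed
  have injE: "inj_on (%u. ga u 1) (ball 0 rh)"
  proof (rule inj_onI)
   fix u w assume uw: "u : ball 0 rh" "w : ball 0 rh" and eq: "ga u 1 = ga w 1"
   have "norm (- (u - w)) <= 1/2 * norm (u - w)" using E[OF uw] unfolding eq by (simp only: diff_self diff_0)
   hence "norm (u - w) <= 0" unfolding norm_minus_cancel by linarith
   thus "u = w" by simp
  qed
  have dE: "inj (FD (%u. ga u 1) u)" if u: "u : ball 0 rh" for u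
  proof -
   let ?D = "FD (%u. ga u 1) u"
   have d: "((%u. ga u 1) has_derivative ?D) (at u)" by (rule smooth_has_derivative[OF smE u])
   hence lin: "linear ?D" by (rule has_derivative_linear)
   \<comment> \<open>If the derivative killed \<open>w\<close>, the displacement along
     \<open>t *R w\<close> would be negligible against \<open>t\<close>, whereas \<open>E\<close>
     forces it to be at least half of \<open>norm (t *R w)\<close>.\<close>
   have "w = 0" if "?D w = 0" for w
   proof (rule ccontr)
    assume w: "w ~= 0"
    have cl: "((%t. ga (u + t *R w) 1) has_vector_derivative ?D w) (at 0)"
     using smooth_compose_line[OF smE, of u 0 w] u by simp
    obtain r where r: "0 < r" "ball u r <= ball 0 rh" using u open_ball unfolding open_contains_ball by blast
    have "((%t. ga (u + t *R w) 1) has_derivative (%t. 0)) (at 0)"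
     using cl that by (simp add: has_vector_derivative_def)
    then obtain d where d: "0 < d" "!!t. norm (t - 0) < d ==>
      norm (ga (u + t *R w) 1 - ga (u + 0 *R w) 1 - 0) <= norm w / 4 * norm (t - 0)"
     unfolding has_derivative_at_alt using w by (metis divide_pos_pos zero_less_norm_iff zero_less_numeral)
    define t where "t = min (d / 2) (r / (2 * norm w))"
    have t: "0 < t" "t < d" "t * norm w < r"
    proof -
     show "0 < t" "t < d" using d(1) r(1) w by (auto simp: t_def)
     have "t * norm w <= r / (2 * norm w) * norm w" by (intro mult_right_mono) (auto simp: t_def)
     thus "t * norm w < r" using w r(1) by simp
    qed
    have "u + t *R w : ball 0 rh" using t r(2) by (intro subsetD[OF r(2)]) (simp add: dist_norm)
    from E[OF this u] have "norm (t *R w) <= norm (ga (u + t *R w) 1 - ga u 1) + 1/2 * norm (t *R w)"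
     using norm_triangle_sub[of "t *R w" "ga (u + t *R w) 1 - ga u 1"] by (simp add: norm_minus_commute)
    also have "... <= norm w / 4 * t + 1/2 * norm (t *R w)" using d(2)[of t] t by (simp add: mult.commute)
    finally have "t * norm w * (1/4) <= 0" using t by simp
    thus False using t w by (simp add: mult_le_0_iff)
   qed
   thus ?thesis using linear_injective_0[OF lin] by blast
  qed
  have "ga u 0 = x0 & ga' u 0 = u & smooth_on {-3/2<..<3/2} (ga u) &
     (ALL t:{-3/2<..<3/2}. ga u t : ball x0 (4 * rh) & (ga u has_vector_derivative ga' u t) (at t) &
      (ga' u has_vector_derivative - Ga (ga u t) (ga' u t) (ga' u t)) (at t))" if u: "u : ball 0 rh" for u
  proof (intro conjI ballI)
   show "ga u 0 = x0" "ga' u 0 = u" using e(2,3) rh by (auto simp: ga_def ga'_def)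
   show "smooth_on {-3/2<..<3/2} (ga u)"
   proof -
    have "smooth_on {-3/2<..<3/2::real} (%t. (u, t))" by (intro smooth_Pair smooth_const smooth_ident open_greaterThanLessThan)
    from smooth_comp[OF smga this] u show ?thesis by (simp add: image_subset_iff)
   qed
   fix t :: real assume t: "t : {-3/2<..<3/2}"
   have b: "xx (u /\<^sub>R rh) t : ball 0 4" using e(6)[OF ub[OF u] t] by simp
   show "ga u t : ball x0 (4 * rh)" unfolding ga_def by (rule inb[OF b])
   have "((%t. x0 + rh *R xx (u /\<^sub>R rh) t) has_vector_derivative 0 + rh *R nv (u /\<^sub>R rh) t) (at t)"
    by (intro has_vector_derivative_add has_vector_derivative_const
      bounded_linear.has_vector_derivative[OF bounded_linear_scaleR_right] e(4)[OF ub[OF u] t])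
   thus "(ga u has_vector_derivative ga' u t) (at t)" by (simp add: ga_def[abs_def] ga'_def)
   have "((%t. rh *R nv (u /\<^sub>R rh) t) has_vector_derivative rh *R (- Ga1 (xx (u /\<^sub>R rh) t) (nv (u /\<^sub>R rh) t) (nv (u /\<^sub>R rh) t))) (at t)"
    by (intro bounded_linear.has_vector_derivative[OF bounded_linear_scaleR_right] e(5)[OF ub[OF u] t])
   moreover have "rh *R (- Ga1 (xx (u /\<^sub>R rh) t) (nv (u /\<^sub>R rh) t) (nv (u /\<^sub>R rh) t)) = - Ga (ga u t) (ga' u t) (ga' u t)"
    using bilinear_lmul[OF Ga(1)[OF inb[OF b]]] bilinear_rmul[OF Ga(1)[OF inb[OF b]]] by (simp add: Ga1_def ga_def ga'_def)
   ultimately show "(ga' u has_vector_derivative - Ga (ga u t) (ga' u t) (ga' u t)) (at t)" by (simp add: ga'_def[abs_def])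
  qed
  thus "EX ga ga' :: 'e => real => 'e.
    (ALL u:ball 0 rh. ga u 0 = x0 & ga' u 0 = u & smooth_on {-3/2<..<3/2} (ga u) &
     (ALL t:{-3/2<..<3/2}. ga u t : ball x0 (4 * rh) & (ga u has_vector_derivative ga' u t) (at t) &
      (ga' u has_vector_derivative - Ga (ga u t) (ga' u t) (ga' u t)) (at t))) &
    smooth_on (ball 0 rh) (%u. ga u 1) & inj_on (%u. ga u 1) (ball 0 rh) &
    (ALL u:ball 0 rh. inj (FD (%u. ga u 1) u))"
   using smE injE dE by blast
 qed
qed

section \<open>Charts and tangent vectors\<close>

locale smooth_mfd =
 fixes M :: "('a, 'e::euclidean_space) manifold"
 assumes mfd: "smooth_manifold M"
begin

lemma chart_is_chart: "c : charts M ==> is_chart (mtop M) c" by (simp add: charts_def)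

lemma chart_open: "c : charts M ==> opn M (fst c)"
 and chart_img_open: "c : charts M ==> open (chart_img c)"
 and chart_homeo: "c : charts M ==> homeomorphic_map (subtopology (mtop M) (fst c)) (top_of_set (chart_img c)) (snd c)"
 using chart_is_chart[of c] by (auto simp: is_chart_def chart_img_def case_prod_beta)

lemma chart_topspace: "c : charts M ==> fst c <= pts M"
 using chart_open openin_subset by blast

lemma chart_inj: assumes "c : charts M" shows "inj_on (snd c) (fst c)"
 using homeomorphic_imp_injective_map[OF chart_homeo[OF assms]] chart_topspace[OF assms] by (simp add: topspace_subtopology Int_absorb1)

lemma chart_inv_in: "x : chart_img c ==> chart_inv c x : fst c"
 and chart_map_inv: "x : chart_img c ==> snd c (chart_inv c x) = x" by (auto simp: chart_img_def chart_inv_def inv_into_into f_inv_into_f)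

lemma chart_inv_map: "c : charts M ==> p : fst c ==> chart_inv c (snd c p) = p"
 using chart_inj by (simp add: chart_inv_def)

lemma chart_map_in: "p : fst c ==> snd c p : chart_img c" by (simp add: chart_img_def)

lemma chart_image_open:
 assumes c: "c : charts M" and N: "opn M N"
 shows "open (snd c ` (fst c Int N))"
proof -
 have "openin (subtopology (mtop M) (fst c)) (fst c Int N)"
  using N by (auto simp: openin_subtopology Int_commute)
 hence "openin (top_of_set (chart_img c)) (snd c ` (fst c Int N))"
  using homeomorphic_imp_open_map[OF chart_homeo[OF c]] by (simp add: open_map_def)
 thus ?thesis using chart_img_open[OF c] by (simp add: openin_open_eq)
qed

lemma chart_preimage_open:
 assumes c: "c : charts M" and V: "open V"
 shows "opn M {p : fst c. snd c p : V}"
proof -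
 have "openin (top_of_set (chart_img c)) (V Int chart_img c)" using V by (auto simp: openin_open)
 hence "openin (subtopology (mtop M) (fst c)) {p : topspace (subtopology (mtop M) (fst c)). snd c p : V Int chart_img c}"
  using homeomorphic_imp_continuous_map[OF chart_homeo[OF c]] unfolding continuous_map by blast
 also have "{p : topspace (subtopology (mtop M) (fst c)). snd c p : V Int chart_img c} = {p : fst c. snd c p : V}"
  using chart_topspace[OF c] by (auto simp: chart_img_def)
 finally show ?thesis using chart_open[OF c] by (simp add: openin_open_subtopology)
qed

lemma chart_image_eq:
 assumes c: "c : charts M" shows "snd c ` (fst c Int N) = {x : chart_img c. chart_inv c x : N}"
proof safe
 fix p assume "p : fst c" "p : N"
 thus "snd c p : chart_img c" "chart_inv c (snd c p) : N" using c by (auto simp: chart_map_in chart_inv_map)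
next
 fix x assume x: "x : chart_img c" "chart_inv c x : N"
 hence "x = snd c (chart_inv c x)" "chart_inv c x : fst c Int N" by (auto simp: chart_map_inv chart_inv_in)
 thus "x : snd c ` (fst c Int N)" by blast
qed

abbreviation tr :: "('a, 'e) chart => ('a, 'e) chart => 'e => 'e" where
 "tr c d == snd d o chart_inv c"

lemma atlas_charts: "atlas M <= charts M"
 using mfd by (auto simp: smooth_manifold_def charts_def)

lemma chart_cover: "p : pts M ==> EX c:atlas M. p : fst c"
 using mfd by (auto simp: smooth_manifold_def)

lemma chart_at:
 assumes "p : pts M" obtains c where "c : charts M" "p : fst c"
 using chart_cover[OF assms] atlas_charts by blast

text \<open>Charts of the maximal atlas are compatible by definition only with charts of the given
  atlas, so the transition is factored locally through one of those.\<close>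

lemma smooth_tr:
 assumes c: "c : charts M" and d: "d : charts M"
 shows "smooth_on (snd c ` (fst c Int fst d)) (tr c d)"
proof (rule smooth_local)
 show "open (snd c ` (fst c Int fst d))" by (rule chart_image_open[OF c chart_open[OF d]])
 fix x assume "x : snd c ` (fst c Int fst d)"
 then obtain p where p: "p : fst c" "p : fst d" "x = snd c p" by blast
 obtain e where e: "e : atlas M" "p : fst e" using chart_cover p(1) chart_topspace[OF c] by blast
 hence eM: "e : charts M" using atlas_charts by blast
 have 1: "smooth_on (snd c ` (fst c Int fst e)) (tr c e)" and 2: "smooth_on (snd e ` (fst d Int fst e)) (tr e d)"
 proof -
  have "compatible_charts c e" "compatible_charts d e" using c d e(1) by (auto simp: charts_def)
  thus "smooth_on (snd c ` (fst c Int fst e)) (tr c e)" "smooth_on (snd e ` (fst d Int fst e)) (tr e d)" by (auto simp: compatible_charts_def)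
 qed
 let ?T = "snd c ` (fst c Int (fst d Int fst e))"
 have op: "open ?T" by (rule chart_image_open[OF c openin_Int[OF chart_open[OF d] chart_open[OF eM]]])
 have "smooth_on ?T (%x. tr e d (tr c e x))"
 proof (rule smooth_comp[OF 2])
  show "smooth_on ?T (tr c e)" by (rule smooth_subset[OF 1 op]) blast
  show "tr c e ` ?T <= snd e ` (fst d Int fst e)" by (auto simp: chart_inv_map[OF c])
 qed
 hence s: "smooth_on ?T (tr c d)" by (rule smooth_cong) (auto simp: chart_inv_map[OF c] chart_inv_map[OF eM])
 have "x : ?T" unfolding p(3) by (rule imageI) (use p e in simp)
 from this s show "EX T. x : T & smooth_on T (tr c d)" by (intro exI conjI)
qed

lemma tr_inverse:
 assumes "c : charts M" "d : charts M" "x : snd c ` (fst c Int fst d)"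
 shows "tr d c (tr c d x) = x" "tr c d x : snd d ` (fst d Int fst c)"
 using chart_inv_map[OF assms(1)] chart_inv_map[OF assms(2)] assms(3) by auto

lemma chart_restrict:
 assumes c: "c : charts M" and U: "opn M U"
 shows "(fst c Int U, snd c) : charts M" "x : snd c ` (fst c Int U) ==> chart_inv (fst c Int U, snd c) x = chart_inv c x"
proof -
 have inv: "chart_inv (fst c Int U, snd c) x = chart_inv c x" if "x : snd c ` (fst c Int U)" for x
  using that chart_inj[OF c] by (auto simp: chart_inv_def inj_on_Int)
 thus "x : snd c ` (fst c Int U) ==> chart_inv (fst c Int U, snd c) x = chart_inv c x" .
 have op: "opn M (fst c Int U)" using chart_open[OF c] U by blast
 have "homeomorphic_map (subtopology (subtopology (mtop M) (fst c)) U)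
  (subtopology (top_of_set (chart_img c)) (snd c ` (fst c Int U))) (snd c)"
 proof (rule homeomorphic_map_subtopologies[OF chart_homeo[OF c]])
  show "snd c ` (topspace (subtopology (mtop M) (fst c)) Int U) = topspace (top_of_set (chart_img c)) Int snd c ` (fst c Int U)"
   using chart_topspace[OF c] by (auto simp: chart_img_def)
 qed
 moreover have "subtopology (top_of_set (chart_img c)) (snd c ` (fst c Int U)) = top_of_set (snd c ` (fst c Int U))"
  by (auto simp: subtopology_subtopology chart_img_def intro!: arg_cong2[where f = subtopology])
 ultimately have ch: "is_chart (mtop M) (fst c Int U, snd c)"
  using op chart_image_open[OF c U] by (simp add: is_chart_def subtopology_subtopology)
 moreover have "compatible_charts (fst c Int U, snd c) d" if "d : atlas M" for d
 proof -
  have d: "d : charts M" using that atlas_charts by blast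
  have o1: "open (snd c ` (fst c Int U Int fst d))"
   using chart_image_open[OF c openin_Int[OF U chart_open[OF d]]] by (simp add: Int_assoc)
  have o2: "open (snd d ` (fst c Int U Int fst d))"
   using chart_image_open[OF d op] by (simp add: Int_commute)
  have "smooth_on (snd c ` (fst c Int U Int fst d)) (snd d o chart_inv (fst c Int U, snd c))"
  proof (rule smooth_cong[OF smooth_subset[OF smooth_tr[OF c d] o1]])
   fix x assume x: "x : snd c ` (fst c Int U Int fst d)"
   show "tr c d x = (snd d o chart_inv (fst c Int U, snd c)) x" using inv[of x] x by auto
  qed auto
  moreover have "smooth_on (snd d ` (fst c Int U Int fst d)) (snd c o chart_inv d)" by (rule smooth_subset[OF smooth_tr[OF d c] o2]) auto
  ultimately show ?thesis by (simp add: compatible_charts_def)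
 qed
 ultimately show "(fst c Int U, snd c) : charts M" by (simp add: charts_def)
qed

lemma chart_compose:
 assumes c: "c : charts M" and fi: "smooth_on (chart_img c) fi" "inj_on fi (chart_img c)"
  "!!x. x : chart_img c ==> inj (FD fi x)"
 shows "(fst c, fi o snd c) : charts M"
  "y : fi ` chart_img c ==> chart_inv (fst c, fi o snd c) y = chart_inv c (inv_into (chart_img c) fi y)"
proof -
 let ?c' = "(fst c, fi o snd c)"
 note invfi = smooth_inverse_function[OF fi]
 have inv: "chart_inv ?c' y = chart_inv c (inv_into (chart_img c) fi y)" if y: "y : fi ` chart_img c" for y
 proof -
  obtain p where p: "p : fst c" "y = fi (snd c p)" using y by (auto simp: chart_img_def)
  have "inj_on (fi o snd c) (fst c)" using comp_inj_on[OF chart_inj[OF c]] fi(2) by (simp add: chart_img_def)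
  hence "chart_inv ?c' y = p" using p inv_into_f_f[of "fi o snd c" "fst c" p] by (simp add: chart_inv_def)
  moreover have "inv_into (chart_img c) fi y = snd c p" using p fi(2) by (simp add: chart_map_in)
  ultimately show ?thesis using chart_inv_map[OF c p(1)] by simp
 qed
 thus "y : fi ` chart_img c ==> chart_inv ?c' y = chart_inv c (inv_into (chart_img c) fi y)" .
 have img: "(fi o snd c) ` fst c = fi ` chart_img c" by (simp add: chart_img_def image_comp)
 have "homeomorphic_map (top_of_set (chart_img c)) (top_of_set (fi ` chart_img c)) fi"
 proof -
  have "homeomorphic_maps (top_of_set (chart_img c)) (top_of_set (fi ` chart_img c)) fi (inv_into (chart_img c) fi)"
   using fi(2) smooth_cont[OF fi(1)] smooth_cont[OF invfi(2)]
   by (auto simp: homeomorphic_maps_def continuous_map_in_subtopology image_subset_iff inv_into_into f_inv_into_f)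
  thus ?thesis unfolding homeomorphic_map_maps by blast
 qed
 hence "is_chart (mtop M) ?c'"
  using homeomorphic_map_compose[OF chart_homeo[OF c]] chart_open[OF c] invfi(1) by (simp add: is_chart_def img[unfolded o_def])
 moreover have "compatible_charts ?c' d" if "d : atlas M" for d
 proof -
  have d: "d : charts M" using that atlas_charts by blast
  let ?S = "snd c ` (fst c Int fst d)"
  have S: "?S <= chart_img c" by (auto simp: chart_img_def)
  have opS: "open ?S" by (rule chart_image_open[OF c chart_open[OF d]])
  have fiS: "open (fi ` ?S)" by (rule invariance_of_domain[OF continuous_on_subset[OF smooth_cont[OF fi(1)] S] opS inj_on_subset[OF fi(2) S]])
  have im: "(fi o snd c) ` (fst c Int fst d) = fi ` ?S" by (simp add: image_comp)
  have iv: "inv_into (chart_img c) fi (fi x) = x" if "x : ?S" for x using that S fi(2) by auto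
  have "smooth_on (fi ` ?S) (%y. tr c d (inv_into (chart_img c) fi y))"
   by (rule smooth_comp[OF smooth_tr[OF c d] smooth_subset[OF invfi(2) fiS]]) (use S iv in auto)
  hence "smooth_on (fi ` ?S) (snd d o chart_inv ?c')" by (rule smooth_cong) (use inv S in auto)
  moreover have "smooth_on (snd d ` (fst c Int fst d)) (%y. fi (tr d c y))"
  proof (rule smooth_comp[OF fi(1)])
   show "smooth_on (snd d ` (fst c Int fst d)) (tr d c)" using smooth_tr[OF d c] by (simp add: Int_commute)
   show "tr d c ` snd d ` (fst c Int fst d) <= chart_img c" using chart_inv_map[OF d] by (auto simp: chart_img_def)
  qed
  ultimately show ?thesis unfolding compatible_charts_def by (simp add: o_def image_image)
 qed
 ultimately show "?c' : charts M" by (simp add: charts_def)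
qed

section \<open>Germs of smooth functions and derivations\<close>

lemma smooth_near_iff:
 assumes c: "c : charts M" and p: "p : fst c"
 shows "smooth_near M p f \<longleftrightarrow> (EX V. open V & snd c p : V & V <= chart_img c & smooth_on V (f o chart_inv c))"
proof
 assume "smooth_near M p f"
 then obtain N where N: "opn M N" "p : N" "smooth_on (snd c ` (fst c Int N)) (f o chart_inv c)"
  using c unfolding smooth_near_def by blast
 thus "EX V. open V & snd c p : V & V <= chart_img c & smooth_on V (f o chart_inv c)"
  using p smooth_open[OF N(3)] by (intro exI[of _ "snd c ` (fst c Int N)"]) (auto simp: chart_img_def)
next
 assume "EX V. open V & snd c p : V & V <= chart_img c & smooth_on V (f o chart_inv c)"
 then obtain V where V: "open V" "snd c p : V" "V <= chart_img c" "smooth_on V (f o chart_inv c)" by blast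
 let ?N = "{q : fst c. snd c q : V}"
 have "smooth_on (snd d ` (fst d Int ?N)) (f o chart_inv d)" if d: "d : charts M" for d
 proof -
  have op: "open (snd d ` (fst d Int ?N))" by (rule chart_image_open[OF d chart_preimage_open[OF c V(1)]])
  have "smooth_on (snd d ` (fst d Int ?N)) (%y. (f o chart_inv c) (tr d c y))" by (rule smooth_comp[OF V(4) smooth_subset[OF smooth_tr[OF d c] op]])
    (use chart_inv_map[OF d] in auto)
  thus ?thesis by (rule smooth_cong) (use chart_inv_map[OF d] chart_inv_map[OF c] in auto)
 qed
 thus "smooth_near M p f"
  unfolding smooth_near_def using chart_preimage_open[OF c V(1)] p V(2) by (intro exI[of _ ?N]) auto
qed

lemma smooth_near_chart: "smooth_near M p f ==> c : charts M ==> p : fst c ==>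
 EX V. open V & snd c p : V & V <= chart_img c & smooth_on V (f o chart_inv c)"
 using smooth_near_iff by blast

lemma smooth_near_topspace: "smooth_near M p f ==> p : pts M"
 unfolding smooth_near_def using openin_subset by blast

lemma smooth_near_deriv:
 assumes "smooth_near M p f" "c : charts M" "p : fst c"
 shows "((f o chart_inv c) has_derivative FD (f o chart_inv c) (snd c p)) (at (snd c p))"
 using smooth_near_chart[OF assms] smooth_has_derivative by blast

lemma smooth_near_combine:
 assumes "smooth_near M p f" "smooth_near M p h"
  and Ph: "!!V (c :: ('a, 'e) chart). smooth_on V (f o chart_inv c) ==> smooth_on V (h o chart_inv c) ==> smooth_on V (k o chart_inv c)"
 shows "smooth_near M p k"
proof -
 obtain c where c: "c : charts M" "p : fst c" using chart_at[OF smooth_near_topspace[OF assms(1)]] .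
 obtain V W where V: "open V" "snd c p : V" "V <= chart_img c" "smooth_on V (f o chart_inv c)"
  and W: "open W" "snd c p : W" "W <= chart_img c" "smooth_on W (h o chart_inv c)"
  using smooth_near_chart[OF assms(1) c] smooth_near_chart[OF assms(2) c] by blast
 have "smooth_on (V Int W) (k o chart_inv c)" by (rule Ph[OF smooth_subset[OF V(4)] smooth_subset[OF W(4)]]) (use V W in auto)
 thus ?thesis unfolding smooth_near_iff[OF c] using V W by blast
qed

lemma smooth_near_const: assumes "p : pts M" shows "smooth_near M p (%_. k)"
proof -
 obtain c where c: "c : charts M" "p : fst c" using chart_at[OF assms] .
 thus ?thesis
  unfolding smooth_near_iff[OF c] using smooth_const[OF chart_img_open[OF c(1)]] chart_img_open[OF c(1)] chart_map_in[OF c(2)]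
  by (intro exI[of _ "chart_img c"]) (simp add: o_def)
qed

lemma smooth_near_lin: "smooth_near M p f ==> smooth_near M p h ==> smooth_near M p (%x. a * f x + b * h x)"
 by (erule smooth_near_combine, assumption) (auto simp: o_def intro!: smooth_add smooth_cmult)

lemma smooth_near_mult: "smooth_near M p f ==> smooth_near M p h ==> smooth_near M p (%x. f x * h x)"
 by (erule smooth_near_combine, assumption) (auto simp: o_def intro!: smooth_mult)

lemma smooth_near_cong:
 assumes "smooth_near M p f" "opn M N" "p : N" "!!q. q : N ==> f q = g q"
 shows "smooth_near M p g"
proof -
 obtain c where c: "c : charts M" "p : fst c" using chart_at[OF smooth_near_topspace[OF assms(1)]] .
 obtain V where V: "open V" "snd c p : V" "V <= chart_img c" "smooth_on V (f o chart_inv c)"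
  using smooth_near_chart[OF assms(1) c] by blast
 let ?W = "V Int snd c ` (fst c Int N)"
 have "open ?W" using V(1) chart_image_open[OF c(1) assms(2)] by blast
 moreover have "smooth_on ?W (g o chart_inv c)"
  by (rule smooth_cong[OF smooth_subset[OF V(4) \<open>open ?W\<close>]]) (use chart_inv_map[OF c(1)] assms(4) in auto)
 ultimately show ?thesis unfolding smooth_near_iff[OF c] using V c assms(3) by (intro exI[of _ ?W]) auto
qed

lemma smooth_near_lift:
 assumes c: "c : charts M" "p : fst c" and h: "smooth_on V h" "snd c p : V"
 shows "smooth_near M p (%q. h (snd c q))"
proof -
 have op: "open (V Int chart_img c)" using smooth_open[OF h(1)] chart_img_open[OF c(1)] by blast
 have "smooth_on (V Int chart_img c) ((%q. h (snd c q)) o chart_inv c)"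
  by (rule smooth_cong[OF smooth_subset[OF h(1) op]]) (auto simp: chart_map_inv)
 thus ?thesis unfolding smooth_near_iff[OF c] using h(2) op chart_map_in[OF c(2)] by blast
qed

lemma lift_deriv:
 assumes c: "c : charts M" "p : fst c" and h: "smooth_on V h" "snd c p : V"
 shows "FD ((%q. h (snd c q)) o chart_inv c) (snd c p) = FD h (snd c p)"
 by (rule frechet_derivative_cong_open[OF chart_img_open[OF c(1)] chart_map_in[OF c(2)]]) (simp add: chart_map_inv)

lemma coord_vec_tangent:
 assumes c: "c : charts M" "p : fst c"
 shows "coord_vec M c p u : tangent_space M p"
proof -
 let ?x = "snd c p"
 have d: "((f o chart_inv c) has_derivative FD (f o chart_inv c) ?x) (at ?x)" if "smooth_near M p f" for f by (rule smooth_near_deriv[OF that c])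
 have ev: "f (chart_inv c ?x) = f p" for f :: "'a => real" by (simp add: chart_inv_map[OF c])
 have 1: "FD ((%x. a * f x + b * h x) o chart_inv c) ?x u
   = a * FD (f o chart_inv c) ?x u + b * FD (h o chart_inv c) ?x u"
  if "smooth_near M p f" "smooth_near M p h" for f h a b
  using has_derivative_frechet[OF has_derivative_add[OF has_derivative_mult_right[OF d[OF that(1)], of a]
   has_derivative_mult_right[OF d[OF that(2)], of b]]] by (simp add: o_def)
 have 2: "FD ((%x. f x * h x) o chart_inv c) ?x u
   = f p * FD (h o chart_inv c) ?x u + h p * FD (f o chart_inv c) ?x u"
  if "smooth_near M p f" "smooth_near M p h" for f h
  using has_derivative_frechet[OF has_derivative_mult[OF d[OF that(1)] d[OF that(2)]]] by (simp add: o_def ev mult.commute)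
 show ?thesis
  unfolding tangent_space_def coord_vec_def using smooth_near_lin smooth_near_mult 1 2 by auto
qed

lemma tangent_lin:
 assumes "D : tangent_space M p" "smooth_near M p f" "smooth_near M p h"
 shows "D (%x. a * f x + b * h x) = a * D f + b * D h" "D (%x. f x * h x) = f p * D h + h p * D f"
 using assms unfolding tangent_space_def by blast+

lemma tangent_zero: "D : tangent_space M p ==> ~ smooth_near M p f ==> D f = 0"
 unfolding tangent_space_def by blast

lemma tangent_const:
 assumes "D : tangent_space M p" shows "D (%_. k) = 0"
proof (cases "p : pts M")
 case True
 note s = smooth_near_const[OF True]
 have "D (%x. 1) = 0" using tangent_lin(2)[OF assms s[of 1] s[of 1]] by simp
 thus ?thesis using tangent_lin(1)[OF assms s[of 1] s[of 1], of k 0] by simp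
qed (use tangent_zero[OF assms] smooth_near_topspace in blast)

text \<open>The difference \<open>h\<close> vanishes on \<open>N\<close>, so it equals its product
  with \<open>k\<close>, which is 0 on \<open>N\<close> and 1 elsewhere. Both factors vanish at
  \<open>p\<close>, and the Leibniz rule gives 0. The jump of \<open>k\<close> is harmless, since
  only smoothness near \<open>p\<close> counts.\<close>

lemma tangent_local:
 assumes D: "D : tangent_space M p" and f: "smooth_near M p f"
  and N: "opn M N" "p : N" "!!q. q : N ==> f q = g q"
 shows "D f = D g"
proof -
 note pM = smooth_near_topspace[OF f]
 have g: "smooth_near M p g" by (rule smooth_near_cong[OF f N])
 define h where "h q = 1 * f q + (-1) * g q" for q
 define k where "k q = (if q : N then 0 else 1 :: real)" for q
 have h: "smooth_near M p h" unfolding h_def by (rule smooth_near_lin[OF f g])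
 have k: "smooth_near M p k" by (rule smooth_near_cong[OF smooth_near_const[OF pM] N(1,2)]) (simp add: k_def)
 have "h = (%q. h q * k q)" using N(3) by (auto simp: h_def k_def)
 moreover have "h p = 0" "k p = 0" using N by (auto simp: h_def k_def)
 ultimately have "D h = 0" using tangent_lin(2)[OF D h k] by simp
 thus ?thesis unfolding h_def using tangent_lin(1)[OF D f g, of 1 "-1"] by simp
qed

lemma tangent_sum:
 assumes D: "D : tangent_space M p" and p: "p : pts M" and "finite I" "!!i. i : I ==> smooth_near M p (f i)"
 shows "smooth_near M p (%q. SUM i:I. f i q) & D (%q. SUM i:I. f i q) = (SUM i:I. D (f i))"
 using assms(3,4)
proof (induction I)
 case empty
 thus ?case using smooth_near_const[OF p] tangent_const[OF D] by simp
next
 case (insert i I)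
 hence s: "smooth_near M p (f i)" "smooth_near M p (%q. SUM i:I. f i q)" by auto
 show ?case
  using smooth_near_lin[OF s, of 1 1] tangent_lin(1)[OF D s, of 1 1] insert by simp
qed

lemma coord_smooth: "c : charts M ==> p : fst c ==> smooth_near M p (%q. snd c q \<bullet> b)"
 using smooth_near_lift[OF _ _ smooth_inner_const[OF smooth_ident[OF open_UNIV]] UNIV_I] by simp

text \<open>Hadamard's lemma writes \<open>f\<close> near \<open>p\<close> as a constant plus
  products of smooth functions with coordinates that vanish at \<open>p\<close>; the Leibniz rule
  then leaves only the values of \<open>D\<close> on the coordinate functions.\<close>

lemma tangent_eq_coord_vec:
 assumes c: "c : charts M" "p : fst c" and D: "D : tangent_space M p"
 shows "D = coord_vec M c p (vec_coords c D)"
proof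
 fix f
 let ?x = "snd c p" and ?X = "%b q. snd c q \<bullet> b"
 have pM: "p : pts M" using c chart_topspace by blast
 show "D f = coord_vec M c p (vec_coords c D) f"
 proof (cases "smooth_near M p f")
  case f: True
  obtain V where V: "open V" "?x : V" "V <= chart_img c" "smooth_on V (f o chart_inv c)"
   using smooth_near_chart[OF f c] by blast
  obtain r where r: "0 < r" "ball ?x r <= V" using V(1,2) open_contains_ball by blast
  obtain h where h: "!!b. smooth_on (ball ?x r) (h b)" "!!b. h b ?x = FD (f o chart_inv c) ?x b"
   "!!y. y : ball ?x r ==> (f o chart_inv c) y = (f o chart_inv c) ?x + (SUM b:Basis. ((y - ?x) \<bullet> b) * h b y)"
   using hadamard[OF smooth_subset[OF V(4) open_ball r(2)] r(1)] by blast
  define g where "g b q = (%q. 1 * ?X b q + (- (?x \<bullet> b)) * 1) q * h b (snd c q)" for b q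
  have X: "smooth_near M p (%q. 1 * ?X b q + (- (?x \<bullet> b)) * 1)" for b
   by (rule smooth_near_lin[OF coord_smooth[OF c] smooth_near_const[OF pM]])
  have H: "smooth_near M p (%q. h b (snd c q))" for b by (rule smooth_near_lift[OF c h(1)]) (use r in simp)
  have g: "smooth_near M p (g b)" for b unfolding g_def by (rule smooth_near_mult[OF X H])
  have Dg: "D (g b) = FD (f o chart_inv c) ?x b * D (?X b)" for b
  proof -
   have "D (g b) = (1 * ?X b p + (- (?x \<bullet> b)) * 1) * D (%q. h b (snd c q)) + h b ?x * D (%q. 1 * ?X b q + (- (?x \<bullet> b)) * 1)"
    unfolding g_def by (rule tangent_lin(2)[OF D X H])
   also have "D (%q. 1 * ?X b q + (- (?x \<bullet> b)) * 1) = 1 * D (?X b) + (- (?x \<bullet> b)) * D (%_. 1)"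
    by (rule tangent_lin(1)[OF D coord_smooth[OF c] smooth_near_const[OF pM]])
   finally show ?thesis by (simp add: tangent_const[OF D] h(2))
  qed
  note S = tangent_sum[OF D pM finite_Basis, of g, OF g]
  have "D f = D (%q. 1 * (SUM b:Basis. g b q) + f p * 1)"
  proof (rule tangent_local[OF D f chart_preimage_open[OF c(1), of "ball ?x r"]])
   fix q assume "q : {q : fst c. snd c q : ball ?x r}"
   hence q: "q : fst c" "snd c q : ball ?x r" by auto
   show "f q = 1 * (SUM b:Basis. g b q) + f p * 1"
    using h(3)[OF q(2)] chart_inv_map[OF c(1) q(1)] chart_inv_map[OF c] by (simp add: g_def inner_diff_left)
  qed (use c r in auto)
  also have "... = (SUM b:Basis. D (g b))"
   using tangent_lin(1)[OF D conjunct1[OF S] smooth_near_const[OF pM], of 1 "f p" 1] conjunct2[OF S] tangent_const[OF D] by simp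
  also have "... = FD (f o chart_inv c) ?x (vec_coords c D)"
   unfolding Dg vec_coords_def
   using has_derivative_linear[OF smooth_near_deriv[OF f c]] by (simp add: linear_sum linear_cmul mult.commute)
  finally show ?thesis using f by (simp add: coord_vec_def)
 qed (simp add: tangent_zero[OF D] coord_vec_def)
qed

lemma vec_coords_coord_vec:
 assumes c: "c : charts M" "p : fst c"
 shows "vec_coords c (coord_vec M c p u) = u"
proof -
 have "coord_vec M c p u (%q. snd c q \<bullet> b) = u \<bullet> b" for b
 proof -
  have "FD ((%q. snd c q \<bullet> b) o chart_inv c) (snd c p) = (%u. u \<bullet> b)"
   using lift_deriv[OF c smooth_inner_const[OF smooth_ident[OF open_UNIV]], of b]
    has_derivative_frechet[OF has_derivative_inner_left[OF has_derivative_ident]] by simp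
  thus ?thesis using coord_smooth[OF c] by (simp add: coord_vec_def)
 qed
 thus ?thesis by (simp add: vec_coords_def euclidean_representation)
qed

lemma coord_vec_lin:
 assumes c: "c : charts M" "p : fst c"
 shows "coord_vec M c p (a *R u + b *R v) = (%f. a * coord_vec M c p u f + b * coord_vec M c p v f)"
 using has_derivative_linear[OF smooth_near_deriv[OF _ c]] by (auto simp: coord_vec_def fun_eq_iff linear_add linear_cmul)

lemma coord_vec_0: "c : charts M ==> p : fst c ==> coord_vec M c p 0 = (%_. 0)"
 using coord_vec_lin[of c p 0 0 0 0] by simp

lemma coord_vec_eq_0: "c : charts M ==> p : fst c ==> coord_vec M c p u = (%_. 0) ==> u = 0"
 using vec_coords_coord_vec[of c p u] by (simp add: vec_coords_def)

lemma coord_vec_apply: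
 assumes "smooth_near M p f" shows "coord_vec M c p u f = FD (f o chart_inv c) (snd c p) u"
 using assms by (simp add: coord_vec_def)

lemma coord_vec_change:
 assumes c: "c : charts M" "p : fst c" and d: "d : charts M" "p : fst d"
 shows "coord_vec M c p u = coord_vec M d p (FD (tr c d) (snd c p) u)"
proof
 fix f
 show "coord_vec M c p u f = coord_vec M d p (FD (tr c d) (snd c p) u) f"
 proof (cases "smooth_near M p f")
  case f: True
  let ?S = "snd c ` (fst c Int fst d)"
  have S: "open ?S" "snd c p : ?S" using chart_image_open[OF c(1) chart_open[OF d(1)]] c d by auto
  have t: "(tr c d has_derivative FD (tr c d) (snd c p)) (at (snd c p))" by (rule smooth_has_derivative[OF smooth_tr[OF c(1) d(1)] S(2)])
  have e: "tr c d (snd c p) = snd d p" using chart_inv_map[OF c] by simp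
  have "((%x. (f o chart_inv d) (tr c d x)) has_derivative
    (%u. FD (f o chart_inv d) (snd d p) (FD (tr c d) (snd c p) u))) (at (snd c p))"
   using has_derivative_compose[OF t, of "f o chart_inv d"] smooth_near_deriv[OF f d] unfolding e by blast
  hence "((f o chart_inv c) has_derivative
    (%u. FD (f o chart_inv d) (snd d p) (FD (tr c d) (snd c p) u))) (at (snd c p))"
   by (rule has_derivative_transform_within_open[OF _ S]) (use chart_inv_map[OF c(1)] chart_inv_map[OF d(1)] in auto)
  thus ?thesis using f by (simp add: coord_vec_def has_derivative_frechet)
 qed (simp add: coord_vec_def)
qed

lemma tr_deriv_inverse:
 assumes c: "c : charts M" and d: "d : charts M" and x: "x : snd c ` (fst c Int fst d)"
 shows "FD (tr d c) (tr c d x) (FD (tr c d) x u) = u"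
  "FD (tr c d) x (FD (tr d c) (tr c d x) u) = u"
proof -
 obtain p where p: "p : fst c" "p : fst d" "x = snd c p" using x by blast
 have e: "tr c d x = snd d p" using chart_inv_map[OF c p(1)] p by simp
 have "coord_vec M c p (FD (tr d c) (snd d p) (FD (tr c d) (snd c p) u)) = coord_vec M c p u" for u
  unfolding coord_vec_change[OF d p(2) c p(1), symmetric] coord_vec_change[OF c p(1) d p(2), symmetric] ..
 hence "FD (tr d c) (snd d p) (FD (tr c d) (snd c p) u) = u" for u by (metis vec_coords_coord_vec[OF c p(1)])
 thus "FD (tr d c) (tr c d x) (FD (tr c d) x u) = u" using e p by simp
 have "coord_vec M d p (FD (tr c d) (snd c p) (FD (tr d c) (snd d p) u)) = coord_vec M d p u" for u
  unfolding coord_vec_change[OF c p(1) d p(2), symmetric] coord_vec_change[OF d p(2) c p(1), symmetric] ..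
 hence "FD (tr c d) (snd c p) (FD (tr d c) (snd d p) u) = u" for u by (metis vec_coords_coord_vec[OF d p(2)])
 thus "FD (tr c d) x (FD (tr d c) (tr c d x) u) = u" using e p by simp
qed

lemma loc2_change:
 assumes c: "c : charts M" and d: "d : charts M" and x: "x : snd c ` (fst c Int fst d)"
 shows "loc2 M c T x u v = loc2 M d T (tr c d x) (FD (tr c d) x u) (FD (tr c d) x v)"
proof -
 obtain p where p: "p : fst c" "p : fst d" "x = snd c p" using x by blast
 thus ?thesis
  using coord_vec_change[OF c p(1) d p(2)] chart_inv_map[OF c p(1)] chart_inv_map[OF d p(2)] by (simp add: loc2_def Let_def)
qed

end

section \<open>Geodesics and the exponential map\<close>

context smooth_mfd
begin

text \<open>Continuity of a smooth curve on the manifold is hidden in the openness clause of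
  \<open>smooth_on\<close>; this makes it explicit.\<close>

lemma curve_preimage_open:
 assumes ga: "smooth_curve_on M I ga" and N: "opn M N"
 shows "open {t : I. ga t : N}"
 unfolding open_subopen[of "{t : I. ga t : N}"]
proof
 fix t assume "t : {t : I. ga t : N}"
 hence t: "t : I" "ga t : N" by auto
 then obtain c where c: "c : charts M" "ga t : fst c" using N chart_at[of "ga t"] openin_subset by blast
 have s: "smooth_on {t : I. ga t : fst c} (snd c o ga)" using ga c by (auto simp: smooth_curve_on_def)
 let ?V = "snd c ` (fst c Int N)"
 let ?T = "{t : I. ga t : fst c} Int (snd c o ga) -` ?V"
 have "open ?T" by (rule continuous_open_preimage[OF smooth_cont[OF s] smooth_open[OF s] chart_image_open[OF c(1) N]])
 moreover have "t : ?T" using t c by auto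
 moreover have "?T <= {t : I. ga t : N}"
 proof
  fix r assume r: "r : ?T"
  then obtain q where "q : fst c" "q : N" "snd c (ga r) = snd c q" by auto
  hence "ga r = q" using r chart_inj[OF c(1)] by (auto simp: inj_on_def)
  thus "r : {t : I. ga t : N}" using r \<open>q : N\<close> by auto
 qed
 ultimately show "EX T. open T & t : T & T <= {t : I. ga t : N}" by blast
qed

lemma curve_smooth_chart:
 "smooth_curve_on M I ga ==> c : charts M ==> smooth_on {t : I. ga t : fst c} (snd c o ga)" by (simp add: smooth_curve_on_def)

lemma chart_curve:
 assumes c: "c : charts M" and y: "smooth_on I y" "y ` I <= chart_img c"
 shows "smooth_curve_on M I (%t. chart_inv c (y t))"
 unfolding smooth_curve_on_def
proof (intro conjI ballI)
 have in_c: "chart_inv c (y t) : fst c" if "t : I" for t by (rule chart_inv_in) (use y(2) that in blast)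
 thus "(%t. chart_inv c (y t)) ` I <= pts M" using chart_topspace[OF c] by blast
 fix d assume d: "d : charts M"
 let ?T = "{t : I. chart_inv c (y t) : fst d}" and ?S = "snd c ` (fst c Int fst d)"
 have eq: "?T = I Int y -` ?S" unfolding chart_image_eq[OF c] using y(2) by auto
 have op: "open ?T"
  unfolding eq by (rule continuous_open_preimage[OF smooth_cont[OF y(1)] smooth_open[OF y(1)] chart_image_open[OF c chart_open[OF d]]])
 have "smooth_on ?T (%t. tr c d (y t))" by (rule smooth_comp[OF smooth_tr[OF c d] smooth_subset[OF y(1) op]]) (use eq in auto)
 thus "smooth_on ?T (snd d o (%t. chart_inv c (y t)))" by (simp add: o_def)
qed

lemma curve_velocity:
 assumes ga: "smooth_curve_on M I ga" and c: "c : charts M" "ga t : fst c" and t: "t : I"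
 shows "velocity M ga t = coord_vec M c (ga t) (vector_derivative (snd c o ga) (at t))"
proof
 fix f
 show "velocity M ga t f = coord_vec M c (ga t) (vector_derivative (snd c o ga) (at t)) f"
 proof (cases "smooth_near M (ga t) f")
  case f: True
  let ?T = "{t : I. ga t : fst c}" and ?y = "snd c o ga"
  have s: "smooth_on ?T ?y" by (rule curve_smooth_chart[OF ga c(1)])
  have tT: "t : ?T" using t c by simp
  have y: "(?y has_vector_derivative vector_derivative ?y (at t)) (at t)"
   using smooth_differentiable[OF s tT] vector_derivative_works differentiableI_vector by (metis vector_derivative_works)
  have "((%t. (f o chart_inv c) (?y t)) has_derivative
    (%h. FD (f o chart_inv c) (?y t) (h *R vector_derivative ?y (at t)))) (at t)"
   by (rule has_derivative_compose[OF y[unfolded has_vector_derivative_def]])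
    (use smooth_near_deriv[OF f c] in "simp add: o_def")
  hence "((f o ga) has_derivative
    (%h. FD (f o chart_inv c) (?y t) (h *R vector_derivative ?y (at t)))) (at t)"
   by (rule has_derivative_transform_within_open[OF _ smooth_open[OF s] tT]) (auto simp: chart_inv_map[OF c(1)])
  hence "((f o ga) has_real_derivative FD (f o chart_inv c) (?y t) (vector_derivative ?y (at t))) (at t)"
   using has_derivative_linear[OF smooth_near_deriv[OF f c]] by (simp add: has_field_derivative_def linear_cmul mult_commute_abs)
  thus ?thesis using f by (simp add: velocity_def coord_vec_def DERIV_imp_deriv)
 qed (simp add: velocity_def coord_vec_def)
qed

context
 fixes g assumes g: "riemannian_metric M g"
begin

lemma metric_on_chart:
 assumes c: "c : charts M" shows "metric_on (chart_img c) (loc2 M c g)"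
proof -
 have s: "smooth_tensor2 M g" using g by (simp add: riemannian_metric_def)
 have "loc2 M c g x u v = loc2 M c g x v u" "u ~= 0 --> 0 < loc2 M c g x u u" if x: "x : chart_img c" for x u v
 proof -
  have p: "chart_inv c x : fst c" "chart_inv c x : pts M" using chart_inv_in[OF x] chart_topspace[OF c] by auto
  note t = coord_vec_tangent[OF c p(1)]
  show "loc2 M c g x u v = loc2 M c g x v u"
   using g p(2) t unfolding riemannian_metric_def loc2_def Let_def by blast
  show "u ~= 0 --> 0 < loc2 M c g x u u"
   using g p(2) t coord_vec_eq_0[OF c p(1), of u] unfolding riemannian_metric_def loc2_def Let_def by blast
 qed
 thus ?thesis using s c unfolding metric_on_def smooth_tensor2_def by blast
qed

lemma tr_isometry:
 assumes c: "c : charts M" and d: "d : charts M"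
 shows "local_isometry (snd c ` (fst c Int fst d)) (chart_img d) (loc2 M c g) (loc2 M d g) (tr c d)"
proof
 let ?S = "snd c ` (fst c Int fst d)"
 show "metric_on ?S (loc2 M c g)"
  by (rule metric_on_subset[OF metric_on_chart[OF c] chart_image_open[OF c chart_open[OF d]]]) (auto simp: chart_img_def)
 show "metric_on (chart_img d) (loc2 M d g)" by (rule metric_on_chart[OF d])
 show "smooth_on ?S (tr c d)" by (rule smooth_tr[OF c d])
 show "tr c d ` ?S <= chart_img d" using tr_inverse(2)[OF c d] by (auto simp: chart_img_def)
 show "surj (FD (tr c d) x)" if "x : ?S" for x
  using tr_deriv_inverse(2)[OF c d that] by (metis surjI)
 show "loc2 M c g x u v = loc2 M d g (tr c d x) (FD (tr c d) x u) (FD (tr c d) x v)"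
  if "x : ?S" for x u v by (rule loc2_change[OF c d that])
qed

text \<open>The definition asks for the geodesic equation in every chart. In another chart the
  second derivative acquires the term \<open>HH (y t) (y' t) (y' t)\<close>, which is exactly what
  \<open>christoffel_transform\<close> compensates.\<close>

lemma chart_geodesic:
 assumes c: "c : charts M" and y: "smooth_on I y" "y ` I <= chart_img c"
  and d1: "!!t. t : I ==> (y has_vector_derivative y' t) (at t)"
  and d2: "!!t. t : I ==> (y' has_vector_derivative - christoffel (loc2 M c g) (y t) (y' t) (y' t)) (at t)"
 shows "geodesic_on M g I (%t. chart_inv c (y t))"
 unfolding geodesic_on_def Let_def
proof (intro conjI ballI impI)
 show cur: "smooth_curve_on M I (%t. chart_inv c (y t))" by (rule chart_curve[OF c y])
 fix d t assume d: "d : charts M" and t: "t : I" "chart_inv c (y t) : fst d"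
 let ?S = "snd c ` (fst c Int fst d)" and ?ps = "tr c d" and ?z = "snd d o (%t. chart_inv c (y t))"
 interpret local_isometry ?S "chart_img d" "loc2 M c g" "loc2 M d g" ?ps by (rule tr_isometry[OF c d])
 let ?T = "{t : I. chart_inv c (y t) : fst d}"
 have opT: "open ?T" by (rule curve_preimage_open[OF cur chart_open[OF d]])
 have inS: "y s : ?S" if "s : ?T" for s unfolding chart_image_eq[OF c] using that y(2) by auto
 have z1: "(?z has_vector_derivative Lm (y s) (y' s)) (at s)" if s: "s : ?T" for s
 proof -
  have "((%t. ?ps (y t)) has_derivative (%h. Lm (y s) (h *R y' s))) (at s)"
   by (rule has_derivative_compose[OF d1[unfolded has_vector_derivative_def] dps[OF inS[OF s]]]) (use s in auto)
  hence "((%t. ?ps (y t)) has_derivative (%h. h *R Lm (y s) (y' s))) (at s)" by (simp only: linear_cmul[OF linLm[OF inS[OF s]]])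
  thus ?thesis by (simp add: has_vector_derivative_def o_def)
 qed
 have tT: "t : ?T" using t by simp
 note yS = inS[OF tT]
 have "((%s. (%y a r. r *R Lm y a) (y s) (y' s) (1::real)) has_derivative
  (%h. FD (%x. 1 *R Lm x (y' t)) (y t) (h *R y' t)
   + 1 *R Lm (y t) (h *R (- christoffel (loc2 M c g) (y t) (y' t) (y' t))) + 0 *R Lm (y t) (y' t))) (at t)"
 proof (rule has_derivative_bilinear_field[where T = "%y a r. r *R Lm y a", OF _ _ yS d1[OF t(1), unfolded has_vector_derivative_def]
    d2[OF t(1), unfolded has_vector_derivative_def] has_derivative_const])
  show "bilinear (%a r::real. r *R Lm x a)" if "x : ?S" for x
   using linLm[OF that] unfolding bilinear_def by (auto simp: linear_iff algebra_simps)
  show "smooth_on ?S (%x. v *R Lm x u)" for u and v :: real by (intro smooth_scaleR smooth_const metric_onD(1)[OF G1] smooth_deriv ps(1))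
 qed
 hence z2: "((%s. Lm (y s) (y' s)) has_vector_derivative
   HH (y t) (y' t) (y' t) - Lm (y t) (christoffel (loc2 M c g) (y t) (y' t) (y' t))) (at t)"
  using linLm[OF yS] has_derivative_linear[OF dLm[OF yS]] by (simp add: has_vector_derivative_def linear_cmul linear_neg algebra_simps)
 have "((%s. vector_derivative ?z (at s)) has_vector_derivative
   HH (y t) (y' t) (y' t) - Lm (y t) (christoffel (loc2 M c g) (y t) (y' t) (y' t))) (at t)"
  by (rule has_vector_derivative_transform_within_open[OF z2 opT tT]) (simp add: vector_derivative_at[OF z1])
 thus "vector_derivative (%s. vector_derivative ?z (at s)) (at t) +
   christoffel (loc2 M d g) (?z t) (vector_derivative ?z (at t)) (vector_derivative ?z (at t)) = 0"
  by (simp add: vector_derivative_at vector_derivative_at[OF z1[OF tT]] christoffel_transform[OF yS])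
qed

lemma geodesic_chart:
 assumes ga: "geodesic_on M g I ga" and c: "c : charts M" and t: "t : I" "ga t : fst c"
 defines "y == snd c o ga" and "y' == %s. vector_derivative (snd c o ga) (at s)"
 shows "(y has_vector_derivative y' t) (at t)"
  "(y' has_vector_derivative - christoffel (loc2 M c g) (y t) (y' t) (y' t)) (at t)"
proof -
 have cur: "smooth_curve_on M I ga" using ga by (simp add: geodesic_on_def)
 have s: "smooth_on {t : I. ga t : fst c} y" unfolding y_def by (rule curve_smooth_chart[OF cur c])
 have tT: "t : {t : I. ga t : fst c}" using t by simp
 show "(y has_vector_derivative y' t) (at t)"
  using smooth_differentiable[OF s tT] vector_derivative_works unfolding y_def y'_def by blast
 have "(y' has_vector_derivative vector_derivative y' (at t)) (at t)"
  using smooth_differentiable[OF smooth_vector_derivative[OF s] tT] vector_derivative_works unfolding y_def y'_def by blast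
 moreover have "vector_derivative y' (at t) + christoffel (loc2 M c g) (y t) (y' t) (y' t) = 0"
  using ga c t unfolding geodesic_on_def Let_def y_def y'_def by blast
 ultimately show "(y' has_vector_derivative - christoffel (loc2 M c g) (y t) (y' t) (y' t)) (at t)" by (simp add: eq_neg_iff_add_eq_0[symmetric])
qed

text \<open>Only the first curve is known to stay in the chart. The set where positions and
  velocities agree is open by uniqueness for the geodesic equation, and its complement in
  \<open>I\<close> is open too.\<close>

lemma geodesic_unique:
 assumes ga1: "geodesic_on M g I ga1" "!!t. t : I ==> ga1 t : fst c" and ga2: "geodesic_on M g I ga2"
  and c: "c : charts M" and I: "open I" "is_interval I" "0 : I"
  and init: "ga1 0 = ga2 0" "velocity M ga1 0 = velocity M ga2 0" and t: "t : I"
 shows "ga1 t = ga2 t"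
proof -
 have cur: "smooth_curve_on M I ga1" "smooth_curve_on M I ga2" using ga1 ga2 by (auto simp: geodesic_on_def)
 define y where "y ga = snd c o ga" for ga :: "real => 'a"
 define y' where "y' ga s = vector_derivative (snd c o ga) (at s)" for ga :: "real => 'a" and s
 have y: "(y ga has_vector_derivative y' ga t) (at t)"
  "(y' ga has_vector_derivative - christoffel (loc2 M c g) (y ga t) (y' ga t) (y' ga t)) (at t)"
  if "geodesic_on M g I ga" "t : I" "ga t : fst c" for ga t
  using geodesic_chart[OF that(1) c that(2,3)] unfolding y_def y'_def[abs_def] by auto
 note metr = metric_on_chart[OF c]
 define F where "F z = (snd z, - christoffel (loc2 M c g) (fst z) (snd z) (snd z))" for z :: "'e \<times> 'e"
 have smF: "smooth_on (chart_img c \<times> UNIV) F"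
 proof -
  have op: "open (chart_img c \<times> (UNIV :: 'e set))" using chart_img_open[OF c] by (intro open_Times) auto
  have i: "smooth_on (chart_img c \<times> (UNIV :: 'e set)) (%z. z)" by (rule smooth_ident[OF op])
  have "smooth_on (chart_img c \<times> UNIV) (%z. christoffel (loc2 M c g) (fst z) (snd z) (snd z))"
   by (rule smooth_bilinear_apply[where L = "%z. christoffel (loc2 M c g) (fst z)", OF _ _ smooth_snd[OF i] smooth_snd[OF i]])
    (auto intro: bilinear_christoffel[OF metr] smooth_comp[OF smooth_christoffel[OF metr] smooth_fst[OF i]])
  thus ?thesis unfolding F_def by (intro smooth_Pair smooth_snd i smooth_minus)
 qed
 define A where "A = {t : I. ga1 t = ga2 t & y' ga1 t = y' ga2 t}"
 let ?J = "{t : I. ga2 t : fst c}"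
 have opJ: "open ?J" by (rule curve_preimage_open[OF cur(2) chart_open[OF c]])
 have opA: "open A"
  unfolding open_contains_ball
 proof
  fix s assume "s : A"
  hence s: "s : ?J" "ga1 s = ga2 s" "y' ga1 s = y' ga2 s" using ga1(2) by (auto simp: A_def) metis
  obtain e where e: "0 < e" "ball s e <= ?J" using opJ s(1) open_contains_ball by blast
  have "(y ga1 t, y' ga1 t) = (y ga2 t, y' ga2 t)" if t: "t : ball s e" for t
  proof (rule ode_unique[OF smF open_ball _ _ t])
   have *: "(y ga t, y' ga t) : chart_img c \<times> UNIV & ((%t. (y ga t, y' ga t)) has_vector_derivative F (y ga t, y' ga t)) (at t)"
    if "geodesic_on M g I ga" "t : I" "ga t : fst c" for t ga
    using has_vector_derivative_Pair[OF y[OF that]] that(3) by (simp add: F_def y_def chart_map_in)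
   fix t assume "t : ball s e"
   hence t: "t : I" "ga2 t : fst c" using e by auto
   show "(y ga1 t, y' ga1 t) : chart_img c \<times> UNIV" "(y ga2 t, y' ga2 t) : chart_img c \<times> UNIV"
    "((%t. (y ga1 t, y' ga1 t)) has_vector_derivative F (y ga1 t, y' ga1 t)) (at t)"
    "((%t. (y ga2 t, y' ga2 t)) has_vector_derivative F (y ga2 t, y' ga2 t)) (at t)"
    using *[OF ga1(1) t(1) ga1(2)[OF t(1)]] *[OF ga2 t] by auto
  qed (use s e in "auto simp: y_def ball_eq_greaterThanLessThan is_interval_oo")
  hence "t : A" if t: "t : ball s e" for t
   using t e(2) ga1(2)[of t] chart_inj[OF c] unfolding A_def y_def inj_on_def by auto
  thus "EX e>0. ball s e <= A" using e by blast
 qed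
 have opC: "open (I - A)"
  unfolding open_subopen[of "I - A"]
 proof
  fix s assume s: "s : I - A"
  \<comment> \<open>Distinct positions are separated by the Hausdorff property, which also covers a
    second curve outside the chart; with equal positions both curves are in the chart, and there the
    inequality of velocities is an open condition.\<close>
  show "EX T. open T & s : T & T <= I - A"
  proof (cases "ga1 s = ga2 s")
   case False
   have "ga1 s : pts M" "ga2 s : pts M" using cur s by (auto simp: smooth_curve_on_def)
   then obtain U V where UV: "opn M U" "opn M V" "ga1 s : U" "ga2 s : V" "disjnt U V"
    using mfd False unfolding smooth_manifold_def Hausdorff_space_def by metis
   have "open ({t : I. ga1 t : U} Int {t : I. ga2 t : V})"
    using curve_preimage_open[OF cur(1) UV(1)] curve_preimage_open[OF cur(2) UV(2)] by blast
   moreover have "{t : I. ga1 t : U} Int {t : I. ga2 t : V} <= I - A"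
    using UV(5) unfolding A_def disjnt_def by auto
   ultimately show ?thesis using s UV(3,4) by (intro exI[of _ "{t : I. ga1 t : U} Int {t : I. ga2 t : V}"]) auto
  next
   case True
   hence sJ: "s : ?J" and ne: "y' ga1 s - y' ga2 s ~= 0" using s ga1(2)[of s] by (auto simp: A_def)
   have "isCont (y' ga1) t" "isCont (y' ga2) t" if "t : ?J" for t
    using has_vector_derivative_continuous[OF y(2)[OF ga1(1)]] has_vector_derivative_continuous[OF y(2)[OF ga2]] ga1(2) that by auto
   hence "continuous_on ?J (%t. y' ga1 t - y' ga2 t)" by (intro continuous_on_diff continuous_at_imp_continuous_on) auto
   from continuous_open_preimage[OF this opJ, of "- {0}"]
   have "open (?J Int (%t. y' ga1 t - y' ga2 t) -` (- {0}))" by auto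
   moreover have "?J Int (%t. y' ga1 t - y' ga2 t) -` (- {0}) <= I - A" by (auto simp: A_def)
   ultimately show ?thesis using sJ ne by (intro exI[of _ "?J Int (%t. y' ga1 t - y' ga2 t) -` (- {0})"]) auto
  qed
 qed
 have 0: "0 : A"
 proof -
  have c0: "ga1 0 : fst c" "ga2 0 : fst c" using ga1(2)[OF I(3)] init(1) by simp_all
  have "coord_vec M c (ga1 0) (y' ga1 0) = coord_vec M c (ga1 0) (y' ga2 0)"
   using curve_velocity[OF cur(1) c c0(1) I(3)] curve_velocity[OF cur(2) c c0(2) I(3)] init by (simp add: y'_def)
  hence "y' ga1 0 = y' ga2 0" using vec_coords_coord_vec[OF c c0(1)] by metis
  thus ?thesis using init I by (simp add: A_def)
 qed
 have "A = I"
 proof (rule ccontr)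
  assume "A ~= I"
  moreover have "connected I" using I(2) by (simp add: is_interval_connected_1)
  moreover have "A <= I" by (auto simp: A_def)
  ultimately show False using connectedD[of I A "I - A"] opA opC 0 by blast
 qed
 thus ?thesis using t by (auto simp: A_def)
qed

text \<open>A competing geodesic may live on another interval and leave the chart; the comparison
  takes place on the intersection of the intervals, which contains 0 and 1.\<close>

lemma exp_map_eqI:
 assumes ga: "geodesic_on M g I ga" "!!t. t : I ==> ga t : fst c" and c: "c : charts M"
  and I: "open I" "is_interval I" "{0..1} <= I"
  and init: "ga 0 = p" "velocity M ga 0 = D"
 shows "exp_graph M g p D (ga 1)" "exp_map M g p D = ga 1"
proof -
 show ex: "exp_graph M g p D (ga 1)" unfolding exp_graph_def using ga(1) I init by blast
 show "exp_map M g p D = ga 1"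
  unfolding exp_map_def
 proof (rule the_equality)
  show "exp_graph M g p D (ga 1)" by (rule ex)
  fix q assume "exp_graph M g p D q"
  then obtain I2 ga2 where 2: "open I2" "is_interval I2" "{0..1} <= I2" "geodesic_on M g I2 ga2"
   "ga2 0 = p" "velocity M ga2 0 = D" "ga2 1 = q" unfolding exp_graph_def by blast
  have res: "geodesic_on M g (I Int I2) de" if "geodesic_on M g J de" "I Int I2 <= J" for J de
  proof -
   have cur: "smooth_curve_on M J de" using that by (simp add: geodesic_on_def)
   have "smooth_on {t : I Int I2. de t : fst d} (snd d o de)" if d: "d : charts M" for d
   proof (rule smooth_subset[OF curve_smooth_chart[OF cur d]])
    have "{t : I Int I2. de t : fst d} = (I Int I2) Int {t : J. de t : fst d}" using \<open>I Int I2 <= J\<close> by blast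
    thus "open {t : I Int I2. de t : fst d}" using I(1) 2(1) curve_preimage_open[OF cur chart_open[OF d]] by (simp add: open_Int)
   qed (use \<open>I Int I2 <= J\<close> in blast)
   thus ?thesis using that unfolding geodesic_on_def smooth_curve_on_def by blast
  qed
  have "ga 1 = ga2 1" by (rule geodesic_unique[OF res[OF ga(1)] _ res[OF 2(4)] c, of 1])
    (use ga(2) I 2 init is_interval_Int in auto)
  thus "q = ga 1" using 2 by simp
 qed
qed

end

end

section \<open>Criterion for bounded geometry\<close>

context smooth_mfd
begin

text \<open>\<open>a\<close> and \<open>b\<close> compare the metric with the Euclidean one,
  \<open>K\<close> bounds the Christoffel symbols and their first derivatives. Each inequality among
  the constants has its purpose: \<open>rh * K <= et\<close> gives the exponential map on radius
  \<open>rh\<close>, \<open>1 <= a * rh\<^sup>2\<close> puts the metric unit ball inside that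
  radius, and the last one makes the sectional curvature at most 1.\<close>

definition good_chart :: "'a tensor2 => real => 'a => ('a, 'e) chart => real => real => real => real => bool" where
 "good_chart g et p c rh a b K \<longleftrightarrow> c : charts M & p : fst c & 0 < rh & rh <= 1 & 0 < a & 0 <= K &
  ball (snd c p) (4 * rh) <= chart_img c & rh * K <= et & 1 <= a * rh\<^sup>2 & b * (2 * K + 2 * K\<^sup>2) <= a\<^sup>2 &
  (ALL x:ball (snd c p) (4 * rh). (ALL u. a * (norm u)\<^sup>2 <= loc2 M c g x u u & loc2 M c g x u u <= b * (norm u)\<^sup>2) &
    (ALL u v. norm (christoffel (loc2 M c g) x u v) <= K * norm u * norm v) &
    (ALL h u v. norm (dfield (christoffel (loc2 M c g)) x h u v) <= K * norm h * norm u * norm v))"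

context
 fixes g assumes g: "riemannian_metric M g"
begin

lemma good_chart_curvature:
 assumes gc: "!!p. p : pts M ==> EX c rh a b K. good_chart g et p c rh a b K"
 shows "sectional_curvature_bounded_above M g"
 unfolding sectional_curvature_bounded_above_def
proof (intro exI[of _ 1] ballI allI impI)
 fix c x and u v :: 'e assume c: "c : charts M" and x: "x : chart_img c"
 define p where "p = chart_inv c x"
 have p: "p : fst c" "snd c p = x" using chart_inv_in[OF x] chart_map_inv[OF x] by (auto simp: p_def)
 obtain d rh a b K where gd: "good_chart g et p d rh a b K" using gc p chart_topspace[OF c] by blast
 hence d: "d : charts M" "p : fst d" by (auto simp: good_chart_def)
 interpret local_isometry "snd c ` (fst c Int fst d)" "chart_img d" "loc2 M c g" "loc2 M d g" "tr c d" by (rule tr_isometry[OF g c d(1)])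
 have xS: "x : snd c ` (fst c Int fst d)" using p d by blast
 have e: "tr c d x = snd d p" by (simp add: p_def)
 have in_ball: "snd d p : ball (snd d p) (4 * rh)" using gd by (simp add: good_chart_def)
 have "sectional_curvature (loc2 M d g) (snd d p) u v <= b * (2 * K + 2 * K\<^sup>2) / a\<^sup>2" for u v
  by (rule sectional_curvature_bound[OF G2]) (use gd in_ball in "auto simp: good_chart_def chart_map_in simp del: mem_ball")
 also have "b * (2 * K + 2 * K\<^sup>2) / a\<^sup>2 <= 1" using gd by (simp add: good_chart_def divide_le_eq_1)
 finally show "sectional_curvature (loc2 M c g) x u v <= 1"
  unfolding sectional_curvature_transform[OF xS] e .
qed

text \<open>In the good chart the exponential map is a diffeomorphism on Euclidean radius
  \<open>rh\<close>, which contains the unit ball of the tangent space. Another chart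
  \<open>c'\<close> at \<open>p\<close> only precomposes with the linear map
  \<open>A\<close>.\<close>

lemma good_chart_exp:
 assumes et: "exp_radius_const TYPE('e) et"
  and gc: "good_chart g et p c rh a b K"
 shows "exp_diffeo_on_ball M g p 1"
proof -
 let ?G = "loc2 M c g" and ?x0 = "snd c p"
 have c: "c : charts M" "p : fst c" and rh: "0 < rh" "rh <= 1" "ball ?x0 (4 * rh) <= chart_img c"
  and a: "0 < a" "1 <= a * rh\<^sup>2" and K: "0 <= K" "rh * K <= et"
  and bd: "!!x u. x : ball ?x0 (4 * rh) ==> a * (norm u)\<^sup>2 <= ?G x u u"
   "!!x u v. x : ball ?x0 (4 * rh) ==> norm (christoffel ?G x u v) <= K * norm u * norm v"
   "!!x h u v. x : ball ?x0 (4 * rh) ==> norm (dfield (christoffel ?G) x h u v) <= K * norm h * norm u * norm v"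
  using gc unfolding good_chart_def by blast+
 note metr = metric_on_chart[OF g c(1)]
 have lip: "norm (christoffel ?G x u v - christoffel ?G y u v) <= K * norm (x - y) * norm u * norm v"
  if xy: "x : ball ?x0 (4 * rh)" "y : ball ?x0 (4 * rh)" for x y u v
 proof -
  have "norm (christoffel ?G x u v - christoffel ?G y u v) <= (K * norm u * norm v) * norm (x - y)"
  proof (rule differentiable_bound[OF convex_ball _ _ xy])
   fix z assume z: "z : ball ?x0 (4 * rh)"
   show "((%x. christoffel ?G x u v) has_derivative FD (%x. christoffel ?G x u v) z) (at z within ball ?x0 (4 * rh))"
    by (rule has_derivative_at_withinI[OF smooth_has_derivative[OF smooth_christoffel[OF metr]]]) (use z rh in blast)
   show "onorm (FD (%x. christoffel ?G x u v) z) <= K * norm u * norm v"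
   proof (rule onorm_bound)
    show "norm (dfield (christoffel ?G) z h u v) <= K * norm u * norm v * norm h" for h
     using bd(3)[OF z, where h = h and u = u and v = v] by (simp add: mult_ac)
   qed (use K in simp)
  qed
  thus ?thesis by (simp add: mult_ac)
 qed
 obtain ga ga' :: "'e => real => 'e" where ga:
  "!!u. u : ball 0 rh ==> ga u 0 = ?x0 & ga' u 0 = u & smooth_on {-3/2<..<3/2} (ga u) &
     (ALL t:{-3/2<..<3/2}. ga u t : ball ?x0 (4 * rh) & (ga u has_vector_derivative ga' u t) (at t) &
      (ga' u has_vector_derivative - christoffel ?G (ga u t) (ga' u t) (ga' u t)) (at t))"
  and e: "smooth_on (ball 0 rh) (%u. ga u 1)" "inj_on (%u. ga u 1) (ball 0 rh)"
    "!!u. u : ball 0 rh ==> inj (FD (%u. ga u 1) u)"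
 proof -
  have *: "ALL x:ball ?x0 (4 * rh). bilinear (christoffel ?G x)"
   "ALL u v. smooth_on (ball ?x0 (4 * rh)) (%x. christoffel ?G x u v)"
   using rh(3) bilinear_christoffel[OF metr] smooth_subset[OF smooth_christoffel[OF metr] open_ball rh(3)] by blast+
  show ?thesis
   using et[unfolded exp_radius_const_def, rule_format, of rh K ?x0 "christoffel ?G"] rh K * bd(2) lip that by blast
 qed
 let ?I = "{-3/2<..<3/2::real}"
 have ex: "exp_graph M g p (coord_vec M c p u) (chart_inv c (ga u 1))" "exp_map M g p (coord_vec M c p u) = chart_inv c (ga u 1)"
  if u: "u : ball 0 rh" for u
 proof -
  have sm: "smooth_on ?I (ga u)" and sub: "ga u ` ?I <= chart_img c" using ga[OF u] rh(3) by blast+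
  have geo: "geodesic_on M g ?I (%t. chart_inv c (ga u t))" by (rule chart_geodesic[OF g c(1) sm sub, of "ga' u"]) (use ga[OF u] in blast)+
  have in_c: "chart_inv c (ga u t) : fst c" if "t : ?I" for t by (rule chart_inv_in) (use sub that in blast)
  have i0: "chart_inv c (ga u 0) = p" using ga[OF u] chart_inv_map[OF c] by simp
  have v0: "velocity M (%t. chart_inv c (ga u t)) 0 = coord_vec M c p u"
  proof -
   have "vector_derivative (snd c o (%t. chart_inv c (ga u t))) (at 0) = u"
   proof (rule vector_derivative_at)
    have "(ga u has_vector_derivative u) (at 0)" using ga[OF u] by (auto dest!: bspec[of _ _ 0])
    thus "((snd c o (%t. chart_inv c (ga u t))) has_vector_derivative u) (at 0)"
     by (rule has_vector_derivative_transform_within_open[of _ _ _ ?I]) (use sub in "auto simp: chart_map_inv image_subset_iff")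
   qed
   thus ?thesis
    using curve_velocity[OF chart_curve[OF c(1) sm sub] c(1), of 0] in_c[of 0] i0 by simp
  qed
  note E = exp_map_eqI[OF g geo in_c c(1) _ _ _ i0 v0]
  show "exp_graph M g p (coord_vec M c p u) (chart_inv c (ga u 1))" by (rule E(1)) (auto simp: is_interval_oo)
  show "exp_map M g p (coord_vec M c p u) = chart_inv c (ga u 1)" by (rule E(2)) (auto simp: is_interval_oo)
 qed
 show ?thesis
  unfolding exp_diffeo_on_ball_def Let_def
 proof (intro ballI impI)
  fix c' assume c': "c' : charts M" "p : fst c'"
  define A where "A = FD (tr c' c) (snd c' p)"
  have xS: "snd c' p : snd c' ` (fst c' Int fst c)" using c c' by blast
  have cv: "coord_vec M c' p u = coord_vec M c p (A u)" for u unfolding A_def by (rule coord_vec_change[OF c' c])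
  have linA: "linear A" unfolding A_def by (rule smooth_FD_linear[OF smooth_tr[OF c'(1) c(1)] xS])
  have injA: "inj A" unfolding A_def using tr_deriv_inverse(1)[OF c'(1) c(1) xS] by (metis injI)
  define B where "B = {u. gnorm g p (coord_vec M c' p u) < 1}"
  define E where "E u = exp_map M g p (coord_vec M c' p u)" for u
  define h where "h u = ga (A u) 1" for u
  have x0b: "?x0 : ball ?x0 (4 * rh)" using rh by simp
  have gn: "gnorm g p (coord_vec M c p w) = sqrt (?G ?x0 w w)" for w by (simp add: gnorm_def loc2_def Let_def chart_inv_map[OF c])
  have Brh: "A u : ball 0 rh" if "u : B" for u
  proof -
   have "?G ?x0 (A u) (A u) < 1" using that by (simp add: B_def cv gn)
   hence "a * (norm (A u))\<^sup>2 < a * rh\<^sup>2" using bd(1)[OF x0b, of "A u"] a(2) by linarith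
   hence "(norm (A u))\<^sup>2 < rh\<^sup>2" using a(1) by simp
   hence "norm (A u) < rh" by (rule power2_less_imp_less) (use rh(1) in simp)
   thus ?thesis by simp
  qed
  have openB: "open B"
  proof -
   have "smooth_on UNIV (%u. ?G ?x0 (A u) (A u))"
   proof (rule smooth_bilinear_apply[where L = "%_. ?G ?x0"])
    show "bilinear (?G ?x0)" by (rule metric_onD(2)[OF metr chart_map_in[OF c(2)]])
   qed (auto intro: smooth_const smooth_linear[OF linA])
   from open_vimage[OF open_lessThan smooth_cont[OF this], of 1]
   show ?thesis by (simp add: B_def cv gn vimage_def)
  qed
  have Eh: "E u = chart_inv c (h u)" if "u : B" for u
   unfolding E_def cv h_def by (rule ex(2)[OF Brh[OF that]])
  have h_img: "h u : chart_img c" if "u : B" for u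
   using ga[OF Brh[OF that]] rh(3) by (auto simp: h_def dest!: bspec[of _ _ 1])
  have cE: "snd c (E u) = h u" "E u : fst c" if "u : B" for u
   using Eh[OF that] chart_map_inv[OF h_img[OF that]] chart_inv_in[OF h_img[OF that]] by auto
  have smA: "smooth_on B A" by (rule smooth_linear[OF linA openB])
  have smh: "smooth_on B h" unfolding h_def by (rule smooth_comp[OF e(1) smA]) (use Brh in blast)
  have injh: "inj_on h B"
   using e(2) injA Brh unfolding h_def inj_on_def by blast
  have dh: "inj (FD h u)" if u: "u : B" for u
  proof -
   have "(h has_derivative (%v. FD (%u. ga u 1) (A u) (A v))) (at u)"
    unfolding h_def by (rule has_derivative_compose[OF linear_imp_has_derivative[OF linA] smooth_has_derivative[OF e(1) Brh[OF u]]])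
   hence "FD h u = FD (%u. ga u 1) (A u) o A" by (simp add: has_derivative_frechet o_def)
   thus ?thesis using inj_compose[OF e(3)[OF Brh[OF u]] injA] by simp
  qed
  note invh = smooth_inverse_function[OF smh injh dh]
  have injE: "inj_on E B" using injh cE unfolding inj_on_def by metis
  have EB: "E ` B = {q : fst c. snd c q : h ` B}"
  proof safe
   fix u assume u: "u : B"
   thus "E u : fst c" by (rule cE(2))
   show "snd c (E u) : h ` B" unfolding cE(1)[OF u] using u by (rule imageI)
  next
   fix q u assume q: "q : fst c" "snd c q = h u" and u: "u : B"
   have "q = E u" by (rule inj_onD[OF chart_inj[OF c(1)] _ q(1) cE(2)[OF u]]) (simp add: cE(1)[OF u] q(2))
   thus "q : E ` B" using u by blast
  qed
  have openEB: "opn M (E ` B)" unfolding EB by (rule chart_preimage_open[OF c(1) invh(1)])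
  show "(ALL u:{u. gnorm g p (coord_vec M c' p u) < 1}. EX q. exp_graph M g p (coord_vec M c' p u) q) &
   inj_on (%u. exp_map M g p (coord_vec M c' p u)) {u. gnorm g p (coord_vec M c' p u) < 1} &
   opn M ((%u. exp_map M g p (coord_vec M c' p u)) ` {u. gnorm g p (coord_vec M c' p u) < 1}) &
   (ALL d:charts M. smooth_on {u : {u. gnorm g p (coord_vec M c' p u) < 1}. exp_map M g p (coord_vec M c' p u) : fst d}
     (snd d o (%u. exp_map M g p (coord_vec M c' p u))) &
    smooth_on (snd d ` (fst d Int (%u. exp_map M g p (coord_vec M c' p u)) ` {u. gnorm g p (coord_vec M c' p u) < 1}))
     (inv_into {u. gnorm g p (coord_vec M c' p u) < 1} (%u. exp_map M g p (coord_vec M c' p u)) o chart_inv d))"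
   unfolding E_def[symmetric] B_def[symmetric]
  proof (intro conjI ballI)
   show "EX q. exp_graph M g p (coord_vec M c' p u) q" if "u : B" for u unfolding cv using ex(1)[OF Brh[OF that]] by blast
   show "inj_on E B" by (rule injE)
   show "opn M (E ` B)" by (rule openEB)
   fix d assume d: "d : charts M"
   let ?T = "{u : B. E u : fst d}" and ?S = "snd c ` (fst c Int fst d)"
   have T: "?T = B Int h -` ?S" unfolding chart_image_eq[OF c(1)] using Eh h_img by auto
   have "open ?T" unfolding T by (rule continuous_open_preimage[OF smooth_cont[OF smh] openB chart_image_open[OF c(1) chart_open[OF d]]])
   hence "smooth_on ?T (%u. tr c d (h u))" by (intro smooth_comp[OF smooth_tr[OF c(1) d] smooth_subset[OF smh]]) (use T in auto)
   thus "smooth_on ?T (snd d o E)" by (rule smooth_cong) (simp add: Eh)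
   let ?U = "snd d ` (fst d Int E ` B)"
   have opU: "open ?U" by (rule chart_image_open[OF d openEB])
   have sub: "?U <= snd d ` (fst d Int fst c)" using cE(2) by blast
   have trU: "tr d c y : h ` B & inv_into B E (chart_inv d y) = inv_into B h (tr d c y)" if y: "y : ?U" for y
   proof -
    obtain u where u: "u : B" "E u : fst d" "y = snd d (E u)" using y by blast
    have "chart_inv d y = E u" using chart_inv_map[OF d u(2)] u(3) by simp
    thus ?thesis using u(1) cE(1)[OF u(1)] inv_into_f_f[OF injE u(1)] inv_into_f_f[OF injh u(1)] by simp
   qed
   have "smooth_on ?U (%y. inv_into B h (tr d c y))" by (rule smooth_comp[OF invh(2) smooth_subset[OF smooth_tr[OF d c(1)] opU sub]], assumption)
     (rule image_subsetI, rule conjunct1[OF trU])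
   thus "smooth_on ?U (inv_into B E o chart_inv d)" by (rule smooth_cong) (use trU in auto)
  qed
 qed
qed

section \<open>Lengths of curves, distances and completeness\<close>

lemma velocity_cont:
 assumes ga: "smooth_curve_on M UNIV ga"
 shows "continuous_on UNIV (%t. gnorm g (ga t) (velocity M ga t))"
proof (rule continuous_at_imp_continuous_on, rule ballI)
 fix t :: real
 have "ga t : pts M" using ga by (auto simp: smooth_curve_on_def)
 then obtain c where c: "c : charts M" "ga t : fst c" by (rule chart_at)
 let ?T = "{t : UNIV. ga t : fst c}" and ?y = "snd c o ga"
 have s: "smooth_on ?T ?y" by (rule curve_smooth_chart[OF ga c(1)])
 note metr = metric_on_chart[OF g c(1)]
 have "smooth_on ?T (%t. loc2 M c g (?y t) (vector_derivative ?y (at t)) (vector_derivative ?y (at t)))"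
 proof (rule smooth_bilinear_apply[where L = "%t. loc2 M c g (?y t)", OF _ _ smooth_vector_derivative[OF s] smooth_vector_derivative[OF s]])
  show "smooth_on ?T (%t. loc2 M c g (?y t) v w)" for v w by (rule smooth_comp[OF metric_onD(5)[OF metr] s]) (auto simp: chart_map_in)
 qed (auto intro!: metric_onD(2)[OF metr] simp: chart_map_in)
 hence "continuous_on ?T (%t. sqrt (loc2 M c g (?y t) (vector_derivative ?y (at t)) (vector_derivative ?y (at t))))"
  by (intro continuous_intros smooth_cont)
 hence "continuous_on ?T (%t. gnorm g (ga t) (velocity M ga t))"
  by (rule continuous_on_eq) (simp add: curve_velocity[OF ga c(1)] gnorm_def loc2_def Let_def chart_inv_map[OF c(1)])
 thus "isCont (%t. gnorm g (ga t) (velocity M ga t)) t"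
  using c(2) smooth_open[OF s] by (simp add: continuous_on_eq_continuous_at)
qed

lemma gnorm_velocity_nonneg:
 assumes ga: "smooth_curve_on M UNIV ga" shows "0 <= gnorm g (ga t) (velocity M ga t)"
proof -
 have "ga t : pts M" using ga by (auto simp: smooth_curve_on_def)
 then obtain c where c: "c : charts M" "ga t : fst c" by (rule chart_at)
 have "0 <= loc2 M c g (snd c (ga t)) w w" for w
  using metric_onD(4)[OF metric_on_chart[OF g c(1)] chart_map_in[OF c(2)], of w]
   bilinear_lzero[OF metric_onD(2)[OF metric_on_chart[OF g c(1)] chart_map_in[OF c(2)]]] by (cases "w = 0") (auto intro: less_imp_le)
 thus ?thesis using curve_velocity[OF ga c] by (simp add: gnorm_def loc2_def Let_def chart_inv_map[OF c])
qed

text \<open>As long as the curve stays in the ball, its coordinate displacement is at most its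
  length divided by \<open>a\<close>. This confines it to a closed ball of radius
  \<open>L / a < r\<close>, so a first exit time \<open>T\<close> cannot exist.\<close>

lemma short_curve:
 assumes c: "c : charts M" and x1: "ball x1 r <= chart_img c" "0 < r" and a: "0 < a"
  and G: "!!x u. x : ball x1 r ==> a\<^sup>2 * (norm u)\<^sup>2 <= loc2 M c g x u u"
  and ga: "smooth_curve_on M UNIV ga" "ga 0 = chart_inv c x1" and L: "curve_length M g ga < a * r"
 shows "ga 1 : fst c & a * norm (snd c (ga 1) - x1) <= curve_length M g ga"
proof -
 define L where "L = curve_length M g ga"
 define N where "N = {q : fst c. snd c q : ball x1 r}"
 have opN: "opn M N" unfolding N_def by (rule chart_preimage_open[OF c open_ball])
 let ?y = "snd c o ga" and ?v = "%t. gnorm g (ga t) (velocity M ga t)"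
 have x1c: "x1 : chart_img c" using x1 by auto
 have vint: "?v integrable_on {s..t}" for s t
  by (rule integrable_continuous_interval[OF continuous_on_subset[OF velocity_cont[OF ga(1)] subset_UNIV]])
 have L0: "0 <= L" unfolding L_def curve_length_def by (rule integral_nonneg[OF vint]) (rule gnorm_velocity_nonneg[OF ga(1)])
 have est: "a * norm (?y t - x1) <= L" if t: "0 <= t" "t <= 1" and inN: "!!s. 0 <= s ==> s <= t ==> ga s : N" for t
 proof -
  have d: "(?y has_vector_derivative vector_derivative ?y (at s)) (at s)" if "0 <= s" "s <= t" for s
  proof -
   have "s : {t : UNIV. ga t : fst c}" using inN[OF that] by (simp add: N_def)
   from smooth_differentiable[OF curve_smooth_chart[OF ga(1) c] this]
   show ?thesis using vector_derivative_works by blast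
  qed
  have "((%s. vector_derivative ?y (at s)) has_integral ?y t - ?y 0) {0..t}"
   by (rule fundamental_theorem_of_calculus[OF _ has_vector_derivative_at_within[OF d]]) (use t in auto)
  hence i: "(%s. vector_derivative ?y (at s)) integrable_on {0..t}" and e: "?y t - ?y 0 = integral {0..t} (%s. vector_derivative ?y (at s))"
   by (auto simp: integral_unique has_integral_integrable)
  have "norm (?y t - ?y 0) <= integral {0..t} (%s. ?v s / a)"
   unfolding e
  proof (rule integral_norm_bound_integral[OF i])
   show "(%s. ?v s / a) integrable_on {0..t}" using vint by (intro integrable_on_divide) 
   fix s assume s: "s : {0..t}"
   hence sN: "ga s : fst c" "snd c (ga s) : ball x1 r" using inN[of s] by (auto simp: N_def)
   have "?v s = sqrt (loc2 M c g (snd c (ga s)) (vector_derivative ?y (at s)) (vector_derivative ?y (at s)))"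
    by (simp add: curve_velocity[OF ga(1) c sN(1)] gnorm_def loc2_def Let_def chart_inv_map[OF c sN(1)])
   moreover have "a * norm (vector_derivative ?y (at s)) <= ..." by (rule real_le_rsqrt) (use G[OF sN(2)] in "simp add: power_mult_distrib")
   ultimately show "norm (vector_derivative ?y (at s)) <= ?v s / a" using a by (simp add: le_divide_eq mult.commute)
  qed
  also have "... <= L / a"
  proof -
   have "integral {0..t} ?v <= L"
    unfolding L_def curve_length_def by (rule integral_subset_le[OF _ vint vint]) (use t gnorm_velocity_nonneg[OF ga(1)] in auto)
   thus ?thesis using a by (simp add: divide_right_mono)
  qed
  finally have "a * norm (?y t - ?y 0) <= L" using a by (simp add: le_divide_eq mult.commute)
  moreover have "?y 0 = x1" by (simp add: ga(2) chart_map_inv[OF x1c])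
  ultimately show ?thesis by simp
 qed
 have all: "ga t : N" if t: "t : {0..1}" for t
 proof (rule ccontr)
  assume nt: "ga t ~: N"
  let ?B = "{0..1} Int - {t : UNIV. ga t : N}"
  have "closed ?B" by (intro closed_Int closed_Compl curve_preimage_open[OF ga(1) opN]) auto
  hence "compact ?B"
   unfolding compact_eq_bounded_closed using bounded_subset[OF bounded_closed_interval, of ?B 0 1] by blast
  moreover have "?B ~= {}" using t nt by blast
  ultimately have "EX T:?B. ALL s:?B. T <= s" by (rule compact_attains_inf)
  then obtain T where T: "T : ?B" "!!s. s : ?B ==> T <= s" by blast
  have "ga 0 : N" using x1 chart_inv_in[OF x1c] chart_map_inv[OF x1c] by (simp add: N_def ga(2))
  hence T0: "0 < T" using T(1) by (cases "T = 0") auto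
  have below: "ga s : N" if "0 <= s" "s < T" for s using T(1) T(2)[of s] that by fastforce
  have close: "?y s : cball x1 (L / a)" if "0 <= s" "s < T" for s
   using est[of s] below that T(1) a by (auto simp: dist_norm norm_minus_commute le_divide_eq mult.commute)
  have La: "L / a < r" using L a by (simp add: L_def divide_less_eq mult.commute)
  define C where "C = chart_inv c ` cball x1 (L / a)"
  have cb: "cball x1 (L / a) <= ball x1 r" using La by auto
  have CN: "C <= N"
  proof
   fix q assume "q : C"
   then obtain x where x: "x : cball x1 (L / a)" "q = chart_inv c x" by (auto simp: C_def)
   hence "x : ball x1 r" "x : chart_img c" using cb x1 by auto
   thus "q : N" using x(2) by (simp add: N_def chart_inv_in chart_map_inv del: mem_ball)
  qed
  \<comment> \<open>At the exit time the curve may have left the chart domain, where coordinates say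
    nothing. As a compact subset of a Hausdorff space \<open>C\<close> is closed in the manifold, so
    the curve would be outside \<open>C\<close> already shortly before \<open>T\<close>, against
    \<open>close\<close>.\<close>
  have "closedin (mtop M) C"
  proof -
   have hm: "homeomorphic_map (subtopology (mtop M) (fst c)) (top_of_set (chart_img c)) (snd c)" by (rule chart_homeo[OF c])
   have "compactin (subtopology (mtop M) (fst c)) C \<longleftrightarrow> compactin (top_of_set (chart_img c)) (snd c ` C)"
    by (rule homeomorphic_map_compactness[OF hm, symmetric]) (use CN chart_topspace[OF c] in "auto simp: N_def")
   moreover have "snd c ` C = cball x1 (L / a)"
   proof -
    have "snd c (chart_inv c x) = x" if "x : cball x1 (L / a)" for x by (rule chart_map_inv) (use that cb x1(1) in blast)
    thus ?thesis unfolding C_def image_image by simp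
   qed
   moreover have "compactin (top_of_set (chart_img c)) (cball x1 (L / a))"
    using cb x1(1) by (simp add: compactin_subtopology)
   ultimately have "compactin (mtop M) C" by (simp add: compactin_subtopology)
   thus ?thesis using mfd compactin_imp_closedin unfolding smooth_manifold_def by blast
  qed
  hence opC: "open {t : UNIV. ga t : pts M - C}" by (intro curve_preimage_open[OF ga(1)]) blast
  have "ga T ~: N" using T(1) by simp
  hence "T : {t : UNIV. ga t : pts M - C}" using CN ga(1) by (auto simp: smooth_curve_on_def)
  then obtain e where e: "0 < e" "ball T e <= {t : UNIV. ga t : pts M - C}" using opC open_contains_ball by blast
  define s where "s = max 0 (T - e / 2)"
  have s: "0 <= s" "s < T" "s : ball T e" using e T0 by (auto simp: s_def dist_real_def)
  have "ga s : fst c" using below[OF s(1,2)] by (simp add: N_def)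
  hence "ga s : C" unfolding C_def using close[OF s(1,2)] chart_inv_map[OF c] by (metis comp_apply image_eqI)
  thus False using e(2) s(3) by blast
 qed
 thus ?thesis using est[of 1] by (auto simp: N_def L_def)
qed

text \<open>Curves have to be smooth on the whole real line. The parameter \<open>sg\<close> runs
  from 0 to 1 on the unit interval and stays between these values at all times, so the curve remains
  on the segment. Its derivative is bounded by pi, whence the factor 4.\<close>

lemma segment_dist:
 assumes c: "c : charts M" and S: "convex S" "S <= chart_img c" and b: "0 <= b"
  and G: "!!x u. x : S ==> loc2 M c g x u u <= b\<^sup>2 * (norm u)\<^sup>2" and xy: "x : S" "y : S"
 shows "riemannian_dist M g (chart_inv c x) (chart_inv c y) <= ereal (4 * b * norm (y - x))"
proof -
 define sg where "sg t = (sin (pi * t / 2))\<^sup>2" for t :: real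
 define z where "z t = x + sg t *R (y - x)" for t
 define z' where "z' t = (pi * sin (pi * t / 2) * cos (pi * t / 2)) *R (y - x)" for t
 have sg01: "0 <= sg t" "sg t <= 1" for t by (auto simp: sg_def abs_square_le_1)
 have zS: "z t : S" for t
 proof -
  have "(1 - sg t) *R x + sg t *R y : S" using convexD_alt[OF S(1) xy sg01[of t]] .
  thus ?thesis by (simp add: z_def algebra_simps)
 qed
 have "smooth_on UNIV (%t::real. pi * t / 2)"
  using smooth_linear[of "%t::real. pi * t / 2" UNIV] by (simp add: linear_iff field_simps)
 hence sm: "smooth_on UNIV z"
  unfolding z_def sg_def power2_eq_square by (intro smooth_add smooth_scaleR smooth_const smooth_mult open_UNIV smooth_comp[OF smooth_on_sin]) auto
 have d: "(z has_vector_derivative z' t) (at t)" for t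
  unfolding z_def z'_def sg_def by (auto intro!: derivative_eq_intros simp: has_vector_derivative_def fun_eq_iff algebra_simps)
 let ?ga = "%t. chart_inv c (z t)"
 have cur: "smooth_curve_on M UNIV ?ga" by (rule chart_curve[OF c sm]) (use zS S in blast)
 have zc: "z t : chart_img c" for t using zS S(2) by blast
 have v: "gnorm g (?ga t) (velocity M ?ga t) <= 4 * b * norm (y - x)" for t
 proof -
  have "vector_derivative (snd c o ?ga) (at t) = z' t"
   using vector_derivative_at[OF d[of t]] zc by (simp add: o_def chart_map_inv)
  hence "gnorm g (?ga t) (velocity M ?ga t) = sqrt (loc2 M c g (z t) (z' t) (z' t))"
   using curve_velocity[OF cur c chart_inv_in[OF zc]] by (simp add: gnorm_def loc2_def Let_def)
  also have "... <= b * norm (z' t)"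
   using real_sqrt_le_mono[OF G[OF zS[of t], of "z' t"]] b by (simp add: real_sqrt_mult)
  also have "b * norm (z' t) <= b * (4 * norm (y - x))"
  proof (rule mult_left_mono[OF _ b])
   have "\<bar>pi * sin (pi * t / 2) * cos (pi * t / 2)\<bar> <= 4 * 1 * 1"
    unfolding abs_mult using pi_less_4 by (intro mult_mono) auto
   thus "norm (z' t) <= 4 * norm (y - x)" unfolding z'_def norm_scaleR by (intro mult_right_mono) auto
  qed
  finally show ?thesis by simp
 qed
 have "curve_length M g ?ga <= integral {0..1} (%t::real. 4 * b * norm (y - x))"
  unfolding curve_length_def
  by (rule integral_le[OF integrable_continuous_interval[OF continuous_on_subset[OF velocity_cont[OF cur] subset_UNIV]]]) (use v in auto)
 hence L: "curve_length M g ?ga <= 4 * b * norm (y - x)" by simp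
 have "riemannian_dist M g (chart_inv c x) (chart_inv c y) <= ereal (curve_length M g ?ga)"
  unfolding riemannian_dist_def by (rule INF_lower) (use cur in "simp add: z_def sg_def")
 also have "... <= ereal (4 * b * norm (y - x))" using L by simp
 finally show ?thesis .
qed

lemma riemannian_dist_nonneg: "0 <= riemannian_dist M g p q"
 unfolding riemannian_dist_def
proof (rule INF_greatest)
 fix ga assume "ga : {ga. smooth_curve_on M UNIV ga & ga 0 = p & ga 1 = q}"
 hence ga: "smooth_curve_on M UNIV ga" by simp
 have "0 <= curve_length M g ga" unfolding curve_length_def
  by (rule integral_nonneg[OF integrable_continuous_interval[OF continuous_on_subset[OF velocity_cont[OF ga] subset_UNIV]]])
   (rule gnorm_velocity_nonneg[OF ga])
 thus "0 <= ereal (curve_length M g ga)" by simp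
qed

lemma dist_chart:
 assumes c: "c : charts M" and x1: "ball x1 r <= chart_img c" "0 < r" and a: "0 < a"
  and G: "!!x u. x : ball x1 r ==> a\<^sup>2 * (norm u)\<^sup>2 <= loc2 M c g x u u"
  and e: "riemannian_dist M g (chart_inv c x1) q < ereal e" "e <= a * r"
 shows "q : fst c & a * norm (snd c q - x1) < e"
proof -
 obtain ga where ga: "smooth_curve_on M UNIV ga" "ga 0 = chart_inv c x1" "ga 1 = q" "ereal (curve_length M g ga) < ereal e"
  using e(1) unfolding riemannian_dist_def INF_less_iff by blast
 show ?thesis
  using short_curve[OF c x1 a G ga(1,2)] ga(3,4) e(2) by auto
qed

text \<open>From some index on, all points are within distance 1/2 of one of them, hence within
  \<open>rh / 2\<close> of the centre of its good chart. There distances control coordinates, the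
  coordinates converge, and segments give back convergence in the distance. The metric size of good
  charts does not depend on the point.\<close>

lemma good_chart_complete:
 assumes gc: "!!p. p : pts M ==> EX c rh a b K. good_chart g et p c rh a b K"
 shows "complete_metric M g"
 unfolding complete_metric_def
proof (intro allI impI)
 fix s :: "nat => 'a"
 assume A: "range s <= pts M & (ALL e>0. EX N. ALL m>=N. ALL n>=N. riemannian_dist M g (s m) (s n) < ereal e)"
 hence A2: "EX N. ALL m>=N. ALL n>=N. riemannian_dist M g (s m) (s n) < ereal e" if "0 < e" for e
  using that by blast
 obtain N where N: "!!m n. m >= N ==> n >= N ==> riemannian_dist M g (s m) (s n) < ereal (1/2)"
  using A2[of "1/2"] by auto
 obtain c rh a b K where gd: "good_chart g et (s N) c rh a b K" using gc[of "s N"] A by blast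
 define x0 where "x0 = snd c (s N)"
 define B where "B = ball x0 (4 * rh)"
 have c: "c : charts M" "s N : fst c" and rh: "0 < rh" "B <= chart_img c" and a: "0 < a" "1 <= a * rh\<^sup>2"
  and bd: "!!x u. x : B ==> a * (norm u)\<^sup>2 <= loc2 M c g x u u" "!!x u. x : B ==> loc2 M c g x u u <= b * (norm u)\<^sup>2"
  using gd unfolding good_chart_def B_def x0_def by blast+
 have sa: "0 < sqrt a" "(sqrt a)\<^sup>2 = a" using a by auto
 have sar: "1 <= sqrt a * rh"
  using real_sqrt_le_mono[OF a(2)] rh(1) by (simp add: real_sqrt_mult)
 have step: "q : fst c & sqrt a * norm (snd c q - x1) < e"
  if "norm (x1 - x0) < rh" "riemannian_dist M g (chart_inv c x1) q < ereal e" "e <= 1" for x1 q e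
 proof -
  have sub: "ball x1 rh <= B"
  proof
   fix z assume "z : ball x1 rh"
   hence "norm (z - x1) < rh" by (simp add: dist_norm norm_minus_commute)
   hence "norm (z - x0) < 2 * rh" using norm_triangle_lt[of "z - x1" "x1 - x0" "2 * rh"] that(1) by simp
   thus "z : B" using rh(1) by (simp add: B_def dist_norm norm_minus_commute)
  qed
  show ?thesis by (rule dist_chart[OF c(1) order_trans[OF sub rh(2)] rh(1) sa(1) _ that(2)]) (use sub bd(1) sa sar that(3) in auto)
 qed
 have x0: "chart_inv c x0 = s N" by (simp add: x0_def chart_inv_map[OF c])
 define x where "x n = snd c (s n)" for n
 have near: "s n : fst c & norm (x n - x0) < rh / 2 & chart_inv c (x n) = s n" if n: "n >= N" for n
 proof -
  have "s n : fst c & sqrt a * norm (x n - x0) < 1/2"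
   unfolding x_def by (rule step) (use rh N[OF order_refl n] x0 in auto)
  moreover from this have "sqrt a * norm (x n - x0) < sqrt a * (rh / 2)" using sar by simp
  hence "norm (x n - x0) < rh / 2" using sa(1) by simp
  ultimately show ?thesis using chart_inv_map[OF c(1)] by (simp add: x_def)
 qed
 have "Cauchy x"
  unfolding Cauchy_def
 proof (intro allI impI)
  fix e :: real assume e: "0 < e"
  hence e': "0 < min 1 (sqrt a * e)" using sa by simp
  then obtain N' where N': "!!m n. m >= N' ==> n >= N' ==> riemannian_dist M g (s m) (s n) < ereal (min 1 (sqrt a * e))"
   using A2[OF e'] by blast
  have "dist (x m) (x n) < e" if "m >= max N N'" "n >= max N N'" for m n
  proof -
   have "s m : fst c & sqrt a * norm (snd c (s m) - x n) < min 1 (sqrt a * e)" by (rule step) (use near[of n] N'[of n m] that rh(1) in auto)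
   hence "sqrt a * norm (x m - x n) < sqrt a * e" by (simp add: x_def)
   thus ?thesis using sa(1) by (simp add: dist_norm)
  qed
  thus "EX M. ALL m>=M. ALL n>=M. dist (x m) (x n) < e" by blast
 qed
 then obtain l where l: "x \<longlonglongrightarrow> l" by (auto simp: Cauchy_convergent_iff convergent_def)
 have lB: "norm (l - x0) <= rh / 2"
 proof (rule Lim_bounded)
  show "(%n. norm (x n - x0)) \<longlonglongrightarrow> norm (l - x0)" by (intro tendsto_intros l)
  show "ALL n>=N. norm (x n - x0) <= rh / 2" using near by (simp add: less_imp_le)
 qed
 have lS: "l : B" using lB rh(1) by (simp add: B_def dist_norm norm_minus_commute)
 have b: "0 <= b"
 proof -
  obtain w :: 'e where "w : Basis" using nonempty_Basis by blast
  thus ?thesis using bd(1)[OF lS, of w] bd(2)[OF lS, of w] a(1) by simp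
 qed
 have le: "riemannian_dist M g (s n) (chart_inv c l) <= ereal (4 * sqrt b * norm (l - x n))" if n: "n >= N" for n
 proof -
  have "x n : B" using near[OF n] rh(1) by (simp add: B_def dist_norm norm_minus_commute)
  from segment_dist[OF c(1) _ rh(2) _ _ this lS, of "sqrt b"] show ?thesis
   using bd(2) b near[OF n] by (simp add: B_def)
 qed
 have lim: "(%n. ereal (4 * sqrt b * norm (l - x n))) \<longlonglongrightarrow> 0"
 proof -
  have "(%n. 4 * sqrt b * norm (l - x n)) \<longlonglongrightarrow> 4 * sqrt b * norm (l - l)" by (intro tendsto_intros l)
  thus ?thesis by (simp add: zero_ereal_def)
 qed
 have "(%n. riemannian_dist M g (s n) (chart_inv c l)) \<longlonglongrightarrow> 0" by (rule tendsto_sandwich[OF _ _ tendsto_const lim])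
   (use riemannian_dist_nonneg le in "auto simp: eventually_sequentially intro: exI[of _ N]")
 moreover have "chart_inv c l : pts M" using chart_inv_in[of l c] chart_topspace[OF c(1)] lS rh(2) by blast
 ultimately show "EX p:pts M. (%n. riemannian_dist M g (s n) p) \<longlonglongrightarrow> 0" by blast
qed

end

lemma good_charts_bounded_geometry:
 obtains et where "0 < et" "!!g. riemannian_metric M g ==>
  (ALL p:pts M. EX c rh a b K. good_chart g et p c rh a b K) ==>
  complete_metric M g & sectional_curvature_bounded_above M g & ereal 1 <= inj_radius M g"
proof (rule local_exponential[where 'e = 'e])
 fix et :: real assume et0: "0 < et" and et: "exp_radius_const TYPE('e) et"
 show thesis
 proof (rule that[OF et0], intro conjI)
  fix g assume g: "riemannian_metric M g" and gc: "ALL p:pts M. EX c rh a b K. good_chart g et p c rh a b K"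
  show "complete_metric M g" by (rule good_chart_complete[OF g]) (use gc in blast)
  show "sectional_curvature_bounded_above M g" by (rule good_chart_curvature[OF g]) (use gc in blast)
  show "ereal 1 <= inj_radius M g"
   unfolding inj_radius_def
  proof (rule INF_greatest)
   fix p assume "p : pts M"
   then obtain c rh a b K where "good_chart g et p c rh a b K" using gc by blast
   hence "exp_diffeo_on_ball M g p 1" by (rule good_chart_exp[OF g et])
   thus "ereal 1 <= inj_radius_at M g p" unfolding inj_radius_at_def by (intro SUP_upper) simp
  qed
 qed
qed

end

section \<open>Compatible complex structures\<close>

definition polA :: "('e::euclidean_space => 'e => real) => ('e => 'e => real) => 'e => 'e" where
 "polA om h u = inv (gram h) (gram om u)"

text \<open>For a number x > 0 the integral of 1 / (sin^2 + x cos^2) over [0, pi/2] is pi / (2 sqrt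
  x); here x is replaced by the positive operator -A^2.\<close>

definition polT :: "('e::euclidean_space => 'e => real) => ('e => 'e => real) => real => 'e => 'e" where
 "polT om h fi w = (sin fi)\<^sup>2 *R w - (cos fi)\<^sup>2 *R polA om h (polA om h w)"

text \<open>The complex structure \<open>A (- A\<^sup>2) powr (-1/2)\<close> of the polar decomposition of \<open>A = h\<^sup>-\<^sup>1 \<omega>\<close>; the
 integral formula for the inverse square root makes its smooth dependence on \<open>\<omega>\<close> and \<open>h\<close> evident.\<close>

definition polJ :: "('e::euclidean_space => 'e => real) => ('e => 'e => real) => 'e => 'e" where
 "polJ om h u = polA om h ((2 / pi) *R integral {0..pi/2} (%fi. inv (polT om h fi) u))"

locale symp_pair =
 fixes om h :: "'e::euclidean_space => 'e => real"
 assumes om: "bilinear om" "!!u. om u u = 0" "nondegenerate om"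
  and h: "bilinear h" "!!u v. h u v = h v u" "!!u. u ~= 0 ==> 0 < h u u"
begin

abbreviation "A == polA om h"

lemma nondeg_h: "nondegenerate h"
 unfolding nondegenerate_def using h(3) by (metis less_irrefl)

lemma om_anti: "om u v = - om v u"
proof -
 have "om (u + v) (u + v) = om u v + om v u"
  unfolding bilinear_ladd[OF om(1)] bilinear_radd[OF om(1)] by (simp add: om(2))
 thus ?thesis unfolding om(2) by linarith
qed

lemma hA: "h (A u) v = om u v"
proof -
 have "h (A u) v = gram h (A u) \<bullet> v" by (rule gram_inner[OF h(1), symmetric])
 also have "gram h (A u) = gram om u"
  unfolding polA_def by (rule linear_inj_inv(2)[OF linear_gram[OF h(1)] inj_gram[OF h(1) nondeg_h]])
 finally show ?thesis by (simp add: gram_inner[OF om(1)])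
qed

lemma h_ext: "(!!z. h w z = h w' z) ==> w = w'"
 using h(3)[of "w - w'"] by (fastforce simp: bilinear_lsub[OF h(1)])

lemma A_eqI: "(!!z. h w z = om u z) ==> A u = w" by (rule h_ext) (simp add: hA)

lemma linA: "linear A" by (rule linearI; rule A_eqI)
  (simp_all add: bilinear_ladd[OF h(1)] bilinear_lmul[OF h(1)] bilinear_ladd[OF om(1)] bilinear_lmul[OF om(1)] hA)

lemma hA_anti: "h (A u) v = - h u (A v)" by (metis hA om_anti h(2))

text \<open>The value pi/2 of \<open>ta\<close> gives \<open>polT\<close>, the value 0 the identity.
  The path between them replaces a diagonalisation of \<open>A\<close> in the proof that the
  integral is an inverse square root.\<close>

definition T :: "real => real => 'e => 'e" where
 "T fi ta w = ((sin fi)\<^sup>2 + (cos fi)\<^sup>2 * (cos ta)\<^sup>2) *R w - ((cos fi)\<^sup>2 * (sin ta)\<^sup>2) *R A (A w)"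

lemma polT_T: "polT om h fi = T fi (pi/2)" by (simp add: polT_def T_def fun_eq_iff)

lemma A_inj: "A w = 0 ==> w = 0"
 using hA[of w] om(3) bilinear_lzero[OF h(1)] by (auto simp: nondegenerate_def)

lemma linT: "linear (T fi ta)" by (rule linearI) (simp_all add: T_def linear_add[OF linA] linear_cmul[OF linA] algebra_simps)

lemma T_pos:
 assumes "w ~= 0" shows "0 < h (T fi ta w) w"
proof -
 have hw: "0 < h w w" "0 < h (A w) (A w)" using assms h(3) A_inj by blast+
 have eq: "h (T fi ta w) w = ((sin fi)\<^sup>2 + (cos fi)\<^sup>2 * (cos ta)\<^sup>2) * h w w + ((cos fi)\<^sup>2 * (sin ta)\<^sup>2) * h (A w) (A w)"
  by (simp add: T_def bilinear_lsub[OF h(1)] bilinear_lmul[OF h(1)] hA_anti[of "A w"])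
 define m where "m = min (h w w) (h (A w) (A w))"
 have "((sin fi)\<^sup>2 + (cos fi)\<^sup>2 * (cos ta)\<^sup>2) * m + ((cos fi)\<^sup>2 * (sin ta)\<^sup>2) * m <= h (T fi ta w) w"
  unfolding eq by (intro add_mono mult_left_mono) (auto simp: m_def)
 moreover have "((sin fi)\<^sup>2 + (cos fi)\<^sup>2 * (cos ta)\<^sup>2) + ((cos fi)\<^sup>2 * (sin ta)\<^sup>2) = 1"
  unfolding add.assoc distrib_left[symmetric] by simp
 ultimately have "m <= h (T fi ta w) w" by (metis distrib_right mult_1)
 thus ?thesis using hw by (auto simp: m_def min_le_iff_disj)
qed

lemma injT: "inj (T fi ta)"
 using linear_injective_0[OF linT] T_pos bilinear_lzero[OF h(1)] by (metis less_irrefl)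

abbreviation "R fi ta == inv (T fi ta)"

lemmas linR = linear_inj_inv(1)[OF linT injT]
 and TR = linear_inj_inv(2)[OF linT injT]
 and RT = linear_inj_inv(3)[OF linT injT]

lemma AT: "A (T fi ta w) = T fi ta (A w)" by (simp add: T_def linear_diff[OF linA] linear_cmul[OF linA])

lemma AR: "A (R fi ta w) = R fi ta (A w)" by (metis AT TR RT)

lemma smooth_T: "smooth_on UNIV (%z. T (fst z) (snd z) b)"
proof -
 have i: "smooth_on UNIV (%z::real \<times> real. z)" by (simp add: smooth_ident)
 have "smooth_on UNIV (%z::real \<times> real. f (fst z))" "smooth_on UNIV (%z::real \<times> real. f (snd z))" if "smooth_on UNIV f" for f :: "real => real"
  using smooth_comp[OF that smooth_fst[OF i]] smooth_comp[OF that smooth_snd[OF i]] by auto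
 note sc = this[OF smooth_on_sin] this[OF smooth_cos]
 show ?thesis
  unfolding T_def power2_eq_square by (intro smooth_diff smooth_scaleR smooth_const open_UNIV smooth_add smooth_mult sc)
qed

lemma smooth_R: "smooth_on UNIV (%z. R (fst z) (snd z) v)" by (rule smooth_inv_linear[OF open_UNIV linT injT smooth_T])

lemma R_has_vd:
 assumes T: "!!b. ((%t. T (x t) (y t) b) has_vector_derivative T' b) (at t)" and T': "linear T'"
 shows "((%t. R (x t) (y t) v) has_vector_derivative - R (x t) (y t) (T' (R (x t) (y t) v))) (at t)"
proof -
 have "((%t. inv (T (x t) (y t)) v) has_derivative
  (%d. - R (x t) (y t) (SUM b:Basis. (R (x t) (y t) v \<bullet> b) *R (d *R T' b)))) (at t)"
  by (rule has_derivative_inv_linear[OF open_UNIV UNIV_I linT injT]) (use T in "simp add: has_vector_derivative_def")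
 moreover have "- R (x t) (y t) (SUM b:Basis. (R (x t) (y t) v \<bullet> b) *R (d *R T' b)) = d *R (- R (x t) (y t) (T' (R (x t) (y t) v)))" for d
 proof -
  have "(SUM b:Basis. (R (x t) (y t) v \<bullet> b) *R (d *R T' b)) = d *R T' (R (x t) (y t) v)"
   unfolding linear_basis_expand[OF T', of "R (x t) (y t) v"] by (simp add: scaleR_sum_right mult.commute)
  thus ?thesis by (simp add: linear_cmul[OF linR])
 qed
 ultimately show ?thesis by (simp add: has_vector_derivative_def)
qed

section \<open>The inverse square root as an integral\<close>

lemma R_cont: "continuous_on X (%fi. R fi ta v)" by (rule continuous_on_compose2[OF smooth_cont[OF smooth_R[of v]], of _ "%fi. (fi, ta)", simplified])
  (auto intro!: continuous_intros)

lemma int_cont: "continuous_on UNIV f ==> f integrable_on {0..pi/2}" for f :: "real => 'e"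
 by (rule integrable_continuous_interval[OF continuous_on_subset]) auto

definition Q :: "real => 'e => 'e" where
 "Q ta v = (2 / pi) *R integral {0..pi/2} (%fi. R fi ta v)"

lemma int_linear:
 assumes "linear f" "continuous_on UNIV g" shows "integral {0..pi/2} (%fi. f (g fi :: 'e)) = f (integral {0..pi/2} g :: 'e)"
 using integral_linear[OF int_cont[OF assms(2)], of f] assms(1) by (simp add: linear_conv_bounded_linear o_def)

lemma linQ: "linear (Q ta)" by (rule linearI)
  (simp_all add: Q_def linear_add[OF linR] linear_cmul[OF linR] integral_add[OF int_cont[OF R_cont] int_cont[OF R_cont]] scaleR_add_right)

lemma AQ: "A (Q ta v) = Q ta (A v)"
 unfolding Q_def linear_cmul[OF linA] int_linear[OF linA R_cont, symmetric] AR ..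

lemma T_self: "h (T fi ta u) v = h u (T fi ta v)"
 by (simp add: T_def bilinear_lsub[OF h(1)] bilinear_rsub[OF h(1)] bilinear_lmul[OF h(1)] bilinear_rmul[OF h(1)] hA_anti)

lemma R_self: "h (R fi ta u) v = h u (R fi ta v)" by (metis T_self TR)

lemma Q_self: "h (Q ta u) v = h u (Q ta v)"
proof -
 have l: "linear (%u. h u v)" "linear (h u)" for u v using h(1) by (auto simp: bilinear_def)
 have i: "integral {0..pi/2} (%fi. f (R fi ta w)) = f (integral {0..pi/2} (%fi. R fi ta w))" if "linear f" for f :: "'e => real" and w
  using integral_linear[OF int_cont[OF R_cont], of f] that by (simp add: linear_conv_bounded_linear o_def)
 show ?thesis
  unfolding Q_def bilinear_lmul[OF h(1)] bilinear_rmul[OF h(1)] i[OF l(1), symmetric] i[OF l(2), symmetric] R_self ..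
qed

text \<open>Along the deformation \<open>cos\<^sup>2 \<tau> - sin\<^sup>2 \<tau> A\<^sup>2\<close> from the identity to \<open>- A\<^sup>2\<close> the operator \<open>Q\<close>
 remains the inverse square root; the derivative with respect to \<open>\<tau>\<close> is an exact derivative
 with respect to \<open>\<phi>\<close>.\<close>

abbreviation "S ta w == (cos ta)\<^sup>2 *R w - (sin ta)\<^sup>2 *R A (A w)"

lemma linS: "linear (S ta)" by (rule linearI) (simp_all add: linear_add[OF linA] linear_cmul[OF linA] algebra_simps)

lemma T_S: "T fi ta w = (sin fi)\<^sup>2 *R w + (cos fi)\<^sup>2 *R S ta w" by (simp add: T_def algebra_simps)

lemma SR: "S ta (R fi sg w) = R fi sg (S ta w)" by (simp add: AR linear_diff[OF linR] linear_cmul[OF linR])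

text \<open>The product sin cos R vanishes at both ends of the interval, and its derivative in
  \<open>fi\<close> is cos^2 R R S - sin^2 R R. So these two terms have equal integrals, while their
  sum is R itself.\<close>

lemma half_integral: "integral {0..pi/2} (%fi. (cos fi)\<^sup>2 *R R fi ta (R fi ta (S ta v))) = (1/2) *R integral {0..pi/2} (%fi. R fi ta v)"
proof -
 let ?c = "%fi::real. (cos fi)\<^sup>2" and ?s = "%fi::real. (sin fi)\<^sup>2"
 have RRc: "continuous_on UNIV (%fi. R fi ta (R fi ta w))" for w by (rule continuous_on_linear_apply[OF linR R_cont R_cont])
 have d: "((%fi. (sin fi * cos fi) *R R fi ta v) has_vector_derivative
   ?c fi *R R fi ta (R fi ta (S ta v)) - ?s fi *R R fi ta (R fi ta v)) (at fi)" for fi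
 proof -
  define T' where "T' w = (2 * sin fi * cos fi) *R (w - S ta w)" for w
  have linT': "linear T'" by (rule linearI) (simp_all add: T'_def linear_add[OF linA] linear_cmul[OF linA] algebra_simps)
  have dT: "((%fi. T fi ta b) has_vector_derivative T' b) (at fi)" for b
   unfolding T_S T'_def by (auto intro!: derivative_eq_intros simp: has_vector_derivative_def fun_eq_iff algebra_simps)
  have sc: "((%fi. sin fi * cos fi) has_real_derivative ?c fi - ?s fi) (at fi)" by (auto intro!: derivative_eq_intros simp: power2_eq_square)
  have "((%fi. (sin fi * cos fi) *R R fi ta v) has_vector_derivative
    (sin fi * cos fi) *R (- R fi ta (T' (R fi ta v))) + (?c fi - ?s fi) *R R fi ta v) (at fi)"
   by (rule has_vector_derivative_scaleR[OF sc R_has_vd[OF dT linT']])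
  moreover have "(sin fi * cos fi) *R (- R fi ta (T' (R fi ta v))) + (?c fi - ?s fi) *R R fi ta v
    = ?c fi *R R fi ta (R fi ta (S ta v)) - ?s fi *R R fi ta (R fi ta v)"
  proof -
   define a b where "a = R fi ta (R fi ta v)" and "b = R fi ta (R fi ta (S ta v))"
   have "R fi ta (T' (R fi ta v)) = (2 * sin fi * cos fi) *R (a - b)"
    unfolding T'_def a_def b_def SR linear_cmul[OF linR] linear_diff[OF linR] ..
   moreover have "R fi ta v = ?s fi *R a + ?c fi *R b"
   proof -
    have "R fi ta v = R fi ta (R fi ta (T fi ta v))" by (simp add: RT)
    also have "... = ?s fi *R a + ?c fi *R b"
     unfolding T_S a_def b_def linear_add[OF linR] linear_cmul[OF linR] ..
    finally show ?thesis .
   qed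
   moreover have "(sin fi * cos fi) *R (- ((2 * sin fi * cos fi) *R (a - b))) + (?c fi - ?s fi) *R (?s fi *R a + ?c fi *R b)
    = (- (2 * ?s fi * ?c fi) + (?c fi - ?s fi) * ?s fi) *R a + (2 * ?s fi * ?c fi + (?c fi - ?s fi) * ?c fi) *R b"
    by (rule euclidean_eqI) (simp only: inner_add_left inner_diff_left inner_minus_left inner_scaleR_left, algebra)
   moreover have "- (2 * ?s fi * ?c fi) + (?c fi - ?s fi) * ?s fi = - ?s fi * (?s fi + ?c fi)"
    "2 * ?s fi * ?c fi + (?c fi - ?s fi) * ?c fi = ?c fi * (?s fi + ?c fi)" by algebra+
   ultimately have "(sin fi * cos fi) *R (- R fi ta (T' (R fi ta v))) + (?c fi - ?s fi) *R R fi ta v = ?c fi *R b - ?s fi *R a"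
    by (simp only:) simp
   thus ?thesis by (simp add: a_def b_def)
  qed
  ultimately show ?thesis by (simp only:)
 qed
 have "((%fi. ?c fi *R R fi ta (R fi ta (S ta v)) - ?s fi *R R fi ta (R fi ta v)) has_integral
   (sin (pi/2) * cos (pi/2)) *R R (pi/2) ta v - (sin 0 * cos 0) *R R 0 ta v) {0..pi/2}"
  by (rule fundamental_theorem_of_calculus[OF _ has_vector_derivative_at_within[OF d]]) simp
 from integral_unique[OF this]
 have 0: "integral {0..pi/2} (%fi. ?c fi *R R fi ta (R fi ta (S ta v)) - ?s fi *R R fi ta (R fi ta v)) = 0" by simp
 have ic: "(%fi. ?c fi *R R fi ta (R fi ta (S ta v))) integrable_on {0..pi/2}"
  and is1: "(%fi. ?s fi *R R fi ta (R fi ta v)) integrable_on {0..pi/2}" by (rule int_cont, intro continuous_intros RRc)+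
 have "integral {0..pi/2} (%fi. R fi ta v) = integral {0..pi/2} (%fi. ?s fi *R R fi ta (R fi ta v) + ?c fi *R R fi ta (R fi ta (S ta v)))"
 proof (rule integral_cong)
  fix fi
  have "R fi ta v = R fi ta (R fi ta (T fi ta v))" by (simp add: RT)
  thus "R fi ta v = ?s fi *R R fi ta (R fi ta v) + ?c fi *R R fi ta (R fi ta (S ta v))"
   unfolding T_S linear_add[OF linR] linear_cmul[OF linR] .
 qed
 also have "... = integral {0..pi/2} (%fi. ?s fi *R R fi ta (R fi ta v)) + integral {0..pi/2} (%fi. ?c fi *R R fi ta (R fi ta (S ta v)))"
  by (rule integral_add[OF is1 ic])
 also have "integral {0..pi/2} (%fi. ?s fi *R R fi ta (R fi ta v)) = integral {0..pi/2} (%fi. ?c fi *R R fi ta (R fi ta (S ta v)))"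
  using 0 unfolding integral_diff[OF ic is1] by simp
 finally show ?thesis by (simp add: scaleR_2[symmetric])
qed

text \<open>All operators commute, so differentiating the integrand in \<open>ta\<close> gives cos^2
  N R R. After application of \<open>S ta\<close> the integral is the one of
  \<open>half_integral\<close>. The derivative \<open>q'\<close> enters the energy below only
  through \<open>S ta q'\<close>.\<close>

lemma Q_deriv:
 obtains q' where "((%ta. Q ta v) has_vector_derivative q') (at ta)" "S ta q' = (sin ta * cos ta) *R (Q ta v + A (A (Q ta v)))"
proof -
 define N where "N w = (2 * sin ta * cos ta) *R (w + A (A w))" for w
 have linN: "linear N" by (rule linearI) (simp_all add: N_def linear_add[OF linA] linear_cmul[OF linA] algebra_simps)
 have NR: "N (R fi ta w) = R fi ta (N w)" for fi w by (simp add: N_def AR linear_add[OF linR] linear_cmul[OF linR])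
 define T' where "T' fi w = - ((cos fi)\<^sup>2 *R N w)" for fi w
 have linT': "linear (T' fi)" for fi using linN by (auto simp: T'_def linear_iff algebra_simps)
 have dT: "((%ta. T fi ta b) has_vector_derivative T' fi b) (at ta)" for fi b
  unfolding T_def T'_def N_def by (auto intro!: derivative_eq_intros simp: has_vector_derivative_def fun_eq_iff algebra_simps)
 have dR: "FD (%z. R (fst z) (snd z) v) (fi, ta) (0, 1) = (cos fi)\<^sup>2 *R N (R fi ta (R fi ta v))" for fi
 proof -
  have "((%ta. (fi, ta)) has_derivative (%s. s *R (0, 1))) (at ta)" by (auto intro!: derivative_eq_intros simp: fun_eq_iff)
  from has_derivative_compose[OF this smooth_has_derivative[OF smooth_R[of v] UNIV_I]]
  have "((%ta. R fi ta v) has_vector_derivative FD (%z. R (fst z) (snd z) v) (fi, ta) (0, 1)) (at ta)"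
   unfolding has_vector_derivative_def linear_cmul[OF smooth_FD_linear[OF smooth_R[of v] UNIV_I]] by simp
  from vector_derivative_unique_at[OF this R_has_vd[OF dT linT']]
  show ?thesis by (simp add: T'_def linear_neg[OF linR] linear_cmul[OF linR] NR)
 qed
 define J where "J = integral {0..pi/2} (%fi. (cos fi)\<^sup>2 *R N (R fi ta (R fi ta v)))"
 have "((%ta. integral {0..pi/2} (%fi. (%z. R (fst z) (snd z) v) (fi, ta))) has_derivative
  (%s. integral {0..pi/2} (%fi. FD (%z. R (fst z) (snd z) v) (fi, ta) (0, s)))) (at ta)"
  by (rule has_derivative_param_integral[OF smooth_onD[OF smooth_R] open_UNIV open_UNIV]) auto
 moreover have "integral {0..pi/2} (%fi. FD (%z. R (fst z) (snd z) v) (fi, ta) (0, s)) = s *R J" for s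
 proof -
  have "FD (%z. R (fst z) (snd z) v) (fi, ta) (0, s) = s *R ((cos fi)\<^sup>2 *R N (R fi ta (R fi ta v)))" for fi
   using linear_cmul[OF smooth_FD_linear[OF smooth_R[of v] UNIV_I, of "(fi, ta)"], of s "(0, 1)"] by (simp add: dR)
  thus ?thesis by (simp add: J_def del: scaleR_scaleR)
 qed
 ultimately have dI: "((%ta. integral {0..pi/2} (%fi. R fi ta v)) has_vector_derivative J) (at ta)" by (simp add: has_vector_derivative_def)
 have "((%ta. Q ta v) has_vector_derivative (2 / pi) *R J) (at ta)"
  unfolding Q_def by (rule bounded_linear.has_vector_derivative[OF bounded_linear_scaleR_right dI])
 moreover have "S ta ((2 / pi) *R J) = (sin ta * cos ta) *R (Q ta v + A (A (Q ta v)))"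
 proof -
  have RRc: "continuous_on UNIV (%fi. (cos fi)\<^sup>2 *R R fi ta (R fi ta w))" for w
   by (intro continuous_intros continuous_on_linear_apply[OF linR R_cont R_cont])
  have J1: "J = N (integral {0..pi/2} (%fi. (cos fi)\<^sup>2 *R R fi ta (R fi ta v)))"
   unfolding J_def int_linear[OF linN RRc, symmetric] by (simp add: linear_cmul[OF linN])
  have SN: "S ta (N w) = N (S ta w)" for w by (simp add: N_def linear_add[OF linA] linear_cmul[OF linA] linear_diff[OF linA] algebra_simps)
  have "S ta J = N (integral {0..pi/2} (%fi. (cos fi)\<^sup>2 *R R fi ta (R fi ta (S ta v))))"
   unfolding J1 SN int_linear[OF linS RRc, symmetric] linear_cmul[OF linS] SR ..
  hence "S ta J = N ((1/2) *R integral {0..pi/2} (%fi. R fi ta v))" unfolding half_integral .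
  hence "S ta ((2 / pi) *R J) = (1/2) *R N (Q ta v)"
   unfolding linear_cmul[OF linS] Q_def linear_cmul[OF linN] by simp
  thus ?thesis by (simp add: N_def mult.assoc)
 qed
 ultimately show ?thesis by (rule that)
qed

text \<open>The left-hand side does not depend on \<open>ta\<close>: its derivative vanishes by
  \<open>Q_deriv\<close>, and at 0 the operator \<open>Q\<close> is the identity. At pi/2 it says
  that A Q is an isometry of \<open>h\<close>.\<close>

lemma Q_energy: "h (Q ta v) (S ta (Q ta v)) = h v v"
proof -
 define f where "f ta = (cos ta)\<^sup>2 * h (Q ta v) (Q ta v) + (sin ta)\<^sup>2 * h (A (Q ta v)) (A (Q ta v))" for ta
 have fS: "f ta = h (Q ta v) (S ta (Q ta v))" for ta
  using hA_anti[of "Q ta v" "A (Q ta v)"] by (simp add: f_def bilinear_rsub[OF h(1)] bilinear_rmul[OF h(1)])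
 have bb: "bounded_bilinear h" using h(1) bilinear_conv_bounded_bilinear by blast
 have "(f has_real_derivative 0) (at ta)" for ta
 proof -
  obtain q' where q': "((%ta. Q ta v) has_vector_derivative q') (at ta)"
   "S ta q' = (sin ta * cos ta) *R (Q ta v + A (A (Q ta v)))" by (rule Q_deriv)
  let ?q = "Q ta v"
  have Aq: "((%ta. A (Q ta v)) has_vector_derivative A q') (at ta)"
   by (rule bounded_linear.has_vector_derivative[OF _ q'(1)]) (use linA in "simp add: linear_conv_bounded_linear")
  have hd: "((%ta. h (w ta) (w ta)) has_real_derivative 2 * h (w ta) w') (at ta)" if "(w has_vector_derivative w') (at ta)" for w w'
   using bounded_bilinear.has_vector_derivative[OF bb that that] h(2)[of w' "w ta"] by (simp add: has_real_derivative_iff_has_vector_derivative)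
  have "(f has_real_derivative (cos ta)\<^sup>2 * (2 * h ?q q') + (- (2 * sin ta * cos ta)) * h ?q ?q
    + ((sin ta)\<^sup>2 * (2 * h (A ?q) (A q')) + (2 * sin ta * cos ta) * h (A ?q) (A ?q))) (at ta)"
   unfolding f_def by (auto intro!: derivative_eq_intros hd[OF q'(1)] hd[OF Aq])
  moreover have "(cos ta)\<^sup>2 * (2 * h ?q q') + (- (2 * sin ta * cos ta)) * h ?q ?q
    + ((sin ta)\<^sup>2 * (2 * h (A ?q) (A q')) + (2 * sin ta * cos ta) * h (A ?q) (A ?q)) = 0"
  proof -
   have "h ?q (S ta q') = (cos ta)\<^sup>2 * h ?q q' + (sin ta)\<^sup>2 * h (A ?q) (A q')"
    using hA_anti[of ?q "A q'"] by (simp add: bilinear_rsub[OF h(1)] bilinear_rmul[OF h(1)])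
   moreover have "h ?q (S ta q') = (sin ta * cos ta) * (h ?q ?q - h (A ?q) (A ?q))"
    unfolding q'(2) using hA_anti[of ?q "A ?q"] by (simp add: bilinear_radd[OF h(1)] bilinear_rmul[OF h(1)])
   ultimately show ?thesis by (simp add: algebra_simps)
  qed
  ultimately show ?thesis by simp
 qed
 hence "f ta = f 0" by (intro DERIV_isconst_all) blast
 also have "f 0 = h v v"
 proof -
  have "T fi 0 = id" for fi by (auto simp: T_def scaleR_left_distrib[symmetric])
  hence "Q 0 v = v" by (simp add: Q_def)
  thus ?thesis by (simp add: f_def)
 qed
 finally show ?thesis unfolding fS .
qed

section \<open>Properties of the complex structure\<close>

lemma polJ_Q: "polJ om h u = A (Q (pi/2) u)" by (simp add: polJ_def polT_T Q_def)

lemma linJ: "linear (polJ om h)"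
 unfolding polJ_Q using linear_compose[OF linQ linA] by (simp add: o_def)

text \<open>By \<open>Q_energy\<close> the operator \<open>B\<close> has the same quadratic form as
  the identity; being self-adjoint with respect to \<open>h\<close>, it is the identity by
  polarisation.\<close>

lemma polJ_square: "polJ om h (polJ om h u) = - u"
proof -
 let ?Q = "Q (pi/2)"
 define B where "B v = - A (A (?Q (?Q v)))" for v
 have lB: "linear B" using linA linQ by (auto simp: B_def linear_iff)
 have e: "h v (B v) = h v v" for v
  using Q_energy[of "pi/2" v] Q_self[of "pi/2" v "A (A (?Q v))"]
  by (simp add: B_def AQ bilinear_rneg[OF h(1)] linear_neg[OF linQ] linear_neg[OF linA])
 have sB: "h u (B v) = h (B u) v" for u v by (simp add: B_def AQ bilinear_rneg[OF h(1)] bilinear_lneg[OF h(1)] hA_anti Q_self)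
 have "h u (B v) = h u v" for u v
 proof -
  have "h (u + v) (B (u + v)) = h (u + v) (u + v)" by (rule e)
  hence "h u (B v) + h v (B u) = 2 * h u v"
   using e[of u] e[of v] h(2)[of v u] by (simp add: linear_add[OF lB] bilinear_ladd[OF h(1)] bilinear_radd[OF h(1)])
  moreover have "h v (B u) = h u (B v)" using sB[of v u] h(2) by metis
  ultimately show ?thesis by simp
 qed
 hence "B v = v" for v by (intro h_ext) (simp add: h(2)[of _ v] h(2)[of "B v"])
 hence "A (A (?Q (?Q u))) = - u" unfolding B_def by (metis minus_minus)
 thus ?thesis unfolding polJ_Q AQ .
qed

lemma h_polJ: "h (polJ om h u) v = - h u (polJ om h v)"
 unfolding polJ_Q by (simp add: hA_anti Q_self AQ)

lemma om_polJ: "om (polJ om h u) (polJ om h v) = om u v"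
proof -
 have "om (polJ om h u) (polJ om h v) = h (A (polJ om h u)) (polJ om h v)" by (rule hA[symmetric])
 also have "A (polJ om h u) = polJ om h (A u)" unfolding polJ_Q AQ ..
 also have "h (polJ om h (A u)) (polJ om h v) = - h (A u) (polJ om h (polJ om h v))" by (rule h_polJ)
 also have "... = h (A u) v" unfolding polJ_square by (simp add: bilinear_rneg[OF h(1)])
 also have "... = om u v" by (rule hA)
 finally show ?thesis .
qed

text \<open>The value is \<open>h (A u) (Q (pi/2) (A u))\<close>, an average of the positive
  quantities \<open>h (A u) (R fi (pi/2) (A u))\<close>.\<close>

lemma om_polJ_pos: assumes "u ~= 0" shows "0 < om u (polJ om h u)"
proof -
 let ?g = "%fi. h (A u) (R fi (pi/2) (A u))"
 have lh: "linear (h (A u))" using h(1) by (auto simp: bilinear_def)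
 have w: "A u ~= 0" using A_inj assms by blast
 have pos: "0 < ?g fi" for fi
  using T_pos[of "R fi (pi/2) (A u)" fi "pi/2"] w TR linear_0[OF linT] by metis
 have c: "continuous_on {0..pi/2} ?g" by (rule linear_continuous_on_compose[OF R_cont lh])
 obtain m where m: "!!fi. fi : {0..pi/2} ==> ?g m <= ?g fi"
  using continuous_attains_inf[OF _ _ c] by (metis compact_Icc atLeastatMost_empty_iff2 pi_half_ge_zero)
 have "0 < integral {0..pi/2} (%fi. ?g m)" using pos[of m] by simp
 also have "... <= integral {0..pi/2} ?g" by (rule integral_le) (use m integrable_continuous_interval[OF c] in auto)
 also have "... = h (A u) (integral {0..pi/2} (%fi. R fi (pi/2) (A u)))"
  using integral_linear[OF int_cont[OF R_cont], of "h (A u)"] lh by (simp add: linear_conv_bounded_linear o_def)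
 finally have "0 < h (A u) (Q (pi/2) (A u))" by (simp add: Q_def bilinear_rmul[OF h(1)])
 thus ?thesis by (simp add: hA[symmetric] polJ_Q AQ)
qed

lemma om_polJ_sym: "om u (polJ om h v) = om v (polJ om h u)"
 using om_polJ[of u "polJ om h v"] om_anti[of "polJ om h u" v] by (simp add: polJ_square bilinear_rneg[OF om(1)])

end

text \<open>Every ingredient is natural under linear isomorphisms; this makes the pointwise
  construction on a manifold independent of charts.\<close>

lemma polJ_equivariant:
 assumes 1: "symp_pair om h" and 2: "symp_pair om' h'" and L: "linear L" "surj L"
  and om: "!!u v. om u v = om' (L u) (L v)" and h: "!!u v. h u v = h' (L u) (L v)"
 shows "L (polJ om h u) = polJ om' h' (L u)"
proof -
 interpret a: symp_pair om h by (rule 1)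
 interpret b: symp_pair om' h' by (rule 2)
 have A: "L (polA om h w) = polA om' h' (L w)" for w
 proof (rule b.A_eqI[symmetric])
  fix z obtain z' where "z = L z'" using L(2) by blast
  thus "h' (L (polA om h w)) z = om' (L w) z" using a.hA[of w z'] by (simp add: om h)
 qed
 have T: "L (a.T fi ta w) = b.T fi ta (L w)" for fi ta w
  unfolding a.T_def b.T_def linear_diff[OF L(1)] linear_cmul[OF L(1)] A ..
 have R: "L (inv (a.T fi ta) w) = inv (b.T fi ta) (L w)" for fi ta w by (metis T a.TR b.RT)
 show ?thesis
  unfolding a.polJ_Q b.polJ_Q A a.Q_def b.Q_def linear_cmul[OF L(1)] a.int_linear[OF L(1) a.R_cont, symmetric] R ..
qed

lemma smooth_polJ:
 fixes om h :: "'p::euclidean_space => 'e::euclidean_space => 'e => real"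
 assumes Z: "open Z" and sp: "!!z. z : Z ==> symp_pair (om z) (h z)"
  and om: "!!u v. smooth_on Z (%z. om z u v)" and h: "!!u v. smooth_on Z (%z. h z u v)"
 shows "smooth_on Z (%z. polJ (om z) (h z) u)"
proof -
 note lin = symp_pair.linA[OF sp]
 have sA: "smooth_on Z (%z. polA (om z) (h z) w)" for w
  unfolding polA_def by (rule smooth_linear_apply[OF linear_inj_inv(1) smooth_inv_linear smooth_gram[OF Z om]])
   (auto intro!: Z linear_gram inj_gram smooth_gram[OF Z h] symp_pair.h(1)[OF sp] symp_pair.nondeg_h[OF sp])
 have sA': "smooth_on Z (%z. polA (om z) (h z) (f z))" if "smooth_on Z f" for f by (rule smooth_linear_apply[OF lin sA that])
 have oU: "open (UNIV \<times> Z :: (real \<times> 'p) set)" by (intro open_Times open_UNIV Z)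
 note i = smooth_ident[OF oU]
 have snd: "smooth_on (UNIV \<times> Z) (%x::real \<times> 'p. f (snd x))" if "smooth_on Z f" for f :: "'p => 'e"
  by (rule smooth_comp[OF that smooth_snd[OF i]]) auto
 have fst: "smooth_on (UNIV \<times> Z) (%x::real \<times> 'p. f (fst x))" if "smooth_on UNIV f" for f :: "real => real"
  by (rule smooth_comp[OF that smooth_fst[OF i]]) auto
 have "smooth_on (UNIV \<times> Z) (%x. inv (polT (om (snd x)) (h (snd x)) (fst x)) u)"
 proof (rule smooth_inv_linear[OF oU])
  fix x :: "real \<times> 'p" assume "x : UNIV \<times> Z"
  hence "symp_pair (om (snd x)) (h (snd x))" by (auto intro: sp)
  thus "linear (polT (om (snd x)) (h (snd x)) (fst x))" "inj (polT (om (snd x)) (h (snd x)) (fst x))"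
   using symp_pair.linT symp_pair.injT symp_pair.polT_T by metis+
 next
  fix b
  have "smooth_on (UNIV \<times> Z) (%x. (sin (fst x))\<^sup>2 *R b - (cos (fst x))\<^sup>2 *R polA (om (snd x)) (h (snd x)) (polA (om (snd x)) (h (snd x)) b))"
   unfolding power2_eq_square
   by (intro smooth_diff smooth_scaleR smooth_mult smooth_const[OF oU] fst[OF smooth_on_sin] fst[OF smooth_cos] snd[OF sA'[OF sA]])
  thus "smooth_on (UNIV \<times> Z) (%x. polT (om (snd x)) (h (snd x)) (fst x) b)"
   unfolding polT_def .
 qed
 from smooth_param_integral[OF this Z, of 0 "pi/2"]
 have "smooth_on Z (%z. integral {0..pi/2} (%fi. inv (polT (om z) (h z) fi) u))" by auto
 thus ?thesis unfolding polJ_def by (intro sA' smooth_scaleR smooth_const Z)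
qed

section \<open>Functions on manifolds\<close>

text \<open>A finite subcover in the form of an induction principle; it takes the place of
  partitions of unity in the constructions and estimates below.\<close>

lemma compact_local_global:
 assumes K: "compactin X K" and loc: "!!p. p : K ==> EX N. openin X N & p : N & P N"
  and P0: "P {}" and P2: "!!A B. openin X A ==> openin X B ==> P A ==> P B ==> P (A Un B)"
 obtains N where "openin X N" "K <= N" "P N"
proof -
 have "K <= \<Union>{N. openin X N & P N}" using loc by blast
 then obtain FF where FF: "finite FF" "FF <= {N. openin X N & P N}" "K <= \<Union>FF"
  using compactinD[OF K, of "{N. openin X N & P N}"] by blast
 from FF(1,2) have "openin X (\<Union>FF) & P (\<Union>FF)" by (induction FF) (auto simp: P0 intro!: P2)
 thus ?thesis using that FF(3) by blast
qed

context smooth_mfd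
begin

definition gsmooth :: "('a => real) => bool" where
 "gsmooth f \<longleftrightarrow> (ALL p:pts M. smooth_near M p f)"

lemma compact_closed: "compactin (mtop M) C ==> closedin (mtop M) C"
 using mfd unfolding smooth_manifold_def by (blast intro: compactin_imp_closedin)

lemma smooth_near_comp:
 fixes fi :: "real => real"
 assumes f: "smooth_near M p f" and fi: "smooth_on UNIV fi"
 shows "smooth_near M p (%q. fi (f q))" by (rule smooth_near_combine[OF f f]) (auto simp: o_def intro: smooth_comp[OF fi])

lemma tangent_chain:
 assumes D: "D : tangent_space M p" and f: "smooth_near M p f" and fi: "smooth_on UNIV fi"
  and d: "(fi has_real_derivative d) (at (f p))"
 shows "D (%q. fi (f q)) = d * D f"
proof -
 obtain c where c: "c : charts M" "p : fst c" using chart_at[OF smooth_near_topspace[OF f]] .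
 obtain u where u: "D = coord_vec M c p u" using tangent_eq_coord_vec[OF c D] by blast
 note df = smooth_near_deriv[OF f c]
 have d': "(fi has_derivative (*) d) (at ((f o chart_inv c) (snd c p)))"
  using d c by (simp add: has_field_derivative_def chart_inv_map[OF c])
 have e: "(%q. fi (f q)) o chart_inv c = (%x. fi ((f o chart_inv c) x))" by auto
 show ?thesis
  unfolding u coord_vec_apply[OF f] coord_vec_apply[OF smooth_near_comp[OF f fi]] e
   has_derivative_frechet[OF has_derivative_compose[OF df d']] ..
qed

lemma smooth_near_preimage:
 assumes N: "opn M N" and f: "!!q. q : N ==> smooth_near M q f" and V: "open V"
 shows "opn M {q : N. f q : V}"
 unfolding openin_subopen[of _ "{q : N. f q : V}"]
proof
 fix p assume p: "p : {q : N. f q : V}"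
 obtain c where c: "c : charts M" "p : fst c" using chart_at[OF smooth_near_topspace[OF f]] p by blast
 obtain U where U: "open U" "snd c p : U" "U <= chart_img c" "smooth_on U (f o chart_inv c)"
  using smooth_near_chart[OF f c] p by blast
 let ?S = "{x : U. (f o chart_inv c) x : V}"
 have "?S = U Int (f o chart_inv c) -` V" by blast
 hence S: "open ?S"
  using continuous_open_preimage[OF smooth_cont[OF U(4)] U(1) V] by (simp only:)
 have "opn M ({q : fst c. snd c q : ?S} Int N)" by (intro openin_Int chart_preimage_open c S N)
 moreover have "p : {q : fst c. snd c q : ?S} Int N" using p c U by (simp add: chart_inv_map[OF c])
 moreover have "{q : fst c. snd c q : ?S} Int N <= {q : N. f q : V}" by (auto simp: chart_inv_map[OF c(1)])
 ultimately show "EX T. opn M T & p : T & T <= {q : N. f q : V}" by blast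
qed

lemma gsmooth_preimage: "gsmooth f ==> open V ==> opn M {q : pts M. f q : V}" by (rule smooth_near_preimage) (auto simp: gsmooth_def)

lemma smooth_near_field:
 assumes X: "smooth_vector_field_on M V X" and p: "p : V" and f: "smooth_near M p f"
 shows "smooth_near M p (%q. X q f)"
proof -
 have V: "opn M V" "!!q. q : V ==> X q : tangent_space M q"
  and sX: "!!c. c : charts M ==> smooth_on (snd c ` (fst c Int V)) (%x. vec_coords c (X (chart_inv c x)))"
  using X by (auto simp: smooth_vector_field_on_def)
 obtain c where c: "c : charts M" "p : fst c" using chart_at[OF smooth_near_topspace[OF f]] .
 obtain N where N: "opn M N" "p : N" "!!c. c : charts M ==> smooth_on (snd c ` (fst c Int N)) (f o chart_inv c)"
  using f unfolding smooth_near_def by blast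
 let ?U = "snd c ` (fst c Int (N Int V))"
 have oU: "open ?U" by (intro chart_image_open c openin_Int N V)
 have "smooth_on ?U (%x. FD (f o chart_inv c) x (vec_coords c (X (chart_inv c x))))"
  by (rule smooth_deriv_apply; rule smooth_subset[OF _ oU]) (auto intro!: N sX c)
 moreover have "FD (f o chart_inv c) x (vec_coords c (X (chart_inv c x))) = ((%q. X q f) o chart_inv c) x" if x: "x : ?U" for x
 proof -
  let ?q = "chart_inv c x"
  have q: "?q : fst c" "?q : N" "?q : V" "snd c ?q = x" using x by (auto simp: chart_inv_map[OF c(1)])
  have "smooth_near M ?q f" using N q unfolding smooth_near_def by blast
  from coord_vec_apply[OF this, of c] show ?thesis
   using tangent_eq_coord_vec[OF c(1) q(1) V(2)[OF q(3)]] q(4) by (simp add: fun_eq_iff)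
 qed
 ultimately have "smooth_on ?U ((%q. X q f) o chart_inv c)" by (rule smooth_cong)
 thus ?thesis
  unfolding smooth_near_iff[OF c] by (intro exI[of _ ?U]) (use oU c N p in "auto simp: chart_img_def")
qed

lemma gsmooth_simps:
 "gsmooth (%_. k)" "gsmooth f ==> gsmooth h ==> gsmooth (%q. f q + h q)"
 "gsmooth f ==> gsmooth h ==> gsmooth (%q. f q - h q)" "gsmooth f ==> gsmooth h ==> gsmooth (%q. f q * h q)"
 "smooth_on UNIV fi ==> gsmooth f ==> gsmooth (%q. fi (f q))" for fi :: "real => real"
 using smooth_near_const smooth_near_lin[of _ f h 1 1] smooth_near_lin[of _ f h 1 "-1"] smooth_near_mult smooth_near_comp by (auto simp: gsmooth_def)

lemma gsmooth_cutoff: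
 assumes ze: "gsmooth ze" and C: "compactin (mtop M) C" "!!q. q ~: C ==> ze q = 0"
  and r: "!!p. p : C ==> smooth_near M p r"
 shows "gsmooth (%q. ze q * r q)"
 unfolding gsmooth_def
proof
 fix p assume p: "p : pts M"
 show "smooth_near M p (%q. ze q * r q)"
 proof (cases "p : C")
  case True thus ?thesis using ze r p by (auto simp: gsmooth_def intro: smooth_near_mult)
 next
  case False
  thus ?thesis by (intro smooth_near_cong[OF smooth_near_const[OF p, of 0], of "pts M - C"])
    (use p C(2) compact_closed[OF C(1)] in auto)
 qed
qed

section \<open>Bump functions and collars\<close>

lemma chart_bump:
 assumes c: "c : charts M" "p : fst c" and U: "opn M U" "p : U"
 shows "EX ze C N. gsmooth ze & (ALL q. 0 <= ze q) & (ALL q. q ~: C --> ze q = 0) & compactin (mtop M) C & C <= fst c Int U &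
  opn M N & p : N & N <= C & (ALL q:N. ze q = 1)"
proof -
 let ?x = "snd c p"
 have "open (snd c ` (fst c Int U))" by (rule chart_image_open[OF c(1) U(1)])
 then obtain r where r: "0 < r" "ball ?x r <= snd c ` (fst c Int U)" using c U open_contains_ball by blast
 have r': "0 < r/3" "r/3 < r/2" using r(1) by auto
 obtain be :: "'e => real" where be: "smooth_on UNIV be" "!!x. 0 <= be x" "!!x. be x <= 1"
  "!!x. x : cball ?x (r/3) ==> be x = 1" "!!x. x ~: ball ?x (r/2) ==> be x = 0"
 proof (rule bump_exists[OF r', where ?x0.0 = ?x])
  fix be :: "'e => real"
  assume "smooth_on UNIV be" "!!x. 0 <= be x" "!!x. be x <= 1"
   "!!x. x : cball ?x (r/3) ==> be x = 1" "!!x. x ~: ball ?x (r/2) ==> be x = 0"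
  show thesis by (rule that[of be]) fact+
 qed
 let ?C = "chart_inv c ` cball ?x (r/2)"
 let ?ze = "%q. if q : fst c then be (snd c q) else 0"
 have cb: "cball ?x (r/2) <= chart_img c" "cball ?x (r/2) <= snd c ` (fst c Int U)" using r by (auto simp: chart_img_def subset_eq)
 obtain k where k: "homeomorphic_maps (subtopology (mtop M) (fst c)) (top_of_set (chart_img c)) (snd c) k"
  using chart_homeo[OF c(1)] homeomorphic_map_maps by blast
 have keq: "k x = chart_inv c x" if "x : chart_img c" for x
 proof -
  have "k x : fst c & snd c (k x) = x"
   using k that chart_topspace[OF c(1)] by (fastforce simp: homeomorphic_maps_def continuous_map_def)
  thus ?thesis using chart_inv_map[OF c(1)] by metis
 qed
 have "compactin (subtopology (mtop M) (fst c)) (k ` cball ?x (r/2))"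
  using k cb(1) by (intro image_compactin[of "top_of_set (chart_img c)"]) (auto simp: homeomorphic_maps_def compactin_subtopology)
 moreover have "k ` cball ?x (r/2) = ?C" using keq cb(1) by (intro image_cong) auto
 ultimately have C: "compactin (mtop M) ?C" "?C <= fst c" by (auto simp: compactin_subtopology)
 have CU: "?C <= fst c Int U" using cb(2) by (fastforce simp: chart_inv_map[OF c(1)])
 have out: "?ze q = 0" if "q ~: ?C" for q
 proof (cases "q : fst c")
  case True
  hence "snd c q ~: ball ?x (r/2)" using that chart_inv_map[OF c(1) True] by (metis ball_subset_cball image_eqI subsetD)
  thus ?thesis using be(5) by simp
 qed simp
 have sm: "gsmooth ?ze"
  unfolding gsmooth_def
 proof
  fix q assume q: "q : pts M"
  show "smooth_near M q ?ze"
  proof (cases "q : fst c")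
   case True
   show ?thesis by (rule smooth_near_cong[OF smooth_near_lift[OF c(1) True be(1) UNIV_I] chart_open[OF c(1)] True]) simp
  next
   case False
   show ?thesis by (rule smooth_near_cong[OF smooth_near_const[OF q, of 0], of "pts M - ?C"])
     (use q False C compact_closed[OF C(1)] out in "auto simp del: if_split")
  qed
 qed
 let ?N = "{q : fst c. snd c q : ball ?x (r/3)}"
 have "?N <= ?C"
 proof
  fix q assume q: "q : ?N"
  hence "snd c q : cball ?x (r/2)" using r(1) by simp
  thus "q : ?C" using q chart_inv_map[OF c(1), of q] by (metis (no_types, lifting) image_eqI mem_Collect_eq)
 qed
 thus ?thesis
  by (intro exI[of _ ?ze] exI[of _ ?C] exI[of _ ?N] conjI allI impI ballI sm out C(1) CU chart_preimage_open[OF c(1) open_ball]) (use be(2,4) c r(1) in auto)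
qed

text \<open>Finitely many local bumps add up to a function that is at least 1 around
  \<open>K\<close>; \<open>smooth_step\<close> makes it equal to 1 there and keeps it in the unit
  interval.\<close>

lemma compact_bump:
 assumes K: "compactin (mtop M) K" and U: "opn M U" "K <= U"
 shows "EX be C N. gsmooth be & (ALL q. 0 <= be q) & (ALL q. be q <= 1) & compactin (mtop M) C & C <= U &
  (ALL q. q ~: C --> be q = 0) & opn M N & K <= N & (ALL q:N. be q = 1)"
proof -
 define P where "P N \<longleftrightarrow> (EX ze C. gsmooth ze & (ALL q. 0 <= ze q) & compactin (mtop M) C & C <= U &
  (ALL q. q ~: C --> ze q = 0) & (ALL q:N. 1 <= ze q))" for N
 obtain N where N: "opn M N" "K <= N" "P N"
 proof (rule compact_local_global[OF K, where P = P])
  fix p assume p: "p : K"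
  hence pW: "p : pts M" using compactin_subset_topspace[OF K] by blast
  obtain c where c: "c : charts M" "p : fst c" using chart_at[OF pW] .
  have pU: "p : U" using p U(2) by blast
  obtain ze C N where b: "gsmooth ze" "!!q. 0 <= ze q" "!!q. q ~: C ==> ze q = 0" "compactin (mtop M) C" "C <= fst c Int U"
   "opn M N" "p : N" "N <= C" "!!q. q : N ==> ze q = 1" using chart_bump[OF c U(1) pU] by blast
  have "P N" unfolding P_def by (intro exI[of _ ze] exI[of _ C]) (use b in auto)
  thus "EX N. opn M N & p : N & P N" using b by blast
 next
  show "P {}" unfolding P_def by (intro exI[of _ "%_. 0"] exI[of _ "{}"]) (simp add: gsmooth_simps)
 next
  fix A B assume "P A" "P B"
  then obtain ze C ze' C' where *: "gsmooth ze" "ALL q. 0 <= ze q" "compactin (mtop M) C" "C <= U" "ALL q. q ~: C --> ze q = 0" "ALL q:A. 1 <= ze q"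
   "gsmooth ze'" "ALL q. 0 <= ze' q" "compactin (mtop M) C'" "C' <= U" "ALL q. q ~: C' --> ze' q = 0" "ALL q:B. 1 <= ze' q"
   unfolding P_def by blast
  have "1 <= ze q + ze' q" if "q : A Un B" for q
   using that *(6)[rule_format, of q] *(12)[rule_format, of q] *(2)[rule_format, of q] *(8)[rule_format, of q] by force
  thus "P (A Un B)"
   unfolding P_def by (intro exI[of _ "%q. ze q + ze' q"] exI[of _ "C Un C'"]) (use * in "simp add: gsmooth_simps compactin_Un")
 qed
 obtain ze C where *: "gsmooth ze" "ALL q. 0 <= ze q" "compactin (mtop M) C" "C <= U" "ALL q. q ~: C --> ze q = 0" "ALL q:N. 1 <= ze q"
  using N(3) unfolding P_def by blast
 show ?thesis by (intro exI[of _ "%q. smooth_step (ze q)"] exI[of _ C] exI[of _ N] conjI gsmooth_simps(5)[OF smooth_smooth_step *(1)])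
   (use * N in "auto simp: smooth_step_0 smooth_step_1 smooth_step_nonneg smooth_step_le_1")
qed

text \<open>Local defining functions of the boundary, cut off and increasing along \<open>X\<close>,
  are glued by addition, as all the required signs are stable under sums. A step function of the sum
  is then completed to the constant 1 away from \<open>K\<close>.\<close>

lemma collar:
 assumes K: "compact_smooth_domain M K" and V: "mtop M frontier_of K <= V" and X: "smooth_vector_field_on M V X"
  and out: "!!p. p : mtop M frontier_of K ==> points_outward M K p (X p)"
  and U: "opn M U" "K <= U"
 shows "EX ps. gsmooth ps & (ALL q. 0 <= ps q & ps q <= 1) & (ALL q:K. ps q = 0) & (ALL q. q ~: U --> ps q = 1) &
  (ALL q. 0 < ps q & ps q < 1 --> q : V & 0 < X q ps)"
proof -
 let ?W = "pts M" and ?F = "mtop M frontier_of K"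
 have cK: "compactin (mtop M) K" using K by (simp add: compact_smooth_domain_def)
 have clK: "closedin (mtop M) K" by (rule compact_closed[OF cK])
 have FK: "?F <= K" by (rule frontier_of_subset_closedin[OF clK])
 have cF: "compactin (mtop M) ?F" by (rule closed_compactin[OF cK FK closedin_frontier_of])
 have oV: "opn M V" and XT: "!!q. q : V ==> X q : tangent_space M q"
  using X by (auto simp: smooth_vector_field_on_def)
 \<comment> \<open>Weak inequalities are demanded globally and strict ones only over
   \<open>N\<close>, so that the property passes to unions by adding the functions.\<close>
 define P where "P N \<longleftrightarrow> (EX u. gsmooth u & (ALL q:K. u q <= 0) & (ALL q. q ~: K --> 0 <= u q) & (ALL q:N - K. 0 < u q) &
  (ALL q:?F. 0 <= X q u) & (ALL q:N Int ?F. 0 < X q u))" for N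
 obtain N where N: "opn M N" "?F <= N" "P N"
 proof (rule compact_local_global[OF cF, where P = P])
  fix p assume p: "p : ?F"
  obtain c b where bc: "boundary_chart M K p c b" "X p (%q. snd c q \<bullet> b) > 0"
   using out[OF p] unfolding points_outward_def by blast
  let ?r = "%q. snd c q \<bullet> b"
  have c: "c : charts M" "p : fst c" and rK: "!!q. q : fst c ==> q : K \<longleftrightarrow> ?r q <= 0"
   using bc(1) by (auto simp: boundary_chart_def)
  have rF: "?r q = 0" if q: "q : ?F" "q : fst c" for q
  proof (rule ccontr)
   assume "?r q ~= 0"
   hence lt: "?r q < 0" using rK[OF q(2)] FK q by force
   have "opn M {q : fst c. snd c q : {x. x \<bullet> b < 0}}" by (intro chart_preimage_open[OF c(1)] open_Collect_less continuous_intros)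
   moreover have "{q : fst c. snd c q : {x. x \<bullet> b < 0}} <= K" using rK by auto
   ultimately have "q : mtop M interior_of K" using lt q unfolding interior_of_def by blast
   thus False using q by (simp add: frontier_of_def)
  qed
  let ?U1 = "{q : fst c Int V. X q ?r : {0<..}}"
  have U1: "opn M ?U1" by (intro smooth_near_preimage openin_Int chart_open[OF c(1)] oV smooth_near_field[OF X] coord_smooth[OF c(1)]) auto
  have pU1: "p : ?U1" using bc c p V by auto
  obtain ze C N where b: "gsmooth ze" "!!q. 0 <= ze q" "!!q. q ~: C ==> ze q = 0" "compactin (mtop M) C" "C <= fst c Int ?U1"
   "opn M N" "p : N" "N <= C" "!!q. q : N ==> ze q = 1"
   using chart_bump[OF c U1 pU1] by blast
  let ?u = "%q. ze q * ?r q"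
  have gu: "gsmooth ?u" by (rule gsmooth_cutoff[OF b(1,4,3)]) (use b(5) coord_smooth[OF c(1)] in blast)+
  have inC: "q : fst c" "q : V" "0 < X q ?r" if "q : C" for q using that b(5) by auto
  have Xu: "X q ?u = ze q * X q ?r" if q: "q : ?F" "q : C" for q
  proof -
   have "q : ?W" using inC(1)[OF q(2)] chart_topspace[OF c(1)] by blast
   hence s: "smooth_near M q ze" using b(1) by (auto simp: gsmooth_def)
   show ?thesis
    using tangent_lin(2)[OF XT[OF inC(2)[OF q(2)]] s coord_smooth[OF c(1) inC(1)[OF q(2)], of b]] rF[OF q(1) inC(1)[OF q(2)]] by simp
  qed
  have Xu0: "0 <= X q ?u" if q: "q : ?F" for q
  proof (cases "q : C")
   case True thus ?thesis using Xu[OF q True] inC(3)[OF True] b(2)[of q] by simp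
  next
   case False
   have "q : ?W" using FK q compactin_subset_topspace[OF cK] by blast
   hence qW: "q : ?W - C" and sm: "smooth_near M q ?u" using False gu unfolding gsmooth_def by blast+
   have "opn M (?W - C)" using compact_closed[OF b(4)] by blast
   from tangent_local[OF XT sm this qW] have "X q ?u = X q (%_. 0)" using b(3) V q by force
   thus ?thesis using tangent_const[OF XT] V q by auto
  qed
  have "P N"
   unfolding P_def
  proof (intro exI[of _ ?u] conjI ballI allI impI gu Xu0)
   fix q show "?u q <= 0" if "q : K"
    using that b(2)[of q] b(3)[of q] rK[of q] inC(1)[of q] by (cases "q : C") (auto simp: mult_nonneg_nonpos)
   show "0 <= ?u q" if "q ~: K"
    using that b(2)[of q] b(3)[of q] rK[of q] inC(1)[of q] by (cases "q : C") auto
   show "0 < ?u q" if "q : N - K"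
    using that b(8,9) rK[of q] inC(1)[of q] by auto
   show "0 < X q ?u" if "q : N Int ?F" using that Xu[of q] b(8,9) inC(3)[of q] by auto
  qed
  thus "EX N. opn M N & p : N & P N" using b by blast
 next
  have "X q (%_. 0) = 0" if "q : ?F" for q using tangent_const[OF XT] that V by blast
  thus "P {}" unfolding P_def by (intro exI[of _ "%_. 0"]) (auto simp: gsmooth_simps)
 next
  fix A B assume "P A" "P B"
  then obtain u u' where *: "gsmooth u" "ALL q:K. u q <= 0" "ALL q. q ~: K --> 0 <= u q" "ALL q:A - K. 0 < u q" "ALL q:?F. 0 <= X q u" "ALL q:A Int ?F. 0 < X q u"
   "gsmooth u'" "ALL q:K. u' q <= 0" "ALL q. q ~: K --> 0 <= u' q" "ALL q:B - K. 0 < u' q" "ALL q:?F. 0 <= X q u'" "ALL q:B Int ?F. 0 < X q u'"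
   unfolding P_def by blast
  have e: "X q (%q. u q + u' q) = X q u + X q u'" if q: "q : ?F" for q
  proof -
   have "q : ?W" using FK q compactin_subset_topspace[OF cK] by blast
   hence "smooth_near M q u" "smooth_near M q u'" using *(1,7) by (auto simp: gsmooth_def)
   from tangent_lin(1)[OF XT this, of 1 1] show ?thesis using q V by auto
  qed
  show "P (A Un B)"
   unfolding P_def
  proof (intro exI[of _ "%q. u q + u' q"] conjI ballI allI impI)
   show "gsmooth (%q. u q + u' q)" by (intro gsmooth_simps(1-4) *)
   fix q
   show "u q + u' q <= 0" if "q : K" using that *(2,8) by (simp add: add_nonpos_nonpos)
   show "0 <= u q + u' q" if "q ~: K" using that *(3,9) by simp
   show "0 < u q + u' q" if "q : (A Un B) - K" using that *(3,9,4,10) by (cases "q : A") (auto intro: add_pos_nonneg add_nonneg_pos)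
   show "0 <= X q (%q. u q + u' q)" if "q : ?F" using that *(5,11) by (simp add: e)
   show "0 < X q (%q. u q + u' q)" if "q : (A Un B) Int ?F"
    using that *(5,11,6,12) by (cases "q : A") (auto simp: e intro: add_pos_nonneg add_nonneg_pos)
  qed
 qed
 then obtain u where u: "gsmooth u" "ALL q:K. u q <= 0" "ALL q:N - K. 0 < u q" "ALL q:N Int ?F. 0 < X q u"
  unfolding P_def by blast
 let ?N = "{q : N Int (V Int U). X q u : {0<..}}"
 have oN: "opn M ?N" by (intro smooth_near_preimage smooth_near_field[OF X] openin_Int N oV U)
   (use u(1) openin_subset[OF oV] in "auto simp: gsmooth_def")
 define G where "G = mtop M interior_of K Un ?N"
 have oI: "opn M G" unfolding G_def by (intro openin_Un openin_interior_of oN)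
 have KI: "K <= G"
 proof
  fix q assume q: "q : K"
  hence "q : mtop M closure_of K" using closure_of_closedin[OF clK] by simp
  hence "q : mtop M interior_of K | q : ?F" by (simp add: frontier_of_def)
  thus "q : G" unfolding G_def using N(2) V U(2) u(4) q by auto
 qed
 \<comment> \<open>\<open>be\<close> is 1 on \<open>O'\<close>, a neighbourhood of \<open>K\<close>.
   On the remainder \<open>C - O'\<close> the function \<open>u\<close> is bounded below by some
   \<open>ep\<close>, so the step in \<open>u / ep\<close> has already reached 1. Hence
   \<open>?ps\<close> differs from 1 only where \<open>be\<close> is 1, and derivatives of
   \<open>be\<close> never enter.\<close>
 obtain be C O' where be: "gsmooth be" "!!q. 0 <= be q" "!!q. be q <= 1" "compactin (mtop M) C" "C <= G"
  "!!q. q ~: C ==> be q = 0" "opn M O'" "K <= O'" "!!q. q : O' ==> be q = 1"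
  using compact_bump[OF cK oI KI] by blast
 have CN: "q : ?N" if "q : C" "q ~: K" for q
  using that be(5) interior_of_subset[of "mtop M" K] unfolding G_def by auto
 have CO: "compactin (mtop M) (C - O')" by (rule closed_compactin[OF be(4) _ closedin_diff[OF compact_closed[OF be(4)] be(7)]]) blast
 obtain N' where N': "opn M N'" "C - O' <= N'" "EX ep>0. ALL q:N'. ep <= u q"
 proof (rule compact_local_global[OF CO, where P = "%N. EX ep>0. ALL q:N. ep <= u q"])
  fix p assume p: "p : C - O'"
  hence pN: "p : ?N" "p ~: K" using CN be(8) by blast+
  hence up: "0 < u p" using u(3) by blast
  have pW: "p : ?W" using pN(1) openin_subset[OF oN] by blast
  have "EX ep>0. ALL q:{q : ?W. u q : {u p / 2<..}}. ep <= u q" by (rule exI[of _ "u p / 2"]) (use up in auto)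
  thus "EX N. opn M N & p : N & (EX ep>0. ALL q:N. ep <= u q)"
   by (intro exI[of _ "{q : ?W. u q : {u p / 2<..}}"] conjI gsmooth_preimage u) (use pW up in auto)
 next
  show "EX ep>0. ALL q:{}. ep <= u q" by (rule exI[of _ 1]) simp
 next
  fix A B assume "EX ep>0. ALL q:A. ep <= u q" "EX ep>0. ALL q:B. ep <= u q"
  then obtain ep ep' where "0 < ep" "ALL q:A. ep <= u q" "0 < ep'" "ALL q:B. ep' <= u q" by blast
  thus "EX ep>0. ALL q:A Un B. ep <= u q" by (intro exI[of _ "min ep ep'"]) (auto simp: min_le_iff_disj)
 qed
 then obtain ep where ep: "0 < ep" "!!q. q : C ==> q ~: O' ==> ep <= u q" by blast
 let ?s = "%q. smooth_step (inverse ep * u q)"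
 let ?ps = "%q. 1 - be q * (1 - ?s q)"
 have gs: "gsmooth ?s" by (intro gsmooth_simps(5)[OF smooth_smooth_step] gsmooth_simps(1-4) u)
 have s01: "0 <= ?s q" "?s q <= 1" for q by (simp_all add: smooth_step_nonneg smooth_step_le_1)
 show ?thesis
 proof (intro exI[of _ ?ps] conjI allI ballI impI)
  show "gsmooth ?ps" by (intro gsmooth_simps(1-4) be(1) gs)
  fix q
  have "be q * (1 - ?s q) <= 1 * 1" by (intro mult_mono) (use be(2,3) s01 in auto)
  thus "0 <= ?ps q" by simp
  show "?ps q <= 1" using be(2)[of q] s01[of q] by simp
  show "?ps q = 0" if "q : K"
   using that u(2) ep(1) be(8) be(9)[of q] by (auto simp: smooth_step_0 mult_nonneg_nonpos)
  show "?ps q = 1" if "q ~: U"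
   using that be(6)[of q] CN[of q] U(2) by auto
  assume "0 < ?ps q & ?ps q < 1"
  hence *: "0 < ?ps q" "?ps q < 1" by blast+
  have R: "q : V & 0 < X q ?ps"
  proof -
   have qC: "q : C" using be(6) * by force
   have s1: "?s q ~= 1" using * by auto
   hence lt: "inverse ep * u q < 1" using smooth_step_1 not_less by blast
   hence "u q < ep" using ep(1) by (simp add: field_simps)
   hence qO: "q : O'" using ep(2)[OF qC] by force
   hence "0 < ?s q" using * be(9) by simp
   hence gt: "0 < inverse ep * u q" using smooth_step_0[of "inverse ep * u q"] by force
   hence "q ~: K" using u(2) ep(1) by (auto simp: zero_less_mult_iff dest!: bspec)
   hence qN: "q : ?N" using CN[OF qC] by blast
   hence q: "q : V" "0 < X q u" "q : ?W" using openin_subset[OF oV] by auto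
   note T = XT[OF q(1)]
   obtain d where d: "0 < d" "(smooth_step has_real_derivative d) (at (inverse ep * u q))" using smooth_step_deriv_pos[OF gt lt] by blast
   have gu: "gsmooth (%q. inverse ep * u q)" by (intro gsmooth_simps(1-4) u)
   have "X q ?ps = X q ?s" by (rule tangent_local[OF T _ be(7) qO]) (use \<open>gsmooth ?ps\<close> q(3) be(9) in "auto simp: gsmooth_def")
   also have "... = d * X q (%q. inverse ep * u q)"
    by (rule tangent_chain[where f = "%q. inverse ep * u q", OF T _ smooth_smooth_step d(2)]) (use gu q(3) in "simp add: gsmooth_def")
   also have "X q (%q. inverse ep * u q) = inverse ep * X q u"
    using tangent_lin(1)[OF T, of u u "inverse ep" 0] u(1) q(3) by (simp add: gsmooth_def)
   finally show ?thesis using q d ep(1) by simp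
  qed
  thus "q : V" "0 < X q ?ps" by blast+
 qed
qed

end

section \<open>Contact exhaustions\<close>

context smooth_mfd
begin

lemma gsmooth_sum: "finite I ==> (!!i. i : I ==> gsmooth (f i)) ==> gsmooth (%q. SUM i:I. f i q)"
 by (induction I rule: finite_induct) (simp_all add: gsmooth_simps(1,2))

lemma gsmooth_chart:
 assumes f: "gsmooth f" and c: "c : charts M" shows "smooth_on (chart_img c) (f o chart_inv c)"
proof (rule smooth_local[OF _ chart_img_open[OF c]])
 fix x assume x: "x : chart_img c"
 let ?p = "chart_inv c x"
 have p: "?p : fst c" "snd c ?p = x" using chart_inv_in[OF x] chart_map_inv[OF x] by auto
 hence "smooth_near M ?p f" using f chart_topspace[OF c] by (auto simp: gsmooth_def)
 from smooth_near_chart[OF this c p(1)]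
 show "EX T. x : T & smooth_on T (f o chart_inv c)" unfolding p(2) by blast
qed

lemma vec_coords_scale: "vec_coords c (%f. k * D f) = k *R vec_coords c D" by (simp add: vec_coords_def scaleR_sum_right)

lemma ext_deriv1_cong:
 assumes "open S" "x : S" "!!y w. y : S ==> al y w = be y w"
 shows "ext_deriv1 al x u v = ext_deriv1 be x u v"
proof -
 have "FD (%y. al y w) x = FD (%y. be y w) x" for w by (rule frechet_derivative_cong_open[OF assms(1,2)]) (use assms(3) in auto)
 thus ?thesis by (simp add: ext_deriv1_def)
qed

lemma gsmooth_local:
 assumes "!!p. p : pts M ==> EX N h. opn M N & p : N & gsmooth h & (ALL q:N. f q = h q)"
 shows "gsmooth f"
 unfolding gsmooth_def
proof
 fix p assume p: "p : pts M"
 then obtain N h where "opn M N" "p : N" "gsmooth h" "ALL q:N. f q = h q" using assms by blast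
 thus "smooth_near M p f"
  using smooth_near_cong[of p h N f] p by (auto simp: gsmooth_def)
qed

end

locale exhausted = smooth_mfd +
 fixes K :: "nat => 'a set"
 assumes K0: "K 0 = {}" and KW: "pts M = (\<Union>n. K n)"
  and Kint: "!!n. K n <= mtop M interior_of K (Suc n)" and Kc: "!!n. compactin (mtop M) (K n)"
begin

abbreviation "W == pts M"

lemma K_mono: "m <= n ==> K m <= K n" by (rule lift_Suc_mono_le[of K]) (use Kint interior_of_subset in fast)

definition level :: "'a => nat" where "level p = (LEAST m. p : K m)"

lemma level: "p : W ==> p : K (level p)" and level_le: "p : K m ==> level p <= m"
 unfolding level_def using KW LeastI Least_le by (metis UN_E, metis)

lemma shell:
 assumes "p : W" obtains m where "level p = Suc m" "p : K (Suc m)" "p ~: K m"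
 using level[OF assms] level_le[of p] K0 by (cases "level p") force+

lemma level_sum:
 assumes "p : K m" "!!n. level p < n ==> f n = 0" shows "(SUM n<=level p. f n) = (SUM n<=m. f n)"
 by (rule sum.mono_neutral_left) (use assms(2) level_le[OF assms(1)] in auto)

text \<open>The metric is a sum of squares of differentials. The functions of \<open>FF n\<close>
  detect all tangent vectors over the shell between \<open>K n\<close> and \<open>K (Suc n)\<close>
  and vanish near \<open>K (n - 1)\<close>, so that the sum is locally finite. For
  \<open>n = 0\<close> truncated subtraction gives the empty set \<open>K 0\<close>.\<close>

lemma metric_exists: "EX g. riemannian_metric M g"
proof -
 define P where "P n N FF \<longleftrightarrow> finite FF & (ALL F:FF. gsmooth F & (EX G. opn M G & K (n - 1) <= G & (ALL q:G. F q = 0))) &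
  (ALL q:N. ALL D:tangent_space M q. (ALL F:FF. D F = 0) --> D = (%_. 0))" for n N FF
 have Pmono: "P n N FF ==> A <= N ==> P n A FF" for n N A FF
  unfolding P_def by (auto dest: subsetD)
 have "EX FF. P n (K (Suc n) - mtop M interior_of K n) FF" for n
 proof -
  let ?A = "K (Suc n) - mtop M interior_of K n" and ?U = "W - K (n - 1)"
  have "compactin (mtop M) ?A" by (rule closed_compactin[OF Kc[of "Suc n"]]) (use compact_closed[OF Kc] in auto)
  then obtain N where "opn M N" "?A <= N" "EX FF. P n N FF"
  proof (rule compact_local_global[where P = "%N. EX FF. P n N FF"])
   fix p assume p: "p : ?A"
   have "p ~: K (n - 1)" using p Kint[of "n - 1"] K0 by (cases n) auto
   hence pU: "p : ?U" using p KW by blast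
   have U: "opn M ?U" using compact_closed[OF Kc] by blast
   obtain c where c: "c : charts M" "p : fst c" using chart_at pU by blast
   obtain ze C N where b: "gsmooth ze" "!!q. q ~: C ==> ze q = 0" "compactin (mtop M) C" "C <= fst c Int ?U"
    "opn M N" "p : N" "N <= C" "!!q. q : N ==> ze q = 1" using chart_bump[OF c U pU] by blast
   let ?F = "%b q. ze q * (snd c q \<bullet> b)"
   have gF: "gsmooth (?F b)" for b by (rule gsmooth_cutoff[OF b(1,3,2)]) (use b(4) coord_smooth[OF c(1)] in blast)+
   have "P n N (?F ` Basis)"
    unfolding P_def
   proof (intro conjI ballI impI)
    fix F assume "F : ?F ` Basis"
    thus "gsmooth F" "EX G. opn M G & K (n - 1) <= G & (ALL q:G. F q = 0)"
     using gF b(2,4) compact_closed[OF b(3)] compactin_subset_topspace[OF Kc[of "n - 1"]] by (auto intro!: exI[of _ "W - C"])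
   next
    fix q D assume q: "q : N" and D: "D : tangent_space M q" and z: "ALL F:?F ` Basis. D F = 0"
    have qc: "q : fst c" using q b(4,7) by blast
    hence qW: "q : W" using chart_topspace[OF c(1)] by blast
    have "D (%q. snd c q \<bullet> b) = 0" if "b : Basis" for b
    proof -
     have "D (?F b) = D (%q. snd c q \<bullet> b)" by (rule tangent_local[OF D _ b(5) q]) (use gF qW b(8) in "auto simp: gsmooth_def")
     thus ?thesis using z that by auto
    qed
    hence "vec_coords c D = 0" by (simp add: vec_coords_def)
    thus "D = (%_. 0)" using tangent_eq_coord_vec[OF c(1) qc D] coord_vec_0[OF c(1) qc] by simp
   qed simp
   thus "EX N. opn M N & p : N & (EX FF. P n N FF)" using b(5,6) by blast
  next
   show "EX FF. P n {} FF" unfolding P_def by (rule exI[of _ "{}"]) simp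
  next
   fix A B assume "EX FF. P n A FF" "EX FF. P n B FF"
   then obtain FF Gs where "P n A FF" "P n B Gs" by blast
   hence "P n (A Un B) (FF Un Gs)" unfolding P_def by (auto simp: ball_Un)
   thus "EX FF. P n (A Un B) FF" by blast
  qed
  then obtain FF where "?A <= N" "P n N FF" by blast
  hence "P n ?A FF" by (rule Pmono[rotated])
  thus ?thesis by blast
 qed
 then obtain FF where FF: "!!n. P n (K (Suc n) - mtop M interior_of K n) (FF n)" by metis
 have fin: "finite (FF n)" and gF: "F : FF n ==> gsmooth F" for n F using FF[of n] unfolding P_def by blast+
 have F0: "D F = 0" if F: "F : FF n" and p: "p : K m" "m < n" and D: "D : tangent_space M p" for D F n m p
 proof -
  obtain G where G: "opn M G" "K (n - 1) <= G" "ALL q:G. F q = 0" using FF[of n] F unfolding P_def by blast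
  have "m <= n - 1" using p(2) by simp
  hence pG: "p : G" using p(1) G(2) K_mono by blast
  have pW: "p : W" using p(1) KW by blast
  have "D F = D (%_. 0)" by (rule tangent_local[OF D _ G(1) pG]) (use gF[OF F] pW G(3) in "auto simp: gsmooth_def")
  thus ?thesis using tangent_const[OF D] by simp
 qed
 define g :: "'a tensor2" where "g p D E = (SUM n<=level p. SUM F:FF n. D F * E F)" for p D E
 have geq: "g p D E = (SUM n<=m. SUM F:FF n. D F * E F)" if "p : K m" "D : tangent_space M p" for p m D E
  unfolding g_def
 proof (rule level_sum[OF that(1)])
  fix n assume "level p < n"
  hence "D F = 0" if "F : FF n" for F using F0[OF that level] \<open>p : K m\<close> \<open>D : tangent_space M p\<close> KW by blast
  thus "(SUM F:FF n. D F * E F) = 0" by simp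
 qed
 have "riemannian_metric M g"
  unfolding riemannian_metric_def smooth_tensor2_def
 proof (intro conjI ballI allI impI)
  fix c assume c: "c : charts M"
  fix x assume x: "x : chart_img c"
  let ?p = "chart_inv c x"
  have p: "?p : fst c" "?p : W" using chart_inv_in[OF x] chart_topspace[OF c] by auto
  have l: "coord_vec M c ?p (u + v) = (%f. coord_vec M c ?p u f + coord_vec M c ?p v f)"
   "coord_vec M c ?p (k *R u) = (%f. k * coord_vec M c ?p u f)" for u v k
   using coord_vec_lin[OF c p(1), of 1 u 1 v] coord_vec_lin[OF c p(1), of k u 0 v] by auto
  show "bilinear (loc2 M c g x)"
   unfolding bilinear_def loc2_def Let_def g_def by (intro conjI allI linearI)
    (simp_all add: l algebra_simps sum.distrib sum_distrib_left)
 next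
  fix c u v assume c: "c : charts M"
  show "smooth_on (chart_img c) (%x. loc2 M c g x u v)"
  proof (rule smooth_local[OF _ chart_img_open[OF c]])
   fix x assume x: "x : chart_img c"
   obtain m where m: "chart_inv c x : K m" using chart_inv_in[OF x] chart_topspace[OF c] KW by blast
   let ?T = "snd c ` (fst c Int mtop M interior_of K (Suc m))"
   let ?d = "%F w y. FD (F o chart_inv c) y w"
   have T: "open ?T" "?T <= chart_img c" by (auto intro!: chart_image_open c openin_interior_of simp: chart_img_def)
   have "smooth_on ?T (%y. SUM n<=Suc m. SUM F:FF n. ?d F u y * ?d F v y)"
    by (intro smooth_sum smooth_mult smooth_deriv smooth_subset[OF gsmooth_chart[OF gF c]] T) (use T in auto)
   hence "smooth_on ?T (%x. loc2 M c g x u v)"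
   proof (rule smooth_cong)
    fix y assume y: "y : ?T"
    let ?q = "chart_inv c y"
    have q: "?q : fst c" "?q : K (Suc m)" "snd c ?q = y"
     using y interior_of_subset[of "mtop M" "K (Suc m)"] by (auto simp: chart_inv_map[OF c])
    have "coord_vec M c ?q w F = ?d F w y" if "F : FF n" for F n w
     using coord_vec_apply[of ?q F c w] gF[OF that] q(2,3) KW by (auto simp: gsmooth_def)
    thus "(SUM n<=Suc m. SUM F:FF n. ?d F u y * ?d F v y) = loc2 M c g y u v"
     unfolding loc2_def Let_def geq[OF q(2) coord_vec_tangent[OF c q(1)]] by (intro sum.cong) auto
   qed
   moreover have "x : ?T"
    using m Kint[of m] chart_inv_in[OF x] chart_map_inv[OF x] by (auto intro!: image_eqI[of _ _ "chart_inv c x"])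
   ultimately show "EX T. x : T & smooth_on T (%x. loc2 M c g x u v)" by (intro exI[of _ ?T] conjI)
  qed
 next
  fix p D E assume p: "p : W" and D: "D : tangent_space M p"
  show "g p D E = g p E D" by (simp add: g_def mult.commute)
  assume "D ~= (%_. 0)"
  moreover obtain m where m: "level p = Suc m" "p : K (Suc m)" "p ~: K m" using shell[OF p] .
  have "p : K (Suc m) - mtop M interior_of K m" using m interior_of_subset[of "mtop M" "K m"] by blast
  ultimately obtain F where F: "F : FF m" "D F ~= 0" using FF[of m] D unfolding P_def by blast
  have "0 < (SUM F:FF m. D F * D F)" by (rule sum_pos2[OF fin F(1)]) (use F(2) in "auto simp: zero_less_mult_iff neq_iff")
  thus "0 < g p D D" unfolding g_def by (intro sum_pos2[of _ m]) (auto simp: m(1) sum_nonneg)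
 qed
 thus ?thesis by blast
qed

end

text \<open>The function \<open>2 pi R\<close> is an angle: near the boundaries of the domains, where its cosine is
 smaller than \<open>1/2\<close>, there is a Liouville field along which \<open>R\<close> increases.\<close>

lemma (in smooth_mfd) contact_exhaustion_function:
 assumes "contact_exhaustion M om K"
 obtains R X where "gsmooth R" "!!p. 0 <= R p" "!!n. compactin (mtop M) {p : pts M. real n <= R p & R p <= real n + 1}"
  "smooth_vector_field_on M (pts M) X"
  "liouville_field_on M om {p : pts M. cos (2 * pi * R p) < 1/2} X"
  "!!p. p : pts M ==> cos (2 * pi * R p) < 1/2 ==> 0 < X p R"
proof -
 interpret exhausted M K
  using assms by unfold_locales (auto simp: contact_exhaustion_def compact_smooth_domain_def)
 define P where "P n V X ps \<longleftrightarrow> liouville_field_on M om V X & gsmooth ps & (ALL q. 0 <= ps q & ps q <= 1) & (ALL q:K n. ps q = 0) &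
  (ALL q. q ~: mtop M interior_of K (Suc n) --> ps q = 1) & (ALL q. 0 < ps q & ps q < 1 --> q : V & 0 < X q ps)" for n V X ps
 have "EX V X ps. P n V X ps" for n
 proof -
  have d: "compact_smooth_domain M (K n)" "convex_contact_boundary M om (K n)" using assms by (auto simp: contact_exhaustion_def)
  obtain V X where VX: "mtop M frontier_of (K n) <= V" "liouville_field_on M om V X"
   "!!p. p : mtop M frontier_of (K n) ==> points_outward M (K n) p (X p)" using d(2) unfolding convex_contact_boundary_def by blast
  have "smooth_vector_field_on M V X" using VX(2) by (simp add: liouville_field_on_def)
  from collar[OF d(1) VX(1) this VX(3) openin_interior_of Kint]
  show ?thesis unfolding P_def using VX(2) by blast
 qed
 then obtain V X ps where P: "!!n. P n (V n) (X n) (ps n)" by metis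
 have ps: "gsmooth (ps n)" "0 <= ps n q" "ps n q <= 1" "q : K n ==> ps n q = 0" "q ~: K (Suc n) ==> ps n q = 1"
  "0 < ps n q ==> ps n q < 1 ==> q : V n & 0 < X n q (ps n)" and li: "liouville_field_on M om (V n) (X n)" for n q
  using P[of n] interior_of_subset[of "mtop M" "K (Suc n)"] unfolding P_def by blast+
 have XV: "opn M (V n)" "q : V n ==> X n q : tangent_space M q"
  "c : charts M ==> smooth_on (snd c ` (fst c Int V n)) (%x. vec_coords c (X n (chart_inv c x)))" for n q c
  using li[of n] by (auto simp: liouville_field_on_def smooth_vector_field_on_def)
 \<comment> \<open>Each collar function rises from 0 to 1 across one shell, so that
   \<open>R p = real m + ps m p\<close> on the shell between \<open>K m\<close> and
   \<open>K (Suc m)\<close>.\<close>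
 define R where "R p = (SUM n<=level p. ps n p)" for p
 have Rsum: "R p = (SUM n<=m. ps n p)" if "p : K m" for p m
  unfolding R_def by (rule level_sum[OF that]) (use ps(4) K_mono level that KW less_imp_le in blast)
 have Rs: "R p = real m + ps m p" if "p : K (Suc m)" "p ~: K m" for p m
 proof -
  have "ps n p = 1" if "n < m" for n using ps(5) K_mono[of "Suc n" m] that \<open>p ~: K m\<close> by auto
  hence "(\<Sum>n<m. ps n p) = real m" by simp
  thus ?thesis using Rsum[OF that(1)] ps(4)[OF that(1)] by (simp add: lessThan_Suc_atMost[symmetric])
 qed
 have R0: "0 <= R p" for p unfolding R_def by (intro sum_nonneg ps(2))
 have gR: "gsmooth R"
 proof (rule gsmooth_local)
  fix p assume "p : W"
  then obtain m where "p : K m" using KW by blast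
  thus "EX N h. opn M N & p : N & gsmooth h & (ALL q:N. R q = h q)"
   using Kint[of m] interior_of_subset[of "mtop M" "K (Suc m)"]
   by (intro exI[of _ "mtop M interior_of K (Suc m)"] exI[of _ "%q. SUM n<=Suc m. ps n q"])
    (auto intro!: gsmooth_sum ps(1) Rsum simp del: sum.atMost_Suc)
 qed
 have cR: "compactin (mtop M) {p : W. real n <= R p & R p <= real n + 1}" for n
 proof (rule closed_compactin[OF Kc[of "Suc (Suc n)"]])
  show "{p : W. real n <= R p & R p <= real n + 1} <= K (Suc (Suc n))"
  proof
   fix p assume p: "p : {p : W. real n <= R p & R p <= real n + 1}"
   then obtain m where m: "p : K (Suc m)" "p ~: K m" using shell by blast
   hence "real m <= real (Suc n)" using Rs[OF m] ps(2)[of m p] p by simp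
   thus "p : K (Suc (Suc n))" using m(1) K_mono[of "Suc m" "Suc (Suc n)"] by auto
  qed
  have "{p : W. real n <= R p & R p <= real n + 1} = W - {p : W. R p : - {real n..real n + 1}}" by auto
  thus "closedin (mtop M) {p : W. real n <= R p & R p <= real n + 1}"
   using gsmooth_preimage[OF gR, of "- {real n..real n + 1}"] by auto
 qed
 \<comment> \<open>Equal to 1 where the cosine is at most 1/2 and to 0 where it is at least 3/4.
   Integral values of \<open>R\<close> lie in the latter region, so the Liouville fields of
   different boundaries fit together to a global smooth field.\<close>
 define ka where "ka x = smooth_step (3 - 4 * cos (2 * pi * x))" for x
 have ska: "smooth_on UNIV ka"
  unfolding ka_def by (rule smooth_comp[OF smooth_smooth_step], rule smooth_diff, rule smooth_const, simp, rule smooth_cmult,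
    rule smooth_comp[OF smooth_cos], intro smooth_cmult smooth_ident) auto
 define Z where "Z p = (%f. ka (R p) * X (level p - 1) p f)" for p
 define Q where "Q m = {p : W. ps m p : {0<..<1}}" for m
 have oQ: "opn M (Q m)" for m unfolding Q_def by (intro gsmooth_preimage ps(1)) simp
 have Qs: "p : K (Suc m)" "p ~: K m" "level p = Suc m" "p : V m" "R p = real m + ps m p" "0 < X m p (ps m)" if "p : Q m" for p m
 proof -
  have 01: "p : W" "0 < ps m p" "ps m p < 1" using that by (auto simp: Q_def)
  show 1: "p : K (Suc m)" "p ~: K m" "p : V m" "0 < X m p (ps m)" using ps(4)[of p m] ps(5)[of p m] ps(6)[of m p] 01 by force+
  show "R p = real m + ps m p" by (rule Rs[OF 1(1,2)])
  obtain k where k: "level p = Suc k" "p : K (Suc k)" "p ~: K k" using shell[OF 01(1)] .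
  show "level p = Suc m" using level_le[OF 1(1)] K_mono[of "Suc k" m] k 1 by (cases "k < m") auto
 qed
 have cover: "EX m. p : Q m" if p: "p : W" "cos (2 * pi * R p) ~= 1" for p
 proof -
  obtain m where m: "p : K (Suc m)" "p ~: K m" using shell[OF p(1)] .
  have e: "2 * pi * R p = 2 * pi * ps m p + real m * (2 * pi)" using Rs[OF m] by (simp add: algebra_simps)
  have "cos (2 * pi * R p) = cos (2 * pi * ps m p)" unfolding e using cos.plus_of_nat[of "2 * pi * ps m p" m] by (simp add: mult.commute)
  hence "ps m p ~= 0" "ps m p ~= 1" using p(2) by auto
  hence "p : Q m" using p(1) ps(2,3)[of m p] by (simp add: Q_def less_le)
  thus ?thesis by blast
 qed
 have ZQ: "Z p = (%f. ka (R p) * X m p f)" if "p : Q m" for p m unfolding Z_def Qs(3)[OF that] by simp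
 have Z0: "Z p = (%_. 0)" if "3/4 <= cos (2 * pi * R p)" for p
  unfolding Z_def ka_def using that by (simp add: smooth_step_0)
 have tsc: "(%f. k * D f) : tangent_space M p" if "D : tangent_space M p" for D k p
  using that by (auto simp: tangent_space_def algebra_simps)
 have Zs: "smooth_vector_field_on M W Z"
  unfolding smooth_vector_field_on_def
 proof (intro conjI ballI)
  fix p assume p: "p : W"
  show "Z p : tangent_space M p"
  proof (cases "3/4 <= cos (2 * pi * R p)")
   case True
   show ?thesis unfolding Z0[OF True] by (simp add: tangent_space_def)
  next
   case False
   then obtain m where "p : Q m" using cover[OF p] by auto
   thus ?thesis unfolding ZQ[OF \<open>p : Q m\<close>] by (intro tsc XV(2) Qs(4))
  qed
 next
  fix c assume c: "c : charts M"
  have e: "fst c Int W = fst c" using chart_topspace[OF c] by blast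
  show "smooth_on (snd c ` (fst c Int W)) (%x. vec_coords c (Z (chart_inv c x)))"
   unfolding e chart_img_def[symmetric]
  proof (rule smooth_local[OF _ chart_img_open[OF c]])
   fix x assume x: "x : chart_img c"
   have p: "chart_inv c x : fst c" "chart_inv c x : W" "snd c (chart_inv c x) = x"
    using chart_inv_in[OF x] chart_map_inv[OF x] e by auto
   show "EX T. x : T & smooth_on T (%x. vec_coords c (Z (chart_inv c x)))"
   proof (cases "3/4 < cos (2 * pi * R (chart_inv c x))")
    case True
    let ?T = "snd c ` (fst c Int {p : W. R p : {r. 3/4 < cos (2 * pi * r)}})"
    have T: "open ?T" by (intro chart_image_open c gsmooth_preimage gR open_Collect_less continuous_intros)
    have "smooth_on ?T (%x. vec_coords c (Z (chart_inv c x)))"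
     by (rule smooth_cong[OF smooth_const[OF T, of 0]]) (auto simp: chart_inv_map[OF c] Z0 vec_coords_def)
    moreover have "x : ?T" using True p by (intro image_eqI[of _ _ "chart_inv c x"]) auto
    ultimately show ?thesis by (intro exI[of _ ?T] conjI)
   next
    case False
    then obtain m where m: "chart_inv c x : Q m" using cover[OF p(2)] by auto
    let ?T = "snd c ` (fst c Int Q m)"
    have T: "open ?T" "?T <= chart_img c" "?T <= snd c ` (fst c Int V m)"
     using Qs(4) by (auto intro!: chart_image_open c oQ simp: chart_img_def)
    have "smooth_on ?T (%x. (ka ((R o chart_inv c) x)) *R vec_coords c (X m (chart_inv c x)))"
     by (intro smooth_scaleR smooth_comp[OF ska smooth_subset[OF gsmooth_chart[OF gR c] T(1,2)]]
       smooth_subset[OF XV(3)[OF c] T(1,3)]) auto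
    hence "smooth_on ?T (%x. vec_coords c (Z (chart_inv c x)))" by (rule smooth_cong) (auto simp: chart_inv_map[OF c] ZQ vec_coords_scale)
    moreover have "x : ?T" using m p by (intro image_eqI[of _ _ "chart_inv c x"]) auto
    ultimately show ?thesis by (intro exI[of _ ?T] conjI)
   qed
  qed
 qed auto
 let ?N = "{p : W. cos (2 * pi * R p) < 1/2}"
 have oN: "opn M ?N"
  using gsmooth_preimage[OF gR, of "{r. cos (2 * pi * r) < 1/2}"] by (simp add: open_Collect_less continuous_intros)
 have ZX: "EX m. p : Q m" "!!m. p : Q m ==> Z p = X m p" if p: "p : ?N" for p
  using cover[of p] p ZQ by (auto simp: ka_def smooth_step_1)
 have "liouville_field_on M om ?N Z"
  unfolding liouville_field_on_def
 proof (intro conjI ballI allI)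
  show "smooth_vector_field_on M ?N Z"
   unfolding smooth_vector_field_on_def
  proof (intro conjI ballI oN)
   fix p assume "p : ?N" thus "Z p : tangent_space M p" using Zs by (auto simp: smooth_vector_field_on_def)
  next
   fix c assume c: "c : charts M"
   have "smooth_on (snd c ` (fst c Int W)) (%x. vec_coords c (Z (chart_inv c x)))" using Zs c by (simp add: smooth_vector_field_on_def)
   thus "smooth_on (snd c ` (fst c Int ?N)) (%x. vec_coords c (Z (chart_inv c x)))" by (rule smooth_subset[OF _ chart_image_open[OF c oN]]) blast
  qed
  fix c x u v assume c: "c : charts M" and x: "x : snd c ` (fst c Int ?N)"
  then obtain p where p: "p : fst c" "p : ?N" "x = snd c p" by blast
  obtain m where m: "p : Q m" using ZX(1)[OF p(2)] by blast
  let ?T = "snd c ` (fst c Int (Q m Int ?N))"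
  have T: "open ?T" by (intro chart_image_open[OF c] openin_Int oQ oN)
  have xT: "x : ?T" using p m by blast
  have "ext_deriv1 (%y w. let q = chart_inv c y in om q (Z q) (coord_vec M c q w)) x u v
   = ext_deriv1 (%y w. let q = chart_inv c y in om q (X m q) (coord_vec M c q w)) x u v"
  proof (rule ext_deriv1_cong[OF T xT])
   fix y w assume "y : ?T"
   hence "chart_inv c y : Q m" "chart_inv c y : ?N" by (auto simp: chart_inv_map[OF c])
   hence "Z (chart_inv c y) = X m (chart_inv c y)" using ZX(2) by blast
   thus "(let q = chart_inv c y in om q (Z q) (coord_vec M c q w)) = (let q = chart_inv c y in om q (X m q) (coord_vec M c q w))"
    by (simp add: Let_def)
  qed
  also have "... = loc2 M c om x u v"
   using li[of m] c Qs(4)[OF m] p unfolding liouville_field_on_def by blast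
  finally show "ext_deriv1 (%y w. let q = chart_inv c y in om q (Z q) (coord_vec M c q w)) x u v = loc2 M c om x u v" .
 qed
 moreover have "0 < Z p R" if p: "p : W" "cos (2 * pi * R p) < 1/2" for p
 proof -
  have pN: "p : ?N" using p by blast
  obtain m where m: "p : Q m" using ZX(1)[OF pN] by blast
  note T = XV(2)[OF Qs(4)[OF m]]
  have sm: "smooth_near M p R" "smooth_near M p (ps m)" "smooth_near M p (%_. 1)" using gR ps(1) p(1) smooth_near_const by (auto simp: gsmooth_def)
  have "Z p R = X m p R" using ZX(2)[OF pN m] by simp
  also have "... = X m p (%q. 1 * ps m q + real m * 1)" by (rule tangent_local[OF T sm(1) oQ m]) (use Qs(5) in auto)
  also have "... = X m p (ps m)" using tangent_lin(1)[OF T sm(2,3), of 1 "real m"] tangent_const[OF T] by simp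
  finally show ?thesis using Qs(6)[OF m] by simp
 qed
 ultimately show ?thesis using that[OF gR R0 cR Zs] by blast
qed

section \<open>Families of metrics in stretched coordinates\<close>

lemma bilinear_bound_compact:
 fixes T :: "'z::t2_space => 'e::euclidean_space => 'e => 'c::real_normed_vector"
 assumes C: "compact C" and T: "!!z. z : C ==> bilinear (T z)" and c: "!!u v. continuous_on C (%z. T z u v)"
 obtains k where "0 <= k" "!!z u v. z : C ==> norm (T z u v) <= k * norm u * norm v"
proof -
 let ?S = "%z. SUM a:Basis. SUM b:Basis. norm (T z a b)"
 have "continuous_on C ?S" by (intro continuous_intros c)
 from compact_imp_bounded[OF compact_continuous_image[OF this C]]
 obtain k where k: "!!z. z : C ==> \<bar>?S z\<bar> <= k" "0 < k" unfolding bounded_pos by auto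
 show ?thesis
 proof (rule that[of k])
  fix z u v assume z: "z : C"
  have l: "linear (%u. T z u v)" "linear (T z u)" for u v using T[OF z] by (auto simp: bilinear_def)
  have "norm (T z u v) <= (SUM a:Basis. norm (T z a v)) * norm u" by (rule frechet_bound_basis[OF l(1)])
  also have "... <= (SUM a:Basis. (SUM b:Basis. norm (T z a b)) * norm v) * norm u"
   by (intro mult_right_mono sum_mono frechet_bound_basis[OF l(2)]) simp
  also have "... = ?S z * norm v * norm u" by (simp add: sum_distrib_right)
  also have "... <= k * norm v * norm u" by (intro mult_right_mono) (use k(1)[OF z] in auto)
  finally show "norm (T z u v) <= k * norm u * norm v" by (simp add: mult_ac)
 qed (use k in simp)
qed

text \<open>On a neck, the first component of a point of \<open>Z\<close> is the inverse stretching
  factor and the second a point of a chart with \<open>R\<close> as a coordinate; \<open>L\<close>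
  is the derivative of the inverse stretching map and \<open>l\<close> the logarithmic derivative of
  the conformal factor, both taken in stretched coordinates.\<close>

locale metric_family =
 fixes Z :: "(real \<times> 'e::euclidean_space) set" and G :: "real \<times> 'e => 'e => 'e => real"
  and L :: "real \<times> 'e => 'e => 'e" and l :: "real \<times> 'e => 'e => real"
 assumes Z: "open Z"
  and G: "!!z. z : Z ==> bilinear (G z)" "!!z u v. z : Z ==> G z u v = G z v u" "!!z u. z : Z ==> u ~= 0 ==> 0 < G z u u"
   "!!u v. smooth_on Z (%z. G z u v)"
  and L: "!!z. z : Z ==> linear (L z)" "!!v. smooth_on Z (%z. L z v)"
  and l: "!!z. z : Z ==> linear (l z)" "!!v. smooth_on Z (%z. l z v)"
begin

text \<open>The operators below become the derivatives and Christoffel symbols of the metric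
 \<open>f(y) G(\<theta>, X(y))\<close> when \<open>X\<close> and \<open>f\<close> have the derivatives \<open>L\<close> and \<open>f l\<close>.\<close>

definition DD :: "real \<times> 'e => 'e => 'e => 'e => real" where
 "DD z h u v = FD (%z. G z u v) z (0, L z h) + l z h * G z u v"

definition C1 :: "real \<times> 'e => 'e => 'e => 'e => real" where
 "C1 z u v w = (DD z u v w + DD z v u w - DD z w u v) / 2"

definition Ga :: "real \<times> 'e => 'e => 'e => 'e" where
 "Ga z u v = inv (gram (G z)) (SUM b:Basis. C1 z u v b *R b)"

definition dGa :: "real \<times> 'e => 'e => 'e => 'e => 'e" where
 "dGa z h u v = FD (%z. Ga z u v) z (0, L z h)"

lemma nondeg: "z : Z ==> nondegenerate (G z)"
 unfolding nondegenerate_def using G(3) by (metis less_irrefl)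

lemma smooth_0L: "smooth_on Z (%z. (0::real, L z h))" by (intro smooth_Pair smooth_const Z L)

lemma smooth_DD: "smooth_on Z (%z. DD z h u v)"
 unfolding DD_def by (intro smooth_add smooth_mult smooth_deriv_apply[OF G(4) smooth_0L] l(2) G(4))

lemma smooth_Ga: "smooth_on Z (%z. Ga z u v)"
proof -
 have "smooth_on Z (%z. C1 z u v b)" for b
  unfolding C1_def divide_inverse by (intro smooth_mult smooth_add smooth_diff smooth_DD smooth_const Z)
 thus ?thesis
  unfolding Ga_def by (intro smooth_linear_apply[OF linear_inj_inv(1) smooth_inv_linear] smooth_sum smooth_scaleR smooth_const)
   (auto intro!: Z linear_gram inj_gram nondeg G(1) smooth_gram[OF Z G(4)])
qed

lemma smooth_dGa: "smooth_on Z (%z. dGa z h u v)"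
 unfolding dGa_def by (rule smooth_deriv_apply[OF smooth_Ga smooth_0L])

lemma frechet_linear0:
 assumes f: "smooth_on Z f" and z: "z : Z" shows "linear (%h. FD f z (0, L z h))"
proof -
 have "linear (%h. (0::real, L z h))" using L(1)[OF z] by (auto simp: linear_iff)
 from linear_compose[OF this smooth_FD_linear[OF f z]] show ?thesis by (simp add: o_def)
qed

lemma DD_linear: assumes z: "z : Z" shows "linear (%h. DD z h u v)" "bilinear (DD z h)"
proof -
 show "linear (%h. DD z h u v)"
  unfolding DD_def using frechet_linear0[OF G(4) z, of u v] l(1)[OF z] by (auto simp: linear_iff algebra_simps)
 have "bilinear (%u v. FD (%z. G z u v) z (0, L z h))" by (rule bilinear_frechet_derivative[OF G(1) G(4) z])
 thus "bilinear (DD z h)"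
  unfolding DD_def using G(1)[OF z] by (auto simp: bilinear_def linear_iff algebra_simps)
qed

lemma C1_linear: assumes z: "z : Z" shows "linear (C1 z u v)" "linear (%u. C1 z u v w)" "linear (%v. C1 z u v w)"
proof -
 note * = DD_linear[OF z]
 have 1: "linear (%u. DD z h u v)" "linear (DD z h u)" for h u v using *(2) by (auto simp: bilinear_def)
 note c = linear_add linear_cmul
 show "linear (C1 z u v)" "linear (%u. C1 z u v w)" "linear (%v. C1 z u v w)"
  unfolding C1_def by (rule linearI; simp add: c[OF *(1)] c[OF 1(1)] c[OF 1(2)] add_divide_distrib diff_divide_distrib algebra_simps)+
qed

lemma bilinear_Ga: assumes z: "z : Z" shows "bilinear (Ga z)"
proof -
 have i: "linear (inv (gram (G z)))" by (intro linear_inj_inv(1) linear_gram inj_gram G(1) nondeg z)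
 note c = linear_add linear_cmul
 show ?thesis
  unfolding bilinear_def Ga_def by (intro conjI allI; rule linearI)
   (simp_all add: c[OF C1_linear(2)[OF z]] c[OF C1_linear(3)[OF z]] scaleR_add_left sum.distrib
    linear_add[OF i] linear_cmul[OF i, symmetric] scaleR_sum_right)
qed

lemma dGa_linear: assumes z: "z : Z" shows "linear (%h. dGa z h u v)" "bilinear (dGa z h)"
 using frechet_linear0[OF smooth_Ga z] bilinear_frechet_derivative[OF bilinear_Ga smooth_Ga z]
 unfolding dGa_def by blast+

lemma bounds:
 assumes C: "compact C" "C <= Z"
 shows "EX a b k. 0 < a & 0 < b & 0 < k & (ALL z:C. (ALL u. a * (norm u)\<^sup>2 <= G z u u & G z u u <= b * (norm u)\<^sup>2 & \<bar>l z u\<bar> <= k * norm u) &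
  (ALL u v. norm (Ga z u v) <= k * norm u * norm v) & (ALL h u v. norm (dGa z h u v) <= k * norm h * norm u * norm v))"
proof -
 have cZ: "continuous_on C f" if "smooth_on Z f" for f :: "real \<times> 'e => 'c::real_normed_vector"
  using continuous_on_subset[OF smooth_cont[OF that] C(2)] .
 have inZ: "z : C ==> z : Z" for z using C(2) by blast
 obtain b where b: "0 <= b" "!!z u v. z : C ==> norm (G z u v) <= b * norm u * norm v"
  using bilinear_bound_compact[OF C(1) G(1)[OF inZ] cZ[OF G(4)]] by blast
 obtain k1 where k1: "0 <= k1" "!!z u v. z : C ==> norm (Ga z u v) <= k1 * norm u * norm v"
  using bilinear_bound_compact[OF C(1) bilinear_Ga[OF inZ] cZ[OF smooth_Ga]] by blast
 have "EX k>=0. ALL z:C. ALL u v. norm (dGa z h u v) <= k * norm u * norm v" for h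
  using bilinear_bound_compact[OF C(1) dGa_linear(2)[OF inZ] cZ[OF smooth_dGa]] by metis
 then obtain K where K: "!!h. 0 <= K h" "!!h z u v. z : C ==> norm (dGa z h u v) <= K h * norm u * norm v" by metis
 define k2 where "k2 = (SUM h:Basis. K h)"
 have k2: "0 <= k2" "norm (dGa z h u v) <= k2 * norm h * norm u * norm v" if z: "z : C" for z h u v
 proof -
  show "0 <= k2" unfolding k2_def by (intro sum_nonneg K)
  have "norm (dGa z h u v) <= (SUM b:Basis. norm (dGa z b u v)) * norm h" by (rule frechet_bound_basis[OF dGa_linear(1)[OF inZ[OF z]]])
  also have "... <= (SUM b:Basis. K b * norm u * norm v) * norm h" by (intro mult_right_mono sum_mono K z) simp
  also have "(SUM b:Basis. K b * norm u * norm v) = k2 * (norm u * norm v)" by (simp add: k2_def sum_distrib_right mult.assoc)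
  finally have "norm (dGa z h u v) <= k2 * norm h * norm u * norm v" by (simp add: mult_ac)
  thus "norm (dGa z h u v) <= k2 * norm h * norm u * norm v" .
 qed
 obtain k3 where k3: "0 <= k3" "!!z u. z : C ==> \<bar>l z u\<bar> <= k3 * norm u"
 proof -
  obtain e :: 'e where e: "e : Basis" using nonempty_Basis by blast
  have 1: "bilinear (%u v. l z u * (v \<bullet> e))" if "z : C" for z
   using l(1)[OF inZ[OF that]] by (auto simp: bilinear_def linear_iff algebra_simps)
  have 2: "continuous_on C (%z. l z u * (v \<bullet> e))" for u v by (intro continuous_intros cZ l)
  obtain k where k: "0 <= k" "!!z u v. z : C ==> norm (l z u * (v \<bullet> e)) <= k * norm u * norm v"
   using bilinear_bound_compact[where T = "%z u v. l z u * (v \<bullet> e)", OF C(1) 1 2] by blast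
  show ?thesis using that[OF k(1)] k(2)[of _ _ e] e by (simp add: inner_Basis)
 qed
 obtain a where a: "0 < a" "!!z u. z : C ==> norm u = 1 ==> a <= G z u u"
 proof (cases "C \<times> sphere (0::'e) 1 = {}")
  case True
  thus ?thesis using that[of 1] by auto
 next
  case False
  have e: "G z u u = (SUM b:Basis. (u \<bullet> b) *R (SUM b':Basis. (u \<bullet> b') *R G z b b'))" if "z : C" for z u
  proof -
   have L1: "linear (%w. G z w u)" and L2: "linear (G z w)" for w
    using G(1)[OF inZ[OF that]] by (auto simp: bilinear_def)
   show ?thesis
    unfolding linear_basis_expand[OF L1, of u] by (intro sum.cong refl arg_cong[where f = "scaleR _"] linear_basis_expand[OF L2])
  qed
  have c: "continuous_on (C \<times> sphere 0 1) (%(z, u). G z u u)"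
  proof -
   have "continuous_on (C \<times> sphere 0 1) (%p. SUM b:Basis. (snd p \<bullet> b) *R (SUM b':Basis. (snd p \<bullet> b') *R G (fst p) b b'))"
    by (intro continuous_intros continuous_on_compose2[OF cZ[OF G(4)]]) auto
   thus ?thesis by (rule continuous_on_cong[THEN iffD1, rotated -1]) (use e in auto)
  qed
  obtain m where m: "m : C \<times> sphere 0 1" "ALL p:C \<times> sphere 0 1. (case m of (z, u) => G z u u) <= (case p of (z, u) => G z u u)"
   using continuous_attains_inf[OF compact_Times[OF C(1) compact_sphere] False c] by blast
  obtain z u where zu: "m = (z, u)" by (cases m)
  have "u ~= 0" using m(1) zu by auto
  hence "0 < G z u u" using m(1) zu G(3)[OF inZ, of z u] by simp
  thus ?thesis using that[of "G z u u"] m zu by auto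
 qed
 have low: "a * (norm u)\<^sup>2 <= G z u u" if z: "z : C" for z u
 proof (cases "u = 0")
  case True
  thus ?thesis using bilinear_lzero[OF G(1)[OF inZ[OF z]]] by simp
 next
  case False
  have "a <= G z (inverse (norm u) *R u) (inverse (norm u) *R u)" by (rule a(2)[OF z]) (use False in simp)
  also have "... = G z u u / (norm u)\<^sup>2"
   by (simp add: bilinear_lmul[OF G(1)[OF inZ[OF z]]] bilinear_rmul[OF G(1)[OF inZ[OF z]]] power2_eq_square divide_inverse)
  finally show ?thesis using False by (simp add: le_divide_eq)
 qed
 define k where "k = k1 + \<bar>k2\<bar> + k3 + 1"
 have up: "k1 * n <= k * n" "k2 * n <= k * n" "k3 * n <= k * n" if "0 <= n" for n
  using that k1(1) k3(1) by (auto simp: k_def intro!: mult_right_mono)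
 show ?thesis
 proof (rule exI[of _ a], rule exI[of _ "b + 1"], rule exI[of _ k], intro conjI ballI allI)
  show "0 < a" "0 < b + 1" "0 < k" using a(1) b(1) k1(1) k3(1) by (auto simp: k_def)
  fix z assume z: "z : C"
  show "a * (norm u)\<^sup>2 <= G z u u" "G z u u <= (b + 1) * (norm u)\<^sup>2" for u
   using low[OF z, of u] b(2)[OF z, of u u] by (simp_all add: power2_eq_square distrib_right mult.assoc add_increasing2 abs_le_iff)
  show "norm (Ga z u v) <= k * norm u * norm v" for u v
   using k1(2)[OF z, of u v] up(1)[of "norm u * norm v"] by (simp add: mult.assoc)
  show "norm (dGa z h u v) <= k * norm h * norm u * norm v" for h u v
   by (rule order_trans[OF k2(2)[OF z]]) (use up(2)[of "norm h * norm u * norm v"] in "simp add: mult.assoc")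
  show "\<bar>l z u\<bar> <= k * norm u" for u using k3(2)[OF z, of u] up(3)[of "norm u"] by simp
 qed
qed

text \<open>The factor \<open>f\<close> multiplies both sides of the equation that defines the
  Christoffel symbols and drops out; its derivative enters only through \<open>l\<close>. The bounds
  on \<open>Ga\<close> and \<open>dGa\<close> therefore hold however large \<open>f\<close>
  is.\<close>

lemma pullback_christoffel:
 assumes H: "metric_on Y H" and in_Z: "!!y. y : Y ==> (te, X y) : Z"
  and X: "!!y. y : Y ==> (X has_derivative L (te, X y)) (at y)"
  and f: "!!y. y : Y ==> 0 < f y" "!!y. y : Y ==> (f has_derivative (%v. f y * l (te, X y) v)) (at y)"
  and HG: "!!y u v. y : Y ==> H y u v = f y * G (te, X y) u v"
  and y: "y : Y"
 shows "christoffel H y u v = Ga (te, X y) u v" "dfield (christoffel H) y h u v = dGa (te, X y) h u v"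
proof -
 have dF: "((%y. F (te, X y)) has_derivative (%h. FD F (te, X y) (0, L (te, X y) h))) (at y)"
  if "smooth_on Z F" "y : Y" for F :: "real \<times> 'e => 'd::real_normed_vector" and y
 proof -
  have "((%y. (te, X y)) has_derivative (%h. (0, L (te, X y) h))) (at y)" by (intro has_derivative_Pair has_derivative_const X that)
  from has_derivative_compose[OF this smooth_has_derivative[OF that(1) in_Z[OF that(2)]]] show ?thesis .
 qed
 have oY: "open Y" by (rule metric_onD(1)[OF H])
 have dH: "dfield H y h u v = f y * DD (te, X y) h u v" if y: "y : Y" for y h u v
 proof -
  have "FD (%y. H y u v) y = FD (%y. f y * G (te, X y) u v) y" by (rule frechet_derivative_cong_open[OF oY y HG])
  thus ?thesis
   unfolding has_derivative_frechet[OF has_derivative_mult[OF f(2)[OF y] dF[OF G(4) y]]] DD_def by (simp add: algebra_simps)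
 qed
 have c1: "christoffel1 H y u v w = f y * C1 (te, X y) u v w" if "y : Y" for y u v w
  unfolding christoffel1_def C1_def dH[OF that] by (simp add: algebra_simps)
 have ch: "christoffel H y u v = Ga (te, X y) u v" if y: "y : Y" for y u v
 proof (rule christoffel_eqI[OF H y])
  fix w
  note z = in_Z[OF y]
  show "H y (Ga (te, X y) u v) w = christoffel1 H y u v w"
   unfolding c1[OF y] HG[OF y] Ga_def gram_solve[OF G(1)[OF z] nondeg[OF z] C1_linear(1)[OF z]] ..
 qed
 have "FD (%y. christoffel H y u v) y = FD (%y. Ga (te, X y) u v) y" by (rule frechet_derivative_cong_open[OF oY y ch])
 thus "christoffel H y u v = Ga (te, X y) u v" "dfield (christoffel H) y h u v = dGa (te, X y) h u v"
  unfolding dGa_def by (simp_all add: has_derivative_frechet[OF dF[OF smooth_Ga y]] ch[OF y])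
qed

end

text \<open>Around \<open>p\<close> the metric is \<open>f\<close> times the member of the family at
  the fixed parameter \<open>te\<close>, with all points \<open>(te, X y)\<close> in
  \<open>C\<close>; constants obtained from compactness of \<open>C\<close> then serve for all
  metrics, points and parameters.\<close>

definition (in smooth_mfd) adapted ::
  "'a tensor2 => ('a, 'e) chart => 'a => real => (real \<times> 'e) set => (real \<times> 'e => 'e => 'e => real) =>
   (real \<times> 'e => 'e => 'e) => (real \<times> 'e => 'e => real) => real => ('e => 'e) => ('e => real) => bool" where
 "adapted g c p r C G L l te X f \<longleftrightarrow> riemannian_metric M g & c : charts M & p : fst c & ball (snd c p) r <= chart_img c &
  (ALL y:ball (snd c p) r. (te, X y) : C & (X has_derivative L (te, X y)) (at y) & 0 < f y &
   (f has_derivative (%v. f y * l (te, X y) v)) (at y) & (ALL u v. loc2 M c g y u v = f y * G (te, X y) u v))"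

text \<open>On a ball of radius at most 4 the factor \<open>f\<close> varies by at most
  \<open>exp (4 * k)\<close> in either direction. Enlarging \<open>f\<close> scales the bounds
  \<open>a\<close> and \<open>b\<close> of the metric but neither \<open>k\<close> nor
  \<open>rh\<close>, and the curvature condition compares one power of the factor with its square.
  So a lower bound for \<open>f\<close> at the centre suffices.\<close>

lemma (in smooth_mfd) family_good_chart:
 assumes fam: "metric_family Z G L l" and C: "compact C" "C <= Z" and et: "0 < et" and rh0: "0 < rh0"
 shows "EX D0. ALL g c p te X f. adapted g c p rh0 C G L l te X f & D0 <= f (snd c p) --> (EX rh a b K. good_chart g et p c rh a b K)"
proof -
 interpret metric_family Z G L l by (rule fam)
 obtain a b k where abk: "0 < a" "0 < b" "0 < k"
  and B: "ALL z:C. (ALL u. a * (norm u)\<^sup>2 <= G z u u & G z u u <= b * (norm u)\<^sup>2 & \<bar>l z u\<bar> <= k * norm u) &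
  (ALL u v. norm (Ga z u v) <= k * norm u * norm v) & (ALL h u v. norm (dGa z h u v) <= k * norm h * norm u * norm v)"
  using bounds[OF C] by (elim exE conjE)
 have bG: "a * (norm u)\<^sup>2 <= G z u u & G z u u <= b * (norm u)\<^sup>2" and bl: "\<bar>l z u\<bar> <= k * norm u"
  and bGa: "norm (Ga z u v) <= k * norm u * norm v" and bd: "norm (dGa z h u v) <= k * norm h * norm u * norm v" if "z : C" for z h u v
  using B that by blast+
 define rh where "rh = min (min 1 (et / k)) (rh0 / 4)"
 have rh: "0 < rh" "rh <= 1" "rh * k <= et" "4 * rh <= rh0"
 proof -
  have "rh <= et / k" by (simp add: rh_def)
  thus "rh * k <= et" using abk by (simp add: pos_le_divide_eq)
 qed (use abk et rh0 in "auto simp: rh_def")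
 define e where "e = exp (4 * k)"
 have e: "0 < e" by (simp add: e_def)
 \<comment> \<open>The first entry ensures \<open>1 <= F / e * a * rh\<^sup>2\<close>, the second
   the curvature inequality, with \<open>F / e * a\<close> and \<open>F * e * b\<close> as
   comparison constants of the metric.\<close>
 define D0 where "D0 = max (e / (a * rh\<^sup>2)) (b * e ^ 3 * (2 * k + 2 * k\<^sup>2) / a\<^sup>2)"
 show ?thesis
  unfolding adapted_def
 proof (rule exI[of _ D0], intro allI impI, elim conjE)
  fix g and c :: "('a, 'e) chart" and p te X and f :: "'e => real"
  let ?x = "snd c p"
  assume g: "riemannian_metric M g" and c: "c : charts M" "p : fst c" and im: "ball ?x rh0 <= chart_img c"
   and all: "ALL y:ball ?x rh0. (te, X y) : C & (X has_derivative L (te, X y)) (at y) & 0 < f y &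
   (f has_derivative (%v. f y * l (te, X y) v)) (at y) & (ALL u v. loc2 M c g y u v = f y * G (te, X y) u v)"
   and D0: "D0 <= f ?x"
  let ?Y = "ball ?x (4 * rh)"
  have sub: "?Y <= ball ?x rh0" using rh(4) by auto
  have Yc: "?Y <= chart_img c" using sub im by blast
  have H: "metric_on ?Y (loc2 M c g)" by (rule metric_on_subset[OF metric_on_chart[OF g c(1)] open_ball Yc])
  have inC: "(te, X y) : C" and dX: "(X has_derivative L (te, X y)) (at y)" and f0: "0 < f y"
   and df: "(f has_derivative (%v. f y * l (te, X y) v)) (at y)"
   and loc: "loc2 M c g y u v = f y * G (te, X y) u v" if "y : ?Y" for y u v
   using all sub that by blast+
  have inZ: "y : ?Y ==> (te, X y) : Z" for y using inC C(2) by blast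
  have ch: "christoffel (loc2 M c g) y u v = Ga (te, X y) u v"
   "dfield (christoffel (loc2 M c g)) y h u v = dGa (te, X y) h u v" if y: "y : ?Y" for y h u v
   by ((rule pullback_christoffel[OF H inZ dX f0 df loc y]; assumption)+)
  have x: "?x : ?Y" using rh(1) by simp
  have ln: "\<bar>ln (f y) - ln (f ?x)\<bar> <= 4 * k" if y: "y : ?Y" for y
  proof -
   have "norm (ln (f y) - ln (f ?x)) <= k * norm (y - ?x)"
   proof (rule differentiable_bound[OF convex_ball _ _ y x])
    fix z assume z: "z : ?Y"
    have "((%y. ln (f y)) has_derivative (%v. (f z * l (te, X z) v) * inverse (f z))) (at z)"
     using has_derivative_ln[OF f0[OF z] df[OF z]] by (simp add: divide_inverse)
    moreover have "(%v. (f z * l (te, X z) v) * inverse (f z)) = l (te, X z)" using f0[OF z] by (simp add: fun_eq_iff)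
    ultimately have "((%y. ln (f y)) has_derivative l (te, X z)) (at z)" by (simp only:)
    thus "((%y. ln (f y)) has_derivative l (te, X z)) (at z within ?Y)" by (rule has_derivative_at_withinI)
    show "onorm (l (te, X z)) <= k" by (rule onorm_bound) (use bl[OF inC[OF z]] abk in "auto simp: mult.commute")
   qed
   also have "... <= k * 4"
    using y rh(2) abk by (intro mult_left_mono) (auto simp: dist_norm norm_minus_commute)
   finally show ?thesis by simp
  qed
  define F where "F = f ?x"
  have F: "0 < F" using f0[OF x] by (simp add: F_def)
  have fb: "F / e <= f y" "f y <= F * e" if y: "y : ?Y" for y
  proof -
   have "exp (ln F - 4 * k) <= exp (ln (f y))" "exp (ln (f y)) <= exp (ln F + 4 * k)" using ln[OF y] by (auto simp: F_def)
   thus "F / e <= f y" "f y <= F * e" using F f0[OF y] by (simp_all add: exp_diff exp_add e_def)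
  qed
  have 1: "1 <= F / e * a * rh\<^sup>2"
   using D0 abk rh(1) e by (simp add: D0_def F_def field_simps)
  have 2: "F * e * b * (2 * k + 2 * k\<^sup>2) <= (F / e * a)\<^sup>2"
  proof -
   have "b * e ^ 3 * (2 * k + 2 * k\<^sup>2) / a\<^sup>2 <= F" using D0 by (simp add: D0_def F_def)
   hence "b * e ^ 3 * (2 * k + 2 * k\<^sup>2) <= F * a\<^sup>2" using abk by (simp add: pos_divide_le_eq)
   hence "(b * e ^ 3 * (2 * k + 2 * k\<^sup>2)) * (F / e\<^sup>2) <= (F * a\<^sup>2) * (F / e\<^sup>2)" by (rule mult_right_mono) (use F e in simp)
   moreover have "(b * e ^ 3 * (2 * k + 2 * k\<^sup>2)) * (F / e\<^sup>2) = F * e * b * (2 * k + 2 * k\<^sup>2)"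
    using e by (simp add: power3_eq_cube power2_eq_square)
   moreover have "(F * a\<^sup>2) * (F / e\<^sup>2) = (F / e * a)\<^sup>2" by (simp add: power2_eq_square)
   ultimately show ?thesis by simp
  qed
  have "good_chart g et p c rh (F / e * a) (F * e * b) k"
   unfolding good_chart_def
  proof (intro conjI ballI allI c rh(1-3) Yc 1 2)
   show "0 < F / e * a" "0 <= k" using F e abk by auto
   fix y assume y: "y : ?Y"
   show "norm (christoffel (loc2 M c g) y u v) <= k * norm u * norm v" for u v
    unfolding ch(1)[OF y] by (rule bGa[OF inC[OF y]])
   show "norm (dfield (christoffel (loc2 M c g)) y h u v) <= k * norm h * norm u * norm v" for h u v
    unfolding ch(2)[OF y] by (rule bd[OF inC[OF y]])
   fix u :: 'e
   have "0 <= a * (norm u)\<^sup>2" using abk by simp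
   hence G0: "0 <= G (te, X y) u u" using bG[OF inC[OF y], of u] by linarith
   have "F / e * (a * (norm u)\<^sup>2) <= f y * G (te, X y) u u"
    by (intro mult_mono fb y) (use bG[OF inC[OF y], of u] f0[OF y] abk in "auto intro: less_imp_le")
   thus "F / e * a * (norm u)\<^sup>2 <= loc2 M c g y u u" unfolding loc[OF y] by (simp add: mult.assoc)
   have "f y * G (te, X y) u u <= F * e * (b * (norm u)\<^sup>2)" by (intro mult_mono fb y) (use G0 bG[OF inC[OF y], of u] F e in auto)
   thus "loc2 M c g y u u <= F * e * b * (norm u)\<^sup>2" unfolding loc[OF y] by (simp add: mult.assoc)
  qed
  thus "EX rh a b K. good_chart g et p c rh a b K" by blast
 qed
qed

section \<open>Stretching profiles\<close>

lemma primitive_exists: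
 fixes u :: "real => real"
 assumes u: "continuous_on UNIV u"
 obtains S where "S 0 = 0" "!!x. (S has_real_derivative u x) (at x)"
proof -
 define S where "S x = integral {0..x} u - integral {x..0} u" for x
 have int: "u integrable_on {a..b}" for a b by (rule integrable_continuous_interval[OF continuous_on_subset[OF u]]) simp
 have "(S has_real_derivative u x) (at x)" for x
 proof -
  define a b where "a = - \<bar>x\<bar> - 1" and "b = \<bar>x\<bar> + 1"
  have x: "x : {a<..<b}" and a0: "a <= 0" by (auto simp: a_def b_def)
  have "((%y. integral {a..y} u) has_real_derivative u x) (at x within {a..b})"
   by (rule integral_has_real_derivative[OF continuous_on_subset[OF u]]) (use x in auto)
  hence "((%y. integral {a..y} u - integral {a..0} u) has_real_derivative u x) (at x within {a<..<b})"
   by (auto intro!: derivative_eq_intros elim: DERIV_subset)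
  hence "((%y. integral {a..y} u - integral {a..0} u) has_real_derivative u x) (at x)"
   using x by (simp add: at_within_open[OF x])
  moreover have "integral {a..y} u - integral {a..0} u = S y" if "y : {a<..<b}" for y
  proof (cases "0 <= y")
   case True
   thus ?thesis using Henstock_Kurzweil_Integration.integral_combine[OF a0 True int] by (cases "y = 0") (auto simp: S_def)
  next
   case False
   thus ?thesis using Henstock_Kurzweil_Integration.integral_combine[of a y 0 u] that int by (auto simp: S_def)
  qed
  ultimately show ?thesis
   using has_field_derivative_transform_within_open[OF _ open_greaterThanLessThan x] by blast
 qed
 thus ?thesis using that[of S] by (simp add: S_def)
qed

text \<open>Equal to 1 where the cosine is at most -1/2, that is on the middle third of each unit
  interval, and to 0 where it is nonnegative, in particular near the integers.\<close>

definition neck :: "real => real" where "neck x = smooth_step (- 2 * cos (2 * pi * x))"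

text \<open>\<open>te n\<close> is the inverse stretching factor of the neck over the unit interval
  from \<open>n\<close> to \<open>n + 1\<close>; \<open>1 / dil te\<close> is the derivative of the
  stretched coordinate.\<close>

definition dil :: "(nat => real) => real => real" where "dil te x = 1 - (1 - te (nat \<lfloor>x\<rfloor>)) * neck x"

lemma neck_bounds: "0 <= neck x" "neck x <= 1" by (simp_all add: neck_def smooth_step_nonneg smooth_step_le_1)

lemma neck_0: "0 <= cos (2 * pi * x) ==> neck x = 0" and neck_1: "cos (2 * pi * x) <= -1/2 ==> neck x = 1"
 by (simp_all add: neck_def smooth_step_0 smooth_step_1)

lemma smooth_cos_angle: "smooth_on UNIV (%x::real. c * cos (2 * pi * x))"
 by (rule smooth_cmult, rule smooth_comp[OF smooth_cos], intro smooth_cmult smooth_ident) auto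

lemma smooth_neck: "smooth_on UNIV neck"
 unfolding neck_def[abs_def] by (rule smooth_comp[OF smooth_smooth_step smooth_cos_angle]) simp

lemma open_cos_less: "open {x. cos (2 * pi * x) < c}" and open_cos_greater: "open {x. c < cos (2 * pi * x)}"
 by (auto intro!: open_Collect_less continuous_intros)

locale profile =
 fixes te :: "nat => real"
 assumes te: "0 < te n" "te n <= 1"
begin

lemma dil_bounds: "0 < dil te x" "dil te x <= 1"
proof -
 let ?h = "te (nat \<lfloor>x\<rfloor>)"
 have "(1 - ?h) * neck x <= (1 - ?h) * 1" by (rule mult_left_mono) (use neck_bounds[of x] te(2) in auto)
 thus "0 < dil te x" using te(1)[of "nat \<lfloor>x\<rfloor>"] by (simp add: dil_def)
 show "dil te x <= 1" using neck_bounds[of x] te(2)[of "nat \<lfloor>x\<rfloor>"] by (simp add: dil_def)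
qed

text \<open>The integer part jumps only at integers, and \<open>neck\<close> vanishes near
  them.\<close>

lemma smooth_dil: "smooth_on UNIV (dil te)"
proof (rule smooth_local[OF _ open_UNIV])
 fix x :: real
 show "EX T. x : T & smooth_on T (dil te)"
 proof (cases "0 < cos (2 * pi * x)")
  case True
  let ?T = "{x. 0 < cos (2 * pi * x)}"
  have "smooth_on ?T (dil te)" by (rule smooth_cong[OF smooth_const[OF open_cos_greater]]) (simp add: dil_def neck_0)
  thus ?thesis using True by (intro exI[of _ ?T] conjI) auto
 next
  case False
  define n where "n = \<lfloor>x\<rfloor>"
  have "x ~= of_int n"
  proof
   assume "x = of_int n"
   hence "cos (2 * pi * x) = 1" using cos_int_2pin[of n] by (simp add: mult.commute)
   thus False using False by simp
  qed
  hence x: "x : {of_int n<..<of_int n + 1}" using floor_correct[of x] by (auto simp: n_def less_le)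
  have "smooth_on {of_int n<..<of_int n + 1} (%x. 1 - (1 - te (nat n)) * neck x)"
   by (intro smooth_diff smooth_mult smooth_const smooth_subset[OF smooth_neck]) auto
  hence "smooth_on {of_int n<..<of_int n + 1} (dil te)"
  proof (rule smooth_cong)
   fix y assume "y : {of_int n<..<(of_int n + 1 :: real)}"
   hence "\<lfloor>y\<rfloor> = n" by (auto simp: floor_eq_iff)
   thus "1 - (1 - te (nat n)) * neck y = dil te y" by (simp add: dil_def)
  qed
  thus ?thesis using x by blast
 qed
qed

text \<open>Relative to the stretched coordinate, whose derivative is \<open>1 / dil te\<close>, the
  function \<open>t\<close> has speed \<open>neck\<close>, which is at most 1; over neck
  \<open>n\<close> it nevertheless gains at least \<open>1 / (3 * te n)\<close>. This is bounded
  speed with arbitrarily large gain.\<close>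

lemma energy_exists:
 obtains t where "smooth_on UNIV t" "!!x. (t has_real_derivative neck x / dil te x) (at x)" "mono t"
  "!!n. (\<Sum>j<n. 1 / (3 * te j)) <= t (real n)"
proof -
 have dn: "dil te x ~= 0" for x using dil_bounds[of x] by simp
 have sm: "smooth_on UNIV (%x. neck x / dil te x)" by (rule smooth_divide[OF smooth_neck smooth_dil]) (use dn in auto)
 obtain t where t: "t 0 = 0" "!!x. (t has_real_derivative neck x / dil te x) (at x)"
  using primitive_exists[OF smooth_cont[OF sm]] by blast
 have st: "smooth_on UNIV t" by (rule smooth_realI[OF open_UNIV t(2)[unfolded has_real_derivative_iff_has_vector_derivative] sm])
 have nn: "0 <= neck x / dil te x" for x using neck_bounds[of x] dil_bounds[of x] by simp
 have mono: "x <= y ==> t x <= t y" for x y by (rule DERIV_nonneg_imp_nondecreasing[of x y t]) (use t(2) nn in blast)+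
 have gain: "t (real n) + 1 / (3 * te n) <= t (real n + 1)" for n
 proof -
  \<comment> \<open>On the middle third the angle is within pi/3 of an odd multiple of pi, so that
    \<open>neck\<close> is 1 and the derivative of \<open>t\<close> is
    \<open>1 / te n\<close>.\<close>
  let ?a = "real n + 1/3" and ?b = "real n + 2/3"
  obtain z where z: "?a < z" "z < ?b" "t ?b - t ?a = (?b - ?a) * (neck z / dil te z)"
   using MVT2[of ?a ?b t "%x. neck x / dil te x"] t(2) by auto
  have "cos (2 * pi * z) <= -1/2"
  proof -
   define w where "w = 2 * pi * (z - real n) - pi"
   have w: "\<bar>w\<bar> <= pi / 3"
   proof -
    have "w = pi * (2 * (z - real n) - 1)" by (simp add: w_def algebra_simps)
    moreover have "\<bar>2 * (z - real n) - 1\<bar> <= 1/3" using z(1,2) unfolding abs_le_iff by (simp add: field_simps)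
    ultimately show ?thesis using mult_left_mono[of "\<bar>2 * (z - real n) - 1\<bar>" "1/3" pi] by (simp add: abs_mult)
   qed
   have "cos (pi / 3) <= cos \<bar>w\<bar>" by (rule cos_monotone_0_pi_le) (use w in auto)
   hence "1/2 <= cos w" by (simp add: cos_60)
   moreover have "2 * pi * z = (w + pi) + real n * (2 * pi)" by (simp add: w_def algebra_simps)
   ultimately show ?thesis using cos.plus_of_nat[of "w + pi" n] by (simp add: mult.commute)
  qed
  hence "neck z = 1" by (rule neck_1)
  moreover have "\<lfloor>z\<rfloor> = int n" using z by (simp add: floor_eq_iff)
  ultimately have "neck z / dil te z = 1 / te n" by (simp add: dil_def)
  hence "t ?b - t ?a = 1 / (3 * te n)" using z(3) by simp
  thus ?thesis using mono[of "real n" ?a] mono[of ?b "real n + 1"] by simp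
 qed
 have "(\<Sum>j<n. 1 / (3 * te j)) <= t (real n)" for n
 proof (induction n)
  case (Suc n) thus ?case using gain[of n] by (simp add: add.commute)
 qed (simp add: t(1))
 thus ?thesis using that st t(2) mono by (simp add: mono_def)
qed

text \<open>Stretching expands distances, so its inverse is 1-Lipschitz and a ball in stretched
  coordinates lies over a ball of no larger radius.\<close>

lemma stretch_exists:
 obtains s where "smooth_on UNIV s" "!!x. (s has_real_derivative 1 / dil te x) (at x)" "!!x y. \<bar>x - y\<bar> <= \<bar>s x - s y\<bar>" "surj s"
proof -
 have dn: "dil te x ~= 0" for x using dil_bounds[of x] by simp
 have sm: "smooth_on UNIV (%x. 1 / dil te x)" by (rule smooth_divide[OF smooth_const smooth_dil]) (use dn in auto)
 obtain s where s: "s 0 = 0" "!!x. (s has_real_derivative 1 / dil te x) (at x)"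
  using primitive_exists[OF smooth_cont[OF sm]] by blast
 have ss: "smooth_on UNIV s" by (rule smooth_realI[OF open_UNIV s(2)[unfolded has_real_derivative_iff_has_vector_derivative] sm])
 have grow: "y - x <= s y - s x" if "x < y" for x y
 proof -
  obtain z where z: "s y - s x = (y - x) * (1 / dil te z)" using MVT2[OF \<open>x < y\<close>, of s "%x. 1 / dil te x"] s(2) by auto
  have "(y - x) * 1 <= (y - x) * (1 / dil te z)" by (rule mult_left_mono) (use dil_bounds[of z] that in auto)
  thus ?thesis using z by simp
 qed
 have exp: "\<bar>x - y\<bar> <= \<bar>s x - s y\<bar>" for x y
  using grow[of x y] grow[of y x] by (cases x y rule: linorder_cases) auto
 have "EX x. s x = y" for y
 proof -
  have "s (- \<bar>y\<bar>) <= y" "y <= s \<bar>y\<bar>" using grow[of "- \<bar>y\<bar>" 0] grow[of 0 "\<bar>y\<bar>"] s(1) by (cases "y = 0"; auto)+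
  moreover have "continuous_on {- \<bar>y\<bar>..\<bar>y\<bar>} s" by (rule continuous_on_subset[OF smooth_cont[OF ss]]) simp
  ultimately show ?thesis using IVT'[of s "- \<bar>y\<bar>" y "\<bar>y\<bar>"] by auto
 qed
 hence "surj s" by (metis surjI)
 thus ?thesis using that ss s(2) exp by blast
qed

end

section \<open>Twisted forms\<close>

text \<open>Pairing a kernel vector \<open>u\<close> with \<open>X\<close> gives
  \<open>(1 + k * r X) * om X u = 0\<close>. Then \<open>u + (k * r u) *R X\<close> is in the kernel
  of \<open>om\<close>, hence 0, and applying \<open>r\<close> to it gives
  \<open>r u = 0\<close>.\<close>

lemma twist_nondegenerate:
 assumes om: "bilinear om" "!!u. om u u = 0" "nondegenerate om" and r: "linear r" and k: "1 + k * r X ~= (0::real)"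
 shows "nondegenerate (%u v. om u v + k * (r u * om X v - r v * om X u))"
 unfolding nondegenerate_def
proof (intro allI impI)
 fix u assume u: "ALL v. om u v + k * (r u * om X v - r v * om X u) = 0"
 have anti: "om u X = - om X u"
  using om(2)[of "u + X"] unfolding bilinear_ladd[OF om(1)] bilinear_radd[OF om(1)] by (simp add: om(2))
 have "- (1 + k * r X) * om X u = 0" using u[rule_format, of X] by (simp add: om(2) anti algebra_simps)
 hence X0: "om X u = 0" using k by simp
 have "om (u + (k * r u) *R X) v = 0" for v
  using u[rule_format, of v] by (simp add: X0 bilinear_ladd[OF om(1)] bilinear_lmul[OF om(1)] algebra_simps)
 hence e: "u + (k * r u) *R X = 0" using om(3) by (simp add: nondegenerate_def)
 have "r u + (k * r u) * r X = 0"
  using arg_cong[OF e, of r] by (simp add: linear_add[OF r] linear_cmul[OF r] linear_0[OF r])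
 hence "r u * (1 + k * r X) = 0" by (simp add: algebra_simps)
 hence "r u = 0" using k by simp
 thus "u = 0" using e by simp
qed

text \<open>The polynomial identity behind \<open>twist_closed\<close>. The first hypothesis is
  closedness of the form, the other three say that the 1-form is a primitive of it where
  \<open>K\<close> is nonzero; \<open>Huv\<close>, \<open>Huw\<close> and \<open>Hvw\<close> stand
  for second derivatives of \<open>R\<close>.\<close>

lemma twist_algebra:
 fixes K :: real
 assumes "D1 - D2 + D3 = 0" "K * (dvw - dwv - ovw) = 0" "K * (duw - dwu - ouw) = 0" "K * (duv - dvu - ouv) = 0"
 shows "F * D1 + K * ru * ovw + (K * (rv * duw + Huv * lw - (rw * duv + Huw * lv)) + K' * ru * (rv * lw - rw * lv))
  - (F * D2 + K * rv * ouw + (K * (ru * dvw + Huv * lw - (rw * dvu + Hvw * lu)) + K' * rv * (ru * lw - rw * lu)))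
  + (F * D3 + K * rw * ouv + (K * (ru * dwv + Huw * lv - (rv * dwu + Hvw * lu)) + K' * rw * (ru * lv - rv * lu))) = 0"
 using assms by algebra

text \<open>The derivative of \<open>F\<close> contributes \<open>k\<close> times the wedge of dR
  with the form, and the second summand contributes its negative, since \<open>l\<close> is a
  primitive where \<open>k\<close> is nonzero. The derivative of \<open>k\<close> is proportional to
  dR and disappears in the wedge with dR.\<close>

lemma twist_closed:
 fixes om :: "'e::euclidean_space => 'e => 'e => real"
 assumes x: "x : S" and om: "!!u v. smooth_on S (%y. om y u v)" and l: "!!v. smooth_on S (%y. l y v)" and R: "smooth_on S R"
  and F: "(F has_derivative (%h. k x * FD R x h)) (at x)"
  and k: "(k has_derivative (%h. k' * FD R x h)) (at x)"
  and closed: "!!u v w. ext_deriv2 om x u v w = 0" and lv: "k x = 0 | (ALL u v. ext_deriv1 l x u v = om x u v)"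
 shows "ext_deriv2 (%y u v. F y * om y u v + k y * (FD R y u * l y v - FD R y v * l y u)) x u v w = 0"
proof -
 let ?r = "%y v. FD R y v"
 let ?d = "%f. FD f x"
 note d = smooth_has_derivative[OF _ x]
 have dr: "((%y. ?r y v) has_derivative ?d (%y. ?r y v)) (at x)" for v by (rule d[OF smooth_deriv[OF R]])
 have e: "?d (%y. F y * om y u v + k y * (?r y u * l y v - ?r y v * l y u)) h =
  F x * ?d (%y. om y u v) h + k x * ?r x h * om x u v +
  (k x * (?r x u * ?d (%y. l y v) h + ?d (%y. ?r y u) h * l x v - (?r x v * ?d (%y. l y u) h + ?d (%y. ?r y v) h * l x u))
   + k' * ?r x h * (?r x u * l x v - ?r x v * l x u))" for u v h
  unfolding has_derivative_frechet[OF has_derivative_add[OF has_derivative_mult[OF F d[OF om]]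
   has_derivative_mult[OF k has_derivative_diff[OF has_derivative_mult[OF dr d[OF l]] has_derivative_mult[OF dr d[OF l]]]]]] by (rule refl)
 have sym: "?d (%y. ?r y u) v = ?d (%y. ?r y v) u" for u v by (rule second_derivative_symmetric[OF R x])
 have "?d (%y. om y v w) u - ?d (%y. om y u w) v + ?d (%y. om y u v) w = 0"
  using closed[of u v w] by (simp add: ext_deriv2_def)
 moreover have "k x * (?d (%y. l y b) a - ?d (%y. l y a) b - om x a b) = 0" for a b
  using lv by (auto simp: ext_deriv1_def)
 note this[of w v] this[of w u] this[of v u]
 ultimately show ?thesis
  unfolding ext_deriv2_def e sym[of u v] sym[of u w] sym[of v w] by (rule twist_algebra)
qed

locale contact_data = smooth_mfd M + profile te for M :: "('a, 'e::euclidean_space) manifold" and te +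
 fixes om g0 R X t
 assumes sym: "symplectic_form M om" and g0: "riemannian_metric M g0" and gR: "gsmooth R"
  and sX: "smooth_vector_field_on M (pts M) X"
  and li: "liouville_field_on M om {p : pts M. cos (2 * pi * R p) < 1/2} X"
  and XR: "!!p. p : pts M ==> cos (2 * pi * R p) < 1/2 ==> 0 < X p R"
  and t: "smooth_on UNIV t" "!!x. (t has_real_derivative neck x / dil te x) (at x)"
begin

abbreviation "W == pts M"

definition "tau x = neck x / dil te x"

text \<open>The form \<open>om\<close> times \<open>a\<close>, plus \<open>b\<close> times the wedge
  of dR with the Liouville form, the contraction of \<open>om\<close> with \<open>X\<close>. As
  tangent vectors are derivations, \<open>D R\<close> is dR evaluated on \<open>D\<close>.\<close>

definition tw :: "('a => real) => ('a => real) => 'a tensor2" where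
 "tw a b p D E = a p * om p D E + b p * (D R * om p (X p) E - E R * om p (X p) D)"

text \<open>Affine in \<open>T\<close>. For every \<open>T\<close> the derivative of the first
  coefficient with respect to \<open>R\<close> is the second coefficient, because \<open>tau\<close>
  is the derivative of \<open>t\<close>; this is the relation that \<open>twist_closed\<close> asks
  for.\<close>

definition Om :: "real => 'a tensor2" where
 "Om T = tw (%p. 1 - T + T * exp (t (R p))) (%p. T * (exp (t (R p)) * tau (R p)))"

definition om2 :: "'a tensor2" where "om2 = tw (%_. 1) (%p. tau (R p))"

text \<open>The added term is the square of ds for the stretched coordinate \<open>s\<close>, as ds
  = dR / dil. It keeps the metric nondegenerate in stretched coordinates when the inverse factor
  tends to 0.\<close>

definition h2 :: "'a tensor2" where "h2 p D E = g0 p D E + (1 / dil te (R p))\<^sup>2 * (D R * E R)"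

abbreviation "rc c == R o chart_inv c"
abbreviation "dr c x == FD (rc c) x"
abbreviation "xc c x == vec_coords c (X (chart_inv c x))"

lemma tau_nonneg: "0 <= tau x" and tau_0: "0 <= cos (2 * pi * x) ==> tau x = 0" and smooth_tau: "smooth_on UNIV tau"
proof -
 show "0 <= tau x" using neck_bounds[of x] dil_bounds[of x] by (simp add: tau_def)
 show "0 <= cos (2 * pi * x) ==> tau x = 0" by (simp add: tau_def neck_0)
 have dn: "dil te x ~= 0" for x using dil_bounds[of x] by simp
 show "smooth_on UNIV tau"
  unfolding tau_def[abs_def] by (rule smooth_divide[OF smooth_neck smooth_dil dn])
qed

context
 fixes c assumes c: "c : charts M"
begin

lemma srd: "smooth_on (chart_img c) (rc c)" by (rule gsmooth_chart[OF gR c])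

lemma lin_dr: "x : chart_img c ==> linear (dr c x)" by (rule smooth_FD_linear[OF srd])

lemma sxc: "smooth_on (chart_img c) (xc c)"
proof -
 have "fst c Int W = fst c" using chart_topspace[OF c] by blast
 thus ?thesis using sX c unfolding smooth_vector_field_on_def by (metis chart_img_def)
qed

lemma cv_R: "x : chart_img c ==> coord_vec M c (chart_inv c x) u R = dr c x u"
 using coord_vec_apply[of "chart_inv c x" R c u] gR chart_inv_in[of x c] chart_topspace[OF c] by (auto simp: gsmooth_def chart_map_inv)

lemma inW: "x : chart_img c ==> chart_inv c x : W"
 using chart_inv_in[of x c] chart_topspace[OF c] by blast

lemma X_xc: "x : chart_img c ==> X (chart_inv c x) = coord_vec M c (chart_inv c x) (xc c x)"
 using tangent_eq_coord_vec[OF c chart_inv_in] sX inW by (auto simp: smooth_vector_field_on_def)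

lemma loc_X: "x : chart_img c ==> om (chart_inv c x) (X (chart_inv c x)) (coord_vec M c (chart_inv c x) v) = loc2 M c om x (xc c x) v"
 using X_xc by (simp add: loc2_def Let_def)

lemma loc2_tw: "x : chart_img c ==> loc2 M c (tw a b) x u v = a (chart_inv c x) * loc2 M c om x u v
  + b (chart_inv c x) * (dr c x u * loc2 M c om x (xc c x) v - dr c x v * loc2 M c om x (xc c x) u)"
 unfolding loc2_def[of M c "tw a b"] Let_def tw_def cv_R loc_X by (simp add: loc2_def Let_def)

lemma loc2_h2: "x : chart_img c ==> loc2 M c h2 x u v = loc2 M c g0 x u v + (1 / dil te (rc c x))\<^sup>2 * (dr c x u * dr c x v)"
 unfolding loc2_def[of M c h2] Let_def h2_def cv_R by (simp add: loc2_def Let_def)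

lemma omc: "x : chart_img c ==> bilinear (loc2 M c om x)" "smooth_on (chart_img c) (%x. loc2 M c om x u v)"
 "x : chart_img c ==> loc2 M c om x u u = 0" "x : chart_img c ==> nondegenerate (loc2 M c om x)"
 "x : chart_img c ==> ext_deriv2 (loc2 M c om) x u v w = 0"
proof -
 show "x : chart_img c ==> bilinear (loc2 M c om x)" "smooth_on (chart_img c) (%x. loc2 M c om x u v)"
  "x : chart_img c ==> ext_deriv2 (loc2 M c om) x u v w = 0"
  using sym c unfolding symplectic_form_def two_form_def smooth_tensor2_def by blast+
 note p = chart_inv_in[of x c] inW
 show "loc2 M c om x u u = 0" if x: "x : chart_img c"
  using sym p(2)[OF x] coord_vec_tangent[OF c chart_inv_in[OF x]] unfolding symplectic_form_def two_form_def loc2_def Let_def by blast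
 show "nondegenerate (loc2 M c om x)" if x: "x : chart_img c"
  unfolding nondegenerate_def
 proof (intro allI impI)
  fix w assume w: "ALL z. loc2 M c om x w z = 0"
  let ?p = "chart_inv c x"
  have "om ?p (coord_vec M c ?p w) E = 0" if "E : tangent_space M ?p" for E
   using w tangent_eq_coord_vec[OF c chart_inv_in[OF x] that] unfolding loc2_def Let_def by metis
  hence "coord_vec M c ?p w = (%_. 0)"
   using sym inW[OF x] coord_vec_tangent[OF c chart_inv_in[OF x]] unfolding symplectic_form_def by blast
  thus "w = 0" by (rule coord_vec_eq_0[OF c chart_inv_in[OF x]])
 qed
qed

lemma sl: "smooth_on (chart_img c) (%x. loc2 M c om x (xc c x) v)"
 by (rule smooth_bilinear_apply[OF omc(1,2) sxc smooth_const[OF chart_img_open[OF c]]])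

lemma bilinear_tw: assumes x: "x : chart_img c" shows "bilinear (loc2 M c (tw a b) x)"
proof -
 note l = lin_dr[OF x]
 show ?thesis
  unfolding bilinear_def loc2_tw[OF x] by (intro conjI allI; rule linearI)
   (simp_all add: linear_add[OF l] linear_cmul[OF l] bilinear_ladd[OF omc(1)[OF x]] bilinear_lmul[OF omc(1)[OF x]]
    bilinear_radd[OF omc(1)[OF x]] bilinear_rmul[OF omc(1)[OF x]] algebra_simps)
qed

text \<open>\<open>tau\<close> is nonzero only where the cosine is negative, and there
  \<open>X\<close> increases \<open>R\<close>; so the quantity required to be nonzero in
  \<open>twist_nondegenerate\<close> is at least 1.\<close>

lemma nondegenerate_tw:
 assumes x: "x : chart_img c" and a: "0 < a (chart_inv c x)" and b: "b (chart_inv c x) = k * tau (rc c x)" "0 <= k"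
 shows "nondegenerate (loc2 M c (tw a b) x)"
proof -
 let ?p = "chart_inv c x"
 have e: "loc2 M c (tw a b) x u v = a ?p * (loc2 M c om x u v + (b ?p / a ?p) *
   (dr c x u * loc2 M c om x (xc c x) v - dr c x v * loc2 M c om x (xc c x) u))" for u v
  unfolding loc2_tw[OF x] using a by (simp add: field_simps)
 have "0 <= b ?p * dr c x (xc c x)"
 proof (cases "0 <= cos (2 * pi * R ?p)")
  case True
  hence "b ?p = 0" by (simp add: b tau_0)
  thus ?thesis by simp
 next
  case False
  hence "0 < X ?p R" by (intro XR inW x) simp
  moreover have "X ?p R = dr c x (xc c x)" using X_xc[OF x] cv_R[OF x] by metis
  ultimately show ?thesis using b tau_nonneg[of "R ?p"] by simp
 qed
 hence "0 <= b ?p / a ?p * dr c x (xc c x)" using a by (simp add: divide_nonneg_pos)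
 hence "nondegenerate (%u v. loc2 M c om x u v + (b ?p / a ?p) *
   (dr c x u * loc2 M c om x (xc c x) v - dr c x v * loc2 M c om x (xc c x) u))" by (intro twist_nondegenerate omc lin_dr x) simp
 thus ?thesis unfolding nondegenerate_def e using a by simp
qed

lemma smooth_Om: "smooth_on (UNIV \<times> chart_img c) (%(T, x). loc2 M c (Om T) x u v)"
proof -
 have o: "open (UNIV \<times> chart_img c :: (real \<times> 'e) set)" by (intro open_Times open_UNIV chart_img_open c)
 note i = smooth_ident[OF o]
 have T: "smooth_on (UNIV \<times> chart_img c) (%z::real \<times> 'e. fst z)" by (rule smooth_fst[OF i])
 have p: "smooth_on (UNIV \<times> chart_img c) (%z::real \<times> 'e. F (snd z))" if "smooth_on (chart_img c) F" for F :: "'e => real"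
  by (rule smooth_comp[OF that smooth_snd[OF i]]) auto
 have ph: "smooth_on (chart_img c) (%x. fi (rc c x))" if "smooth_on UNIV fi" for fi :: "real => real" by (rule smooth_comp[OF that srd]) auto
 have ex: "smooth_on UNIV (%x. exp (t x))" by (rule smooth_comp[OF smooth_exp t(1)]) auto
 have "smooth_on (UNIV \<times> chart_img c) (%z. (1 - fst z + fst z * exp (t (rc c (snd z)))) * loc2 M c om (snd z) u v
  + fst z * (exp (t (rc c (snd z))) * tau (rc c (snd z))) * (dr c (snd z) u * loc2 M c om (snd z) (xc c (snd z)) v
   - dr c (snd z) v * loc2 M c om (snd z) (xc c (snd z)) u))"
  by (intro smooth_add smooth_diff smooth_mult T smooth_const o p[OF ph[OF ex]] p[OF ph[OF smooth_tau]]
    p[OF smooth_deriv[OF srd]] p[OF sl] p[OF omc(2)])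
 thus ?thesis by (rule smooth_cong) (auto simp: Om_def loc2_tw)
qed

lemma closed_Om:
 assumes x: "x : chart_img c" shows "ext_deriv2 (loc2 M c (Om T)) x u v w = 0"
proof -
 define F where "F y = 1 - T + T * exp (t (rc c y))" for y
 define k where "k y = T * (exp (t (rc c y)) * tau (rc c y))" for y
 let ?l = "%y w. loc2 M c om y (xc c y) w"
 note dR = smooth_has_derivative[OF srd x]
 have "(%s. exp (t s) * tau s) differentiable (at (rc c x))"
  by (rule smooth_differentiable[OF smooth_mult[OF smooth_comp[OF smooth_exp t(1)] smooth_tau]]) auto
 then obtain m where m: "((%s. exp (t s) * tau s) has_real_derivative m) (at (rc c x))"
  using real_differentiableE by blast
 have "((%s. 1 - T + T * exp (t s)) has_real_derivative T * (exp (t (rc c x)) * tau (rc c x))) (at (rc c x))"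
  unfolding tau_def by (auto intro!: derivative_eq_intros t(2) simp: mult_ac)
 from has_derivative_compose[OF dR this[unfolded has_field_derivative_def]]
 have F: "(F has_derivative (%h. k x * dr c x h)) (at x)" unfolding F_def k_def .
 have "((%s. T * (exp (t s) * tau s)) has_real_derivative T * m) (at (rc c x))" by (rule DERIV_cmult[OF m])
 from has_derivative_compose[OF dR this[unfolded has_field_derivative_def]]
 have k: "(k has_derivative (%h. T * m * dr c x h)) (at x)" unfolding k_def .
 have lv: "k x = 0 | (ALL u v. ext_deriv1 ?l x u v = loc2 M c om x u v)"
 proof (cases "0 <= cos (2 * pi * rc c x)")
  case True thus ?thesis by (simp add: k_def tau_0)
 next
  case False
  let ?N = "{p : W. cos (2 * pi * R p) < 1/2}"
  have "?N = {p : W. R p : {r. cos (2 * pi * r) < 1/2}}" by simp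
  hence oN: "opn M ?N" using gsmooth_preimage[OF gR open_cos_less] by (simp only:)
  have xN: "x : snd c ` (fst c Int ?N)"
   using False x inW[OF x] by (intro image_eqI[of _ _ "chart_inv c x"]) (auto simp: chart_map_inv chart_inv_in)
  have "ext_deriv1 ?l x u v = ext_deriv1 (%y w. let q = chart_inv c y in om q (X q) (coord_vec M c q w)) x u v" for u v
   by (rule ext_deriv1_cong[OF chart_image_open[OF c oN] xN]) (auto simp: Let_def loc_X chart_img_def)
  moreover have "ext_deriv1 (%y w. let q = chart_inv c y in om q (X q) (coord_vec M c q w)) x u v = loc2 M c om x u v" for u v
   using li c xN unfolding liouville_field_on_def by blast
  ultimately show ?thesis by simp
 qed
 have "ext_deriv2 (%y u v. F y * loc2 M c om y u v + k y * (dr c y u * ?l y v - dr c y v * ?l y u)) x u v w = 0"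
  by (rule twist_closed[OF x omc(2) sl srd F k omc(5)[OF x] lv])
 moreover have "FD (%y. loc2 M c (Om T) y u v) x = FD (%y. F y * loc2 M c om y u v + k y * (dr c y u * ?l y v - dr c y v * ?l y u)) x" for u v
  by (rule frechet_derivative_cong_open[OF chart_img_open[OF c] x]) (simp add: Om_def loc2_tw F_def k_def)
 ultimately show ?thesis unfolding ext_deriv2_def by simp
qed

end

section \<open>The homotopy of symplectic forms\<close>

lemma two_form_Om: "two_form M (Om T)"
 unfolding two_form_def smooth_tensor2_def
proof (intro conjI ballI allI)
 fix c u v assume c: "c : charts M"
 show "bilinear (loc2 M c (Om T) x)" if "x : chart_img c" for x unfolding Om_def by (rule bilinear_tw[OF c that])
 have "smooth_on (chart_img c) (%x. (T, x))" by (intro smooth_Pair smooth_const smooth_ident chart_img_open c)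
 from smooth_comp[OF smooth_Om[OF c] this] show "smooth_on (chart_img c) (%x. loc2 M c (Om T) x u v)" by auto
next
 fix p D assume "p : W" "D : tangent_space M p"
 hence "om p D D = 0" using sym unfolding symplectic_form_def two_form_def by blast
 thus "Om T p D D = 0" by (simp add: Om_def tw_def)
qed

lemma symplectic_Om: assumes T: "T : {0..1}" shows "symplectic_form M (Om T)"
 unfolding symplectic_form_def
proof (intro conjI two_form_Om ballI allI impI closed_Om)
 fix p D assume p: "p : W" and D: "D : tangent_space M p" and z: "ALL E:tangent_space M p. Om T p D E = 0"
 obtain c where c: "c : charts M" "p : fst c" using chart_at[OF p] .
 let ?x = "snd c p"
 have x: "?x : chart_img c" and px: "chart_inv c ?x = p" using chart_map_in[OF c(2)] chart_inv_map[OF c] by auto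
 have "1 - T + T * exp (t (R p)) > 0"
  using T by (cases "T = 0") (auto intro: add_nonneg_pos)
 hence "nondegenerate (loc2 M c (Om T) ?x)"
  unfolding Om_def by (intro nondegenerate_tw[OF c(1) x, of _ _ "T * exp (t (R p))"]) (use T px in auto)
 moreover have "loc2 M c (Om T) ?x (vec_coords c D) v = 0" for v
  using z coord_vec_tangent[OF c, of v] tangent_eq_coord_vec[OF c D] by (simp add: loc2_def Let_def px)
 ultimately have "vec_coords c D = 0" by (simp add: nondegenerate_def)
 thus "D = (%_. 0)" using tangent_eq_coord_vec[OF c D] coord_vec_0[OF c] by simp
qed

lemma homotopic: "symplectic_homotopic M om (Om 1)"
 unfolding symplectic_homotopic_def by (intro exI[of _ Om] conjI allI ballI two_form_Om symplectic_Om smooth_Om) (auto simp: Om_def tw_def)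

end

section \<open>The compatible triple\<close>

context contact_data
begin

text \<open>An arbitrary chart at \<open>p\<close> serves for the definition; by
  \<open>polJ_equivariant\<close> every chart gives the same result, as recorded in
  \<open>J_chart\<close>.\<close>

definition J :: "'a endo" where
 "J p D = (let c = SOME c. c : charts M & p : fst c in
  coord_vec M c p (polJ (loc2 M c om2 (snd c p)) (loc2 M c h2 (snd c p)) (vec_coords c D)))"

abbreviation "jc c x == polJ (loc2 M c om2 x) (loc2 M c h2 x)"

definition "g' = compatible_metric (Om 1) J"

lemma Om_om2: "Om 1 p D E = exp (t (R p)) * om2 p D E" by (simp add: Om_def om2_def tw_def algebra_simps)

context
 fixes c assumes c: "c : charts M"
begin

lemma pair: assumes x: "x : chart_img c" shows "symp_pair (loc2 M c om2 x) (loc2 M c h2 x)"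
proof
 note g = metric_onD[OF metric_on_chart[OF g0 c]]
 note l = lin_dr[OF c x]
 show "bilinear (loc2 M c om2 x)" unfolding om2_def by (rule bilinear_tw[OF c x])
 show "nondegenerate (loc2 M c om2 x)" unfolding om2_def by (rule nondegenerate_tw[OF c x, of _ _ 1]) auto
 show "loc2 M c om2 x u u = 0" for u unfolding om2_def loc2_tw[OF c x] by (simp add: omc(3)[OF c x])
 show "bilinear (loc2 M c h2 x)"
  unfolding bilinear_def loc2_h2[OF c x] by (intro conjI allI; rule linearI)
   (simp_all add: linear_add[OF l] linear_cmul[OF l] bilinear_ladd[OF g(2)[OF x]] bilinear_lmul[OF g(2)[OF x]]
    bilinear_radd[OF g(2)[OF x]] bilinear_rmul[OF g(2)[OF x]] algebra_simps)
 show "loc2 M c h2 x u v = loc2 M c h2 x v u" for u v unfolding loc2_h2[OF c x] using g(3)[OF x, of u v] by simp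
 show "0 < loc2 M c h2 x u u" if "u ~= 0" for u
  unfolding loc2_h2[OF c x] using g(4)[OF x that] by (simp add: add_pos_nonneg)
qed

lemma smooth_pair: "smooth_on (chart_img c) (%x. loc2 M c om2 x u v)" "smooth_on (chart_img c) (%x. loc2 M c h2 x u v)"
proof -
 have ph: "smooth_on (chart_img c) (%x. fi (rc c x))" if "smooth_on UNIV fi" for fi :: "real => real" by (rule smooth_comp[OF that srd[OF c]]) auto
 have dn: "dil te x ~= 0" for x using dil_bounds[of x] by simp
 have d: "smooth_on UNIV (%x. 1 / dil te x)" by (rule smooth_divide[OF smooth_const smooth_dil dn]) simp
 note s = smooth_deriv[OF srd[OF c]] and o = chart_img_open[OF c]
 have "smooth_on (chart_img c) (%x. 1 * loc2 M c om x u v + tau (rc c x) * (dr c x u * loc2 M c om x (xc c x) v - dr c x v * loc2 M c om x (xc c x) u))"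
  by (intro smooth_add smooth_diff smooth_mult smooth_const o ph[OF smooth_tau] s sl[OF c] omc(2)[OF c])
 thus "smooth_on (chart_img c) (%x. loc2 M c om2 x u v)" by (rule smooth_cong) (simp add: om2_def loc2_tw[OF c])
 have "smooth_on (chart_img c) (%x. loc2 M c g0 x u v + (1 / dil te (rc c x)) * (1 / dil te (rc c x)) * (dr c x u * dr c x v))"
  by (intro smooth_add smooth_mult ph[OF d] s metric_onD(5)[OF metric_on_chart[OF g0 c]])
 thus "smooth_on (chart_img c) (%x. loc2 M c h2 x u v)" by (rule smooth_cong) (simp add: loc2_h2[OF c] power2_eq_square)
qed

lemma smooth_jc: "smooth_on (chart_img c) (%x. jc c x u)" by (rule smooth_polJ[OF chart_img_open[OF c] pair smooth_pair])

end

lemma J_chart: assumes c: "c : charts M" and p: "p : fst c" shows "J p (coord_vec M c p u) = coord_vec M c p (jc c (snd c p) u)"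
proof -
 define d where "d = (SOME c. c : charts M & p : fst c)"
 have d: "d : charts M" "p : fst d" using someI[of "%c. c : charts M & p : fst c" c] c p by (auto simp: d_def)
 let ?L = "FD (tr c d) (snd c p)"
 have x: "snd c p : snd c ` (fst c Int fst d)" using p d by blast
 have e: "tr c d (snd c p) = snd d p" using chart_inv_map[OF c p] by simp
 have L: "linear ?L" by (rule smooth_FD_linear[OF smooth_tr[OF c d(1)] x])
 have sL: "surj ?L" using tr_deriv_inverse(2)[OF c d(1) x] by (metis surjI)
 have "?L (jc c (snd c p) u) = jc d (snd d p) (?L u)"
  by (rule polJ_equivariant[OF pair[OF c chart_map_in[OF p]] pair[OF d(1) chart_map_in[OF d(2)]] L sL])
   (use loc2_change[OF c d(1) x] e in simp_all)
 hence "coord_vec M c p (jc c (snd c p) u) = coord_vec M d p (jc d (snd d p) (?L u))"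
  using coord_vec_change[OF c p d] by simp
 thus ?thesis
  unfolding J_def d_def[symmetric] Let_def coord_vec_change[OF c p d, of u] vec_coords_coord_vec[OF d] by simp
qed

lemma loc_J: "c : charts M ==> x : chart_img c ==> loc_endo M c J x u = jc c x u"
 using J_chart[OF _ chart_inv_in] vec_coords_coord_vec[OF _ chart_inv_in] by (simp add: loc_endo_def Let_def chart_map_inv)

lemma loc_g': assumes c: "c : charts M" and x: "x : chart_img c" shows "loc2 M c g' x u v = exp (t (rc c x)) * loc2 M c om2 x u (jc c x v)"
 using J_chart[OF c chart_inv_in[OF x]] by (simp add: loc2_def Let_def g'_def compatible_metric_def Om_om2 chart_map_inv[OF x])

lemma acs: "almost_complex_structure M J"
 unfolding almost_complex_structure_def smooth_endo_def
proof (intro conjI ballI allI)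
 fix p assume p: "p : W"
 obtain c where c: "c : charts M" "p : fst c" using chart_at[OF p] .
 note x = chart_map_in[OF c(2)]
 note T = tangent_eq_coord_vec[OF c]
 show "J p ` tangent_space M p <= tangent_space M p"
 proof
  fix E assume "E : J p ` tangent_space M p"
  then obtain D where D: "D : tangent_space M p" "E = J p D" by blast
  have "J p D = coord_vec M c p (jc c (snd c p) (vec_coords c D))" using J_chart[OF c] T[OF D(1)] by metis
  thus "E : tangent_space M p" using coord_vec_tangent[OF c] D(2) by simp
 qed
 fix D assume D: "D : tangent_space M p"
 have "J p (J p (coord_vec M c p u)) = (%f. - coord_vec M c p u f)" for u
  unfolding J_chart[OF c] symp_pair.polJ_square[OF pair[OF c(1) x]] using coord_vec_lin[OF c, of "-1" u 0 0] by simp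
 thus "J p (J p D) = (%f. - D f)" using T[OF D] by metis
next
 fix c assume c: "c : charts M"
 show "linear (loc_endo M c J x)" if x: "x : chart_img c" for x
  using symp_pair.linJ[OF pair[OF c x]] loc_J[OF c x] by (simp add: fun_eq_iff[symmetric] linear_iff)
 show "smooth_on (chart_img c) (%x. loc_endo M c J x u)" for u by (rule smooth_cong[OF smooth_jc[OF c]]) (simp add: loc_J[OF c])
qed

lemma metric_g': "riemannian_metric M g'"
 unfolding riemannian_metric_def smooth_tensor2_def
proof (intro conjI ballI allI impI)
 fix c assume c: "c : charts M"
 show "bilinear (loc2 M c g' x)" if x: "x : chart_img c" for x
 proof -
  interpret symp_pair "loc2 M c om2 x" "loc2 M c h2 x" by (rule pair[OF c x])
  show ?thesis
   unfolding bilinear_def loc_g'[OF c x] by (intro conjI allI; rule linearI)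
    (simp_all add: linear_add[OF linJ] linear_cmul[OF linJ] bilinear_ladd[OF om(1)] bilinear_lmul[OF om(1)]
     bilinear_radd[OF om(1)] bilinear_rmul[OF om(1)] algebra_simps)
 qed
 have "smooth_on (chart_img c) (%x. exp (t (rc c x)))" by (rule smooth_comp[OF smooth_exp smooth_comp[OF t(1) srd[OF c]]]) auto
 hence "smooth_on (chart_img c) (%x. exp (t (rc c x)) * loc2 M c om2 x u (jc c x v))" for u v
  by (intro smooth_mult smooth_bilinear_apply[OF symp_pair.om(1)[OF pair[OF c]] smooth_pair(1)[OF c]]
    smooth_const smooth_jc c chart_img_open)
 thus "smooth_on (chart_img c) (%x. loc2 M c g' x u v)" for u v by (rule smooth_cong) (simp add: loc_g'[OF c])
next
 fix p D E assume p: "p : W" and D: "D : tangent_space M p"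
 obtain c where c: "c : charts M" "p : fst c" using chart_at[OF p] .
 interpret symp_pair "loc2 M c om2 (snd c p)" "loc2 M c h2 (snd c p)" by (rule pair[OF c(1) chart_map_in[OF c(2)]])
 have e: "g' p (coord_vec M c p u) (coord_vec M c p v) = exp (t (R p)) * loc2 M c om2 (snd c p) u (jc c (snd c p) v)" for u v
  using loc_g'[OF c(1) chart_map_in[OF c(2)], of u v] by (simp add: loc2_def[of M c g'] Let_def chart_inv_map[OF c])
 show "g' p D E = g' p E D" if E: "E : tangent_space M p"
  using e[of "vec_coords c D" "vec_coords c E"] e[of "vec_coords c E" "vec_coords c D"] om_polJ_sym
   tangent_eq_coord_vec[OF c D] tangent_eq_coord_vec[OF c E] by metis
 assume "D ~= (%_. 0)"
 hence "vec_coords c D ~= 0" using tangent_eq_coord_vec[OF c D] coord_vec_0[OF c] by metis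
 hence "0 < exp (t (R p)) * loc2 M c om2 (snd c p) (vec_coords c D) (jc c (snd c p) (vec_coords c D))" by (intro mult_pos_pos om_polJ_pos) auto
 thus "0 < g' p D D" using e[of "vec_coords c D" "vec_coords c D"] tangent_eq_coord_vec[OF c D] by metis
qed

text \<open>Compatibility makes both constants of the taming condition 1:
  \<open>Om 1 p D (J p D)\<close> is the squared norm of \<open>D\<close>, and
  \<open>Om 1 p D E\<close> is minus the inner product of \<open>D\<close> with
  \<open>J p E\<close>, to which Cauchy-Schwarz applies as \<open>J\<close> is an isometry.\<close>

lemma strongly_bounded:
 assumes "complete_metric M g'" "sectional_curvature_bounded_above M g'" "ereal 1 <= inj_radius M g'"
 shows "strongly_geometrically_bounded M (Om 1)"
proof -
 have sy: "symplectic_form M (Om 1)" by (rule symplectic_Om) simp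
 have pt: "Om 1 p (J p D) (J p E) = Om 1 p D E" "\<bar>Om 1 p D E\<bar> <= gnorm g' p D * gnorm g' p E"
  "Om 1 p D (J p D) = (gnorm g' p D)\<^sup>2"
  if p: "p : W" and D: "D : tangent_space M p" and E: "E : tangent_space M p" for p D E
 proof -
  obtain c where c: "c : charts M" "p : fst c" using chart_at[OF p] .
  note x = chart_map_in[OF c(2)]
  interpret symp_pair "loc2 M c om2 (snd c p)" "loc2 M c h2 (snd c p)" by (rule pair[OF c(1) x])
  let ?u = "vec_coords c D" and ?v = "vec_coords c E" and ?j = "jc c (snd c p)" and ?f = "exp (t (R p))"
  have DE: "D = coord_vec M c p ?u" "E = coord_vec M c p ?v" using tangent_eq_coord_vec[OF c] D E by auto
  have o: "Om 1 p (coord_vec M c p u) (coord_vec M c p v) = ?f * loc2 M c om2 (snd c p) u v" for u v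
   by (simp add: Om_om2 loc2_def Let_def chart_inv_map[OF c])
  have g: "g' p (coord_vec M c p u) (coord_vec M c p v) = loc2 M c g' (snd c p) u v" for u v by (simp add: loc2_def Let_def chart_inv_map[OF c])
  have lg: "loc2 M c g' (snd c p) u v = ?f * loc2 M c om2 (snd c p) u (?j v)" for u v
   using loc_g'[OF c(1) x] by (simp add: chart_inv_map[OF c])
  have J: "J p D = coord_vec M c p (?j ?u)" "J p E = coord_vec M c p (?j ?v)" using J_chart[OF c] DE by metis+
  have "Om 1 p (J p D) (J p E) = ?f * loc2 M c om2 (snd c p) ?u ?v" unfolding J o om_polJ ..
  thus "Om 1 p (J p D) (J p E) = Om 1 p D E" using o DE by metis
  have nn: "0 <= g' p F F" if "F : tangent_space M p" for F
  proof (cases "F = (%_. 0)")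
   case True
   hence "g' p F F = loc2 M c g' (snd c p) 0 0" using coord_vec_0[OF c] g[of 0 0] by simp
   thus ?thesis using bilinear_lzero[OF metric_onD(2)[OF metric_on_chart[OF metric_g' c(1)] x]] by simp
  next
   case False thus ?thesis using metric_g' p that unfolding riemannian_metric_def by (meson less_imp_le)
  qed
  show "Om 1 p D (J p D) = (gnorm g' p D)\<^sup>2"
   using nn[OF D] by (simp add: gnorm_def g'_def compatible_metric_def)
  have "(loc2 M c g' (snd c p) ?u (?j ?v))\<^sup>2 <= loc2 M c g' (snd c p) ?u ?u * loc2 M c g' (snd c p) (?j ?v) (?j ?v)"
   by (rule metric_cauchy_schwarz[OF metric_on_chart[OF metric_g' c(1)] x])
  moreover have "loc2 M c g' (snd c p) (?j ?v) (?j ?v) = g' p E E" 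
   using lg[of ?v ?v] lg[of "?j ?v" "?j ?v"] g[of ?v ?v] DE(2) om_polJ[of ?v "?j ?v"] by metis
  moreover have "loc2 M c g' (snd c p) ?u ?u = g' p D D" using g[of ?u ?u] DE by metis
  moreover have "loc2 M c g' (snd c p) ?u (?j ?v) = - Om 1 p D E"
   unfolding lg polJ_square bilinear_rneg[OF om(1)] using o[of ?u ?v] DE by simp
  ultimately have "(Om 1 p D E)\<^sup>2 <= g' p D D * g' p E E" by simp
  hence "\<bar>Om 1 p D E\<bar> <= sqrt (g' p D D * g' p E E)" by (rule real_le_rsqrt[of "\<bar>Om 1 p D E\<bar>", simplified])
  thus "\<bar>Om 1 p D E\<bar> <= gnorm g' p D * gnorm g' p E" by (simp add: gnorm_def real_sqrt_mult)
 qed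
 have pos: "0 < Om 1 p D (J p D)" if "p : W" "D : tangent_space M p" "D ~= (%_. 0)" for p D
  using metric_g' that unfolding riemannian_metric_def g'_def compatible_metric_def by blast
 have "compatible_acs M (Om 1) J"
  unfolding compatible_acs_def using acs pt(1) pos by blast
 moreover have "geometrically_bounded M (Om 1) J g'"
  unfolding geometrically_bounded_def
 proof (intro conjI sy acs metric_g' assms)
  show "EX A>0. EX B>0. ALL p:W. ALL u:tangent_space M p. ALL v:tangent_space M p.
    Om 1 p u (J p u) >= A * (gnorm g' p u)\<^sup>2 & \<bar>Om 1 p u v\<bar> <= B * gnorm g' p u * gnorm g' p v"
   by (intro exI[of _ "1::real"] conjI) (auto simp: pt)
  show "EX ep>0. ereal ep <= inj_radius M g'" using assms(3) by (intro exI[of _ 1]) simp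
 qed
 ultimately show ?thesis
  unfolding strongly_geometrically_bounded_def g'_def using sy by blast
qed

end

section \<open>Uniform estimates on the necks\<close>

lemma polJ_family:
 fixes w h :: "'z::euclidean_space => 'e::euclidean_space => 'e => real"
 assumes Z: "open Z" and sp: "!!z. z : Z ==> symp_pair (w z) (h z)"
  and w: "!!u v. smooth_on Z (%z. w z u v)" and h: "!!u v. smooth_on Z (%z. h z u v)"
 defines "G == %z u v. w z u (polJ (w z) (h z) v)"
 shows "z : Z ==> bilinear (G z)" "z : Z ==> G z u v = G z v u" "z : Z ==> u ~= 0 ==> 0 < G z u u"
  "smooth_on Z (%z. G z u v)"
proof -
 show "bilinear (G z)" "G z u v = G z v u" if z: "z : Z"
 proof -
  interpret symp_pair "w z" "h z" by (rule sp[OF z])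
  show "bilinear (G z)"
   unfolding bilinear_def G_def by (intro conjI allI; rule linearI)
    (simp_all add: linear_add[OF linJ] linear_cmul[OF linJ] bilinear_ladd[OF om(1)] bilinear_lmul[OF om(1)]
     bilinear_radd[OF om(1)] bilinear_rmul[OF om(1)])
  show "G z u v = G z v u" unfolding G_def by (rule om_polJ_sym)
 qed
 show "0 < G z u u" if z: "z : Z" and u: "u ~= 0" unfolding G_def by (rule symp_pair.om_polJ_pos[OF sp[OF z] u])
 show "smooth_on Z (%z. G z u v)"
  unfolding G_def by (rule smooth_bilinear_apply[OF symp_pair.om(1)[OF sp] w smooth_const[OF Z] smooth_polJ[OF Z sp w h]])
qed

text \<open>The stretched form stays nondegenerate in the limit \<open>A = 0\<close> of an infinitely long neck.\<close>

lemma stretched_nondegenerate: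
 fixes om :: "'e::euclidean_space => 'e => real"
 assumes om: "bilinear om" "!!u. om u u = 0" "nondegenerate om" and b: "b : Basis"
  and q: "X \<bullet> b ~= 0" and A: "A + k * (X \<bullet> b) ~= 0"
 defines "L == %u. u + ((A - 1) * (u \<bullet> b)) *R b"
 shows "nondegenerate (%u v. om (L u) (L v) + k * ((u \<bullet> b) * om X (L v) - (v \<bullet> b) * om X (L u)))"
 unfolding nondegenerate_def
proof (intro allI impI)
 fix u assume u: "ALL v. om (L u) (L v) + k * ((u \<bullet> b) * om X (L v) - (v \<bullet> b) * om X (L u)) = 0"
 note bil = bilinear_ladd[OF om(1)] bilinear_lmul[OF om(1)] bilinear_radd[OF om(1)] bilinear_rmul[OF om(1)]
 have bb: "b \<bullet> b = 1" using b by simp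
 have anti: "om u v = - om v u" for u v
  using om(2)[of "u + v"] unfolding bil by (simp add: om(2))
 define Y where "Y = A *R X + ((1 - A) * (X \<bullet> b)) *R b"
 have Yb: "Y \<bullet> b = X \<bullet> b" by (simp add: Y_def inner_simps bb algebra_simps)
 hence LY: "L Y = A *R X" unfolding L_def by (simp add: Y_def algebra_simps)
 have "- (A + k * (X \<bullet> b)) * om X (L u) = 0"
  using u[rule_format, of Y] unfolding LY Yb bil anti[of "L u" X] by (simp add: om(2) algebra_simps)
 hence 0: "om X (L u) = 0" using A by simp
 define w where "w = L u + (k * (u \<bullet> b)) *R X"
 have wL: "om w (L v) = 0" for v using u[rule_format, of v] by (simp add: w_def bil 0 algebra_simps)
 have wX: "om w X = 0" using anti[of "L u" X] by (simp add: w_def bil 0 om(2))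
 have "om w z = 0" for z
 proof -
  let ?s = "(z \<bullet> b) / (X \<bullet> b)"
  have "L (z - ?s *R X) = z - ?s *R X" using q by (simp add: L_def inner_simps)
  hence "om w (z - ?s *R X) = 0" using wL by metis
  thus ?thesis using wX by (simp add: bilinear_rsub[OF om(1)] bil)
 qed
 hence w0: "w = 0" using om(3) by (simp add: nondegenerate_def)
 have "w \<bullet> b = (u \<bullet> b) * (A + k * (X \<bullet> b))" by (simp add: w_def L_def inner_simps bb algebra_simps)
 hence ub: "u \<bullet> b = 0" using w0 A by simp
 thus "u = 0" using w0 by (simp add: w_def L_def)
qed

context smooth_mfd
begin

text \<open>Some coordinate direction \<open>b\<close> has nonzero derivative of \<open>R\<close>.
  Replacing that coordinate by the value of \<open>R\<close> has an injective derivative at the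
  point, so it is a local change of coordinates.\<close>

lemma function_chart:
 assumes p0: "p0 : pts M" and R: "gsmooth R" and D: "D : tangent_space M p0" "D R ~= 0"
  and U: "opn M U" "p0 : U"
 obtains c b where "c : charts M" "p0 : fst c" "fst c <= U" "b : Basis" "!!q. q : fst c ==> snd c q \<bullet> b = R q"
proof -
 obtain c where c: "c : charts M" "p0 : fst c" using chart_at[OF p0] .
 let ?x = "snd c p0" and ?r = "R o chart_inv c"
 note sr = gsmooth_chart[OF R c(1)]
 have x: "?x : chart_img c" by (rule chart_map_in[OF c(2)])
 have lin: "linear (FD ?r ?x)" by (rule smooth_FD_linear[OF sr x])
 have "smooth_near M p0 R" using R p0 by (simp add: gsmooth_def)
 hence "FD ?r ?x (vec_coords c D) ~= 0"
  using tangent_eq_coord_vec[OF c D(1)] coord_vec_apply[of p0 R c] D(2) by metis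
 then obtain b where b: "b : Basis" "FD ?r ?x b ~= 0"
  unfolding linear_basis_expand[OF lin, of "vec_coords c D"] by (metis (no_types, lifting) scaleR_zero_right sum.neutral)
 define fi where "fi x = x + (?r x - x \<bullet> b) *R b" for x
 have sfi: "smooth_on (chart_img c) fi"
  unfolding fi_def by (intro smooth_add smooth_scaleR smooth_diff sr smooth_inner smooth_const smooth_ident chart_img_open c)
 have dfi: "(fi has_derivative (%h. h + (FD ?r ?x h - h \<bullet> b) *R b)) (at ?x)"
  unfolding fi_def
  by (intro has_derivative_add has_derivative_ident has_derivative_scaleR_left has_derivative_diff has_derivative_inner_left smooth_has_derivative[OF sr x])
 have "inj (FD fi ?x)"
  unfolding has_derivative_frechet[OF dfi]
 proof (subst linear_injective_0[OF has_derivative_linear[OF dfi]], intro allI impI)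
  fix h assume h: "h + (FD ?r ?x h - h \<bullet> b) *R b = 0"
  define s where "s = h \<bullet> b - FD ?r ?x h"
  have hs: "h = s *R b" using h by (simp add: s_def algebra_simps)
  have "s = s - s * FD ?r ?x b" using b(1) by (subst (1) s_def) (simp add: hs linear_cmul[OF lin])
  thus "h = 0" using b(2) hs by simp
 qed
 from smooth_local_injective[OF sfi x this]
 obtain e where e: "0 < e" "ball ?x e <= chart_img c" "inj_on fi (ball ?x e)"
  and ie: "!!y. y : ball ?x e ==> inj (FD fi y)" by blast
 define V where "V = U Int {p : fst c. snd c p : ball ?x e}"
 have V: "opn M V" unfolding V_def by (intro openin_Int U chart_preimage_open[OF c(1)] open_ball)
 define c1 where "c1 = (fst c Int V, snd c)"
 have c1: "c1 : charts M" unfolding c1_def by (rule chart_restrict(1)[OF c(1) V])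
 have im: "chart_img c1 <= ball ?x e" "chart_img c1 <= chart_img c" by (auto simp: c1_def chart_img_def V_def)
 have "(fst c1, fi o snd c1) : charts M"
  by (rule chart_compose(1)[OF c1 smooth_subset[OF sfi chart_img_open[OF c1] im(2)] inj_on_subset[OF e(3) im(1)] ie])
   (use im in blast)
 moreover have "p0 : fst (fst c1, fi o snd c1)" using c U e(1) by (simp add: c1_def V_def)
 moreover have "fst (fst c1, fi o snd c1) <= U" by (auto simp: c1_def V_def)
 moreover have "snd (fst c1, fi o snd c1) q \<bullet> b = R q" if "q : fst (fst c1, fi o snd c1)" for q
 proof -
  have "q : fst c" using that by (simp add: c1_def)
  thus ?thesis using b(1) chart_inv_map[OF c(1), of q] by (simp add: fi_def c1_def inner_simps)
 qed
 ultimately show ?thesis using that b(1) by blast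
qed

end

context contact_data
begin

text \<open>The quantification over all profiles is the point: the threshold belongs to the set
  \<open>N\<close> and is valid for all stretching factors, which can therefore be chosen after
  it.\<close>

definition good_near :: "real => 'a set => real => bool" where
 "good_near et N D0 \<longleftrightarrow> (ALL te' t'. contact_data M te' om g0 R X t' --> (ALL p:N. D0 <= exp (t' (R p)) -->
  (EX c rh a b K. good_chart (contact_data.g' M te' om g0 R X t') et p c rh a b K)))"

lemma d_exp_t:
 assumes F: "(F has_derivative F') (at y)"
 shows "((%y. exp (t (F y))) has_derivative (%v. exp (t (F y)) * (tau (F y) * F' v))) (at y)"
proof -
 have "((%s. exp (t s)) has_real_derivative exp (t (F y)) * tau (F y)) (at (F y))"
  unfolding tau_def by (auto intro!: derivative_eq_intros t(2))
 from has_derivative_compose[OF F this[unfolded has_field_derivative_def]] show ?thesis by (simp add: mult.assoc)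
qed

text \<open>On a chart where the cosine is positive \<open>neck\<close> vanishes, so neither
  \<open>om2\<close> nor \<open>h2\<close> depends on the profile and the conformal factor is
  locally constant. The family needs no stretching: \<open>L\<close> is the identity,
  \<open>l\<close> is 0, and the parameter is fixed at 0.\<close>

lemma ordinary_piece:
 assumes p0: "p0 : W" "0 < cos (2 * pi * R p0)" and et: "0 < et"
 shows "EX N. opn M N & p0 : N & (EX D0. good_near et N D0)"
proof -
 obtain c0 where c0: "c0 : charts M" "p0 : fst c0" using chart_at[OF p0(1)] .
 define U where "U = {p : W. R p : {r. 0 < cos (2 * pi * r)}}"
 have U: "opn M U" unfolding U_def by (rule gsmooth_preimage[OF gR open_cos_greater])
 define c where "c = (fst c0 Int U, snd c0)"
 have c: "c : charts M" "p0 : fst c" using chart_restrict(1)[OF c0(1) U] c0 p0 by (auto simp: c_def U_def)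
 have cU: "0 < cos (2 * pi * rc c y)" if "y : chart_img c" for y
  using chart_inv_in[OF that] by (simp add: c_def U_def)
 obtain r where r: "0 < r" "cball (snd c p0) r <= chart_img c"
  using chart_img_open[OF c(1)] chart_map_in[OF c(2)] open_contains_cball by blast
 let ?Z = "UNIV \<times> chart_img c :: (real \<times> 'e) set" and ?G = "%z u v. loc2 M c om2 (snd z) u (jc c (snd z) v)"
 have Z: "open ?Z" by (intro open_Times open_UNIV chart_img_open c)
 have sZ: "smooth_on ?Z (%z. F (snd z))" if "smooth_on (chart_img c) F" for F :: "'e => real"
  by (rule smooth_comp[OF that smooth_snd[OF smooth_ident[OF Z]]]) auto
 have sp: "symp_pair (loc2 M c om2 (snd z)) (loc2 M c h2 (snd z))" if "z : ?Z" for z by (rule pair[OF c(1)]) (use that in auto)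
 have fam: "metric_family ?Z ?G (%z v. v) (%z v. 0)"
  by (intro metric_family.intro polJ_family[OF Z sp sZ[OF smooth_pair(1)] sZ[OF smooth_pair(2)]] Z smooth_const)
   (auto simp: linear_iff c)
 have C: "compact ({0} \<times> cball (snd c p0) r)" "{0} \<times> cball (snd c p0) r <= ?Z" using r(2) by (auto intro: compact_Times)
 obtain D0 where D0: "!!g c' p te X f. adapted g c' p (r/2) ({0} \<times> cball (snd c p0) r) ?G (%z v. v) (%z v. 0) te X f ==> D0 <= f (snd c' p) ==>
   (EX rh a b K. good_chart g et p c' rh a b K)"
  using family_good_chart[OF fam C et half_gt_zero[OF r(1)]] by blast
 let ?N = "{p : fst c. snd c p : ball (snd c p0) (r/2)}"
 have "good_near et ?N D0"
  unfolding good_near_def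
 proof (intro allI impI ballI)
  fix te' t' p assume d: "contact_data M te' om g0 R X t'" and p: "p : ?N" and le: "D0 <= exp (t' (R p))"
  interpret d: contact_data M te' om g0 R X t' by (rule d)
  have sub: "ball (snd c p) (r/2) <= cball (snd c p0) r"
  proof
   fix y assume "y : ball (snd c p) (r/2)"
   thus "y : cball (snd c p0) r" using p dist_triangle_less_add[of "snd c p0" "snd c p" "r/2" y "r/2"] by (simp add: dist_commute)
  qed
  have "adapted d.g' c p (r/2) ({0} \<times> cball (snd c p0) r) ?G (%z v. v) (%z v. 0) 0 (%y. y) (%y. exp (t' (rc c y)))"
   unfolding adapted_def
  proof (intro conjI d.metric_g' c(1))
   show "p : fst c" "ball (snd c p) (r/2) <= chart_img c" using p sub r(2) by auto
   show "ALL y:ball (snd c p) (r/2). (0, y) : {0} \<times> cball (snd c p0) r & ((%y. y) has_derivative (%v. v)) (at y) & 0 < exp (t' (rc c y)) &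
    ((%y. exp (t' (rc c y))) has_derivative (%v. exp (t' (rc c y)) * 0)) (at y) &
    (ALL u v. loc2 M c d.g' y u v = exp (t' (rc c y)) * ?G (0, y) u v)"
   proof (intro ballI conjI allI)
    fix y assume "y : ball (snd c p) (r/2)"
    hence yC: "y : cball (snd c p0) r" using sub by blast
    thus "(0, y) : {0} \<times> cball (snd c p0) r" by simp
    have y: "y : chart_img c" using yC r(2) by blast
    have n0: "neck (rc c y) = 0" using cU[OF y] by (simp add: neck_0)
    show "((%y. exp (t' (rc c y))) has_derivative (%v. exp (t' (rc c y)) * 0)) (at y)"
     using d.d_exp_t[OF smooth_has_derivative[OF srd[OF c(1)] y]] n0 by (simp add: d.tau_def)
    have "loc2 M c d.om2 y = loc2 M c om2 y" "loc2 M c d.h2 y = loc2 M c h2 y"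
     using n0 by (auto simp: fun_eq_iff d.om2_def om2_def d.loc2_tw[OF c(1) y] loc2_tw[OF c(1) y]
       d.loc2_h2[OF c(1) y] loc2_h2[OF c(1) y] d.tau_def tau_def dil_def)
    thus "loc2 M c d.g' y u v = exp (t' (rc c y)) * ?G (0, y) u v" for u v
     using d.loc_g'[OF c(1) y, of u v] by simp
   qed auto
  qed
  moreover have "D0 <= exp (t' (rc c (snd c p)))" using le p chart_inv_map[OF c(1), of p] by simp
  ultimately have "EX rh a b K. good_chart d.g' et p c rh a b K" by (rule D0)
  thus "EX c rh a b K. good_chart d.g' et p c rh a b K" by blast
 qed
 moreover have "opn M ?N" by (rule chart_preimage_open[OF c(1) open_ball])
 moreover have "p0 : ?N" using c r(1) by simp
 ultimately show ?thesis by blast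
qed

text \<open>In a chart with \<open>R\<close> as coordinate \<open>b\<close>, stretching acts on this
  coordinate alone. In the stretched chart the geometry becomes a smooth family over pairs of an
  inverse factor and a point of the unstretched chart, so that compactness of the set of factors
  from 0 to 1 gives one threshold for all profiles.\<close>

lemma neck_piece:
 assumes p0: "p0 : W" "cos (2 * pi * R p0) < 1/2" and et: "0 < et"
 shows "EX N. opn M N & p0 : N & (EX D0. good_near et N D0)"
proof -
 define m where "m = \<lfloor>R p0\<rfloor>"
 have "R p0 ~= of_int m"
 proof
  assume "R p0 = of_int m"
  hence "cos (2 * pi * R p0) = 1" using cos_int_2pin[of m] by (simp add: mult.commute)
  thus False using p0(2) by simp
 qed
 hence m: "R p0 : {of_int m<..<of_int m + 1}" using floor_correct[of "R p0"] by (auto simp: m_def less_le)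
 define U where "U = {p : W. R p : {r. cos (2 * pi * r) < 1/2} Int {of_int m<..<of_int m + 1}}"
 have U: "opn M U" unfolding U_def by (intro gsmooth_preimage[OF gR] open_Int open_cos_less) simp
 have "X p0 : tangent_space M p0" using sX p0(1) by (simp add: smooth_vector_field_on_def)
 moreover have "X p0 R ~= 0" using XR[OF p0] by simp
 moreover have "p0 : U" using p0 m by (simp add: U_def)
 ultimately obtain c b where c: "c : charts M" "p0 : fst c" and cU: "fst c <= U" and b: "b : Basis"
  and cR: "!!q. q : fst c ==> snd c q \<bullet> b = R q" using function_chart[OF p0(1) gR _ _ U] by blast
 have bb: "b \<bullet> b = 1" using b by simp
 note oc = chart_img_open[OF c(1)]
 have rcb: "rc c x = x \<bullet> b" if "x : chart_img c" for x
  using cR[OF chart_inv_in[OF that]] by (simp add: chart_map_inv[OF that])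
 have xU: "x \<bullet> b : {of_int m<..<of_int m + 1}" "cos (2 * pi * (x \<bullet> b)) < 1/2" if "x : chart_img c" for x
  using chart_inv_in[OF that] cU rcb[OF that] by (auto simp: U_def)
 have drb: "dr c x = (%u. u \<bullet> b)" if x: "x : chart_img c" for x
 proof -
  have "dr c x = FD (%x. x \<bullet> b) x" by (rule frechet_derivative_cong_open[OF oc x rcb])
  also have "... = (%u. u \<bullet> b)"
   by (rule has_derivative_frechet[OF bounded_linear.has_derivative[OF bounded_linear_inner_left has_derivative_ident]])
  finally show ?thesis .
 qed
 have Xb: "0 < xc c x \<bullet> b" if x: "x : chart_img c" for x
 proof -
  have "cos (2 * pi * R (chart_inv c x)) < 1/2" using xU(2)[OF x] rcb[OF x] by simp
  hence "0 < X (chart_inv c x) R" by (intro XR inW[OF c(1) x])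
  moreover have "X (chart_inv c x) R = xc c x \<bullet> b"
   using cv_R[OF c(1) x, of "xc c x"] X_xc[OF c(1) x] drb[OF x] by metis
  ultimately show ?thesis by simp
 qed
 \<comment> \<open>The function \<open>dil\<close> over the chart, with the inverse factor of the
   neck as a free real variable. It is affine in that variable, hence defined and smooth also at 0
   and around it.\<close>
 define A where "A z = 1 - (1 - fst z) * neck (snd z \<bullet> b)" for z :: "real \<times> 'e"
 define L where "L z u = u + ((A z - 1) * (u \<bullet> b)) *R b" for z u
 define la where "la x v = loc2 M c om x (xc c x) v" for x v
 \<comment> \<open>\<open>w\<close> and \<open>h\<close> are \<open>om2\<close> and
   \<open>h2\<close> in stretched coordinates. The denominators \<open>dil\<close> in
   \<open>tau\<close> and in the metric term are cancelled by the factor \<open>A\<close> that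
   \<open>L\<close> produces in the component along \<open>b\<close>, so nothing is singular at
   factor 0.\<close>
 define w where "w z u v = loc2 M c om (snd z) (L z u) (L z v)
  + neck (snd z \<bullet> b) * ((u \<bullet> b) * la (snd z) (L z v) - (v \<bullet> b) * la (snd z) (L z u))" for z u v
 define h where "h z u v = loc2 M c g0 (snd z) (L z u) (L z v) + (u \<bullet> b) * (v \<bullet> b)" for z u v
 \<comment> \<open>The open set on which the condition of \<open>stretched_nondegenerate\<close>
   holds.\<close>
 define Z where "Z = {z : UNIV \<times> chart_img c. A z + neck (snd z \<bullet> b) * (xc c (snd z) \<bullet> b) : {0<..}}"
 let ?Z0 = "UNIV \<times> chart_img c :: (real \<times> 'e) set"
 have Z0: "open ?Z0" by (intro open_Times open_UNIV oc)
 note iZ = smooth_ident[OF Z0]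
 have sZ: "smooth_on ?Z0 (%z. F (snd z))" if "smooth_on (chart_img c) F" for F :: "'e => 'f::euclidean_space"
  by (rule smooth_comp[OF that smooth_snd[OF iZ]]) auto
 have sn: "smooth_on ?Z0 (%z. neck (snd z \<bullet> b))"
  by (rule smooth_comp[OF smooth_neck smooth_inner[OF smooth_snd[OF iZ] smooth_const[OF Z0]]]) simp
 have sA: "smooth_on ?Z0 A" unfolding A_def by (intro smooth_diff smooth_mult smooth_const Z0 sn smooth_fst iZ)
 have sL: "smooth_on ?Z0 (%z. L z u)" for u
  unfolding L_def by (intro smooth_add smooth_scaleR smooth_mult smooth_diff smooth_const Z0 sA)
 note g = metric_onD[OF metric_on_chart[OF g0 c(1)]]
 have sB: "smooth_on ?Z0 (%z. B (snd z) (F z) (F' z))" if "!!x. x : chart_img c ==> bilinear (B x)" "!!u v. smooth_on (chart_img c) (%x. B x u v)"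
  "smooth_on ?Z0 F" "smooth_on ?Z0 F'" for B :: "'e => 'e => 'e => real" and F F'
  by (rule smooth_bilinear_apply[OF _ sZ[OF that(2)] that(3,4)]) (use that(1) in auto)
 have sw: "smooth_on ?Z0 (%z. w z u v)" for u v
  unfolding w_def la_def by (intro smooth_add smooth_diff smooth_mult sn sB[OF omc(1,2)[OF c(1)]] sL sZ[OF sxc[OF c(1)]] smooth_const Z0)
 have sh: "smooth_on ?Z0 (%z. h z u v)" for u v
  unfolding h_def by (intro smooth_add smooth_const Z0 sB[OF g(2,5)] sL)
 have Z: "open Z" unfolding Z_def
 proof -
  have "smooth_on ?Z0 (%z. A z + neck (snd z \<bullet> b) * (xc c (snd z) \<bullet> b))"
   by (intro smooth_add smooth_mult sA sn smooth_inner sZ[OF sxc[OF c(1)]] smooth_const Z0)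
  from continuous_open_preimage[OF smooth_cont[OF this] Z0 open_greaterThan]
  have "open (?Z0 Int (%z. A z + neck (snd z \<bullet> b) * (xc c (snd z) \<bullet> b)) -` {0<..})" .
  moreover have "?Z0 Int (%z. A z + neck (snd z \<bullet> b) * (xc c (snd z) \<bullet> b)) -` {0<..} = {z : ?Z0. A z + neck (snd z \<bullet> b) * (xc c (snd z) \<bullet> b) : {0<..}}" by blast
  ultimately show "open {z : ?Z0. A z + neck (snd z \<bullet> b) * (xc c (snd z) \<bullet> b) : {0<..}}" by (simp only:)
 qed
 have ZZ: "Z <= ?Z0" by (auto simp: Z_def)
 note sub = smooth_subset[OF _ Z ZZ]
 have Ladd: "L z (u + v) = L z u + L z v" and Lmul: "L z (k *R u) = k *R L z u" for z u v k by (simp_all add: L_def inner_simps algebra_simps)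
 have sp: "symp_pair (w z) (h z)" if z: "z : Z" for z
 proof
  have x: "snd z : chart_img c" using z by (auto simp: Z_def)
  note B = omc(1)[OF c(1) x] and B0 = g(2)[OF x]
  show "bilinear (w z)"
   unfolding bilinear_def w_def la_def by (intro conjI allI; rule linearI)
    (simp_all add: Ladd Lmul bilinear_ladd[OF B] bilinear_lmul[OF B] bilinear_radd[OF B] bilinear_rmul[OF B] inner_simps algebra_simps)
  show "bilinear (h z)"
   unfolding bilinear_def h_def by (intro conjI allI; rule linearI)
    (simp_all add: Ladd Lmul bilinear_ladd[OF B0] bilinear_lmul[OF B0] bilinear_radd[OF B0] bilinear_rmul[OF B0] inner_simps algebra_simps)
  show "w z u u = 0" for u by (simp add: w_def omc(3)[OF c(1) x])
  show "nondegenerate (w z)"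
   unfolding w_def la_def L_def by (rule stretched_nondegenerate[OF B omc(3,4)[OF c(1) x] b]) (use Xb[OF x] z in "auto simp: Z_def")
  show "h z u v = h z v u" for u v using g(3)[OF x, of "L z u" "L z v"] by (simp add: h_def)
  show "0 < h z u u" if u: "u ~= 0" for u
  proof (cases "u \<bullet> b = 0")
   case True
   hence "L z u = u" by (simp add: L_def)
   thus ?thesis using True g(4)[OF x u] by (simp add: h_def)
  next
   case False
   have "0 <= loc2 M c g0 (snd z) (L z u) (L z u)"
    using g(4)[OF x, of "L z u"] bilinear_lzero[OF B0] by (cases "L z u = 0") auto
   moreover have "0 < (u \<bullet> b) * (u \<bullet> b)" using False by (auto simp: zero_less_mult_iff neq_iff)
   ultimately show ?thesis by (simp add: h_def)
  qed
 qed
 let ?G = "%z u v. w z u (polJ (w z) (h z) v)" and ?l = "%z v. neck (snd z \<bullet> b) * (v \<bullet> b)"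
 have fam: "metric_family Z ?G L ?l"
 proof (intro metric_family.intro polJ_family[OF Z sp sub[OF sw] sub[OF sh]] Z)
  show "linear (L z)" for z by (rule linearI) (simp_all add: Ladd Lmul)
  show "linear (?l z)" for z by (rule linearI) (simp_all add: inner_simps algebra_simps)
  show "smooth_on Z (%z. L z v)" for v by (rule sub[OF sL])
  show "smooth_on Z (%z. ?l z v)" for v by (intro smooth_mult sub[OF sn] smooth_const Z)
 qed
 obtain r where r: "0 < r" "cball (snd c p0) r <= chart_img c"
  using oc chart_map_in[OF c(2)] open_contains_cball by blast
 let ?C = "{0..1} \<times> cball (snd c p0) r :: (real \<times> 'e) set"
 have "?C <= Z"
 proof
  fix z assume z: "z : ?C"
  hence x: "snd z : chart_img c" using r(2) by (cases z) auto
  let ?n = "neck (snd z \<bullet> b)"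
  have n: "0 <= ?n" "?n <= 1" by (rule neck_bounds)+
  have t: "0 <= fst z" "fst z <= 1" using z by (cases z; auto)+
  have "(1 - fst z) * ?n <= 1 * ?n" by (rule mult_right_mono) (use t n in auto)
  hence A: "1 - ?n <= A z" by (simp add: A_def)
  \<comment> \<open>\<open>A z\<close> can vanish only where \<open>neck\<close> is 1, and there the
    term with the Liouville field is positive.\<close>
  have "0 < A z + ?n * (xc c (snd z) \<bullet> b)"
  proof (cases "?n = 1")
   case True thus ?thesis using A Xb[OF x] by simp
  next
   case False
   hence "0 < A z" using A n by simp
   thus ?thesis using n Xb[OF x] by (intro add_pos_nonneg mult_nonneg_nonneg) auto
  qed
  thus "z : Z" using x by (cases z) (simp add: Z_def)
 qed
 hence C: "compact ?C" "?C <= Z" by (auto intro: compact_Times)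
 obtain D0 where D0: "!!g c' p te X f. adapted g c' p (r/2) ?C ?G L ?l te X f ==> D0 <= f (snd c' p) ==>
   (EX rh a b K. good_chart g et p c' rh a b K)"
  using family_good_chart[OF fam C et half_gt_zero[OF r(1)]] by blast
 let ?N = "{p : fst c. snd c p : ball (snd c p0) (r/2)}"
 have "good_near et ?N D0"
  unfolding good_near_def
 proof (intro allI impI ballI)
  fix te' t' p assume d: "contact_data M te' om g0 R X t'" and p: "p : ?N" and le: "D0 <= exp (t' (R p))"
  interpret d: contact_data M te' om g0 R X t' by (rule d)
  \<comment> \<open>The chart lies over a single unit interval of values of \<open>R\<close>, so the
    profile enters through this one factor.\<close>
  define th where "th = te' (nat m)"
  have th: "th : {0..1}" using d.te[of "nat m"] by (simp add: th_def)
  have dA: "dil te' (x \<bullet> b) = A (th, x)" if "x : chart_img c" for x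
  proof -
   have "\<lfloor>x \<bullet> b\<rfloor> = m" using xU(1)[OF that] by (auto simp: floor_eq_iff)
   thus ?thesis by (simp add: dil_def A_def th_def)
  qed
  obtain s where s: "smooth_on UNIV s" "!!x. (s has_real_derivative 1 / dil te' x) (at x)" "!!x y. \<bar>x - y\<bar> <= \<bar>s x - s y\<bar>" "surj s"
   using d.stretch_exists by blast
  define si where "si = inv s"
  have ssi: "s (si y) = y" for y using s(4) by (simp add: si_def surj_f_inv_f)
  have sis: "si (s x) = x" for x using s(3)[of "si (s x)" x] ssi by simp
  have lip: "\<bar>si x - si y\<bar> <= \<bar>x - y\<bar>" for x y using s(3)[of "si x" "si y"] ssi by simp
  have dn: "dil te' x ~= 0" for x using d.dil_bounds[of x] by simp
  have dsi: "(si has_real_derivative dil te' (si y)) (at y)" for y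
  proof -
   have "continuous_on UNIV si"
    unfolding continuous_on_iff dist_real_def using lip le_less_trans by blast
   hence "isCont si y" by (simp add: continuous_on_eq_continuous_at)
   from DERIV_inverse_function[OF s(2)[of "si y"] _ _ _ ssi this, of "y - 1" "y + 1"] dn[of "si y"] show ?thesis by simp
  qed
  \<comment> \<open>The stretching of coordinate \<open>b\<close> and its inverse \<open>Xi\<close>.
    As \<open>Xi\<close> is 1-Lipschitz, a ball of radius \<open>r/2\<close> in the stretched chart
    stays over the fixed ball of radius \<open>r\<close>, whatever the factor.\<close>
  define Y where "Y x = x + (s (x \<bullet> b) - x \<bullet> b) *R b" for x :: 'e
  define Xi where "Xi y = y + (si (y \<bullet> b) - y \<bullet> b) *R b" for y :: 'e
  have YXi: "Y (Xi y) = y" and XiY: "Xi (Y y) = y" for y by (simp_all add: Y_def Xi_def inner_simps bb ssi sis algebra_simps)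
  have XiL: "norm (Xi x - Xi y) <= norm (x - y)" for x y
  proof (rule norm_le_componentwise)
   fix e :: 'e assume e: "e : Basis"
   show "\<bar>(Xi x - Xi y) \<bullet> e\<bar> <= \<bar>(x - y) \<bullet> e\<bar>"
    using lip[of "x \<bullet> b" "y \<bullet> b"] inner_Basis[OF b e] by (cases "b = e") (auto simp: Xi_def inner_simps)
  qed
  have db: "((%x. x \<bullet> b) has_derivative (%h. h \<bullet> b)) (at x)" for x
   by (rule bounded_linear.has_derivative[OF bounded_linear_inner_left has_derivative_ident])
  have dY: "(Y has_derivative (%h. h + (1 / dil te' (x \<bullet> b) * (h \<bullet> b) - h \<bullet> b) *R b)) (at x)" for x
   unfolding Y_def by (intro has_derivative_add has_derivative_ident has_derivative_scaleR_left has_derivative_diff db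
     has_derivative_compose[OF db s(2)[unfolded has_field_derivative_def]])
  have dXi: "(Xi has_derivative (%h. h + (dil te' (Xi y \<bullet> b) * (h \<bullet> b) - h \<bullet> b) *R b)) (at y)" for y
  proof -
   have "Xi y \<bullet> b = si (y \<bullet> b)" by (simp add: Xi_def inner_simps bb)
   thus ?thesis
    unfolding Xi_def by (intro has_derivative_add has_derivative_ident has_derivative_scaleR_left has_derivative_diff db
     has_derivative_compose[OF db dsi[unfolded has_field_derivative_def], THEN has_derivative_eq_rhs]) simp
  qed
  have sY: "smooth_on UNIV Y"
   unfolding Y_def by (intro smooth_add smooth_scaleR smooth_diff smooth_inner smooth_ident smooth_const open_UNIV
     smooth_comp[OF s(1)]) auto
  have iY: "inj (FD Y x)" for x
   unfolding has_derivative_frechet[OF dY]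
  proof (subst linear_injective_0[OF has_derivative_linear[OF dY]], intro allI impI)
   fix h assume h: "h + (1 / dil te' (x \<bullet> b) * (h \<bullet> b) - h \<bullet> b) *R b = 0"
   have "1 / dil te' (x \<bullet> b) * (h \<bullet> b) = 0" using arg_cong[OF h, of "%v. v \<bullet> b"] by (simp add: inner_simps bb)
   hence "h \<bullet> b = 0" using dn by simp
   thus "h = 0" using h by simp
  qed
  have injY: "inj_on Y S" for S using XiY by (metis inj_onI)
  define e where "e = (fst c, Y o snd c)"
  have e: "e : charts M" unfolding e_def by (rule chart_compose(1)[OF c(1) smooth_subset[OF sY oc] injY iY]) simp
  have eim: "chart_img e = Y ` chart_img c" by (auto simp: e_def chart_img_def)
  have einv: "chart_inv e y = chart_inv c (Xi y)" and Xi_in: "Xi y : chart_img c" if ye: "y : chart_img e" for y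
  proof -
   from ye obtain x where x: "x : chart_img c" "y = Y x" unfolding eim by (elim imageE) (rule that)
   thus "Xi y : chart_img c" by (simp add: XiY)
   have "chart_inv e y = chart_inv c (inv_into (chart_img c) Y y)" unfolding e_def
    by (rule chart_compose(2)[OF c(1) smooth_subset[OF sY oc] injY iY]) (use x in auto)
   thus "chart_inv e y = chart_inv c (Xi y)" using inv_into_f_f[OF injY x(1)] x(2) by (simp add: XiY)
  qed
  have tre: "tr e c y = Xi y" if "y : chart_img e" for y
   using einv[OF that] chart_map_inv[OF Xi_in[OF that]] by simp
  have ball: "Xi y : cball (snd c p0) r" "y : chart_img e" if "y : ball (snd e p) (r/2)" for y
  proof -
   have "norm (Xi y - Xi (Y (snd c p))) <= norm (y - Y (snd c p))" by (rule XiL)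
   also have "... < r/2" using that by (simp add: e_def dist_norm norm_minus_commute)
   finally have "dist (snd c p) (Xi y) < r/2" by (simp add: XiY dist_norm norm_minus_commute)
   thus 1: "Xi y : cball (snd c p0) r" using p dist_triangle_less_add[of "snd c p0" "snd c p" "r/2" "Xi y" "r/2"] by (simp add: dist_commute)
   thus "y : chart_img e" using r(2) eim YXi[of y] by (metis image_eqI subsetD)
  qed
  let ?f = "%y. exp (t' (Xi y \<bullet> b))"
  have pe: "p : fst e" using p by (simp add: e_def)
  have "adapted d.g' e p (r/2) ?C ?G L ?l th Xi ?f"
   unfolding adapted_def
  proof (intro conjI d.metric_g' e pe ballI allI)
   show "ball (snd e p) (r/2) <= chart_img e" using ball(2) by blast
   fix y assume y: "y : ball (snd e p) (r/2)"
   note ye = ball(2)[OF y]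
   let ?x = "Xi y"
   have x: "?x : chart_img c" by (rule Xi_in[OF ye])
   show "(th, ?x) : ?C" using th ball(1)[OF y] by simp
   have dd: "dil te' (?x \<bullet> b) = A (th, ?x)" by (rule dA[OF x])
   show dX: "(Xi has_derivative L (th, ?x)) (at y)"
    using dXi[of y] unfolding dd L_def by (simp add: algebra_simps)
   show "0 < ?f y" by simp
   have Lb: "L (th, ?x) v \<bullet> b = A (th, ?x) * (v \<bullet> b)" for v by (simp add: L_def inner_simps bb algebra_simps)
   have tA: "d.tau (?x \<bullet> b) * A (th, ?x) = neck (?x \<bullet> b)" using dd dn[of "?x \<bullet> b"] by (simp add: d.tau_def)
   have "((%y. Xi y \<bullet> b) has_derivative (%v. L (th, ?x) v \<bullet> b)) (at y)"
    by (rule bounded_linear.has_derivative[OF bounded_linear_inner_left dX])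
   from d.d_exp_t[OF this]
   show "(?f has_derivative (%v. ?f y * (neck (snd (th, ?x) \<bullet> b) * (v \<bullet> b)))) (at y)"
    unfolding Lb by (simp add: tA[symmetric] mult.assoc)
   fix u v
   have yS: "y : snd e ` (fst e Int fst c)" using ye by (simp add: chart_img_def e_def)
   have "FD (tr e c) y = FD Xi y" by (rule frechet_derivative_cong_open[OF chart_img_open[OF e] ye tre])
   hence fL: "FD (tr e c) y = L (th, ?x)" by (simp add: has_derivative_frechet[OF dX])
   note ch = loc2_change[OF e c(1) yS, unfolded tre[OF ye] fL]
   have rx: "rc c ?x = ?x \<bullet> b" by (rule rcb[OF x])
   have "loc2 M e d.om2 y u v = w (th, ?x) u v" for u v
   proof -
    have "loc2 M e d.om2 y u v = loc2 M c om ?x (L (th, ?x) u) (L (th, ?x) v) + d.tau (?x \<bullet> b) *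
      (A (th, ?x) * (u \<bullet> b) * la ?x (L (th, ?x) v) - A (th, ?x) * (v \<bullet> b) * la ?x (L (th, ?x) u))"
     unfolding ch[of d.om2] unfolding d.om2_def d.loc2_tw[OF c(1) x] using rx by (simp add: drb[OF x] Lb la_def)
    also have "... = w (th, ?x) u v" by (simp add: w_def tA[symmetric] algebra_simps)
    finally show ?thesis .
   qed
   hence we: "loc2 M e d.om2 y = w (th, ?x)" by blast
   have "loc2 M e d.h2 y u v = h (th, ?x) u v" for u v
   proof -
    have "(1 / A (th, ?x))\<^sup>2 * ((A (th, ?x) * (u \<bullet> b)) * (A (th, ?x) * (v \<bullet> b))) = (u \<bullet> b) * (v \<bullet> b)"
     using dd dn[of "?x \<bullet> b"] by (simp add: power2_eq_square)
    thus ?thesis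
     unfolding ch[of d.h2] d.loc2_h2[OF c(1) x] rx dd by (simp add: drb[OF x] Lb h_def)
   qed
   hence he: "loc2 M e d.h2 y = h (th, ?x)" by blast
   have "rc e y = ?x \<bullet> b" using rx einv[OF ye] by simp
   thus "loc2 M e d.g' y u v = ?f y * ?G (th, ?x) u v"
    unfolding d.loc_g'[OF e ye] we he by simp
  qed
  moreover have "D0 <= ?f (snd e p)"
   using le p cR[of p] by (simp add: e_def XiY)
  ultimately have "EX rh a b K. good_chart d.g' et p e rh a b K" by (rule D0)
  thus "EX c rh a b K. good_chart d.g' et p c rh a b K" by blast
 qed
 moreover have "opn M ?N" by (rule chart_preimage_open[OF c(1) open_ball])
 moreover have "p0 : ?N" using c r(1) by simp
 ultimately show ?thesis by blast
qed

lemma good_near_compact: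
 assumes K: "compactin (mtop M) K" and et: "0 < et"
 shows "EX D0. good_near et K D0"
proof -
 obtain N where N: "opn M N" "K <= N" "EX D0. good_near et N D0"
 proof (rule compact_local_global[OF K, where P = "%N. EX D0. good_near et N D0"])
  fix p assume "p : K"
  hence p: "p : W" using compactin_subset_topspace[OF K] by blast
  show "EX N. opn M N & p : N & (EX D0. good_near et N D0)"
   using ordinary_piece[OF p _ et] neck_piece[OF p _ et] by (cases "0 < cos (2 * pi * R p)") auto
 next
  show "EX D0. good_near et {} D0" by (simp add: good_near_def)
 next
  fix A B assume "EX D0. good_near et A D0" "EX D0. good_near et B D0"
  then obtain D E where "good_near et A D" "good_near et B E" by blast
  hence "good_near et (A Un B) (max D E)" unfolding good_near_def by (metis Un_iff max.bounded_iff)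
  thus "EX D0. good_near et (A Un B) D0" by blast
 qed
 thus ?thesis unfolding good_near_def by (meson subsetD)
qed

end

theorem theorem1:
 fixes M :: "('a, 'e::euclidean_space) manifold"
  and \<omega> :: "'a tensor2"
 assumes "smooth_manifold M"
  and "symplectic_form M \<omega>"
  and "\<exists>K. contact_exhaustion M \<omega> K"
 shows "\<exists>\<omega>'. symplectic_homotopic M \<omega> \<omega>' \<and> strongly_geometrically_bounded M \<omega>'"
proof -
 interpret smooth_mfd M by unfold_locales (rule assms(1))
 obtain K where K: "contact_exhaustion M \<omega> K" using assms(3) by blast
 interpret exhausted M K
  using K by unfold_locales (auto simp: contact_exhaustion_def compact_smooth_domain_def)
 obtain g0 where g0: "riemannian_metric M g0" using metric_exists by blast
 obtain R X where R: "gsmooth R" "!!p. 0 <= R p" "!!n. compactin (mtop M) {p : pts M. real n <= R p & R p <= real n + 1}"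
  and X: "smooth_vector_field_on M (pts M) X"
  "liouville_field_on M \<omega> {p : pts M. cos (2 * pi * R p) < 1/2} X"
  "!!p. p : pts M ==> cos (2 * pi * R p) < 1/2 ==> 0 < X p R" by (rule contact_exhaustion_function[OF K]) (rule that)
 have data: "contact_data M te \<omega> g0 R X t"
  if "profile te" "smooth_on UNIV t" "!!x. (t has_real_derivative neck x / dil te x) (at x)" for te t
  by (intro contact_data.intro contact_data_axioms.intro that smooth_mfd_axioms assms(2) g0 R(1) X)
 obtain et where et: "0 < et" "!!g. riemannian_metric M g ==>
  (ALL p:pts M. EX c rh a b K. good_chart g et p c rh a b K) ==>
  complete_metric M g & sectional_curvature_bounded_above M g & ereal 1 <= inj_radius M g" by (rule good_charts_bounded_geometry) (rule that)
 have p1: "profile (%_. 1)" by unfold_locales auto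
 obtain t1 where t1: "smooth_on UNIV t1" "!!x. (t1 has_real_derivative neck x / dil (%_. 1) x) (at x)" "mono t1"
  "!!n. (\<Sum>j<n. 1 / (3 * (%_. 1) j)) <= t1 (real n)" by (rule profile.energy_exists[OF p1]) (rule that)
 interpret base: contact_data M "%_. 1" \<omega> g0 R X t1 by (rule data[OF p1 t1(1,2)])
 \<comment> \<open>The thresholds are found with the unstretched profile, but
   \<open>good_near\<close> asserts them for every profile.\<close>
 have "ALL n. EX D. base.good_near et {p : W. real n <= R p & R p <= real n + 1} D"
  using base.good_near_compact[OF R(3) et(1)] by blast
 then obtain D where D: "ALL n. base.good_near et {p : W. real n <= R p & R p <= real n + 1} (D n)" by (rule choice[THEN exE])
 \<comment> \<open>Shell \<open>Suc n\<close> lies beyond neck \<open>n\<close>, over which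
   \<open>t0\<close> gains at least \<open>1 / (3 * te n)\<close>; this is 1/3 plus the modulus of
   the logarithm of the threshold of that shell.\<close>
 define te where "te n = 1 / (1 + 3 * \<bar>ln \<bar>D (Suc n)\<bar>\<bar>)" for n
 have pr: "profile te" by unfold_locales (auto simp: te_def)
 obtain t0 where t0: "smooth_on UNIV t0" "!!x. (t0 has_real_derivative neck x / dil te x) (at x)" "mono t0"
  "!!n. (\<Sum>j<n. 1 / (3 * te j)) <= t0 (real n)" by (rule profile.energy_exists[OF pr]) (rule that)
 \<comment> \<open>The additive constant serves shell 0, which has no complete neck before
   it.\<close>
 define t where "t x = t0 x + \<bar>ln \<bar>D 0\<bar>\<bar>" for x
 have t: "smooth_on UNIV t" "!!x. (t has_real_derivative neck x / dil te x) (at x)"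
  unfolding t_def by (auto intro!: smooth_add smooth_const t0(1) derivative_eq_intros t0(2))
 interpret C: contact_data M te \<omega> g0 R X t by (rule data[OF pr t])
 have big: "D n <= exp (t (R p))" if "real n <= R p" for n p
 proof -
  have pos: "0 <= 1 / (3 * te j)" for j by (simp add: te_def)
  have "\<bar>ln \<bar>D n\<bar>\<bar> <= (\<Sum>j<n. 1 / (3 * te j)) + \<bar>ln \<bar>D 0\<bar>\<bar>"
  proof (cases n)
   case (Suc k)
   have "\<bar>ln \<bar>D n\<bar>\<bar> <= 1 / (3 * te k)" by (simp add: te_def Suc)
   also have "... <= (\<Sum>j<n. 1 / (3 * te j))" by (rule member_le_sum) (use pos Suc in auto)
   finally show ?thesis by simp
  qed simp
  also have "... <= t (R p)" using t0(4)[of n] monoD[OF t0(3) that] by (simp add: t_def)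
  \<comment> \<open>Absolute values were taken because a threshold may be negative or zero; zero is
    treated separately.\<close>
  finally have "exp (ln \<bar>D n\<bar>) <= exp (t (R p))" by simp
  thus ?thesis by (cases "D n = 0") (auto intro: order_trans[OF abs_ge_self] less_imp_le)
 qed
 have "EX c rh a b K. good_chart C.g' et p c rh a b K" if p: "p : W" for p
 proof -
  define n where "n = nat \<lfloor>R p\<rfloor>"
  have n: "real n <= R p" "R p <= real n + 1" using R(2)[of p] floor_correct[of "R p"] by (auto simp: n_def)
  thus ?thesis
   using D[rule_format, of n] C.contact_data_axioms p big[OF n(1)] unfolding base.good_near_def by blast
 qed
 hence "strongly_geometrically_bounded M (C.Om 1)"
  using et(2)[OF C.metric_g'] by (intro C.strongly_bounded) auto
 thus ?thesis using C.homotopic by blast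
qed

end
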